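(* Let $Y_1,\dots,Y_n$ be i.i.d. observations from $f_{0Y}:=f_\varepsilon\ast f_{0X}$ on $\mathbb R$, where $f_\varepsilon(u)=e^{-|u|}/2$ is the standard Laplace density and $f_{0X}$, the density of $\mu_{0X}$, satisfies $f_{0X}(x)\lesssim e^{-(1+C_0)|x|}$, $x\in\mathbb R$, for some constant $C_0>0$. Let $\Pi$ be the prior distribution induced by $\mathscr D_{H_0}\otimes\Pi_\sigma$ through $\mu_X=\phi_\sigma\ast\mu_H$, $(\mu_H,\sigma)\sim\mathscr D_{H_0}\otimes\Pi_\sigma$, where: (A) the base measure $H_0$ has a continuous and positive density $h_0$ on $\mathbb R$ such that, for constants $b_0,b_0',c_0,c_0'>0$ and some $\iota>1$, $c_0\exp(-b_0|u|^\iota)\le h_0(u)\le c_0'\exp(-b_0'|u|^\iota)$ for all $u\in\mathbb R$; (B) $\Pi_\sigma$ has a continuous density $\pi_\sigma$ on $(0,\infty)$ such that, for constants $D_1,D_2>0$ and $s_1,s_2,t_1,t_2\ge0$, $\sigma^{-s_1}\exp(-D_1\sigma^{-1}|\log\sigma|^{t_1})\lesssim\pi_\sigma(\sigma)\lesssim\sigma^{-s_2}\exp(-D_2\sigma^{-1}|\log\sigma|^{t_2})$ for all $\sigma$ in a neighbourhood of $0$, and, for constants $D_3>0$ and $\varpi>1$, $\Pi_\sigma((\bar\sigma,\infty))\lesssim\exp(-D_3\bar\sigma^\varpi)$ as $\bar\sigma\to\infty$. Then there exist $K$ large enough and $\kappa>0$ so that $$\Pi(\mu_X:W_1(\mu_X,\mu_{0X})>Kn^{-1/5}(\log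 n)^\kappa\mid Y^{(n)})\to0\quad\text{in }P_{0Y}^n\text{-probability}.$$
   Context: $\phi_\sigma(x)=\sigma^{-1}\phi(x/\sigma)$ with $\phi$ the standard normal density. $\mathscr D_{H_0}$ is the Dirichlet process law on probability measures on $\mathbb R$ with finite positive base measure $H_0$. The model density is $f_Y=f_\varepsilon\ast(\phi_\sigma\ast\mu_H)$, and $\Pi(\cdot\mid Y^{(n)})$ is the posterior given $Y^{(n)}=(Y_1,\dots,Y_n)$, proportional to $\prod_if_Y(Y_i)\,\mathrm d\Pi$. $P_{0Y}$ has density $f_{0Y}$ and $P_{0Y}^n$ is its $n$-fold product. $W_1$ is the $L^1$-Wasserstein distance on $\mathbb R$. $a\lesssim b$ means $a\le Cb$ for some constant $C>0$. *)

theory Defs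
  imports "HOL-Probability.Probability"
begin

text \<open>Gamma law with shape \<open>a\<close> and unit rate; shape \<open>0\<close> is read as the point mass at \<open>0\<close>, so that
  Dirichlet laws may have vanishing parameters (cells of a partition that are null for the base
  measure).\<close>

definition gamma_law :: "real \<Rightarrow> real measure" where
  "gamma_law a = (if a = 0 then return borel 0
     else density lborel
       (\<lambda>x. ennreal (indicator {0<..} x * x powr (a - 1) * exp (- x) / Gamma a)))"

definition dirichlet_law :: "nat \<Rightarrow> (nat \<Rightarrow> real) \<Rightarrow> (nat \<Rightarrow> real) measure" where
  "dirichlet_law k a =
     distr (\<Pi>\<^sub>M i\<in>{..<k}. gamma_law (a i)) (\<Pi>\<^sub>M i\<in>{..<k}. borel)
       (\<lambda>g. \<lambda>i\<in>{..<k}. g i / (\<Sum>j<k. g j))"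

text \<open>Ferguson's definition, for a finite nonzero base measure \<open>H\<close>. It determines the law \<open>D\<close> uniquely, since the sigma-algebra of
  \<^term>\<open>prob_algebra borel\<close> is generated by the evaluations \<open>P \<mapsto> P A\<close>.\<close>

definition is_dirichlet_process :: "real measure \<Rightarrow> real measure measure \<Rightarrow> bool" where
  "is_dirichlet_process H D \<longleftrightarrow>
     prob_space D \<and> sets D = sets (prob_algebra borel) \<and>
     (\<forall>k (A :: nat \<Rightarrow> real set).
        (\<forall>i<k. A i \<in> sets borel) \<longrightarrow> disjoint_family_on A {..<k} \<longrightarrow> (\<Union>i<k. A i) = UNIV \<longrightarrow>
        distr D (\<Pi>\<^sub>M i\<in>{..<k}. borel) (\<lambda>P. \<lambda>i\<in>{..<k}. measure P (A i))
          = dirichlet_law k (\<lambda>i. measure H (A i)))"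

definition laplace_density :: "real \<Rightarrow> real" where
  "laplace_density u = exp (- \<bar>u\<bar>) / 2"

definition obs_density :: "real measure \<Rightarrow> real \<Rightarrow> real" where
  "obs_density \<mu> y = (\<integral>x. laplace_density (y - x) \<partial>\<mu>)"

definition mixture_prior :: "real measure measure \<Rightarrow> real measure \<Rightarrow> real measure measure" where
  "mixture_prior D S =
     distr (D \<Otimes>\<^sub>M S) (prob_algebra borel)
       (\<lambda>(\<mu>, \<sigma>). density lborel (\<lambda>x. ennreal (normal_density 0 \<sigma> x)) \<star> \<mu>)"

text \<open>The integrands lie between \<open>0\<close> and \<open>1\<close>, and the normalising constant is positive whenever
  the prior is a probability measure on \<^term>\<open>prob_algebra borel\<close>.\<close>

definition posterior :: "real measure measure \<Rightarrow> nat \<Rightarrow> (nat \<Rightarrow> real) \<Rightarrow> real measure measure" where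
  "posterior Q n y =
     density Q (\<lambda>\<mu>. ennreal
       ((\<Prod>i<n. obs_density \<mu> (y i)) / (\<integral>\<nu>. (\<Prod>i<n. obs_density \<nu> (y i)) \<partial>Q)))"

definition couplings :: "real measure \<Rightarrow> real measure \<Rightarrow> (real \<times> real) measure set" where
  "couplings \<mu> \<nu> =
     {\<gamma>. prob_space \<gamma> \<and> sets \<gamma> = sets (borel \<Otimes>\<^sub>M borel) \<and>
          distr \<gamma> borel fst = \<mu> \<and> distr \<gamma> borel snd = \<nu>}"

text \<open>Extended-valued, as the first moments are not assumed finite.\<close>

definition wasserstein1 :: "real measure \<Rightarrow> real measure \<Rightarrow> ennreal" where
  "wasserstein1 \<mu> \<nu> = (INF \<gamma>\<in>couplings \<mu> \<nu>. \<integral>\<^sup>+p. ennreal \<bar>fst p - snd p\<bar> \<partial>\<gamma>)"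

end

theory Submission
  imports Defs "HOL-Real_Asymp.Real_Asymp"
begin

text \<open>Since the Laplace kernel solves a linear differential equation of second order off its peak, its value at
  \<open>x\<close> is, outside any interval containing \<open>x\<close>, an exact combination of the kernels at the two end points.
  Moving the mass of a measure in cells of width \<open>\<delta>\<close> to the end points of the cells therefore changes the
  density of the observations only inside the respective cell. Applied to \<open>\<mu>0X\<close>, this yields mixtures on about
  \<open>log n / \<delta>\<close> atoms within chi-square distance \<open>\<delta> ^ 4\<close>; for \<open>\<delta>\<close> of order \<open>n powr (- 1 / 5)\<close> the prior charges a
  neighbourhood of them with mass at least \<open>exp (- n powr (1 / 5) polylog n)\<close>. Applied to an arbitrary \<open>\<mu>X\<close>, it shows
  that the density is determined in \<open>L\<^sup>1\<close> up to \<open>\<delta>\<^sup>2\<close> by its values at the nodes, so that the entropy is of the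
  same order and the density of the observations is recovered in \<open>L\<^sup>1\<close> at the rate \<open>n powr (- 2 / 5) polylog n\<close>.
  Finally, Laplace noise is inverted by \<open>1 - d\<^sup>2 / d t\<^sup>2\<close>: averages of the distribution function of \<open>\<mu>X\<close> over windows
  of width \<open>h\<close> are controlled by the \<open>L\<^sup>1\<close> distance of the densities divided by \<open>h\<close>, and monotonicity gives
  \<open>W\<^sub>1 \<le> 2 h + O(L\<^sup>1 / h)\<close> up to tails, where \<open>h = n powr (- 1 / 5)\<close> is optimal.\<close>

section \<open>The Laplace kernel\<close>

text \<open>The evidence is controlled through the chi-square distance, which divides by the mixture
  density, so errors must be small relative to that density. The margin \<open>C0\<close> in the
  tail of the signal makes this possible: \<open>exp \<bar>x\<bar>\<close> is integrable, the true
  density \<open>f0\<close> of the observations is squeezed between two multiples of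
  \<open>exp (- \<bar>y\<bar>)\<close>, and the approximation errors in the signal are all proved
  pointwise in the form \<open>\<delta>\<^sup>2 * exp (- \<bar>y\<bar>)\<close>. The second obstacle
  is that locations and bandwidths are unbounded. With \<open>r = n powr (1 / 5)\<close>, bandwidths
  above \<open>r\<close> and mixing measures whose first moment beyond \<open>r ln n\<close> exceeds
  \<open>1 / n\<close> have prior mass of order \<open>exp (- const * r powr w)\<close> and, up to a
  factor \<open>n\<close>, \<open>exp (- const * r powr \<iota>)\<close>; both lose against an
  evidence \<open>exp (- r polylog n)\<close> because \<open>w\<close> and \<open>\<iota>\<close>
  exceed 1. The tests need no such cut-off: finitely many sets detect every distant mixing measure.
  Tails matter only in the step from \<open>L\<^sup>1\<close> to \<open>W\<^sub>1\<close>, where the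
  error of the density is weighted by \<open>\<bar>y\<bar>\<close>.\<close>

lemma exp_le_quadratic:
  fixes x :: real
  assumes "\<bar>x\<bar> \<le> 1"
  shows "exp x \<le> 1 + x + x\<^sup>2"
proof (cases "0 \<le> x")
  case True
  then show ?thesis using exp_bound assms by auto
next
  case False
  define t where "t = -x"
  have t: "0 \<le> t" using False t_def by simp
  have pos: "0 < 1 + t + t^2/2" using t by (intro add_pos_nonneg) auto
  have "exp x = 1 / exp t" unfolding t_def by (simp add: exp_minus inverse_eq_divide)
  also have "\<dots> \<le> 1 / (1 + t + t^2/2)"
    using exp_lower_Taylor_quadratic[OF t] pos by (intro divide_left_mono) (auto intro!: mult_pos_pos)
  also have "\<dots> \<le> 1 - t + t^2"
  proof -
    \<comment> \<open>A negative argument is handled by the reciprocal of the Taylor polynomial at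
      \<open>t = - x\<close>; in the product all terms of odd sign cancel.\<close>
    have "(1 - t + t^2) * (1 + t + t^2/2) = 1 + t^2/2 + t^3/2 + t^4/2"
      by (simp add: field_simps power2_eq_square power3_eq_cube power4_eq_xxxx)
    then have "1 \<le> (1 - t + t^2) * (1 + t + t^2/2)" using t by simp
    then show ?thesis using pos by (simp add: divide_le_eq)
  qed
  finally show ?thesis by (simp add: t_def)
qed

lemma laplace_density_pos: "0 < laplace_density u"
  by (simp add: laplace_density_def)

lemma laplace_density_le: "laplace_density u \<le> 1/2"
  by (simp add: laplace_density_def)

lemma laplace_density_measurable [measurable]: "laplace_density \<in> borel_measurable borel"
  unfolding laplace_density_def by measurable

lemma laplace_density_symmetric: "laplace_density (x - y) = laplace_density (y - x)"
  by (simp add: laplace_density_def abs_minus_commute)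

lemma laplace_density_shift: "laplace_density (y - x) \<le> exp \<bar>x - z\<bar> * laplace_density (y - z)"
proof -
  have "- \<bar>y - x\<bar> \<le> \<bar>x - z\<bar> - \<bar>y - z\<bar>" by linarith
  then have "exp (- \<bar>y - x\<bar>) \<le> exp (\<bar>x - z\<bar> - \<bar>y - z\<bar>)" by simp
  also have "\<dots> = exp \<bar>x - z\<bar> * exp (- \<bar>y - z\<bar>)" by (simp add: exp_diff exp_minus divide_inverse)
  finally show ?thesis by (simp add: laplace_density_def)
qed

text \<open>This and \<open>weight_right\<close> are the solutions of \<open>u'' = u\<close> on
  \<open>[a, b]\<close> with boundary values (1, 0) and (0, 1); equivalently, the probabilities that
  a Brownian motion killed at rate 1/2 leaves the interval at \<open>a\<close> or at
  \<open>b\<close>. The killing is why they add up to at most 1.\<close>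

definition weight_left :: "real \<Rightarrow> real \<Rightarrow> real \<Rightarrow> real" where
  "weight_left a b x = sinh (b - x) / sinh (b - a)"

definition weight_right :: "real \<Rightarrow> real \<Rightarrow> real \<Rightarrow> real" where
  "weight_right a b x = sinh (x - a) / sinh (b - a)"

lemma weight_measurable [measurable]:
  "weight_left a b \<in> borel_measurable borel" "weight_right a b \<in> borel_measurable borel"
  unfolding weight_left_def weight_right_def sinh_def by measurable

lemma weight_nonneg:
  assumes "a < b" "x \<in> {a..b}"
  shows "0 \<le> weight_left a b x" "0 \<le> weight_right a b x"
  using assms by (auto simp: weight_left_def weight_right_def intro!: divide_nonneg_pos)

lemma weight_sum_le_1:
  assumes "a < b" "x \<in> {a..b}"
  shows "weight_left a b x + weight_right a b x \<le> 1"
proof -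
  have s: "sinh (b - a) > 0" using assms by simp
  have "sinh (b - a) = sinh ((b - x) + (x - a))" by simp
  also have "\<dots> = sinh (b - x) * cosh (x - a) + cosh (b - x) * sinh (x - a)" by (rule sinh_add)
  also have "\<dots> \<ge> sinh (b - x) * 1 + 1 * sinh (x - a)"
    using assms by (intro add_mono mult_mono cosh_real_ge_1) auto
  finally show ?thesis using s by (simp add: weight_left_def weight_right_def field_simps)
qed

text \<open>With \<open>d = b - a\<close> the lost mass is governed by \<open>cosh d - 1\<close>,
  which is quadratic in \<open>d\<close>. This is why moving mass to the nodes costs only second
  order in total mass.\<close>

lemma weight_sum_ge:
  assumes "a < b" "x \<in> {a..b}" "b - a \<le> 1"
  shows "1 - (b - a)\<^sup>2 \<le> weight_left a b x + weight_right a b x"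
proof -
  define d where "d = b - a"
  have s: "sinh d > 0" using assms by (simp add: d_def)
  have cosh_mono: "cosh u \<le> cosh d" if "0 \<le> u" "u \<le> d" for u :: real
    using that cosh_real_nonneg_le_iff by auto
  have "sinh d = sinh ((b - x) + (x - a))" by (simp add: d_def)
  also have "\<dots> = sinh (b - x) * cosh (x - a) + cosh (b - x) * sinh (x - a)" by (rule sinh_add)
  also have "\<dots> \<le> sinh (b - x) * cosh d + cosh d * sinh (x - a)"
    using assms by (intro add_mono mult_mono cosh_mono) (auto simp: d_def)
  finally have 1: "1 \<le> cosh d * (weight_left a b x + weight_right a b x)"
    using s by (simp add: weight_left_def weight_right_def field_simps d_def)
  have "exp d \<le> 1 + d + d^2" "exp (-d) \<le> 1 + (-d) + (-d)^2"
    using assms by (intro exp_le_quadratic; simp add: d_def)+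
  then have c: "cosh d \<le> 1 + d^2" by (simp add: cosh_def)
  define W where "W = weight_left a b x + weight_right a b x"
  have W0: "0 \<le> W" using weight_nonneg[OF assms(1,2)] by (simp add: W_def)
  have W1: "W \<le> 1" using weight_sum_le_1[OF assms(1,2)] by (simp add: W_def)
  have "1 \<le> cosh d * W" using 1 by (simp add: W_def)
  also have "\<dots> \<le> (1 + d^2) * W" using c W0 by (rule mult_right_mono)
  also have "\<dots> \<le> W + d^2" using W0 W1 mult_left_le_one_le[of "d^2" W] by (simp add: algebra_simps)
  finally show ?thesis by (simp add: W_def d_def)
qed

text \<open>Between the nodes \<open>a\<close> and \<open>b\<close> the functions \<open>exp\<close> and \<open>exp \<circ> uminus\<close> are
  interpolated exactly, so replacing the kernel at \<open>x\<close> by the interpolation of its values at the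
  nodes costs nothing outside the cell, where the kernel is a multiple of one of them.\<close>

lemma laplace_interpolation_outside:
  assumes "a < b" "x \<in> {a..b}" "y \<notin> {a<..<b}"
  shows "laplace_density (y - x) =
    weight_left a b x * laplace_density (y - a) + weight_right a b x * laplace_density (y - b)"
proof -
  have s: "sinh (b - a) > 0" using assms by simp
  \<comment> \<open>The sign \<open>s\<close> covers both exponentials at once; which of them is
    relevant depends on the side of the cell on which \<open>y\<close> lies.\<close>
  have id: "sinh (b - x) * exp (s * a) + sinh (x - a) * exp (s * b) = sinh (b - a) * exp (s * x)"
    if "s = 1 \<or> s = -1" for s :: real
    using that by (elim disjE) (simp_all add: sinh_def algebra_simps flip: exp_add)
  have *: "sinh (b - x) * exp (- \<bar>y - a\<bar>) + sinh (x - a) * exp (- \<bar>y - b\<bar>) = sinh (b - a) * exp (- \<bar>y - x\<bar>)"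
  proof (cases "y \<le> a")
    case True
    then have "- \<bar>y - a\<bar> = (-1) * a + y" "- \<bar>y - b\<bar> = (-1) * b + y" "- \<bar>y - x\<bar> = (-1) * x + y"
      using assms by auto
    then show ?thesis using arg_cong[OF id[of "-1"], of "\<lambda>t. exp y * t"]
      by (simp only: exp_add) (simp add: algebra_simps)
  next
    case False
    then have "- \<bar>y - a\<bar> = 1 * a + (-y)" "- \<bar>y - b\<bar> = 1 * b + (-y)" "- \<bar>y - x\<bar> = 1 * x + (-y)"
      using assms by auto
    then show ?thesis using arg_cong[OF id[of "1"], of "\<lambda>t. exp (-y) * t"]
      by (simp only: exp_add) (simp add: algebra_simps)
  qed
  then show ?thesis using s
    by (simp add: weight_left_def weight_right_def laplace_density_def field_simps)
qed

text \<open>Exactness is lost at the kink of the kernel, but on a cell of width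
  \<open>d = b - a\<close> the kernel and its interpolant both lie between \<open>1 / 2 - d\<close>
  and \<open>1 / 2\<close>.\<close>

lemma laplace_interpolation_inside:
  assumes "a < b" "x \<in> {a..b}" "y \<in> {a..b}" "b - a \<le> 1"
  shows "\<bar>laplace_density (y - x) -
    (weight_left a b x * laplace_density (y - a) + weight_right a b x * laplace_density (y - b))\<bar> \<le> b - a"
proof -
  define d where "d = b - a"
  define I where "I = weight_left a b x * laplace_density (y - a) + weight_right a b x * laplace_density (y - b)"
  define W where "W = weight_left a b x + weight_right a b x"
  have d: "0 < d" "d \<le> 1" using assms by (auto simp: d_def)
  note wn = weight_nonneg[OF assms(1,2)]
  have low: "(1 - d)/2 \<le> laplace_density (y - z)" if "z \<in> {a..b}" for z
  proof -
    have "1 - d \<le> exp (- d)" using exp_ge_add_one_self[of "-d"] by simp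
    also have "\<dots> \<le> exp (- \<bar>y - z\<bar>)" using that assms by (auto simp: d_def)
    finally show ?thesis by (simp add: laplace_density_def)
  qed
  have "I \<le> weight_left a b x * (1/2) + weight_right a b x * (1/2)"
    unfolding I_def using wn by (intro add_mono mult_left_mono laplace_density_le) auto
  also have "\<dots> \<le> 1/2" using weight_sum_le_1[OF assms(1,2)] by simp
  finally have I1: "I \<le> 1/2" .
  have "(1 - d^2) * ((1-d)/2) \<le> W * ((1-d)/2)"
    using weight_sum_ge[OF assms(1,2,4)] d by (intro mult_right_mono) (auto simp: d_def W_def)
  also have "\<dots> = weight_left a b x * ((1-d)/2) + weight_right a b x * ((1-d)/2)"
    by (simp add: W_def algebra_simps add_divide_distrib diff_divide_distrib)
  also have "\<dots> \<le> I"
    unfolding I_def using wn assms(1) by (intro add_mono mult_left_mono low) auto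
  finally have I2: "(1 - d^2) * ((1-d)/2) \<le> I" .
  have "d * d \<le> d" "0 \<le> d * (d * d)" using d by (auto simp: mult_left_le)
  then have "1/2 - d \<le> (1 - d^2) * ((1-d)/2)"
    by (simp add: field_simps power2_eq_square)
  with I1 I2 low[OF assms(2)] laplace_density_le[of "y - x"] d
  show ?thesis unfolding I_def[symmetric] d_def[symmetric] by (simp add: abs_le_iff)
qed

section \<open>Dirichlet processes\<close>

lemma sets_gamma_law [simp, measurable_cong]: "sets (gamma_law a) = sets borel"
  by (simp add: gamma_law_def)

lemma space_gamma_law [simp]: "space (gamma_law a) = UNIV"
  by (simp add: gamma_law_def)

lemma gamma_density_measurable [measurable]:
  "(\<lambda>x::real. ennreal (indicator {0<..} x * x powr (a - 1) * exp (- x) / Gamma a)) \<in> borel_measurable borel"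
  by measurable

lemma sigma_finite_gamma_law: "sigma_finite_measure (gamma_law a)"
proof (cases "a = 0")
  case True
  then show ?thesis by (simp add: gamma_law_def prob_space_return prob_space_imp_sigma_finite)
next
  case False
  then show ?thesis
    unfolding gamma_law_def
    by (simp add: sigma_finite_measure.sigma_finite_iff_density_finite[OF lborel.sigma_finite_measure_axioms])
qed

lemma emeasure_gamma_law_ge:
  assumes "0 < a" "0 \<le> u" "u \<le> v"
    and low: "\<And>x. u < x \<Longrightarrow> x \<le> v \<Longrightarrow> L \<le> x powr (a - 1) * exp (- x) / Gamma a" and "0 \<le> L"
  shows "ennreal (L * (v - u)) \<le> emeasure (gamma_law a) {u..v}"
proof -
  have "ennreal (L * (v - u)) = (\<integral>\<^sup>+x. ennreal L * indicator {u<..v} x \<partial>lborel)"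
    using assms by (simp add: nn_integral_cmult ennreal_mult)
  also have "\<dots> \<le> (\<integral>\<^sup>+x. ennreal (indicator {0<..} x * x powr (a - 1) * exp (- x) / Gamma a) * indicator {u..v} x \<partial>lborel)"
    using low \<open>0 \<le> u\<close> by (intro nn_integral_mono) (auto split: split_indicator intro!: ennreal_leI)
  also have "\<dots> = emeasure (gamma_law a) {u..v}"
    using \<open>0 < a\<close> by (simp add: gamma_law_def emeasure_density)
  finally show ?thesis .
qed

text \<open>Log-convexity keeps \<open>Gamma\<close> below 1 on \<open>[1, 2]\<close>, since it
  equals 1 at both ends; the functional equation carries the bound to \<open>(0, 1]\<close>.\<close>

lemma Gamma_le_inverse:
  assumes "0 < a" "a \<le> (1::real)"
  shows "Gamma a \<le> 1 / a"
proof -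
  have "(ln \<circ> Gamma) ((1 - a) *\<^sub>R 1 + a *\<^sub>R 2) \<le> (1 - a) * (ln \<circ> Gamma) 1 + a * (ln \<circ> Gamma) (2::real)"
    using assms by (intro convex_onD[OF log_convex_Gamma_real]) auto
  moreover have "Gamma (2::real) = 1" using Gamma_fact[of 1, where 'a=real] by simp
  ultimately have "ln (Gamma (1 + a)) \<le> 0" by (simp add: algebra_simps)
  then have "Gamma (1 + a) \<le> 1" using assms by (simp add: ln_le_zero_iff Gamma_real_pos)
  moreover have "Gamma (1 + a) = a * Gamma a" using Gamma_plus1[of a] nonpos_Ints_nonpos[of a] assms by (auto simp: add.commute)
  ultimately show ?thesis using assms by (simp add: field_simps)
qed

text \<open>On \<open>(0, 2]\<close> the density is at least of order \<open>a\<close>, because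
  \<open>1 / Gamma a\<close> is. The bound is thus linear in the shape, and a cell with tiny base
  mass enters the exponent of the prior mass only through a logarithm.\<close>

lemma emeasure_gamma_law_small_shape:
  assumes "0 < a" "a \<le> 1" "0 \<le> w" "w \<le> 1" "0 < \<eta>" "\<eta> \<le> 1"
  shows "ennreal (a * exp (-2) / 2 * \<eta>) \<le> emeasure (gamma_law a) {w..w + \<eta>}"
proof -
  have "a * exp (-2) / 2 \<le> x powr (a - 1) * exp (- x) / Gamma a" if "w < x" "x \<le> w + \<eta>" for x
  proof -
    have x: "0 < x" "x \<le> 2" using that assms by auto
    have "1/2 = 2 powr (-1::real)" by (simp add: powr_minus)
    also have "\<dots> \<le> 2 powr (a - 1)" using assms by (intro powr_mono) auto
    also have "\<dots> \<le> x powr (a - 1)" using x assms by (intro powr_mono2') auto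
    finally have 1: "1/2 \<le> x powr (a - 1)" .
    have 2: "a \<le> 1 / Gamma a" using Gamma_le_inverse[of a] assms by (simp add: field_simps Gamma_real_pos)
    have "1/2 * exp (-2) * a \<le> x powr (a - 1) * exp (-x) * (1 / Gamma a)"
      using 1 2 x assms by (intro mult_mono) auto
    then show ?thesis by (simp add: field_simps)
  qed
  then have "ennreal (a * exp (-2) / 2 * (w + \<eta> - w)) \<le> emeasure (gamma_law a) {w..w + \<eta>}"
    using assms by (intro emeasure_gamma_law_ge) auto
  then show ?thesis by simp
qed

text \<open>Only the upper half of the interval is used, with the power \<open>a\<close> in place of
  \<open>a - 1\<close>, so that shapes below and above 1 need no distinction. It serves the last
  cell of a partition, whose shape may be large.\<close>

lemma emeasure_gamma_law_near_0:
  assumes "0 < a" "0 < \<eta>" "\<eta> \<le> 1"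
  shows "ennreal ((\<eta> / 2) powr (a + 1) * exp (-1) / Gamma a) \<le> emeasure (gamma_law a) {0..\<eta>}"
proof -
  have "(\<eta> / 2) powr a * exp (-1) / Gamma a \<le> x powr (a - 1) * exp (- x) / Gamma a"
    if "\<eta> / 2 < x" "x \<le> \<eta>" for x
  proof -
    have "(\<eta> / 2) powr a \<le> x powr a" using that assms by (intro powr_mono2) auto
    also have "\<dots> \<le> x powr (a - 1)" using that assms by (intro powr_mono') auto
    finally show ?thesis using that assms by (intro divide_right_mono mult_mono) (auto simp: Gamma_real_pos less_imp_le)
  qed
  then have "ennreal ((\<eta> / 2) powr a * exp (-1) / Gamma a * (\<eta> - \<eta>/2)) \<le> emeasure (gamma_law a) {\<eta>/2..\<eta>}"
    using assms by (intro emeasure_gamma_law_ge) (auto simp: Gamma_real_pos less_imp_le)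
  also have "(\<eta> / 2) powr a * exp (-1) / Gamma a * (\<eta> - \<eta>/2) = (\<eta> / 2) powr (a + 1) * exp (-1) / Gamma a"
    using assms by (simp add: powr_add mult_ac)
  also have "emeasure (gamma_law a) {\<eta>/2..\<eta>} \<le> emeasure (gamma_law a) {0..\<eta>}"
    using assms by (intro emeasure_mono) auto
  finally show ?thesis .
qed

lemma dirichlet_map_measurable [measurable]:
  "(\<lambda>g. \<lambda>i\<in>{..<k}. g i / (\<Sum>j<k. g j)) \<in> (\<Pi>\<^sub>M i\<in>{..<k}. gamma_law (a i)) \<rightarrow>\<^sub>M (\<Pi>\<^sub>M i\<in>{..<k}. (borel :: real measure))"
proof (rule measurable_restrict)
  fix i assume "i \<in> {..<k}"
  moreover have "(\<lambda>g. g j) \<in> (\<Pi>\<^sub>M i\<in>{..<k}. gamma_law (a i)) \<rightarrow>\<^sub>M borel" if "j < k" for j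
    using measurable_component_singleton[of j "{..<k}" "\<lambda>i. gamma_law (a i)"] that by simp
  ultimately show "(\<lambda>g. g i / (\<Sum>j<k. g j)) \<in> borel_measurable (\<Pi>\<^sub>M i\<in>{..<k}. gamma_law (a i))"
    by (intro borel_measurable_divide borel_measurable_sum) auto
qed

text \<open>Normalising gamma variables \<open>g\<close> with \<open>g i \<in> {w i..w i + \<eta>}\<close> for \<open>i < m\<close> and a last one in
  \<open>{0..\<eta>}\<close> perturbs the weights \<open>w i / s\<close> by little.\<close>

lemma dirichlet_law_box:
  fixes a w :: "nat \<Rightarrow> real"
  assumes a: "\<And>i. i < m \<Longrightarrow> 0 < a i \<and> a i \<le> 1" and am: "0 < a m"
    and w: "\<And>i. i < m \<Longrightarrow> 0 \<le> w i" and s: "s = (\<Sum>i<m. w i)" "0 < s" "s \<le> 1"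
    and \<eta>: "0 < \<eta>" "\<eta> \<le> 1"
  shows "ennreal ((\<Prod>i<m. a i * exp (-2) / 2 * \<eta>) * ((\<eta> / 2) powr (a m + 1) * exp (-1) / Gamma (a m)))
    \<le> emeasure (dirichlet_law (Suc m) a)
        {p \<in> space (\<Pi>\<^sub>M i\<in>{..<Suc m}. borel). \<forall>i<m. w i / (s + real (Suc m) * \<eta>) \<le> p i \<and> p i \<le> (w i + \<eta>) / s}"
    (is "_ \<le> emeasure _ ?B")
proof -
  interpret product_sigma_finite "\<lambda>i. gamma_law (a i)"
    by (simp add: product_sigma_finite_def sigma_finite_gamma_law)
  define J where "J i = (if i < m then {w i..w i + \<eta>} else {0..\<eta>})" for i
  let ?M = "\<Pi>\<^sub>M i\<in>{..<Suc m}. gamma_law (a i)"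
  let ?f = "\<lambda>g. \<lambda>i\<in>{..<Suc m}. g i / (\<Sum>j<Suc m. g j)"
  have B: "?B \<in> sets (\<Pi>\<^sub>M i\<in>{..<Suc m}. (borel :: real measure))"
  proof -
    let ?P = "\<Pi>\<^sub>M i\<in>{..<Suc m}. (borel :: real measure)"
    have "{p \<in> space ?P. \<forall>i\<in>{..<m}. w i / (s + real (Suc m) * \<eta>) \<le> p i \<and> p i \<le> (w i + \<eta>) / s} \<in> sets ?P"
    proof (rule sets.sets_Collect_finite_All)
      fix i assume "i \<in> {..<m}"
      then have [measurable]: "(\<lambda>p. p i) \<in> borel_measurable ?P"
        using measurable_component_singleton[of i "{..<Suc m}" "\<lambda>_. borel :: real measure"] by simp
      show "{p \<in> space ?P. w i / (s + real (Suc m) * \<eta>) \<le> p i \<and> p i \<le> (w i + \<eta>) / s} \<in> sets ?P"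
        by measurable
    qed simp
    then show ?thesis by (simp add: Ball_def)
  qed
  have w1: "w i \<le> 1" if "i < m" for i
  proof -
    have "w i \<le> s" unfolding s(1) using that w by (intro member_le_sum) auto
    then show ?thesis using s by simp
  qed
  have "ennreal ((\<Prod>i<m. a i * exp (-2) / 2 * \<eta>) * ((\<eta> / 2) powr (a m + 1) * exp (-1) / Gamma (a m)))
      = (\<Prod>i<m. ennreal (a i * exp (-2) / 2 * \<eta>)) * ennreal ((\<eta> / 2) powr (a m + 1) * exp (-1) / Gamma (a m))"
  proof -
    have "0 \<le> (\<eta> / 2) powr (a m + 1) * exp (-1) / Gamma (a m)"
      using Gamma_real_pos[OF am] by simp
    then have "ennreal ((\<Prod>i<m. a i * exp (-2) / 2 * \<eta>) * ((\<eta> / 2) powr (a m + 1) * exp (-1) / Gamma (a m)))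
      = ennreal (\<Prod>i<m. a i * exp (-2) / 2 * \<eta>) * ennreal ((\<eta> / 2) powr (a m + 1) * exp (-1) / Gamma (a m))"
      by (rule ennreal_mult'')
    moreover have "(\<Prod>i<m. ennreal (a i * exp (-2) / 2 * \<eta>)) = ennreal (\<Prod>i<m. a i * exp (-2) / 2 * \<eta>)"
      using a \<eta> by (intro prod_ennreal) (auto simp: less_imp_le)
    ultimately show ?thesis by simp
  qed
  also have "\<dots> \<le> (\<Prod>i<m. emeasure (gamma_law (a i)) (J i)) * emeasure (gamma_law (a m)) (J m)"
  proof (intro mult_mono prod_mono_ennreal)
    show "ennreal (a i * exp (-2) / 2 * \<eta>) \<le> emeasure (gamma_law (a i)) (J i)" if "i \<in> {..<m}" for i
      using that emeasure_gamma_law_small_shape[of "a i" "w i" \<eta>] a[of i] w[of i] w1[of i] \<eta> by (simp add: J_def)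
    show "ennreal ((\<eta> / 2) powr (a m + 1) * exp (-1) / Gamma (a m)) \<le> emeasure (gamma_law (a m)) (J m)"
      using emeasure_gamma_law_near_0[OF am \<eta>] by (simp add: J_def)
  qed auto
  also have "\<dots> = (\<Prod>i<Suc m. emeasure (gamma_law (a i)) (J i))" by simp
  also have "\<dots> = emeasure ?M (Pi\<^sub>E {..<Suc m} J)"
    by (rule emeasure_PiM[symmetric]) (auto simp: J_def)
  also have "\<dots> \<le> emeasure ?M (?f -` ?B \<inter> space ?M)"
  proof (rule emeasure_mono)
    show "?f -` ?B \<inter> space ?M \<in> sets ?M"
      using B dirichlet_map_measurable[where k="Suc m" and a=a] by (rule measurable_sets[rotated])
    show "Pi\<^sub>E {..<Suc m} J \<subseteq> ?f -` ?B \<inter> space ?M"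
    proof
      fix g assume g: "g \<in> Pi\<^sub>E {..<Suc m} J"
      then have gi: "w i \<le> g i \<and> g i \<le> w i + \<eta>" if "i < m" for i
        using that by (auto simp: PiE_iff J_def dest!: bspec[where x=i])
      have gm: "0 \<le> g m \<and> g m \<le> \<eta>" using g by (auto simp: PiE_iff J_def dest!: bspec[where x=m])
      \<comment> \<open>The normaliser lies between \<open>s\<close> and
        \<open>s + (m + 1) * \<eta>\<close>; this is the origin of the two different denominators of
        the box.\<close>
      define S where "S = (\<Sum>j<Suc m. g j)"
      have "s \<le> (\<Sum>j<m. g j)" unfolding s(1) using gi by (intro sum_mono) auto
      then have S1: "s \<le> S" using gm by (simp add: S_def)
      have "(\<Sum>j<m. g j) \<le> (\<Sum>j<m. w j + \<eta>)" using gi by (intro sum_mono) auto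
      also have "\<dots> = s + real m * \<eta>" by (simp add: sum.distrib s(1))
      finally have S2: "S \<le> s + real (Suc m) * \<eta>" using gm by (simp add: S_def algebra_simps)
      have "w i / (s + real (Suc m) * \<eta>) \<le> g i / S \<and> g i / S \<le> (w i + \<eta>) / s" if "i < m" for i
      proof
        have "w i / (s + real (Suc m) * \<eta>) \<le> w i / S"
          using S1 S2 s w that by (intro divide_left_mono mult_pos_pos) auto
        also have "\<dots> \<le> g i / S" using gi that S1 s by (intro divide_right_mono) auto
        finally show "w i / (s + real (Suc m) * \<eta>) \<le> g i / S" .
        have "g i / S \<le> (w i + \<eta>) / S" using gi that S1 s by (intro divide_right_mono) auto
        also have "\<dots> \<le> (w i + \<eta>) / s" using w that S1 s \<eta> by (intro divide_left_mono) (auto simp: add_nonneg_nonneg)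
        finally show "g i / S \<le> (w i + \<eta>) / s" .
      qed
      then show "g \<in> ?f -` ?B \<inter> space ?M"
        using g unfolding S_def[symmetric] by (auto simp: space_PiM PiE_iff S_def)
    qed
  qed
  also have "\<dots> = emeasure (dirichlet_law (Suc m) a) ?B"
    unfolding dirichlet_law_def using B by (simp add: emeasure_distr)
  finally show ?thesis .
qed

section \<open>Laplace transforms of gamma laws and the mean of a Dirichlet process\<close>

lemma nn_integral_gamma_powr:
  assumes "0 < b" "0 \<le> (t::real)"
  shows "(\<integral>\<^sup>+x. ennreal (indicator {0<..} x * x powr (b - 1) * exp (- ((1 + t) * x))) \<partial>lborel)
    = ennreal (Gamma b * (1 + t) powr (- b))"
proof -
  have t: "1 + t \<noteq> 0" "1 + t > 0" using assms by auto
  have "ennreal (Gamma b) = (\<integral>\<^sup>+x. ennreal (indicator {0..} x * x powr (b - 1) / exp x) \<partial>lborel)"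
    by (rule Gamma_conv_nn_integral_real) fact
  also have "\<dots> = ennreal \<bar>1 + t\<bar> * (\<integral>\<^sup>+x. ennreal (indicator {0..} (0 + (1 + t) * x) * (0 + (1 + t) * x) powr (b - 1) / exp (0 + (1 + t) * x)) \<partial>lborel)"
    by (rule nn_integral_real_affine[OF _ t(1)]) simp
  also have "\<dots> = ennreal (1 + t) * (\<integral>\<^sup>+x. ennreal ((1 + t) powr (b - 1)) *
      ennreal (indicator {0<..} x * x powr (b - 1) * exp (- ((1 + t) * x))) \<partial>lborel)"
  proof (intro arg_cong2[where f="(*)"] nn_integral_cong)
    fix x :: real
    show "ennreal (indicator {0..} (0 + (1 + t) * x) * (0 + (1 + t) * x) powr (b - 1) / exp (0 + (1 + t) * x))
      = ennreal ((1 + t) powr (b - 1)) * ennreal (indicator {0<..} x * x powr (b - 1) * exp (- ((1 + t) * x)))"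
    proof (cases "0 < x")
      case True
      then have "0 < (1 + t) * x" using t by simp
      then show ?thesis using t True
        by (simp add: powr_mult exp_minus divide_inverse mult_ac flip: ennreal_mult)
    next
      case False
      then have "(1 + t) * x < 0 \<or> x = 0" using t by (auto simp: mult_less_0_iff)
      then show ?thesis using False by auto
    qed
  qed (use t in auto)
  also have "\<dots> = ennreal ((1 + t) powr b) * (\<integral>\<^sup>+x. ennreal (indicator {0<..} x * x powr (b - 1) * exp (- ((1 + t) * x))) \<partial>lborel)"
  proof -
    have e: "ennreal (1 + t) * ennreal ((1 + t) powr (b - 1)) = ennreal ((1 + t) powr b)"
      using t by (simp add: powr_diff flip: ennreal_mult)
    show ?thesis by (subst nn_integral_cmult, measurable) (simp only: mult.assoc[symmetric] e)
  qed
  finally have *: "ennreal (Gamma b) = ennreal ((1 + t) powr b) * (\<integral>\<^sup>+x. ennreal (indicator {0<..} x * x powr (b - 1) * exp (- ((1 + t) * x))) \<partial>lborel)" (is "_ = _ * ?I") .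
  have "ennreal (Gamma b * (1 + t) powr (- b)) = ennreal ((1 + t) powr (-b)) * ennreal (Gamma b)"
    by (simp add: ennreal_mult'' mult.commute)
  also have "\<dots> = ennreal ((1 + t) powr (-b) * (1 + t) powr b) * ?I"
    unfolding * by (simp add: mult.assoc ennreal_mult)
  also have "(1 + t) powr (-b) * (1 + t) powr b = 1" using t by (simp flip: powr_add)
  finally show ?thesis by simp
qed

text \<open>The second transform carries the factor \<open>x\<close> that the numerator contributes
  to the mean of \<open>g 0 / (g 0 + g 1)\<close>. Both formulas remain right for shape 0, the point
  mass at 0.\<close>

lemma gamma_law_Laplace_transform:
  assumes "0 \<le> a" "0 \<le> t"
  shows "(\<integral>\<^sup>+x. ennreal (exp (- (t * x))) \<partial>gamma_law a) = ennreal ((1 + t) powr (- a))"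
    and "(\<integral>\<^sup>+x. ennreal (x * exp (- (t * x))) \<partial>gamma_law a) = ennreal (a * (1 + t) powr (- a - 1))"
proof -
  have "(\<integral>\<^sup>+x. ennreal (exp (- (t * x))) \<partial>gamma_law a) = ennreal ((1 + t) powr (- a)) \<and>
    (\<integral>\<^sup>+x. ennreal (x * exp (- (t * x))) \<partial>gamma_law a) = ennreal (a * (1 + t) powr (- a - 1))"
  proof (cases "a = 0")
    case True
    then show ?thesis using assms by (simp add: gamma_law_def nn_integral_return)
  next
    case False
    then have a: "0 < a" using assms by simp
    have G: "0 < Gamma a" using a by (rule Gamma_real_pos)
    have "(\<integral>\<^sup>+x. ennreal (exp (- (t * x))) \<partial>gamma_law a)
      = (\<integral>\<^sup>+x. ennreal (1 / Gamma a) * ennreal (indicator {0<..} x * x powr (a - 1) * exp (- ((1 + t) * x))) \<partial>lborel)"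
      using False a G unfolding gamma_law_def
      by (auto simp: nn_integral_density exp_add[symmetric] algebra_simps split: split_indicator
           simp flip: ennreal_mult'' intro!: nn_integral_cong)
    also have "\<dots> = ennreal (1 / Gamma a) * ennreal (Gamma a * (1 + t) powr (- a))"
      by (subst nn_integral_cmult) (simp_all only: nn_integral_gamma_powr[OF a assms(2)], measurable)
    also have "\<dots> = ennreal ((1 + t) powr (- a))" using G by (simp flip: ennreal_mult)
    finally have 1: "(\<integral>\<^sup>+x. ennreal (exp (- (t * x))) \<partial>gamma_law a) = ennreal ((1 + t) powr (- a))" .
    have "(\<integral>\<^sup>+x. ennreal (x * exp (- (t * x))) \<partial>gamma_law a)
      = (\<integral>\<^sup>+x. ennreal (1 / Gamma a) * ennreal (indicator {0<..} x * x powr ((a + 1) - 1) * exp (- ((1 + t) * x))) \<partial>lborel)"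
      using False a G unfolding gamma_law_def
      by (auto simp: nn_integral_density exp_add[symmetric] algebra_simps powr_diff split: split_indicator
           simp flip: ennreal_mult'' intro!: nn_integral_cong)
    also have "\<dots> = ennreal (1 / Gamma a) * ennreal (Gamma (a + 1) * (1 + t) powr (- (a + 1)))"
      using a by (subst nn_integral_cmult) (simp_all only: nn_integral_gamma_powr[OF _ assms(2)] add_pos_pos zero_less_one, measurable)
    also have "Gamma (a + 1) = a * Gamma a" using Gamma_plus1[of a] nonpos_Ints_nonpos[of a] a by auto
    also have "ennreal (1 / Gamma a) * ennreal (a * Gamma a * (1 + t) powr (- (a + 1))) = ennreal (a * (1 + t) powr (- a - 1))"
      using G[THEN less_imp_neq] a by (simp add: Gamma_real_pos less_imp_le flip: ennreal_mult)
    finally show ?thesis using 1 by simp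
  qed
  then show "(\<integral>\<^sup>+x. ennreal (exp (- (t * x))) \<partial>gamma_law a) = ennreal ((1 + t) powr (- a))"
    and "(\<integral>\<^sup>+x. ennreal (x * exp (- (t * x))) \<partial>gamma_law a) = ennreal (a * (1 + t) powr (- a - 1))" by auto
qed

lemma prob_space_gamma_law:
  assumes "0 \<le> a" shows "prob_space (gamma_law a)"
  using gamma_law_Laplace_transform(1)[OF assms, of 0] by (intro prob_spaceI) simp

lemma AE_gamma_law_nonneg: "AE x in gamma_law a. 0 \<le> x"
proof (cases "a = 0")
  case True
  have "AE x in return borel (0 :: real). 0 \<le> x" by (subst AE_return) auto
  then show ?thesis unfolding gamma_law_def using True by simp
next
  case False
  then show ?thesis unfolding gamma_law_def by (simp add: AE_density indicator_def)
qed

lemma nn_integral_exp_tail: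
  assumes "0 < (c::real)"
  shows "(\<integral>\<^sup>+t. ennreal (exp (- (t * c))) * indicator {0..} t \<partial>lborel) = ennreal (1 / c)"
proof -
  have "(\<integral>\<^sup>+t. ennreal (exp (- (t * c))) * indicator {0..} t \<partial>lborel) = 0 - (- exp (- (0 * c)) / c)"
  proof (rule nn_integral_FTC_atLeast)
    have "LIM t at_top. t * c :> at_top"
      by (rule filterlim_at_top_mult_tendsto_pos[OF tendsto_const assms filterlim_ident])
    then have "((\<lambda>t. exp (- (t * c))) \<longlongrightarrow> 0) at_top"
      by (intro filterlim_compose[OF exp_at_bot] filterlim_compose[OF filterlim_uminus_at_bot_at_top])
    then have "((\<lambda>t. - exp (- (t * c)) / c) \<longlongrightarrow> - 0 / c) at_top"
      using assms by (intro tendsto_intros) auto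
    then show "((\<lambda>t. - exp (- (t * c)) / c) \<longlongrightarrow> 0) at_top" by simp
  qed (use assms in \<open>auto intro!: derivative_eq_intros\<close>)
  then show ?thesis by simp
qed

lemma nn_integral_powr_tail:
  assumes "0 < (c::real)"
  shows "(\<integral>\<^sup>+t. ennreal ((1 + t) powr (- c - 1)) * indicator {0..} t \<partial>lborel) = ennreal (1 / c)"
proof -
  have "(\<integral>\<^sup>+t. ennreal ((1 + t) powr (- c - 1)) * indicator {0..} t \<partial>lborel) = 0 - (- ((1 + 0) powr (- c)) / c)"
  proof (rule nn_integral_FTC_atLeast)
    have "((\<lambda>t. - ((1 + t) powr (- c)) / c) \<longlongrightarrow> - 0 / c) at_top"
      using assms by (intro tendsto_intros tendsto_neg_powr filterlim_tendsto_add_at_top[OF tendsto_const] filterlim_ident) auto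
    then show "((\<lambda>t. - ((1 + t) powr (- c)) / c) \<longlongrightarrow> 0) at_top" by simp
    show "((\<lambda>t. - ((1 + t) powr (- c)) / c) has_real_derivative (1 + x) powr (- c - 1)) (at x)" if "0 \<le> x" for x
      using that assms by (auto intro!: derivative_eq_intros)
  qed auto
  then show ?thesis by simp
qed

text \<open>Writing \<open>1 / c\<close> as the integral of \<open>exp (- t * c)\<close> over
  \<open>t \<ge> 0\<close> decouples the two gamma variables: once the integrals are exchanged,
  their Laplace transforms multiply, and the remaining integral of a power of \<open>1 + t\<close>
  is elementary. This replaces the change of variables to ratio and sum, and it admits vanishing
  shapes.\<close>

lemma dirichlet_law_mean_le:
  fixes a :: "nat \<Rightarrow> real"
  assumes a: "\<And>i. 0 \<le> a i" "0 < a 0 + a 1"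
  shows "(\<integral>\<^sup>+p. ennreal (p 0) \<partial>dirichlet_law 2 a) \<le> ennreal (a 0 / (a 0 + a 1))"
proof -
  have two: "{..<2::nat} = {0, 1}" by auto
  interpret product_sigma_finite "\<lambda>i. gamma_law (a i)"
    by (simp add: product_sigma_finite_def sigma_finite_gamma_law)
  interpret P: finite_product_sigma_finite "\<lambda>i. gamma_law (a i)" "{..<2}"
    by standard simp
  let ?M = "\<Pi>\<^sub>M i\<in>{..<2}. gamma_law (a i)"
  interpret M: sigma_finite_measure ?M by (rule sigma_finite) simp
  interpret pair_sigma_finite ?M lborel by standard
  have comp: "(\<lambda>g. g i) \<in> borel_measurable ?M" if "i < 2" for i
    using measurable_component_singleton[of i "{..<2}" "\<lambda>i. gamma_law (a i)"] that by simp
  have comp01: "(\<lambda>g. g 0) \<in> borel_measurable ?M" "(\<lambda>g. g 1) \<in> borel_measurable ?M" "(\<lambda>g. g (Suc 0)) \<in> borel_measurable ?M"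
    using comp[of 0] comp[of 1] by auto
  have AE: "AE g in ?M. 0 \<le> g i" if "i < 2" for i
    using that a by (intro AE_PiM_component prob_space_gamma_law AE_gamma_law_nonneg) auto
  have "(\<integral>\<^sup>+p. ennreal (p 0) \<partial>dirichlet_law 2 a) = (\<integral>\<^sup>+g. ennreal (g 0 / (g 0 + g 1)) \<partial>?M)"
    unfolding dirichlet_law_def
    by (subst nn_integral_distr[OF dirichlet_map_measurable]) (auto simp: two intro!: measurable_compose[OF measurable_component_singleton])
  also have "\<dots> \<le> (\<integral>\<^sup>+g. (\<integral>\<^sup>+t. ennreal (g 0 * exp (- (t * g 0)) * exp (- (t * g 1))) * indicator {0..} t \<partial>lborel) \<partial>?M)"
  proof (rule nn_integral_mono_AE)
    show "AE g in ?M. ennreal (g 0 / (g 0 + g 1)) \<le> (\<integral>\<^sup>+t. ennreal (g 0 * exp (- (t * g 0)) * exp (- (t * g 1))) * indicator {0..} t \<partial>lborel)"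
      using AE[of 0, simplified] AE[of 1, simplified]
    proof eventually_elim
      case (elim g)
      show ?case
      \<comment> \<open>If both variables vanish, the quotient is 0 by the convention for division,
        so the inequality is trivial there.\<close>
      proof (cases "g 0 + g 1 = 0")
        case False
        define c u where "c = g 0 + g 1" and "u = g 0"
        then have c: "0 < c" using elim False by simp
        have "(\<integral>\<^sup>+t. ennreal (g 0 * exp (- (t * g 0)) * exp (- (t * g 1))) * indicator {0..} t \<partial>lborel)
          = (\<integral>\<^sup>+t. ennreal u * (ennreal (exp (- (t * c))) * indicator {0..} t) \<partial>lborel)"
          using elim by (intro nn_integral_cong) (auto simp: c_def u_def algebra_simps simp flip: exp_add ennreal_mult split: split_indicator)
        also have "\<dots> = ennreal u * ennreal (1 / c)"
          by (subst nn_integral_cmult) (simp_all only: nn_integral_exp_tail[OF c], measurable)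
        also have "\<dots> = ennreal (g 0 / (g 0 + g 1))" using elim c by (simp add: c_def u_def flip: ennreal_mult)
        finally show ?thesis by simp
      qed simp
    qed
  qed
  also have "\<dots> = (\<integral>\<^sup>+t. (\<integral>\<^sup>+g. ennreal (g 0 * exp (- (t * g 0)) * exp (- (t * g 1))) * indicator {0..} t \<partial>?M) \<partial>lborel)"
  proof -
    note comp01 [measurable]
    show ?thesis by (rule Fubini'[symmetric]) measurable
  qed
  also have "\<dots> = (\<integral>\<^sup>+t. ennreal (a 0) * (ennreal ((1 + t) powr (- (a 0 + a 1) - 1)) * indicator {0..} t) \<partial>lborel)"
  proof (rule nn_integral_cong)
    fix t :: real
    show "(\<integral>\<^sup>+g. ennreal (g 0 * exp (- (t * g 0)) * exp (- (t * g 1))) * indicator {0..} t \<partial>?M)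
      = ennreal (a 0) * (ennreal ((1 + t) powr (- (a 0 + a 1) - 1)) * indicator {0..} t)"
    proof (cases "0 \<le> t")
      case True
      let ?f = "\<lambda>i x. if i = (0::nat) then ennreal (x * exp (- (t * x))) else ennreal (exp (- (t * x)))"
      have "(\<integral>\<^sup>+g. ennreal (g 0 * exp (- (t * g 0)) * exp (- (t * g 1))) * indicator {0..} t \<partial>?M)
        = (\<integral>\<^sup>+g. (\<Prod>i\<in>{..<2}. ?f i (g i)) \<partial>?M)"
        using True by (intro nn_integral_cong) (simp add: two ennreal_mult'')
      also have "\<dots> = (\<Prod>i\<in>{..<2}. integral\<^sup>N (gamma_law (a i)) (?f i))"
        by (rule product_nn_integral_prod) auto
      also have "\<dots> = ennreal (a 0 * (1 + t) powr (- a 0 - 1)) * ennreal ((1 + t) powr (- a 1))"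
        using True a by (simp add: two gamma_law_Laplace_transform)
      also have "\<dots> = ennreal (a 0) * ennreal ((1 + t) powr (- a 0 - 1) * (1 + t) powr (- a 1))"
        using a by (simp add: ennreal_mult mult.assoc)
      also have "(1 + t) powr (- a 0 - 1) * (1 + t) powr (- a 1) = (1 + t) powr (- (a 0 + a 1) - 1)"
        by (simp flip: powr_add add: algebra_simps)
      finally show ?thesis using True by simp
    qed simp
  qed
  also have "\<dots> = ennreal (a 0) * ennreal (1 / (a 0 + a 1))"
    by (subst nn_integral_cmult) (simp_all only: nn_integral_powr_tail[OF a(2)], measurable)
  also have "\<dots> = ennreal (a 0 / (a 0 + a 1))" using a by (simp flip: ennreal_mult)
  finally show ?thesis .
qed

text \<open>Ferguson's property is applied to the partition into \<open>A\<close> and its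
  complement; either of them may be null for \<open>H\<close>, which is where shape 0
  enters.\<close>

lemma dirichlet_process_mean_le:
  assumes D: "is_dirichlet_process H D" and H: "finite_measure H" "sets H = sets borel" "0 < measure H UNIV"
    and A: "A \<in> sets borel"
  shows "(\<integral>\<^sup>+P. emeasure P A \<partial>D) \<le> ennreal (measure H A / measure H UNIV)"
proof -
  interpret H: finite_measure H by fact
  have sD [measurable_cong]: "sets D = sets (prob_algebra borel)" using D by (simp add: is_dirichlet_process_def)
  have spD: "space D = space (prob_algebra borel)" using sD by (rule sets_eq_imp_space_eq)
  define B where "B i = (if i = (0::nat) then A else - A)" for i
  have dist: "distr D (\<Pi>\<^sub>M i\<in>{..<2}. borel) (\<lambda>P. \<lambda>i\<in>{..<2}. measure P (B i)) = dirichlet_law 2 (\<lambda>i. measure H (B i))"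
  proof -
    have "\<forall>i<2. B i \<in> sets borel" using A by (auto simp: B_def)
    moreover have "disjoint_family_on B {..<2}" by (auto simp: disjoint_family_on_def B_def)
    moreover have "(\<Union>i<2. B i) = UNIV"
    proof -
      have "{..<2::nat} = {0, 1}" by auto
      then show ?thesis by (simp add: B_def)
    qed
    ultimately show ?thesis using D unfolding is_dirichlet_process_def by blast
  qed
  have tot: "measure H (B 0) + measure H (B 1) = measure H UNIV"
    using H.finite_measure_Union[of A "- A"] A H(2) by (simp add: B_def Un_commute)
  have m: "(\<lambda>P. \<lambda>i\<in>{..<2}. measure P (B i)) \<in> D \<rightarrow>\<^sub>M (\<Pi>\<^sub>M i\<in>{..<2}. borel)"
    using A by (intro measurable_restrict) (auto simp: B_def)
  have "(\<integral>\<^sup>+P. emeasure P A \<partial>D) = (\<integral>\<^sup>+P. ennreal ((\<lambda>i\<in>{..<2}. measure P (B i)) 0) \<partial>D)"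
  proof (rule nn_integral_cong)
    fix P assume "P \<in> space D"
    then have "prob_space P" by (simp add: spD space_prob_algebra)
    then interpret prob_space P .
    show "emeasure P A = ennreal ((\<lambda>i\<in>{..<2}. measure P (B i)) 0)" by (simp add: B_def emeasure_eq_measure)
  qed
  also have "\<dots> = (\<integral>\<^sup>+p. ennreal (p 0) \<partial>distr D (\<Pi>\<^sub>M i\<in>{..<2}. borel) (\<lambda>P. \<lambda>i\<in>{..<2}. measure P (B i)))"
    by (subst nn_integral_distr[OF m]) (auto intro!: measurable_compose[OF measurable_component_singleton])
  also have "\<dots> \<le> ennreal (measure H (B 0) / (measure H (B 0) + measure H (B 1)))"
    unfolding dist using tot H(3) by (intro dirichlet_law_mean_le) auto
  finally show ?thesis unfolding tot by (simp add: B_def)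
qed

text \<open>The bound for sets says that the mean measure of the process, formed as a monadic bind,
  is dominated by the normalised \<open>H\<close>; domination of measures passes on to integrals. It
  controls the tails of a random mixing measure through those of the base measure.\<close>

lemma dirichlet_process_nn_integral_le:
  fixes g :: "real \<Rightarrow> ennreal"
  assumes D: "is_dirichlet_process H D" and H: "finite_measure H" "sets H = sets borel" "0 < measure H UNIV"
    and g: "g \<in> borel_measurable borel"
  shows "(\<integral>\<^sup>+P. (\<integral>\<^sup>+x. g x \<partial>P) \<partial>D) \<le> ennreal (1 / measure H UNIV) * (\<integral>\<^sup>+x. g x \<partial>H)"
proof -
  interpret H: finite_measure H by fact
  have sD: "sets D = sets (prob_algebra borel)" using D by (simp add: is_dirichlet_process_def)
  have id: "(\<lambda>x. x) \<in> D \<rightarrow>\<^sub>M subprob_algebra borel"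
    by (intro measurable_prob_algebraD) (simp add: sD cong: measurable_cong_sets)
  have ne: "space D \<noteq> {}" using D prob_space.not_empty[of D] unfolding is_dirichlet_process_def by blast
  let ?N = "D \<bind> (\<lambda>x. x)"
  have sN: "sets ?N = sets borel" using ne id by (intro sets_bind) (auto simp: measurable_space[OF id, THEN space_subprob_algebra[THEN equalityD1, THEN subsetD]] dest!: measurable_space[OF id] simp: space_subprob_algebra)
  have "(\<integral>\<^sup>+P. (\<integral>\<^sup>+x. g x \<partial>P) \<partial>D) = (\<integral>\<^sup>+x. g x \<partial>?N)"
    by (rule nn_integral_bind[OF g id, symmetric])
  also have "\<dots> \<le> (\<integral>\<^sup>+x. g x \<partial>scale_measure (ennreal (1 / measure H UNIV)) H)"
  proof (rule nn_integral_mono_measure)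
    show "sets ?N = sets (scale_measure (ennreal (1 / measure H UNIV)) H)" using sN H by simp
    show "?N \<le> scale_measure (ennreal (1 / measure H UNIV)) H"
      unfolding le_measure[OF \<open>sets ?N = sets (scale_measure (ennreal (1 / measure H UNIV)) H)\<close>]
    proof
      fix A assume "A \<in> sets ?N"
      then have A: "A \<in> sets borel" by (simp add: sN)
      have "emeasure ?N A = (\<integral>\<^sup>+P. emeasure P A \<partial>D)" by (rule emeasure_bind[OF ne id A])
      also have "\<dots> \<le> ennreal (measure H A / measure H UNIV)"
        by (rule dirichlet_process_mean_le[OF D H A])
      also have "\<dots> = ennreal (1 / measure H UNIV) * emeasure H A"
        using H by (simp add: H.emeasure_eq_measure flip: ennreal_mult)
      finally show "emeasure ?N A \<le> emeasure (scale_measure (ennreal (1 / measure H UNIV)) H) A" by simp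
    qed
  qed
  also have "\<dots> = ennreal (1 / measure H UNIV) * (\<integral>\<^sup>+x. g x \<partial>H)"
    using g H by (intro nn_integral_scale_measure) (simp cong: measurable_cong_sets)
  finally show ?thesis .
qed

section \<open>Posterior mass in dominated models\<close>

text \<open>This is the moment generating function of a Bernoulli variable, estimated by
  \<open>exp t \<le> 1 + t + t\<^sup>2\<close>.\<close>

lemma (in prob_space) nn_integral_exp_indicator_le:
  assumes A: "A \<in> events" and t: "\<bar>t\<bar> \<le> (1::real)"
  shows "(\<integral>\<^sup>+x. ennreal (exp (t * indicator A x)) \<partial>M) \<le> ennreal (exp (t * prob A + t\<^sup>2))"
proof -
  have [simp]: "space M - A \<in> events" using A by auto
  have "(\<integral>\<^sup>+x. ennreal (exp (t * indicator A x)) \<partial>M)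
    = (\<integral>\<^sup>+x. ennreal (exp t) * indicator A x + indicator (space M - A) x \<partial>M)"
    by (intro nn_integral_cong) (auto split: split_indicator)
  also have "\<dots> = ennreal (exp t) * emeasure M A + emeasure M (space M - A)"
    using A by (simp add: nn_integral_add nn_integral_cmult)
  also have "\<dots> = ennreal (exp t * prob A + (1 - prob A))"
    using A by (simp add: emeasure_eq_measure prob_compl ennreal_mult ennreal_plus)
  also have "\<dots> \<le> ennreal (exp (t * prob A + t\<^sup>2))"
  proof (rule ennreal_leI)
    have "exp t * prob A \<le> (1 + t + t\<^sup>2) * prob A"
      by (intro mult_right_mono exp_le_quadratic t) simp
    moreover have "t\<^sup>2 * prob A \<le> t\<^sup>2" by (simp add: mult_left_le)
    ultimately have "exp t * prob A + (1 - prob A) \<le> 1 + (t * prob A + t\<^sup>2)"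
      by (simp add: algebra_simps)
    also have "\<dots> \<le> exp (t * prob A + t\<^sup>2)" by (rule exp_ge_add_one_self)
    finally show "exp t * prob A + (1 - prob A) \<le> exp (t * prob A + t\<^sup>2)" .
  qed
  finally show ?thesis .
qed

text \<open>The prior is the measure \<open>M\<close> on an abstract parameter space, so that
  posterior mass can be estimated on pairs of a mixing measure and a bandwidth, before the pairs are
  mapped to laws. Strict positivity of the densities keeps the likelihood ratio and its inverse
  finite without exceptional null sets.\<close>

locale dominated_model = prob_space M for M :: "'a measure" +
  fixes f :: "'a \<Rightarrow> real \<Rightarrow> real" and f0 :: "real \<Rightarrow> real"
  assumes f_measurable [measurable]: "case_prod f \<in> borel_measurable (M \<Otimes>\<^sub>M borel)"
    and f_pos: "\<And>\<theta> y. \<theta> \<in> space M \<Longrightarrow> 0 < f \<theta> y"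
    and f_total: "\<And>\<theta>. \<theta> \<in> space M \<Longrightarrow> (\<integral>\<^sup>+y. ennreal (f \<theta> y) \<partial>lborel) = 1"
    and f0_measurable [measurable]: "f0 \<in> borel_measurable borel"
    and f0_pos: "\<And>y. 0 < f0 y"
    and f0_total: "(\<integral>\<^sup>+y. ennreal (f0 y) \<partial>lborel) = 1"
begin

definition P0 :: "real measure" where "P0 = density lborel (\<lambda>y. ennreal (f0 y))"

definition P0n :: "nat \<Rightarrow> (nat \<Rightarrow> real) measure" where "P0n n = (\<Pi>\<^sub>M i\<in>{..<n}. P0)"

definition P\<theta> :: "'a \<Rightarrow> real measure" where "P\<theta> \<theta> = density lborel (\<lambda>y. ennreal (f \<theta> y))"

text \<open>Extended-valued, so that prior and sample integrals can be exchanged freely.\<close>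

definition lr :: "nat \<Rightarrow> 'a \<Rightarrow> (nat \<Rightarrow> real) \<Rightarrow> ennreal" where
  "lr n \<theta> y = (\<Prod>i<n. ennreal (f \<theta> (y i) / f0 (y i)))"

lemma sets_P0 [simp, measurable_cong]: "sets P0 = sets borel" by (simp add: P0_def)
lemma space_P0 [simp]: "space P0 = UNIV" by (simp add: P0_def)
lemma sets_P\<theta> [simp, measurable_cong]: "sets (P\<theta> \<theta>) = sets borel" by (simp add: P\<theta>_def)
lemma space_P\<theta> [simp]: "space (P\<theta> \<theta>) = UNIV" by (simp add: P\<theta>_def)

lemma sets_P0n [measurable_cong]: "sets (P0n n) = sets (\<Pi>\<^sub>M i\<in>{..<n}. borel)"
  unfolding P0n_def by (intro sets_PiM_cong) auto

lemma f_section [measurable]: "\<theta> \<in> space M \<Longrightarrow> f \<theta> \<in> borel_measurable borel"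
  using measurable_compose[OF measurable_Pair1' f_measurable] by simp

lemma prob_space_P0: "prob_space P0"
  by (rule prob_spaceI) (simp add: P0_def emeasure_density f0_total)

lemma prob_space_P\<theta>: "\<theta> \<in> space M \<Longrightarrow> prob_space (P\<theta> \<theta>)"
  by (rule prob_spaceI) (simp add: P\<theta>_def emeasure_density f_total)

lemma prob_space_P0n: "prob_space (P0n n)"
  unfolding P0n_def by (intro prob_space_PiM prob_space_P0)

lemma component_measurable: "i < n \<Longrightarrow> (\<lambda>y. y i) \<in> P0n n \<rightarrow>\<^sub>M borel"
  using measurable_component_singleton[of i "{..<n}" "\<lambda>i. P0"] by (simp add: P0n_def)

lemma lr_measurable [measurable]: "(\<lambda>(\<theta>, y). lr n \<theta> y) \<in> borel_measurable (M \<Otimes>\<^sub>M P0n n)"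
  unfolding lr_def case_prod_beta
proof (intro borel_measurable_prod_ennreal measurable_compose[OF _ measurable_ennreal] borel_measurable_divide)
  fix i assume "i \<in> {..<n}"
  then have [measurable]: "(\<lambda>x. snd x i) \<in> M \<Otimes>\<^sub>M P0n n \<rightarrow>\<^sub>M borel"
    by (intro measurable_compose[OF measurable_snd] component_measurable) auto
  have "(\<lambda>x. (fst x, snd x i)) \<in> M \<Otimes>\<^sub>M P0n n \<rightarrow>\<^sub>M M \<Otimes>\<^sub>M borel" by measurable
  from measurable_compose[OF this f_measurable]
  show "(\<lambda>x. f (fst x) (snd x i)) \<in> borel_measurable (M \<Otimes>\<^sub>M P0n n)" by simp
  show "(\<lambda>x. f0 (snd x i)) \<in> borel_measurable (M \<Otimes>\<^sub>M P0n n)" by measurable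
qed

lemma lr_measurable_fst [measurable]: "y \<in> space (P0n n) \<Longrightarrow> (\<lambda>\<theta>. lr n \<theta> y) \<in> borel_measurable M"
  using measurable_compose[OF measurable_Pair2' lr_measurable] by simp

lemma lr_measurable_snd [measurable]: "\<theta> \<in> space M \<Longrightarrow> lr n \<theta> \<in> borel_measurable (P0n n)"
  using measurable_compose[OF measurable_Pair1' lr_measurable] by simp

lemma nn_integral_P0n_prod:
  assumes "g \<in> borel_measurable borel"
  shows "(\<integral>\<^sup>+y. (\<Prod>i<n. g (y i)) \<partial>P0n n) = (\<integral>\<^sup>+y. g y \<partial>P0) ^ n"
proof -
  interpret product_sigma_finite "\<lambda>i::nat. P0"
    using prob_space_P0 by (simp add: product_sigma_finite_def prob_space_imp_sigma_finite)
  note assms [measurable]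
  show ?thesis unfolding P0n_def
    by (subst product_nn_integral_prod) (simp_all add: P0_def)
qed

lemma nn_integral_P0_ratio:
  assumes \<theta>: "\<theta> \<in> space M" and g[measurable]: "g \<in> borel_measurable borel"
  shows "(\<integral>\<^sup>+y. ennreal (f \<theta> y / f0 y) * g y \<partial>P0) = (\<integral>\<^sup>+y. g y \<partial>P\<theta> \<theta>)"
proof -
  note [measurable] = f_section[OF \<theta>]
  have "ennreal (f0 y) * (ennreal (f \<theta> y / f0 y) * g y) = ennreal (f \<theta> y) * g y" for y
    using f0_pos[of y] f_pos[OF \<theta>, of y] by (simp flip: mult.assoc ennreal_mult)
  then show ?thesis unfolding P0_def P\<theta>_def by (simp add: nn_integral_density)
qed

lemma nn_integral_lr_test:
  assumes \<theta>: "\<theta> \<in> space M" and g[measurable]: "g \<in> borel_measurable borel"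
  shows "(\<integral>\<^sup>+y. lr n \<theta> y * (\<Prod>i<n. g (y i)) \<partial>P0n n) = (\<integral>\<^sup>+y. g y \<partial>P\<theta> \<theta>) ^ n"
proof -
  note [measurable] = f_section[OF \<theta>]
  have "(\<integral>\<^sup>+y. lr n \<theta> y * (\<Prod>i<n. g (y i)) \<partial>P0n n)
    = (\<integral>\<^sup>+y. (\<Prod>i<n. ennreal (f \<theta> (y i) / f0 (y i)) * g (y i)) \<partial>P0n n)"
    by (simp add: lr_def prod.distrib)
  also have "\<dots> = (\<integral>\<^sup>+y. ennreal (f \<theta> y / f0 y) * g y \<partial>P0) ^ n"
    by (rule nn_integral_P0n_prod) measurable
  finally show ?thesis by (simp add: nn_integral_P0_ratio[OF \<theta> g])
qed

lemma pair_sigma_finite_P0n: "pair_sigma_finite M (P0n n)"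
  unfolding pair_sigma_finite_def
  using prob_space_P0n[of n] prob_space_axioms by (auto simp: prob_space_imp_sigma_finite)

text \<open>After exchanging the integrals the likelihood ratio acts as a change of measure from the
  truth to \<open>\<theta>\<close>. With \<open>g = 1\<close> the result bounds the expected
  numerator of the posterior by the prior mass; with an exponential \<open>g\<close> it is a type 2
  error averaged over the prior.\<close>

lemma nn_integral_mass_test:
  assumes A[measurable]: "A \<in> sets M" and g[measurable]: "g \<in> borel_measurable borel"
    and c: "\<And>\<theta>. \<theta> \<in> A \<Longrightarrow> (\<integral>\<^sup>+y. g y \<partial>P\<theta> \<theta>) ^ n \<le> c"
  shows "(\<integral>\<^sup>+y. (\<integral>\<^sup>+\<theta>. lr n \<theta> y * indicator A \<theta> \<partial>M) * (\<Prod>i<n. g (y i)) \<partial>P0n n) \<le> c * emeasure M A"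
proof -
  have [measurable]: "(\<lambda>y. \<Prod>i<n. g (y i)) \<in> borel_measurable (P0n n)"
    by (intro borel_measurable_prod_ennreal measurable_compose[OF component_measurable g]) auto
  have "(\<integral>\<^sup>+y. (\<integral>\<^sup>+\<theta>. lr n \<theta> y * indicator A \<theta> \<partial>M) * (\<Prod>i<n. g (y i)) \<partial>P0n n)
    = (\<integral>\<^sup>+y. (\<integral>\<^sup>+\<theta>. lr n \<theta> y * indicator A \<theta> * (\<Prod>i<n. g (y i)) \<partial>M) \<partial>P0n n)"
    by (intro nn_integral_cong nn_integral_multc[symmetric]) measurable
  also have "\<dots> = (\<integral>\<^sup>+\<theta>. (\<integral>\<^sup>+y. lr n \<theta> y * indicator A \<theta> * (\<Prod>i<n. g (y i)) \<partial>P0n n) \<partial>M)"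
    by (rule pair_sigma_finite.Fubini'[OF pair_sigma_finite_P0n]) measurable
  also have "\<dots> \<le> (\<integral>\<^sup>+\<theta>. c * indicator A \<theta> \<partial>M)"
  proof (rule nn_integral_mono)
    fix \<theta> assume \<theta>: "\<theta> \<in> space M"
    show "(\<integral>\<^sup>+y. lr n \<theta> y * indicator A \<theta> * (\<Prod>i<n. g (y i)) \<partial>P0n n) \<le> c * indicator A \<theta>"
      using nn_integral_lr_test[OF \<theta> g, of n] c[of \<theta>] by (auto split: split_indicator)
  qed
  also have "\<dots> = c * emeasure M A" by (simp add: nn_integral_cmult)
  finally show ?thesis .
qed

text \<open>On the event that the evidence of \<open>B\<close> is below \<open>e\<close>, the inequality \<open>2 \<le> c u + 1 / (c u)\<close>
  with \<open>u\<close> the likelihood ratio and \<open>c = prob B / e\<close>, integrated over \<open>B\<close>, forces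
  the integral of the inverse likelihood ratio to be at least \<open>(prob B)\<^sup>2 / e\<close>.\<close>

lemma evidence_lower_bound:
  assumes B[measurable]: "B \<in> events" and b: "0 < prob B" and e: "0 < e"
    and chi: "\<And>\<theta>. \<theta> \<in> B \<Longrightarrow> (\<integral>\<^sup>+y. ennreal ((f0 y)\<^sup>2 / f \<theta> y) \<partial>lborel) \<le> ennreal (exp \<delta>)"
  shows "emeasure (P0n n) {y \<in> space (P0n n). (\<integral>\<^sup>+\<theta>. lr n \<theta> y * indicator B \<theta> \<partial>M) < ennreal e}
    \<le> ennreal (e / prob B * exp (real n * \<delta>))"
proof -
  define ir where "ir \<theta> y = (\<Prod>i<n. ennreal (f0 (y i) / f \<theta> (y i)))" for \<theta> and y :: "nat \<Rightarrow> real"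
  have ir_meas [measurable]: "(\<lambda>(\<theta>, y). ir \<theta> y) \<in> borel_measurable (M \<Otimes>\<^sub>M P0n n)"
    unfolding ir_def case_prod_beta
  proof (intro borel_measurable_prod_ennreal measurable_compose[OF _ measurable_ennreal] borel_measurable_divide)
    fix i assume "i \<in> {..<n}"
    then have [measurable]: "(\<lambda>x. snd x i) \<in> M \<Otimes>\<^sub>M P0n n \<rightarrow>\<^sub>M borel"
      by (intro measurable_compose[OF measurable_snd] component_measurable) auto
    have "(\<lambda>x. (fst x, snd x i)) \<in> M \<Otimes>\<^sub>M P0n n \<rightarrow>\<^sub>M M \<Otimes>\<^sub>M borel" by measurable
    from measurable_compose[OF this f_measurable]
    show "(\<lambda>x. f (fst x) (snd x i)) \<in> borel_measurable (M \<Otimes>\<^sub>M P0n n)" by simp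
    show "(\<lambda>x. f0 (snd x i)) \<in> borel_measurable (M \<Otimes>\<^sub>M P0n n)" by measurable
  qed
  define b where "b = prob B"
  have b0: "0 < b" using \<open>0 < prob B\<close> by (simp add: b_def)
  define G where "G = {y \<in> space (P0n n). (\<integral>\<^sup>+\<theta>. lr n \<theta> y * indicator B \<theta> \<partial>M) < ennreal e}"
  define I where "I y = (\<integral>\<^sup>+\<theta>. ir \<theta> y * indicator B \<theta> \<partial>M)" for y
  have I_meas [measurable]: "I \<in> borel_measurable (P0n n)" unfolding I_def by measurable
  have GI: "ennreal (b\<^sup>2 / e) \<le> I y" if "y \<in> G" for y
  proof -
    define c where "c = b / e"
    have c: "0 < c" using e b0 by (simp add: c_def)
    have y: "y \<in> space (P0n n)" using that by (simp add: G_def)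
    have [measurable]: "(\<lambda>\<theta>. ir \<theta> y) \<in> borel_measurable M"
      using measurable_compose[OF measurable_Pair2'[OF y] ir_meas] by simp
    note [measurable] = lr_measurable_fst[OF y]
    have point: "2 \<le> ennreal c * lr n \<theta> y + ennreal (1/c) * ir \<theta> y" if \<theta>: "\<theta> \<in> space M" for \<theta>
    proof -
      define u where "u = (\<Prod>i<n. f \<theta> (y i) / f0 (y i))"
      have u: "0 < u" unfolding u_def using f_pos[OF \<theta>] f0_pos by (intro prod_pos) auto
      have 1: "lr n \<theta> y = ennreal u" unfolding lr_def u_def
        using f_pos[OF \<theta>] f0_pos by (intro prod_ennreal) (auto simp: less_imp_le)
      have "ir \<theta> y = ennreal (\<Prod>i<n. f0 (y i) / f \<theta> (y i))" unfolding ir_def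
        using f_pos[OF \<theta>] f0_pos by (intro prod_ennreal) (auto simp: less_imp_le)
      also have "(\<Prod>i<n. f0 (y i) / f \<theta> (y i)) = 1 / u"
        unfolding u_def by (simp add: prod_dividef)
      finally have 2: "ir \<theta> y = ennreal (1 / u)" .
      have "0 \<le> (c * u - 1)\<^sup>2 / (c * u)" using c u by simp
      also have "(c * u - 1)\<^sup>2 / (c * u) = c * u + (1/c) * (1/u) - 2"
        using c u by (simp add: field_simps power2_eq_square)
      finally have "2 \<le> c * u + (1/c) * (1/u)" by simp
      then have "ennreal 2 \<le> ennreal (c * u + (1/c) * (1/u))" by (rule ennreal_leI)
      also have "\<dots> = ennreal c * ennreal u + ennreal (1/c) * ennreal (1/u)"
        using c u by (simp add: ennreal_plus flip: ennreal_mult)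
      finally show ?thesis by (simp add: 1 2)
    qed
    have "ennreal (2 * b) = (\<integral>\<^sup>+\<theta>. 2 * indicator B \<theta> \<partial>M)"
      by (simp add: nn_integral_cmult b_def emeasure_eq_measure ennreal_mult)
    also have "\<dots> \<le> (\<integral>\<^sup>+\<theta>. ennreal c * (lr n \<theta> y * indicator B \<theta>) + ennreal (1/c) * (ir \<theta> y * indicator B \<theta>) \<partial>M)"
      using point by (intro nn_integral_mono) (auto split: split_indicator)
    also have "\<dots> = ennreal c * (\<integral>\<^sup>+\<theta>. lr n \<theta> y * indicator B \<theta> \<partial>M) + ennreal (1/c) * I y"
      by (simp add: nn_integral_add nn_integral_cmult I_def)
    also have "\<dots> \<le> ennreal c * ennreal e + ennreal (1/c) * I y"
      using that by (intro add_right_mono mult_left_mono) (auto simp: G_def less_imp_le)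
    also have "ennreal c * ennreal e = ennreal b" using e c by (simp add: c_def flip: ennreal_mult)
    finally have le: "ennreal (2 * b) \<le> ennreal b + ennreal (1/c) * I y" .
    have "ennreal b \<le> ennreal (1/c) * I y"
    proof (rule ccontr)
      assume "\<not> ?thesis"
      then have "ennreal (1/c) * I y < ennreal b" by simp
      then have "ennreal b + ennreal (1/c) * I y < ennreal b + ennreal b"
        by (intro ennreal_add_left_cancel_less[THEN iffD2]) auto
      also have "\<dots> = ennreal (2 * b)" using b0 by (simp flip: ennreal_plus)
      finally show False using le by simp
    qed
    then have "ennreal c * ennreal b \<le> ennreal c * (ennreal (1/c) * I y)" by (intro mult_left_mono) auto
    also have "\<dots> = I y" using c by (simp flip: mult.assoc ennreal_mult)
    finally show ?thesis using b0 c e by (simp add: c_def power2_eq_square flip: ennreal_mult)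
  qed
  have "(\<integral>\<^sup>+y. I y \<partial>P0n n) = (\<integral>\<^sup>+\<theta>. (\<integral>\<^sup>+y. ir \<theta> y * indicator B \<theta> \<partial>P0n n) \<partial>M)"
    unfolding I_def by (rule pair_sigma_finite.Fubini'[OF pair_sigma_finite_P0n]) measurable
  also have "\<dots> \<le> (\<integral>\<^sup>+\<theta>. ennreal (exp (real n * \<delta>)) * indicator B \<theta> \<partial>M)"
  proof (rule nn_integral_mono)
    fix \<theta> assume \<theta>: "\<theta> \<in> space M"
    note [measurable] = f_section[OF \<theta>]
    have "(\<integral>\<^sup>+y. ir \<theta> y \<partial>P0n n) = (\<integral>\<^sup>+y. ennreal (f0 y / f \<theta> y) \<partial>P0) ^ n"
      unfolding ir_def by (rule nn_integral_P0n_prod) measurable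
    also have "(\<integral>\<^sup>+y. ennreal (f0 y / f \<theta> y) \<partial>P0) = (\<integral>\<^sup>+y. ennreal ((f0 y)\<^sup>2 / f \<theta> y) \<partial>lborel)"
      unfolding P0_def using f0_pos f_pos[OF \<theta>]
      by (subst nn_integral_density) (auto intro!: nn_integral_cong simp: power2_eq_square less_imp_le simp flip: ennreal_mult)
    finally have *: "(\<integral>\<^sup>+y. ir \<theta> y \<partial>P0n n) = \<dots> ^ n" .
    have "(\<integral>\<^sup>+y. ir \<theta> y \<partial>P0n n) \<le> ennreal (exp (real n * \<delta>))" if "\<theta> \<in> B"
    proof -
      have "(\<integral>\<^sup>+y. ir \<theta> y \<partial>P0n n) \<le> ennreal (exp \<delta>) ^ n"
        unfolding * by (intro power_mono chi that) auto
      then show ?thesis by (simp add: ennreal_power exp_of_nat_mult)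
    qed
    then show "(\<integral>\<^sup>+y. ir \<theta> y * indicator B \<theta> \<partial>P0n n) \<le> ennreal (exp (real n * \<delta>)) * indicator B \<theta>"
      by (auto split: split_indicator)
  qed
  also have "\<dots> = ennreal (exp (real n * \<delta>) * b)"
    by (simp add: nn_integral_cmult b_def emeasure_eq_measure ennreal_mult)
  finally have EI: "(\<integral>\<^sup>+y. I y \<partial>P0n n) \<le> ennreal (exp (real n * \<delta>) * b)" .
  have "emeasure (P0n n) G \<le> (\<integral>\<^sup>+y. ennreal (e / b\<^sup>2) * I y \<partial>P0n n)"
  proof -
    have Gm: "G \<in> sets (P0n n)" unfolding G_def by measurable
    have "emeasure (P0n n) G = (\<integral>\<^sup>+y. indicator G y \<partial>P0n n)" using Gm by simp
    also have "\<dots> \<le> (\<integral>\<^sup>+y. ennreal (e / b\<^sup>2) * I y \<partial>P0n n)"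
    proof (intro nn_integral_mono)
      fix y
      show "indicator G y \<le> ennreal (e / b\<^sup>2) * I y"
      proof (cases "y \<in> G")
        case True
        have "1 = ennreal (e / b\<^sup>2) * ennreal (b\<^sup>2 / e)" using e b0 by (simp flip: ennreal_mult)
        also have "\<dots> \<le> ennreal (e / b\<^sup>2) * I y" by (intro mult_left_mono GI True) auto
        finally show ?thesis using True by simp
      qed simp
    qed
    finally show ?thesis .
  qed
  also have "\<dots> = ennreal (e / b\<^sup>2) * (\<integral>\<^sup>+y. I y \<partial>P0n n)" by (rule nn_integral_cmult) measurable
  also have "\<dots> \<le> ennreal (e / b\<^sup>2) * ennreal (exp (real n * \<delta>) * b)" by (intro mult_left_mono EI) auto
  also have "\<dots> = ennreal (e / b * exp (real n * \<delta>))"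
    using e b0 by (simp add: power2_eq_square flip: ennreal_mult)
  finally show ?thesis by (simp add: G_def b_def)
qed

text \<open>The test for \<open>A\<close> rejects when the empirical frequency of \<open>A\<close> is at most \<open>P0 A - \<epsilon> / 2\<close>;
  both error probabilities are Chernoff bounds with exponent \<open>\<epsilon> / 4\<close>.\<close>

definition reject :: "nat \<Rightarrow> real \<Rightarrow> real set \<Rightarrow> (nat \<Rightarrow> real) set" where
  "reject n \<epsilon> A = {y \<in> space (P0n n). (\<Sum>i<n. indicator A (y i)) \<le> real n * (measure P0 A - \<epsilon> / 2)}"

lemma reject_sets [measurable]:
  assumes [measurable]: "A \<in> sets borel" shows "reject n \<epsilon> A \<in> sets (P0n n)"
proof -
  have [measurable]: "(\<lambda>y. \<Sum>i<n. indicator A (y i) :: real) \<in> borel_measurable (P0n n)"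
    by (intro borel_measurable_sum measurable_compose[OF component_measurable]) auto
  show ?thesis unfolding reject_def by measurable
qed

lemma type_1_error:
  assumes A[measurable]: "A \<in> sets borel" and \<epsilon>: "0 < \<epsilon>" "\<epsilon> \<le> 1"
  shows "emeasure (P0n n) (reject n \<epsilon> A) \<le> ennreal (exp (- (real n * \<epsilon>\<^sup>2 / 16)))"
proof -
  define q where "q = measure P0 A - \<epsilon> / 2"
  \<comment> \<open>Per observation the exponent is \<open>t * \<epsilon> / 2 + t\<^sup>2\<close>,
    and this \<open>t\<close> minimises it with value
    \<open>- \<epsilon>\<^sup>2 / 16\<close>.\<close>
  define t where "t = - \<epsilon> / 4"
  have t: "\<bar>t\<bar> \<le> 1" using \<epsilon> by (simp add: t_def)
  let ?g = "\<lambda>x. ennreal (exp (- t * q)) * ennreal (exp (t * indicator A x))"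
  have "emeasure (P0n n) (reject n \<epsilon> A) = (\<integral>\<^sup>+y. indicator (reject n \<epsilon> A) y \<partial>P0n n)" by simp
  also have "\<dots> \<le> (\<integral>\<^sup>+y. (\<Prod>i<n. ?g (y i)) \<partial>P0n n)"
  proof (rule nn_integral_mono)
    fix y
    have "(\<Prod>i<n. ?g (y i)) = ennreal (exp (\<Sum>i<n. - t * q + t * indicator A (y i)))"
      by (simp add: exp_sum mult_exp_exp ennreal_mult[symmetric] prod_ennreal)
    also have "(\<Sum>i<n. - t * q + t * z i) = - t * (real n * q - (\<Sum>i<n. z i))" for z
      by (simp add: sum.distrib sum_subtractf algebra_simps flip: sum_distrib_left)
    finally have eq: "(\<Prod>i<n. ?g (y i)) = ennreal (exp (- t * (real n * q - (\<Sum>i<n. indicator A (y i)))))" .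
    show "indicator (reject n \<epsilon> A) y \<le> (\<Prod>i<n. ?g (y i))"
      unfolding eq using \<epsilon> by (auto simp: reject_def q_def[symmetric] t_def split: split_indicator)
  qed
  also have "\<dots> = (\<integral>\<^sup>+y. ?g y \<partial>P0) ^ n" by (rule nn_integral_P0n_prod) measurable
  also have "\<dots> \<le> ennreal (exp (- \<epsilon>\<^sup>2 / 16)) ^ n"
  proof (rule power_mono)
    have "(\<integral>\<^sup>+y. ?g y \<partial>P0) = ennreal (exp (- t * q)) * (\<integral>\<^sup>+y. ennreal (exp (t * indicator A y)) \<partial>P0)"
      by (rule nn_integral_cmult) measurable
    also have "\<dots> \<le> ennreal (exp (- t * q)) * ennreal (exp (t * measure P0 A + t\<^sup>2))"
      using prob_space.nn_integral_exp_indicator_le[OF prob_space_P0 _ t, of A] A by (intro mult_left_mono) auto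
    also have "\<dots> = ennreal (exp (- \<epsilon>\<^sup>2 / 16))"
      by (simp add: t_def q_def power2_eq_square algebra_simps flip: ennreal_mult exp_add)
    finally show "(\<integral>\<^sup>+y. ?g y \<partial>P0) \<le> ennreal (exp (- \<epsilon>\<^sup>2 / 16))" .
  qed simp
  also have "\<dots> = ennreal (exp (- (real n * \<epsilon>\<^sup>2 / 16)))"
    by (simp add: ennreal_power flip: exp_of_nat_mult)
  finally show ?thesis .
qed

text \<open>The Chernoff bound depends on \<open>\<theta>\<close> only through the probability of
  \<open>A\<close>, so a single test is good for all of \<open>U\<close> at once and its error is
  not increased by the size of \<open>U\<close>.\<close>

lemma type_2_error:
  assumes A[measurable]: "A \<in> sets borel" and \<epsilon>: "0 < \<epsilon>" "\<epsilon> \<le> 1" and U: "U \<in> sets M"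
    and far: "\<And>\<theta>. \<theta> \<in> U \<Longrightarrow> measure (P\<theta> \<theta>) A \<le> measure P0 A - \<epsilon>"
  shows "(\<integral>\<^sup>+y. (\<integral>\<^sup>+\<theta>. lr n \<theta> y * indicator U \<theta> \<partial>M) * indicator (space (P0n n) - reject n \<epsilon> A) y \<partial>P0n n)
    \<le> ennreal (exp (- (real n * \<epsilon>\<^sup>2 / 16)))"
proof -
  define q where "q = measure P0 A - \<epsilon> / 2"
  define t where "t = \<epsilon> / 4"
  have t: "\<bar>t\<bar> \<le> 1" using \<epsilon> by (simp add: t_def)
  let ?g = "\<lambda>x. ennreal (exp (- t * q)) * ennreal (exp (t * indicator A x))"
  have "(\<integral>\<^sup>+y. (\<integral>\<^sup>+\<theta>. lr n \<theta> y * indicator U \<theta> \<partial>M) * indicator (space (P0n n) - reject n \<epsilon> A) y \<partial>P0n n)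
    \<le> (\<integral>\<^sup>+y. (\<integral>\<^sup>+\<theta>. lr n \<theta> y * indicator U \<theta> \<partial>M) * (\<Prod>i<n. ?g (y i)) \<partial>P0n n)"
  proof (intro nn_integral_mono mult_left_mono)
    fix y
    have "(\<Prod>i<n. ?g (y i)) = ennreal (exp (\<Sum>i<n. - t * q + t * indicator A (y i)))"
      by (simp add: exp_sum mult_exp_exp ennreal_mult[symmetric] prod_ennreal)
    also have "(\<Sum>i<n. - t * q + t * z i) = t * ((\<Sum>i<n. z i) - real n * q)" for z
      by (simp add: sum.distrib sum_subtractf algebra_simps flip: sum_distrib_left)
    finally have eq: "(\<Prod>i<n. ?g (y i)) = ennreal (exp (t * ((\<Sum>i<n. indicator A (y i)) - real n * q)))" .
    show "indicator (space (P0n n) - reject n \<epsilon> A) y \<le> (\<Prod>i<n. ?g (y i))"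
      unfolding eq using \<epsilon> by (auto simp: reject_def q_def[symmetric] t_def split: split_indicator)
  qed simp
  also have "\<dots> \<le> ennreal (exp (- (real n * \<epsilon>\<^sup>2 / 16))) * emeasure M U"
  proof (rule nn_integral_mass_test[OF U])
    fix \<theta> assume \<theta>: "\<theta> \<in> U"
    then have \<theta>': "\<theta> \<in> space M" using U sets.sets_into_space by blast
    have "(\<integral>\<^sup>+y. ?g y \<partial>P\<theta> \<theta>) = ennreal (exp (- t * q)) * (\<integral>\<^sup>+y. ennreal (exp (t * indicator A y)) \<partial>P\<theta> \<theta>)"
      by (rule nn_integral_cmult) measurable
    also have "\<dots> \<le> ennreal (exp (- t * q)) * ennreal (exp (t * measure (P\<theta> \<theta>) A + t\<^sup>2))"
      using prob_space.nn_integral_exp_indicator_le[OF prob_space_P\<theta>[OF \<theta>'] _ t, of A] A by (intro mult_left_mono) auto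
    also have "\<dots> = ennreal (exp (t * measure (P\<theta> \<theta>) A + t\<^sup>2 - t * q))"
      by (simp add: algebra_simps flip: ennreal_mult exp_add)
    also have "\<dots> \<le> ennreal (exp (- \<epsilon>\<^sup>2 / 16))"
    proof -
      have "t * measure (P\<theta> \<theta>) A \<le> t * (measure P0 A - \<epsilon>)"
        using far[OF \<theta>] \<epsilon> by (intro mult_left_mono) (auto simp: t_def)
      then have "t * measure (P\<theta> \<theta>) A + t\<^sup>2 - t * q \<le> - \<epsilon>\<^sup>2 / 16"
        by (simp add: t_def q_def power2_eq_square algebra_simps)
      then show ?thesis by (intro ennreal_leI) simp
    qed
    finally have "(\<integral>\<^sup>+y. ?g y \<partial>P\<theta> \<theta>) ^ n \<le> ennreal (exp (- \<epsilon>\<^sup>2 / 16)) ^ n" by (intro power_mono) auto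
    also have "\<dots> = ennreal (exp (- (real n * \<epsilon>\<^sup>2 / 16)))"
      by (simp add: ennreal_power flip: exp_of_nat_mult)
    finally show "(\<integral>\<^sup>+y. ?g y \<partial>P\<theta> \<theta>) ^ n \<le> ennreal (exp (- (real n * \<epsilon>\<^sup>2 / 16)))" .
  qed measurable
  also have "\<dots> \<le> ennreal (exp (- (real n * \<epsilon>\<^sup>2 / 16))) * 1"
    by (intro mult_left_mono) (auto simp: emeasure_le_1)
  finally show ?thesis by simp
qed

text \<open>The ratio can exceed \<open>d\<close> only on one of three bad events: the evidence of
  \<open>B\<close> is below \<open>e\<close> (\<open>G\<close>), some test rejects
  (\<open>R j\<close>), or the surviving numerator \<open>h\<close> reaches \<open>d * e\<close>
  (\<open>F\<close>). The three summands bound their probabilities in this order, the last one by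
  Markov's inequality.\<close>

theorem posterior_mass_bound:
  assumes B[measurable]: "B \<in> events" and b: "0 < prob B" and e: "0 < e" and d: "0 < d"
    and chi: "\<And>\<theta>. \<theta> \<in> B \<Longrightarrow> (\<integral>\<^sup>+y. ennreal ((f0 y)\<^sup>2 / f \<theta> y) \<partial>lborel) \<le> ennreal (exp \<delta>)"
    and J: "finite J" and A: "\<And>j. j \<in> J \<Longrightarrow> A j \<in> sets borel" and \<epsilon>: "0 < \<epsilon>" "\<epsilon> \<le> 1"
    and V[measurable]: "V \<in> events" and W[measurable]: "W \<in> events"
    and cover: "W \<subseteq> V \<union> (\<Union>j\<in>J. {\<theta> \<in> space M. measure (P\<theta> \<theta>) (A j) \<le> measure P0 (A j) - \<epsilon>})"
  shows "measure (P0n n) {y \<in> space (P0n n).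
      ennreal d * (\<integral>\<^sup>+\<theta>. lr n \<theta> y \<partial>M) < (\<integral>\<^sup>+\<theta>. lr n \<theta> y * indicator W \<theta> \<partial>M)}
    \<le> e / prob B * exp (real n * \<delta>) + real (card J) * exp (- (real n * \<epsilon>\<^sup>2 / 16))
      + (prob V + real (card J) * exp (- (real n * \<epsilon>\<^sup>2 / 16))) / (d * e)"
proof -
  define E where "E = exp (- (real n * \<epsilon>\<^sup>2 / 16))"
  define U where "U j = {\<theta> \<in> space M. measure (P\<theta> \<theta>) (A j) \<le> measure P0 (A j) - \<epsilon>}" for j
  have U[measurable]: "U j \<in> events" if "j \<in> J" for j
  proof -
    note A[OF that, measurable]
    have "measure (P\<theta> \<theta>) (A j) = enn2real (\<integral>\<^sup>+y. ennreal (f \<theta> y) * indicator (A j) y \<partial>lborel)" if "\<theta> \<in> space M" for \<theta>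
      using f_section[OF that] unfolding P\<theta>_def measure_def by (subst emeasure_density) auto
    then have "U j = {\<theta> \<in> space M. enn2real (\<integral>\<^sup>+y. ennreal (f \<theta> y) * indicator (A j) y \<partial>lborel) \<le> measure P0 (A j) - \<epsilon>}"
      by (auto simp: U_def)
    also have "\<dots> \<in> events" by measurable
    finally show ?thesis .
  qed
  define G where "G = {y \<in> space (P0n n). (\<integral>\<^sup>+\<theta>. lr n \<theta> y * indicator B \<theta> \<partial>M) < ennreal e}"
  have G[measurable]: "G \<in> sets (P0n n)" unfolding G_def by measurable
  define R where "R j = reject n \<epsilon> (A j)" for j
  have R[measurable]: "R j \<in> sets (P0n n)" if "j \<in> J" for j unfolding R_def by (intro reject_sets A that)
  \<comment> \<open>When no test rejects, \<open>h\<close> dominates the numerator over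
    \<open>W\<close>: the part in \<open>V\<close> is bounded by prior mass only, each
    \<open>U j\<close> by the acceptance of its own test.\<close>
  define h where "h y = (\<integral>\<^sup>+\<theta>. lr n \<theta> y * indicator V \<theta> \<partial>M)
      + (\<Sum>j\<in>J. (\<integral>\<^sup>+\<theta>. lr n \<theta> y * indicator (U j) \<theta> \<partial>M) * indicator (space (P0n n) - R j) y)" for y
  have h1: "(\<lambda>y. (\<integral>\<^sup>+\<theta>. lr n \<theta> y * indicator (U j) \<theta> \<partial>M) * indicator (space (P0n n) - R j) y) \<in> borel_measurable (P0n n)" if "j \<in> J" for j
    using U[OF that] R[OF that] by measurable
  have h[measurable]: "h \<in> borel_measurable (P0n n)" unfolding h_def
    by (intro borel_measurable_add borel_measurable_sum h1) measurable
  have Eh: "(\<integral>\<^sup>+y. h y \<partial>P0n n) \<le> ennreal (prob V + real (card J) * E)"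
  proof -
    have "(\<integral>\<^sup>+y. h y \<partial>P0n n) = (\<integral>\<^sup>+y. (\<integral>\<^sup>+\<theta>. lr n \<theta> y * indicator V \<theta> \<partial>M) \<partial>P0n n)
      + (\<Sum>j\<in>J. (\<integral>\<^sup>+y. (\<integral>\<^sup>+\<theta>. lr n \<theta> y * indicator (U j) \<theta> \<partial>M) * indicator (space (P0n n) - R j) y \<partial>P0n n))"
      unfolding h_def using h1
      by (subst nn_integral_add) (auto intro!: borel_measurable_sum simp: nn_integral_sum)
    also have "\<dots> \<le> ennreal (prob V) + (\<Sum>j\<in>J. ennreal E)"
    proof (intro add_mono sum_mono)
      have "(\<integral>\<^sup>+y. 1 \<partial>P\<theta> \<theta>) ^ n \<le> 1" if "\<theta> \<in> V" for \<theta>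
      proof -
        have "\<theta> \<in> space M" using that sets.sets_into_space[OF V] by auto
        then show ?thesis using prob_space.emeasure_space_1[OF prob_space_P\<theta>] by simp
      qed
      from nn_integral_mass_test[OF V _ this]
      show "(\<integral>\<^sup>+y. (\<integral>\<^sup>+\<theta>. lr n \<theta> y * indicator V \<theta> \<partial>M) \<partial>P0n n) \<le> ennreal (prob V)"
        by (simp add: emeasure_eq_measure)
      fix j assume j: "j \<in> J"
      show "(\<integral>\<^sup>+y. (\<integral>\<^sup>+\<theta>. lr n \<theta> y * indicator (U j) \<theta> \<partial>M) * indicator (space (P0n n) - R j) y \<partial>P0n n) \<le> ennreal E"
        unfolding R_def E_def by (rule type_2_error[OF A[OF j] \<epsilon> U[OF j]]) (simp add: U_def)
    qed
    also have "\<dots> = ennreal (prob V + real (card J) * E)"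
      by (simp add: E_def ennreal_plus ennreal_mult ennreal_of_nat_eq_real_of_nat)
    finally show ?thesis .
  qed
  define F where "F = {y \<in> space (P0n n). ennreal (d * e) \<le> h y}"
  have F[measurable]: "F \<in> sets (P0n n)" unfolding F_def by measurable
  let ?S = "{y \<in> space (P0n n). ennreal d * (\<integral>\<^sup>+\<theta>. lr n \<theta> y \<partial>M) < (\<integral>\<^sup>+\<theta>. lr n \<theta> y * indicator W \<theta> \<partial>M)}"
  have sub: "?S \<subseteq> G \<union> (\<Union>j\<in>J. R j) \<union> F"
  proof
    fix y assume yS: "y \<in> ?S"
    then have y: "y \<in> space (P0n n)" by simp
    note [measurable] = lr_measurable_fst[OF y]
    show "y \<in> G \<union> (\<Union>j\<in>J. R j) \<union> F"
    proof (rule ccontr)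
      assume not: "\<not> ?thesis"
      then have "ennreal e \<le> (\<integral>\<^sup>+\<theta>. lr n \<theta> y * indicator B \<theta> \<partial>M)" using y by (auto simp: G_def)
      also have "\<dots> \<le> (\<integral>\<^sup>+\<theta>. lr n \<theta> y \<partial>M)" by (intro nn_integral_mono) (auto split: split_indicator)
      finally have 1: "ennreal (d * e) \<le> ennreal d * (\<integral>\<^sup>+\<theta>. lr n \<theta> y \<partial>M)"
        using d e by (simp add: ennreal_mult mult_left_mono)
      have "(\<integral>\<^sup>+\<theta>. lr n \<theta> y * indicator W \<theta> \<partial>M) \<le> (\<integral>\<^sup>+\<theta>. lr n \<theta> y * indicator V \<theta> + (\<Sum>j\<in>J. lr n \<theta> y * indicator (U j) \<theta>) \<partial>M)"
      proof (rule nn_integral_mono)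
        fix \<theta>
        show "lr n \<theta> y * indicator W \<theta> \<le> lr n \<theta> y * indicator V \<theta> + (\<Sum>j\<in>J. lr n \<theta> y * indicator (U j) \<theta>)"
        proof (cases "\<theta> \<in> W \<and> \<theta> \<notin> V")
          case True
          then obtain j where j: "j \<in> J" "\<theta> \<in> U j" using cover by (auto simp: U_def)
          have "lr n \<theta> y * indicator W \<theta> \<le> lr n \<theta> y * indicator (U j) \<theta>" using True j by simp
          also have "\<dots> \<le> (\<Sum>j\<in>J. lr n \<theta> y * indicator (U j) \<theta>)" using j J by (intro member_le_sum) auto
          finally show ?thesis using True by simp
        qed (auto split: split_indicator)
      qed
      also have "\<dots> = (\<integral>\<^sup>+\<theta>. lr n \<theta> y * indicator V \<theta> \<partial>M) + (\<Sum>j\<in>J. (\<integral>\<^sup>+\<theta>. lr n \<theta> y * indicator (U j) \<theta> \<partial>M))"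
        using U by (subst nn_integral_add) (auto intro!: borel_measurable_sum simp: nn_integral_sum)
      also have "\<dots> = h y" unfolding h_def using not y by (auto intro!: sum.cong)
      finally have "ennreal d * (\<integral>\<^sup>+\<theta>. lr n \<theta> y \<partial>M) < h y" using yS by auto
      then have "ennreal (d * e) \<le> h y" using 1 by auto
      then show False using not y by (auto simp: F_def)
    qed
  qed
  have "emeasure (P0n n) ?S \<le> emeasure (P0n n) (G \<union> (\<Union>j\<in>J. R j) \<union> F)"
    using J R by (intro emeasure_mono sub sets.Un sets.finite_UN) auto
  also have "\<dots> \<le> emeasure (P0n n) G + (\<Sum>j\<in>J. emeasure (P0n n) (R j)) + emeasure (P0n n) F"
  proof -
    have m: "(\<Union>j\<in>J. R j) \<in> sets (P0n n)" using J R by (intro sets.finite_UN) auto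
    have "emeasure (P0n n) (G \<union> (\<Union>j\<in>J. R j) \<union> F) \<le> emeasure (P0n n) (G \<union> (\<Union>j\<in>J. R j)) + emeasure (P0n n) F"
      using m by (intro emeasure_subadditive) auto
    also have "emeasure (P0n n) (G \<union> (\<Union>j\<in>J. R j)) \<le> emeasure (P0n n) G + emeasure (P0n n) (\<Union>j\<in>J. R j)"
      using m by (intro emeasure_subadditive) auto
    also have "emeasure (P0n n) (\<Union>j\<in>J. R j) \<le> (\<Sum>j\<in>J. emeasure (P0n n) (R j))"
      using J R by (intro emeasure_subadditive_finite) auto
    finally show ?thesis by (simp add: add_right_mono)
  qed
  also have "\<dots> \<le> ennreal (e / prob B * exp (real n * \<delta>)) + (\<Sum>j\<in>J. ennreal E) + ennreal ((prob V + real (card J) * E) / (d * e))"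
  proof (intro add_mono sum_mono)
    show "emeasure (P0n n) G \<le> ennreal (e / prob B * exp (real n * \<delta>))"
      unfolding G_def by (rule evidence_lower_bound[OF B b e chi])
    show "emeasure (P0n n) (R j) \<le> ennreal E" if "j \<in> J" for j
      unfolding R_def E_def by (rule type_1_error[OF A[OF that] \<epsilon>])
    have "emeasure (P0n n) F = (\<integral>\<^sup>+y. indicator F y \<partial>P0n n)" by simp
    also have "\<dots> \<le> (\<integral>\<^sup>+y. ennreal (1 / (d * e)) * h y \<partial>P0n n)"
    proof (intro nn_integral_mono)
      fix y
      show "indicator F y \<le> ennreal (1 / (d * e)) * h y"
      proof (cases "y \<in> F")
        case True
        have "1 = ennreal (1 / (d * e)) * ennreal (d * e)" using d e by (simp flip: ennreal_mult)
        also have "\<dots> \<le> ennreal (1 / (d * e)) * h y" using True by (intro mult_left_mono) (auto simp: F_def)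
        finally show ?thesis using True by simp
      qed simp
    qed
    also have "\<dots> = ennreal (1 / (d * e)) * (\<integral>\<^sup>+y. h y \<partial>P0n n)" by (rule nn_integral_cmult) measurable
    also have "\<dots> \<le> ennreal (1 / (d * e)) * ennreal (prob V + real (card J) * E)" by (intro mult_left_mono Eh) auto
    also have "\<dots> = ennreal ((prob V + real (card J) * E) / (d * e))"
      using d e by (subst ennreal_mult[symmetric]) (auto simp: E_def intro!: add_nonneg_nonneg)
    finally show "emeasure (P0n n) F \<le> ennreal ((prob V + real (card J) * E) / (d * e))" .
  qed
  also have "\<dots> = ennreal (e / prob B * exp (real n * \<delta>) + real (card J) * E + (prob V + real (card J) * E) / (d * e))"
    using d e b by (simp add: E_def ennreal_plus ennreal_mult ennreal_of_nat_eq_real_of_nat)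
  finally have le: "emeasure (P0n n) ?S \<le> \<dots>" .
  interpret P: prob_space "P0n n" by (rule prob_space_P0n)
  have "0 \<le> e / prob B * exp (real n * \<delta>) + real (card J) * E + (prob V + real (card J) * E) / (d * e)"
    using d e by (intro add_nonneg_nonneg divide_nonneg_nonneg mult_nonneg_nonneg) (auto simp: E_def)
  then show ?thesis using le unfolding P.emeasure_eq_measure E_def by (subst (asm) ennreal_le_iff)
qed

end

section \<open>Laplace convolutions\<close>

lemma laplace_nn_integral_ge:
  "(\<integral>\<^sup>+y. ennreal (laplace_density y) * indicator {0..} y \<partial>lborel) = ennreal (1 / 2)"
proof -
  have "(\<integral>\<^sup>+y. ennreal (exp (- y) / 2) * indicator {0..} y \<partial>lborel) = ennreal (0 - (- exp (- 0) / 2))"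
  proof (rule nn_integral_FTC_atLeast)
    have "((\<lambda>t::real. - exp (- t) / 2) \<longlongrightarrow> - 0 / 2) at_top"
      by (intro tendsto_intros filterlim_compose[OF exp_at_bot] filterlim_uminus_at_bot_at_top) simp
    then show "((\<lambda>t::real. - exp (- t) / 2) \<longlongrightarrow> 0) at_top" by simp
  qed (auto intro!: derivative_eq_intros)
  also have "(\<integral>\<^sup>+y. ennreal (exp (- y) / 2) * indicator {0..} y \<partial>lborel) = (\<integral>\<^sup>+y. ennreal (laplace_density y) * indicator {0..} y \<partial>lborel)"
    by (intro nn_integral_cong) (auto simp: laplace_density_def split: split_indicator)
  finally show ?thesis by simp
qed

lemma laplace_nn_integral: "(\<integral>\<^sup>+y. ennreal (laplace_density (y - x)) \<partial>lborel) = 1"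
proof -
  have "(\<integral>\<^sup>+y. ennreal (laplace_density (y - x)) \<partial>lborel) = (\<integral>\<^sup>+y. ennreal (laplace_density y) \<partial>lborel)"
    using nn_integral_real_affine[of "\<lambda>y. ennreal (laplace_density (y - x))" 1 x] by simp
  also have "\<dots> = (\<integral>\<^sup>+y. ennreal (laplace_density y) * indicator {0..} y + ennreal (laplace_density y) * indicator {..<0} y \<partial>lborel)"
    by (intro nn_integral_cong) (auto split: split_indicator)
  also have "\<dots> = (\<integral>\<^sup>+y. ennreal (laplace_density y) * indicator {0..} y \<partial>lborel) + (\<integral>\<^sup>+y. ennreal (laplace_density y) * indicator {..<0} y \<partial>lborel)"
    by (rule nn_integral_add) measurable
  also have "(\<integral>\<^sup>+y. ennreal (laplace_density y) * indicator {..<0} y \<partial>lborel) = (\<integral>\<^sup>+y. ennreal (laplace_density y) * indicator {0..} y \<partial>lborel)"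
  proof -
    have "(\<integral>\<^sup>+y. ennreal (laplace_density y) * indicator {..<0} y \<partial>lborel)
      = (\<integral>\<^sup>+y. ennreal (laplace_density (0 + (-1) * y)) * indicator {..<0} (0 + (-1) * y) \<partial>lborel)"
      by (subst nn_integral_real_affine[where c="-1" and t=0]) auto
    also have "\<dots> = (\<integral>\<^sup>+y. ennreal (laplace_density y) * indicator {0..} y \<partial>lborel)"
    proof (rule nn_integral_cong_AE)
      show "AE y in lborel. ennreal (laplace_density (0 + (-1) * y)) * indicator {..<0} (0 + (-1) * y) = ennreal (laplace_density y) * indicator {0..} y"
        using AE_lborel_singleton[of "0::real"] by eventually_elim (auto simp: laplace_density_def split: split_indicator)
    qed
    finally show ?thesis .
  qed
  also have "(\<integral>\<^sup>+y. ennreal (laplace_density y) * indicator {0..} y \<partial>lborel) + (\<integral>\<^sup>+y. ennreal (laplace_density y) * indicator {0..} y \<partial>lborel) = 1"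
    unfolding laplace_nn_integral_ge by (subst ennreal_plus[symmetric]) auto
  finally show ?thesis .
qed

context
  fixes \<mu> :: "real measure"
  assumes fin: "finite_measure \<mu>" and sets_\<mu> [measurable_cong]: "sets \<mu> = sets borel"
begin

interpretation finite_measure \<mu> by (rule fin)

lemma laplace_integrable: "integrable \<mu> (\<lambda>x. laplace_density (y - x))"
  by (rule integrable_const_bound[where B=1])
     (auto simp: abs_of_pos laplace_density_pos intro!: AE_I2 order_trans[OF laplace_density_le])

lemma ennreal_obs_density: "ennreal (obs_density \<mu> y) = (\<integral>\<^sup>+x. ennreal (laplace_density (y - x)) \<partial>\<mu>)"
  unfolding obs_density_def
  by (rule nn_integral_eq_integral[symmetric]) (auto simp: laplace_integrable laplace_density_pos less_imp_le)

lemma obs_density_nonneg: "0 \<le> obs_density \<mu> y"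
  unfolding obs_density_def by (intro integral_nonneg_AE) (auto simp: laplace_density_pos less_imp_le)

lemma obs_density_measurable: "obs_density \<mu> \<in> borel_measurable borel"
  unfolding obs_density_def by measurable

lemma nn_integral_obs_density:
  assumes [measurable]: "g \<in> borel_measurable borel"
  shows "(\<integral>\<^sup>+y. g y * ennreal (obs_density \<mu> y) \<partial>lborel)
    = (\<integral>\<^sup>+x. (\<integral>\<^sup>+y. g y * ennreal (laplace_density (y - x)) \<partial>lborel) \<partial>\<mu>)"
proof -
  interpret pair_sigma_finite lborel \<mu>
    unfolding pair_sigma_finite_def using sigma_finite_measure_axioms lborel.sigma_finite_measure_axioms by auto
  have "(\<integral>\<^sup>+y. g y * ennreal (obs_density \<mu> y) \<partial>lborel) = (\<integral>\<^sup>+y. (\<integral>\<^sup>+x. g y * ennreal (laplace_density (y - x)) \<partial>\<mu>) \<partial>lborel)"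
    unfolding ennreal_obs_density by (intro nn_integral_cong nn_integral_cmult[symmetric]) measurable
  also have "\<dots> = (\<integral>\<^sup>+x. (\<integral>\<^sup>+y. g y * ennreal (laplace_density (y - x)) \<partial>lborel) \<partial>\<mu>)"
    by (rule Fubini'[symmetric]) measurable
  finally show ?thesis .
qed

lemma obs_density_total: "(\<integral>\<^sup>+y. ennreal (obs_density \<mu> y) \<partial>lborel) = emeasure \<mu> UNIV"
  using nn_integral_obs_density[of "\<lambda>_. 1"] sets_eq_imp_space_eq[OF sets_\<mu>] by (simp add: laplace_nn_integral)

lemma obs_density_integrable: "integrable lborel (obs_density \<mu>)"
  by (rule integrableI_nonneg)
     (auto simp: obs_density_measurable obs_density_nonneg obs_density_total less_top[symmetric])

lemma obs_density_pos:
  assumes "emeasure \<mu> UNIV \<noteq> 0" shows "0 < obs_density \<mu> y"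
proof -
  have "obs_density \<mu> y \<noteq> 0"
  proof
    assume "obs_density \<mu> y = 0"
    then have "AE x in \<mu>. laplace_density (y - x) = 0"
      unfolding obs_density_def
      by (subst (asm) integral_nonneg_eq_0_iff_AE) (auto simp: laplace_integrable laplace_density_pos less_imp_le)
    then have "AE x in \<mu>. False" by eventually_elim (use laplace_density_pos in \<open>simp add: less_imp_neq[symmetric]\<close>)
    then show False using assms sets_eq_imp_space_eq[OF sets_\<mu>] by (simp add: eventually_False ae_filter_eq_bot_iff)
  qed
  then show ?thesis using obs_density_nonneg[of y] by simp
qed

end

text \<open>The expected payoff \<open>(t - Y)\<^sub>+\<close> under the Laplace law; adding \<open>laplace_density\<close> to
  \<open>(t - x)\<^sub>+\<close> is the effect of Laplace noise since the Laplace convolution inverts \<open>1 - d\<^sup>2 / d t\<^sup>2\<close>.\<close>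

lemma laplace_payoff:
  "(\<integral>\<^sup>+y. ennreal (max 0 (t - y)) * ennreal (laplace_density (y - x)) \<partial>lborel)
    = ennreal (max 0 (t - x) + laplace_density (t - x))"
proof -
  define s where "s = t - x"
  have lim: "((\<lambda>u::real. - ((1 + u) * exp (s - u) / 2)) \<longlongrightarrow> 0) at_top" by real_asymp
  have upper: "(\<integral>\<^sup>+u. ennreal (u * exp (s - u) / 2) * indicator {a..} u \<partial>lborel) = ennreal ((1 + a) * exp (s - a) / 2)"
    if "0 \<le> a" for a
  proof -
    have "(\<integral>\<^sup>+u. ennreal (u * exp (s - u) / 2) * indicator {a..} u \<partial>lborel) = ennreal (0 - (- ((1 + a) * exp (s - a) / 2)))"
      using that by (intro nn_integral_FTC_atLeast[OF _ _ _ lim])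
        (auto intro!: derivative_eq_intros simp: field_simps)
    then show ?thesis by simp
  qed
  have "(\<integral>\<^sup>+y. ennreal (max 0 (t - y)) * ennreal (laplace_density (y - x)) \<partial>lborel)
    = (\<integral>\<^sup>+u. ennreal (max 0 u) * ennreal (laplace_density (s - u)) \<partial>lborel)"
    by (subst nn_integral_real_affine[where c="-1" and t=t]) (auto simp: s_def algebra_simps)
  also have "\<dots> = ennreal (max 0 s + laplace_density s)"
  proof (cases "s \<le> 0")
    case True
    have "(\<integral>\<^sup>+u. ennreal (max 0 u) * ennreal (laplace_density (s - u)) \<partial>lborel)
      = (\<integral>\<^sup>+u. ennreal (u * exp (s - u) / 2) * indicator {0..} u \<partial>lborel)"
      using True by (intro nn_integral_cong) (auto simp: laplace_density_def max_def simp flip: ennreal_mult split: split_indicator)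
    then show ?thesis using True upper[of 0] by (simp add: laplace_density_def)
  next
    case False
    then have s: "0 \<le> s" by simp
    have lower: "(\<integral>\<^sup>+u. ennreal (u * exp (u - s) / 2) * indicator {0..s} u \<partial>lborel) = ennreal ((s - 1) * exp (s - s) / 2 - (0 - 1) * exp (0 - s) / 2)"
      using s by (intro nn_integral_FTC_Icc) (auto intro!: derivative_eq_intros simp: field_simps)
    have "(\<integral>\<^sup>+u. ennreal (max 0 u) * ennreal (laplace_density (s - u)) \<partial>lborel)
      = (\<integral>\<^sup>+u. ennreal (u * exp (u - s) / 2) * indicator {0..s} u + ennreal (u * exp (s - u) / 2) * indicator {s..} u \<partial>lborel)"
    proof (rule nn_integral_cong_AE)
      show "AE u in lborel. ennreal (max 0 u) * ennreal (laplace_density (s - u))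
          = ennreal (u * exp (u - s) / 2) * indicator {0..s} u + ennreal (u * exp (s - u) / 2) * indicator {s..} u"
        using AE_lborel_singleton[of s]
        by eventually_elim (use s in \<open>auto simp: laplace_density_def max_def simp flip: ennreal_mult split: split_indicator\<close>)
    qed
    also have "\<dots> = ennreal ((s - 1) * exp (s - s) / 2 - (0 - 1) * exp (0 - s) / 2) + ennreal ((1 + s) * exp (s - s) / 2)"
      by (subst nn_integral_add) (simp_all only: lower upper[OF s], measurable)
    also have "\<dots> = ennreal (max 0 s + laplace_density s)"
    proof -
      have "0 \<le> (s - 1) / 2 + exp (- s) / 2"
        using exp_ge_add_one_self[of "-s"] by (simp flip: add_divide_distrib)
      then show ?thesis using s
        by (simp add: laplace_density_def max_def field_simps flip: ennreal_plus)
    qed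
    finally show ?thesis .
  qed
  finally show ?thesis by (simp add: s_def)
qed

section \<open>Windowed averages of distribution functions\<close>

text \<open>As a function of \<open>y\<close> this is the integral, over \<open>s\<close> in
  \<open>[x, x + h]\<close>, of the step that equals 1 for \<open>y \<le> s\<close>. Being a
  difference of two payoffs it is bounded, and the effect of Laplace noise on it is
  explicit.\<close>

definition ramp :: "real \<Rightarrow> real \<Rightarrow> real \<Rightarrow> real" where
  "ramp h x y = max 0 (x + h - y) - max 0 (x - y)"

lemma ramp_measurable [measurable]: "(\<lambda>(x, y). ramp h x y) \<in> borel_measurable (borel \<Otimes>\<^sub>M borel)"
  "ramp h x \<in> borel_measurable borel"
  unfolding ramp_def by measurable

lemma ramp_bounds: "0 < h \<Longrightarrow> 0 \<le> ramp h x y" "0 < h \<Longrightarrow> ramp h x y \<le> h"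
  by (auto simp: ramp_def)

text \<open>The two payoff identities are subtracted, which is legitimate in \<open>ennreal\<close>
  because the subtracted value is finite. The second claim keeps the sign that the return to real
  integrals requires.\<close>

lemma ramp_laplace:
  assumes h: "0 < h"
  shows "(\<integral>\<^sup>+y. ennreal (ramp h x y) * ennreal (laplace_density (y - z)) \<partial>lborel)
    = ennreal (ramp h x z + laplace_density (x + h - z) - laplace_density (x - z))"
    and "0 \<le> ramp h x z + laplace_density (x + h - z) - laplace_density (x - z)"
proof -
  let ?I = "\<integral>\<^sup>+y. ennreal (ramp h x y) * ennreal (laplace_density (y - z)) \<partial>lborel"
  define a where "a = max 0 (x - z) + laplace_density (x - z)"
  define b where "b = max 0 (x + h - z) + laplace_density (x + h - z)"
  have a: "0 \<le> a" unfolding a_def using laplace_density_pos[of "x - z"] by simp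
  have "ennreal b = (\<integral>\<^sup>+y. ennreal (max 0 (x + h - y)) * ennreal (laplace_density (y - z)) \<partial>lborel)"
    unfolding b_def by (rule laplace_payoff[symmetric])
  also have "\<dots> = (\<integral>\<^sup>+y. ennreal (ramp h x y) * ennreal (laplace_density (y - z)) + ennreal (max 0 (x - y)) * ennreal (laplace_density (y - z)) \<partial>lborel)"
  proof (intro nn_integral_cong)
    fix y
    have "max 0 (x + h - y) = ramp h x y + max 0 (x - y)" by (simp add: ramp_def)
    then show "ennreal (max 0 (x + h - y)) * ennreal (laplace_density (y - z))
      = ennreal (ramp h x y) * ennreal (laplace_density (y - z)) + ennreal (max 0 (x - y)) * ennreal (laplace_density (y - z))"
      using ramp_bounds[OF h, of x y] by (simp add: distrib_right)
  qed
  also have "\<dots> = ?I + ennreal a"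
    unfolding a_def laplace_payoff[symmetric] by (rule nn_integral_add) measurable
  finally have eq: "ennreal b = ?I + ennreal a" .
  then have le: "ennreal a \<le> ennreal b" by simp
  have "?I = ennreal b - ennreal a" unfolding eq by simp
  also have "\<dots> = ennreal (b - a)" using a by (rule ennreal_minus)
  finally show "?I = ennreal (ramp h x z + laplace_density (x + h - z) - laplace_density (x - z))"
    by (simp add: a_def b_def ramp_def algebra_simps)
  have "a \<le> b" using le a laplace_density_pos[of "x + h - z"] by (subst (asm) ennreal_le_iff) (auto simp: b_def)
  then show "0 \<le> ramp h x z + laplace_density (x + h - z) - laplace_density (x - z)"
    by (simp add: a_def b_def ramp_def algebra_simps)
qed

text \<open>In the variable \<open>y\<close> the second derivative of the ramp is a unit mass at
  \<open>x + h\<close> minus one at \<open>x\<close>. Undoing the noise by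
  \<open>1 - d^2/dy^2\<close> therefore leaves just two values of the density, and the density
  itself is never differentiated.\<close>

lemma ramp_obs_density:
  assumes P: "prob_space \<mu>" and s[measurable_cong]: "sets \<mu> = sets borel" and h: "0 < h"
  shows "(\<integral>y. ramp h x y * obs_density \<mu> y \<partial>lborel)
    = (\<integral>z. ramp h x z \<partial>\<mu>) + obs_density \<mu> (x + h) - obs_density \<mu> x"
    and "integrable lborel (\<lambda>y. ramp h x y * obs_density \<mu> y)"
proof -
  interpret prob_space \<mu> by (rule P)
  note F = finite_measure_axioms s
  note [measurable] = obs_density_measurable[OF F]
  show int: "integrable lborel (\<lambda>y. ramp h x y * obs_density \<mu> y)"
    using ramp_bounds[OF h, of x] h
    by (intro Bochner_Integration.integrable_bound[OF integrable_mult_right[OF obs_density_integrable[OF F], of h]])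
       (auto simp: abs_mult obs_density_nonneg[OF F] intro!: AE_I2 mult_right_mono)
  have intr: "integrable \<mu> (ramp h x)"
    using ramp_bounds[OF h, of x] by (intro integrable_const_bound[where B=h]) auto
  let ?k = "\<lambda>z. ramp h x z + laplace_density (x + h - z) - laplace_density (x - z)"
  have "ennreal (\<integral>y. ramp h x y * obs_density \<mu> y \<partial>lborel) = (\<integral>\<^sup>+y. ennreal (ramp h x y * obs_density \<mu> y) \<partial>lborel)"
    using ramp_bounds[OF h] by (intro nn_integral_eq_integral[symmetric] int) (auto intro!: AE_I2 mult_nonneg_nonneg obs_density_nonneg[OF F])
  also have "\<dots> = (\<integral>\<^sup>+y. ennreal (ramp h x y) * ennreal (obs_density \<mu> y) \<partial>lborel)"
    using ramp_bounds[OF h] by (simp add: ennreal_mult obs_density_nonneg[OF F])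
  also have "\<dots> = (\<integral>\<^sup>+z. ennreal (?k z) \<partial>\<mu>)"
    by (subst nn_integral_obs_density[OF F]) (simp_all add: ramp_laplace[OF h])
  also have "\<dots> = ennreal (\<integral>z. ?k z \<partial>\<mu>)"
    using ramp_laplace(2)[OF h] by (intro nn_integral_eq_integral) (auto intro!: intr laplace_integrable[OF F])
  finally have "(\<integral>y. ramp h x y * obs_density \<mu> y \<partial>lborel) = (\<integral>z. ?k z \<partial>\<mu>)"
    using ramp_laplace(2)[OF h, of x] ramp_bounds[OF h, of x] obs_density_nonneg[OF F]
    by (subst (asm) ennreal_inj) (auto intro!: integral_nonneg_AE AE_I2 mult_nonneg_nonneg)
  also have "\<dots> = (\<integral>z. ramp h x z \<partial>\<mu>) + obs_density \<mu> (x + h) - obs_density \<mu> x"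
    unfolding obs_density_def using intr laplace_integrable[OF F] by simp
  finally show "(\<integral>y. ramp h x y * obs_density \<mu> y \<partial>lborel) = \<dots>" .
qed

section \<open>Wasserstein distance\<close>

lemma nn_integral_between:
  "(\<integral>\<^sup>+x. indicator {x::real. (a \<le> x) \<noteq> (b \<le> x)} x \<partial>lborel) = ennreal \<bar>a - b\<bar>"
proof -
  have "{x::real. (a \<le> x) \<noteq> (b \<le> x)} = {min a b..<max a b}" by auto
  then show ?thesis by (auto simp: min_def max_def)
qed

text \<open>The quantile coupling has cost \<open>\<integral>\<bar>F - G\<bar>\<close>: both integrals measure the region between the
  graphs of the two distribution functions.\<close>

lemma wasserstein1_le_cdf:
  assumes \<mu>: "prob_space \<mu>" "sets \<mu> = sets borel" and \<nu>: "prob_space \<nu>" "sets \<nu> = sets borel"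
  shows "wasserstein1 \<mu> \<nu> \<le> (\<integral>\<^sup>+x. ennreal \<bar>cdf \<mu> x - cdf \<nu> x\<bar> \<partial>lborel)"
proof -
  interpret M: prob_space \<mu> by (rule \<mu>)
  interpret N: prob_space \<nu> by (rule \<nu>)
  interpret M: cdf_distribution \<mu>
    using \<mu> sets_eq_imp_space_eq[OF \<mu>(2)]
    by (simp add: cdf_distribution_def real_distribution_def real_distribution_axioms_def)
  interpret N: cdf_distribution \<nu>
    using \<nu> sets_eq_imp_space_eq[OF \<nu>(2)]
    by (simp add: cdf_distribution_def real_distribution_def real_distribution_axioms_def)
  define \<Omega> :: "real measure" where "\<Omega> = restrict_space lborel {0<..<1}"
  interpret \<Omega>: prob_space \<Omega>
    unfolding \<Omega>_def by (auto simp add: emeasure_restrict_space space_restrict_space intro!: prob_spaceI)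
  have [measurable]: "M.I \<in> borel_measurable \<Omega>" "N.I \<in> borel_measurable \<Omega>"
    using M.measurable_CI N.measurable_CI unfolding \<Omega>_def
    by (simp_all cong: measurable_cong_sets sets_restrict_space_cong)
  have dM: "distr \<Omega> borel M.I = \<mu>" unfolding \<Omega>_def by (rule M.distr_I_eq_M)
  have dN: "distr \<Omega> borel N.I = \<nu>" unfolding \<Omega>_def by (rule N.distr_I_eq_M)
  define \<gamma> where "\<gamma> = distr \<Omega> (borel \<Otimes>\<^sub>M borel) (\<lambda>\<omega>. (M.I \<omega>, N.I \<omega>))"
  have "\<gamma> \<in> couplings \<mu> \<nu>"
    unfolding couplings_def \<gamma>_def
    by (auto intro!: \<Omega>.prob_space_distr simp: distr_distr o_def dM dN)
  then have "wasserstein1 \<mu> \<nu> \<le> (\<integral>\<^sup>+p. ennreal \<bar>fst p - snd p\<bar> \<partial>\<gamma>)"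
    unfolding wasserstein1_def by (rule INF_lower)
  also have "\<dots> = (\<integral>\<^sup>+\<omega>. ennreal \<bar>M.I \<omega> - N.I \<omega>\<bar> \<partial>\<Omega>)"
    unfolding \<gamma>_def by (subst nn_integral_distr) auto
  also have "\<dots> = (\<integral>\<^sup>+\<omega>. (\<integral>\<^sup>+x. indicator {x. (M.I \<omega> \<le> x) \<noteq> (N.I \<omega> \<le> x)} x \<partial>lborel) \<partial>\<Omega>)"
    unfolding nn_integral_between ..
  also have "\<dots> = (\<integral>\<^sup>+x. (\<integral>\<^sup>+\<omega>. indicator {x. (M.I \<omega> \<le> x) \<noteq> (N.I \<omega> \<le> x)} x \<partial>\<Omega>) \<partial>lborel)"
  proof -
    interpret pair_sigma_finite lborel \<Omega> ..
    have [measurable]: "(\<lambda>(x, \<omega>). indicator {x. (M.I \<omega> \<le> x) \<noteq> (N.I \<omega> \<le> x)} x :: ennreal) \<in> borel_measurable (lborel \<Otimes>\<^sub>M \<Omega>)"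
      unfolding indicator_def case_prod_beta mem_Collect_eq by measurable
    show ?thesis by (rule Fubini') measurable
  qed
  also have "\<dots> \<le> (\<integral>\<^sup>+x. ennreal \<bar>cdf \<mu> x - cdf \<nu> x\<bar> \<partial>lborel)"
  proof (rule nn_integral_mono)
    fix x
    let ?S = "{\<omega> \<in> space \<Omega>. (M.I \<omega> \<le> x) \<noteq> (N.I \<omega> \<le> x)}"
    have sp: "space \<Omega> = {0<..<1}" by (simp add: \<Omega>_def space_restrict_space)
    have S: "?S \<in> sets \<Omega>" by measurable
    have "(\<integral>\<^sup>+\<omega>. indicator {x. (M.I \<omega> \<le> x) \<noteq> (N.I \<omega> \<le> x)} x \<partial>\<Omega>) = (\<integral>\<^sup>+\<omega>. indicator ?S \<omega> \<partial>\<Omega>)"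
      by (intro nn_integral_cong) (auto split: split_indicator)
    also have "\<dots> = emeasure \<Omega> ?S" using S by simp
    also have "\<dots> = emeasure lborel ?S"
      unfolding \<Omega>_def by (rule emeasure_restrict_space) (auto simp: space_restrict_space)
    also have "\<dots> \<le> emeasure lborel {min (cdf \<mu> x) (cdf \<nu> x)..max (cdf \<mu> x) (cdf \<nu> x)}"
    proof (rule emeasure_mono)
      \<comment> \<open>For the quantile function \<open>I\<close>, the condition
        \<open>I \<omega> \<le> x\<close> is equivalent to \<open>\<omega> \<le> cdf x\<close>;
        hence the two events can only disagree for \<open>\<omega>\<close> between the two values of
        the distribution functions.\<close>
      show "?S \<subseteq> {min (cdf \<mu> x) (cdf \<nu> x)..max (cdf \<mu> x) (cdf \<nu> x)}"
        using M.pseudoinverse[of _ x] N.pseudoinverse[of _ x] unfolding sp by force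
    qed simp
    also have "\<dots> = ennreal \<bar>cdf \<mu> x - cdf \<nu> x\<bar>" by (auto simp: min_def max_def)
    finally show "(\<integral>\<^sup>+\<omega>. indicator {x. (M.I \<omega> \<le> x) \<noteq> (N.I \<omega> \<le> x)} x \<partial>\<Omega>) \<le> ennreal \<bar>cdf \<mu> x - cdf \<nu> x\<bar>" .
  qed
  finally show ?thesis .
qed

text \<open>A distribution function lies between its averages over the windows to the left and to the
  right, and such an average equals \<open>\<integral>ramp h x \<partial>\<mu> / h\<close>.\<close>

lemma cdf_diff_le_ramp:
  assumes \<mu>: "prob_space \<mu>" "sets \<mu> = sets borel" and \<nu>: "prob_space \<nu>" "sets \<nu> = sets borel"
    and h: "0 < h"
  defines "\<Phi> \<equiv> \<lambda>M x. \<integral>z. ramp h x z \<partial>M"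
  shows "\<bar>cdf \<mu> x - cdf \<nu> x\<bar> \<le> measure \<nu> {x - h..x + h} + \<bar>\<Phi> \<mu> x - \<Phi> \<nu> x\<bar> / h + \<bar>\<Phi> \<mu> (x - h) - \<Phi> \<nu> (x - h)\<bar> / h"
proof -
  have int: "integrable M (ramp h t)" if "prob_space M" "sets M = sets borel" for M t
  proof -
    interpret prob_space M by fact
    show ?thesis using ramp_bounds[OF h, of t] that(2)
      by (intro integrable_const_bound[where B=h]) (auto cong: measurable_cong_sets)
  qed
  have up: "h * cdf M x \<le> \<Phi> M x" if M: "prob_space M" "sets M = sets borel" for M
  proof -
    interpret prob_space M by fact
    have [measurable]: "{..x} \<in> sets M" using M by simp
    have ind: "integrable M (\<lambda>z. h * indicator {..x} z)"
      by (intro integrable_mult_right integrable_real_indicator) (auto simp: less_top[symmetric])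
    have "h * cdf M x = (\<integral>z. h * indicator {..x} z \<partial>M)"
      using sets_eq_imp_space_eq[OF M(2)] by (simp add: cdf_def)
    also have "\<dots> \<le> \<Phi> M x"
      unfolding \<Phi>_def using h
      by (intro integral_mono int ind M) (auto simp: ramp_def split: split_indicator)
    finally show ?thesis .
  qed
  have down: "\<Phi> M (x - h) \<le> h * cdf M x" if M: "prob_space M" "sets M = sets borel" for M
  proof -
    interpret prob_space M by fact
    have [measurable]: "{..x} \<in> sets M" using M by simp
    have ind: "integrable M (\<lambda>z. h * indicator {..x} z)"
      by (intro integrable_mult_right integrable_real_indicator) (auto simp: less_top[symmetric])
    have "\<Phi> M (x - h) \<le> (\<integral>z. h * indicator {..x} z \<partial>M)"
      unfolding \<Phi>_def using h
      by (intro integral_mono int ind M) (auto simp: ramp_def split: split_indicator)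
    also have "\<dots> = h * cdf M x"
      using sets_eq_imp_space_eq[OF M(2)] by (simp add: cdf_def)
    finally show ?thesis .
  qed
  \<comment> \<open>The difference of the two ramps is a tent of height \<open>h\<close> over the
    window. Both directions of the comparison can use the gap of \<open>\<nu>\<close>, so no window
    mass of \<open>\<mu>\<close> appears.\<close>
  have gap: "\<Phi> \<nu> x - \<Phi> \<nu> (x - h) \<le> h * measure \<nu> {x - h..x + h}"
  proof -
    interpret prob_space \<nu> by fact
    have [measurable]: "{x - h..x + h} \<in> sets \<nu>" using \<nu> by simp
    have "\<Phi> \<nu> x - \<Phi> \<nu> (x - h) = (\<integral>z. ramp h x z - ramp h (x - h) z \<partial>\<nu>)"
      unfolding \<Phi>_def using int[OF \<nu>] by simp
    also have "\<dots> \<le> (\<integral>z. h * indicator {x - h..x + h} z \<partial>\<nu>)"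
    proof (intro integral_mono Bochner_Integration.integrable_diff int \<nu>)
      show "integrable \<nu> (\<lambda>z. h * indicator {x - h..x + h} z)"
        by (intro integrable_mult_right integrable_real_indicator) (auto simp: less_top[symmetric])
      show "ramp h x z - ramp h (x - h) z \<le> h * indicator {x - h..x + h} z" for z
        using h by (auto simp: ramp_def max_def split: split_indicator)
    qed
    also have "\<dots> = h * measure \<nu> {x - h..x + h}"
      using sets_eq_imp_space_eq[OF \<nu>(2)] by simp
    finally show ?thesis .
  qed
  have "h * \<bar>cdf \<mu> x - cdf \<nu> x\<bar> = \<bar>h * cdf \<mu> x - h * cdf \<nu> x\<bar>"
    using h by (simp add: abs_mult flip: right_diff_distrib)
  also have "\<dots> \<le> h * measure \<nu> {x - h..x + h} + \<bar>\<Phi> \<mu> x - \<Phi> \<nu> x\<bar> + \<bar>\<Phi> \<mu> (x - h) - \<Phi> \<nu> (x - h)\<bar>"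
    using up[OF \<mu>] up[OF \<nu>] down[OF \<mu>] down[OF \<nu>] gap by linarith
  finally show ?thesis using h by (simp add: field_simps)
qed

text \<open>A point lies in exactly those windows whose centre is within distance \<open>h\<close>,
  a set of centres of length \<open>2 * h\<close>.\<close>

lemma nn_integral_window:
  assumes \<nu>: "prob_space \<nu>" "sets \<nu> = sets borel" and h: "0 < h"
  shows "(\<integral>\<^sup>+x. ennreal (measure \<nu> {x - h..x + h}) \<partial>lborel) = ennreal (2 * h)"
proof -
  interpret prob_space \<nu> by fact
  interpret pair_sigma_finite lborel \<nu> ..
  note [measurable_cong] = \<nu>(2)
  have "(\<integral>\<^sup>+x. ennreal (measure \<nu> {x - h..x + h}) \<partial>lborel) = (\<integral>\<^sup>+x. (\<integral>\<^sup>+z. indicator {x - h..x + h} z \<partial>\<nu>) \<partial>lborel)"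
    using \<nu> by (simp add: emeasure_eq_measure)
  also have "\<dots> = (\<integral>\<^sup>+x. (\<integral>\<^sup>+z. indicator {z - h..z + h} x \<partial>\<nu>) \<partial>lborel)"
    by (intro nn_integral_cong) (auto split: split_indicator)
  also have "\<dots> = (\<integral>\<^sup>+z. (\<integral>\<^sup>+x. indicator {z - h..z + h} x \<partial>lborel) \<partial>\<nu>)"
  proof -
    have [measurable]: "(\<lambda>(x, z). indicator {z - h..z + h} x :: ennreal) \<in> borel_measurable (lborel \<Otimes>\<^sub>M \<nu>)"
      unfolding indicator_def case_prod_beta atLeastAtMost_iff by measurable
    show ?thesis by (rule Fubini'[symmetric]) measurable
  qed
  also have "\<dots> = ennreal (2 * h)" using h emeasure_space_1 by simp
  finally show ?thesis .
qed

text \<open>Since \<open>g\<close> integrates to 0, the ramp may be replaced by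
  \<open>ramp - h\<close> when \<open>x \<ge> 0\<close>. The modified ramp vanishes unless
  \<open>- \<bar>y\<bar> - h \<le> x \<le> \<bar>y\<bar>\<close>, so the integral over
  \<open>x\<close> costs only \<open>h * (2 * \<bar>y\<bar> + h)\<close> and the unbounded line is
  paid for by a first moment of \<open>g\<close>.\<close>

lemma nn_integral_ramp_abs_le:
  fixes g :: "real \<Rightarrow> real"
  assumes g: "integrable lborel g" "(\<integral>y. g y \<partial>lborel) = 0" and h: "0 < h"
  shows "(\<integral>\<^sup>+x. ennreal \<bar>\<integral>y. ramp h x y * g y \<partial>lborel\<bar> \<partial>lborel)
    \<le> ennreal h * (\<integral>\<^sup>+y. ennreal ((2 * \<bar>y\<bar> + h) * \<bar>g y\<bar>) \<partial>lborel)"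
proof -
  have [measurable]: "g \<in> borel_measurable borel" using g(1) by auto
  have int: "integrable lborel (\<lambda>y. r y * g y)" if "r \<in> borel_measurable borel" "\<And>y. \<bar>r y\<bar> \<le> h" for r
    using that h by (intro Bochner_Integration.integrable_bound[OF integrable_mult_right[OF g(1), of h]])
      (auto simp: abs_mult intro!: AE_I2 mult_right_mono)
  have "ennreal \<bar>\<integral>y. ramp h x y * g y \<partial>lborel\<bar> \<le> (\<integral>\<^sup>+y. ennreal h * (ennreal \<bar>g y\<bar> * indicator {- \<bar>y\<bar> - h..\<bar>y\<bar>} x) \<partial>lborel)" for x
  proof -
    define r where "r y = (if 0 \<le> x then ramp h x y - h else ramp h x y)" for y
    have r[measurable]: "r \<in> borel_measurable borel" unfolding r_def by measurable
    have rb: "\<bar>r y\<bar> \<le> h * indicator {- \<bar>y\<bar> - h..\<bar>y\<bar>} x" for y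
      using h by (auto simp: r_def ramp_def split: split_indicator)
    have rh: "\<bar>r y\<bar> \<le> h" for y using rb[of y] h by (auto split: split_indicator_asm)
    have "(\<integral>y. ramp h x y * g y \<partial>lborel) = (\<integral>y. r y * g y \<partial>lborel)"
    proof (cases "0 \<le> x")
      case True
      have "(\<integral>y. r y * g y \<partial>lborel) = (\<integral>y. ramp h x y * g y - h * g y \<partial>lborel)"
        using True by (simp add: r_def left_diff_distrib)
      also have "\<dots> = (\<integral>y. ramp h x y * g y \<partial>lborel) - (\<integral>y. h * g y \<partial>lborel)"
        using ramp_bounds[OF h, of x] g(1) h by (intro Bochner_Integration.integral_diff int) auto
      finally show ?thesis using g(2) by simp
    qed (simp add: r_def)
    then have "ennreal \<bar>\<integral>y. ramp h x y * g y \<partial>lborel\<bar> \<le> (\<integral>\<^sup>+y. ennreal \<bar>r y * g y\<bar> \<partial>lborel)"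
      using integral_norm_bound_ennreal[OF int[OF r rh]] by simp
    also have "\<dots> \<le> (\<integral>\<^sup>+y. ennreal h * (ennreal \<bar>g y\<bar> * indicator {- \<bar>y\<bar> - h..\<bar>y\<bar>} x) \<partial>lborel)"
    proof (rule nn_integral_mono)
      fix y
      have "\<bar>r y * g y\<bar> \<le> h * indicator {- \<bar>y\<bar> - h..\<bar>y\<bar>} x * \<bar>g y\<bar>"
        unfolding abs_mult by (intro mult_right_mono rb) simp
      then have "ennreal \<bar>r y * g y\<bar> \<le> ennreal (h * indicator {- \<bar>y\<bar> - h..\<bar>y\<bar>} x * \<bar>g y\<bar>)" by (rule ennreal_leI)
      also have "\<dots> = ennreal h * (ennreal \<bar>g y\<bar> * indicator {- \<bar>y\<bar> - h..\<bar>y\<bar>} x)"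
        using h by (auto simp: ennreal_mult split: split_indicator)
      finally show "ennreal \<bar>r y * g y\<bar> \<le> \<dots>" .
    qed
    finally show ?thesis .
  qed
  then have "(\<integral>\<^sup>+x. ennreal \<bar>\<integral>y. ramp h x y * g y \<partial>lborel\<bar> \<partial>lborel)
    \<le> (\<integral>\<^sup>+x. (\<integral>\<^sup>+y. ennreal h * (ennreal \<bar>g y\<bar> * indicator {- \<bar>y\<bar> - h..\<bar>y\<bar>} x) \<partial>lborel) \<partial>lborel)"
    by (rule nn_integral_mono)
  also have "\<dots> = (\<integral>\<^sup>+y. (\<integral>\<^sup>+x. ennreal h * (ennreal \<bar>g y\<bar> * indicator {- \<bar>y\<bar> - h..\<bar>y\<bar>} x) \<partial>lborel) \<partial>lborel)"
  proof -
    have [measurable]: "(\<lambda>(x, y). ennreal h * (ennreal \<bar>g y\<bar> * indicator {- \<bar>y\<bar> - h..\<bar>y\<bar>} x)) \<in> borel_measurable (lborel \<Otimes>\<^sub>M lborel)"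
      unfolding indicator_def case_prod_beta atLeastAtMost_iff by measurable
    show ?thesis by (rule lborel_pair.Fubini'[symmetric]) measurable
  qed
  also have "\<dots> = (\<integral>\<^sup>+y. ennreal h * (ennreal \<bar>g y\<bar> * ennreal (2 * \<bar>y\<bar> + h)) \<partial>lborel)"
    using h by (intro nn_integral_cong) (simp add: nn_integral_cmult)
  also have "\<dots> = ennreal h * (\<integral>\<^sup>+y. ennreal \<bar>g y\<bar> * ennreal (2 * \<bar>y\<bar> + h) \<partial>lborel)"
    by (rule nn_integral_cmult) measurable
  finally show ?thesis using h by (simp add: ennreal_mult'' mult.commute)
qed

text \<open>The difference of the windowed averages consists of a ramp integral of \<open>g\<close>,
  which carries a factor \<open>h\<close>, and of two boundary values of \<open>g\<close>, which do
  not. Division by \<open>h\<close> thus leaves a first moment free of \<open>h\<close> and an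
  \<open>L\<^sup>1\<close> term with \<open>1 / h\<close>; this asymmetry creates the trade-off in
  \<open>h\<close>. The coefficient \<open>6 / h\<close> absorbs
  \<open>2 * h + 4 / h\<close>.\<close>

theorem wasserstein1_le_obs_density:
  assumes \<mu>: "prob_space \<mu>" "sets \<mu> = sets borel" and \<nu>: "prob_space \<nu>" "sets \<nu> = sets borel"
    and h: "0 < h" "h \<le> 1"
  shows "wasserstein1 \<mu> \<nu> \<le> ennreal (2 * h)
    + 4 * (\<integral>\<^sup>+y. ennreal (\<bar>y\<bar> * \<bar>obs_density \<mu> y - obs_density \<nu> y\<bar>) \<partial>lborel)
    + ennreal (6 / h) * (\<integral>\<^sup>+y. ennreal \<bar>obs_density \<mu> y - obs_density \<nu> y\<bar> \<partial>lborel)"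
proof -
  interpret M: prob_space \<mu> by (rule \<mu>)
  interpret N: prob_space \<nu> by (rule \<nu>)
  note FM = M.finite_measure_axioms \<mu>(2) and FN = N.finite_measure_axioms \<nu>(2)
  note [measurable] = obs_density_measurable[OF FM] obs_density_measurable[OF FN]
  define g where "g y = obs_density \<mu> y - obs_density \<nu> y" for y
  have [measurable]: "g \<in> borel_measurable borel" unfolding g_def by measurable
  have gi: "integrable lborel g"
    unfolding g_def by (intro Bochner_Integration.integrable_diff obs_density_integrable FM FN)
  have one: "(\<integral>y. obs_density M y \<partial>lborel) = 1" if "prob_space M" "sets M = sets borel" for M
  proof -
    interpret prob_space M by fact
    have "ennreal (\<integral>y. obs_density M y \<partial>lborel) = (\<integral>\<^sup>+y. ennreal (obs_density M y) \<partial>lborel)"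
      using that finite_measure_axioms
      by (intro nn_integral_eq_integral[symmetric] obs_density_integrable) (auto simp: obs_density_nonneg)
    also have "\<dots> = 1" using obs_density_total[OF finite_measure_axioms that(2)] emeasure_space_1
        sets_eq_imp_space_eq[OF that(2)] by simp
    finally show ?thesis using ennreal_eq_1 by metis
  qed
  have g0: "(\<integral>y. g y \<partial>lborel) = 0"
    unfolding g_def using one[OF \<mu>] one[OF \<nu>] obs_density_integrable[OF FM] obs_density_integrable[OF FN] by simp
  define \<Delta> where "\<Delta> x = (\<integral>z. ramp h x z \<partial>\<mu>) - (\<integral>z. ramp h x z \<partial>\<nu>)" for x
  define R where "R x = (\<integral>y. ramp h x y * g y \<partial>lborel)" for x
  have \<Delta>: "\<Delta> x = R x - g (x + h) + g x" for x
    unfolding \<Delta>_def R_def g_def right_diff_distrib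
    using ramp_obs_density[OF \<mu> h(1), of x] ramp_obs_density[OF \<nu> h(1), of x] by simp
  have [measurable]: "R \<in> borel_measurable borel" unfolding R_def by measurable
  have [measurable]: "\<Delta> \<in> borel_measurable borel" unfolding \<Delta> by measurable
  let ?I = "\<integral>\<^sup>+y. ennreal \<bar>g y\<bar> \<partial>lborel"
  have shift: "(\<integral>\<^sup>+x. ennreal (F (x + c)) \<partial>lborel) = (\<integral>\<^sup>+x. ennreal (F x) \<partial>lborel)"
    if [measurable]: "F \<in> borel_measurable borel" for F :: "real \<Rightarrow> real" and c
    using nn_integral_real_affine[of "\<lambda>x. ennreal (F x)" 1 c] by (simp add: add.commute)
  have ID: "(\<integral>\<^sup>+x. ennreal \<bar>\<Delta> x\<bar> \<partial>lborel) \<le> ennreal h * (\<integral>\<^sup>+y. ennreal ((2 * \<bar>y\<bar> + h) * \<bar>g y\<bar>) \<partial>lborel) + 2 * ?I"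
  proof -
    have "(\<integral>\<^sup>+x. ennreal \<bar>\<Delta> x\<bar> \<partial>lborel) \<le> (\<integral>\<^sup>+x. ennreal \<bar>R x\<bar> + ennreal \<bar>g (x + h)\<bar> + ennreal \<bar>g x\<bar> \<partial>lborel)"
      by (intro nn_integral_mono) (auto simp: \<Delta> simp flip: ennreal_plus intro!: ennreal_leI)
    also have "\<dots> = (\<integral>\<^sup>+x. ennreal \<bar>R x\<bar> \<partial>lborel) + (\<integral>\<^sup>+x. ennreal \<bar>g (x + h)\<bar> \<partial>lborel) + ?I"
      by (simp add: nn_integral_add)
    also have "(\<integral>\<^sup>+x. ennreal \<bar>g (x + h)\<bar> \<partial>lborel) = ?I" by (rule shift) measurable
    also have "(\<integral>\<^sup>+x. ennreal \<bar>R x\<bar> \<partial>lborel) + ?I + ?I \<le> ennreal h * (\<integral>\<^sup>+y. ennreal ((2 * \<bar>y\<bar> + h) * \<bar>g y\<bar>) \<partial>lborel) + ?I + ?I"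
      unfolding R_def by (intro add_right_mono nn_integral_ramp_abs_le gi g0 h(1))
    finally show ?thesis by (simp only: mult_2 add.assoc)
  qed
  have "(\<integral>\<^sup>+y. ennreal ((2 * \<bar>y\<bar> + h) * \<bar>g y\<bar>) \<partial>lborel) = (\<integral>\<^sup>+y. 2 * ennreal (\<bar>y\<bar> * \<bar>g y\<bar>) + ennreal h * ennreal \<bar>g y\<bar> \<partial>lborel)"
  proof (intro nn_integral_cong)
    fix y
    have "2 * ennreal (\<bar>y\<bar> * \<bar>g y\<bar>) + ennreal h * ennreal \<bar>g y\<bar> = ennreal (2 * (\<bar>y\<bar> * \<bar>g y\<bar>) + h * \<bar>g y\<bar>)"
      using h by (simp add: ennreal_mult ennreal_plus)
    then show "ennreal ((2 * \<bar>y\<bar> + h) * \<bar>g y\<bar>) = 2 * ennreal (\<bar>y\<bar> * \<bar>g y\<bar>) + ennreal h * ennreal \<bar>g y\<bar>"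
      by (simp add: algebra_simps)
  qed
  also have "\<dots> = 2 * (\<integral>\<^sup>+y. ennreal (\<bar>y\<bar> * \<bar>g y\<bar>) \<partial>lborel) + ennreal h * ?I"
    by (simp add: nn_integral_add nn_integral_cmult)
  finally have IY: "(\<integral>\<^sup>+y. ennreal ((2 * \<bar>y\<bar> + h) * \<bar>g y\<bar>) \<partial>lborel) = \<dots>" .
  have "wasserstein1 \<mu> \<nu> \<le> (\<integral>\<^sup>+x. ennreal \<bar>cdf \<mu> x - cdf \<nu> x\<bar> \<partial>lborel)"
    by (rule wasserstein1_le_cdf[OF \<mu> \<nu>])
  also have "\<dots> \<le> (\<integral>\<^sup>+x. ennreal (measure \<nu> {x - h..x + h}) + ennreal (1 / h) * ennreal \<bar>\<Delta> x\<bar> + ennreal (1 / h) * ennreal \<bar>\<Delta> (x + (- h))\<bar> \<partial>lborel)"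
    using cdf_diff_le_ramp[OF \<mu> \<nu> h(1)] h
    by (intro nn_integral_mono) (auto simp: \<Delta>_def simp flip: ennreal_plus ennreal_mult intro!: ennreal_leI)
  also have "\<dots> = (\<integral>\<^sup>+x. ennreal (measure \<nu> {x - h..x + h}) \<partial>lborel) + ennreal (1 / h) * (\<integral>\<^sup>+x. ennreal \<bar>\<Delta> x\<bar> \<partial>lborel) + ennreal (1 / h) * (\<integral>\<^sup>+x. ennreal \<bar>\<Delta> (x + (- h))\<bar> \<partial>lborel)"
  proof -
    have [measurable]: "(\<lambda>x. measure \<nu> {x - h..x + h}) \<in> borel_measurable borel"
    proof -
      note [measurable_cong] = \<nu>(2)
      have [measurable]: "Measurable.pred (borel \<Otimes>\<^sub>M \<nu>) (\<lambda>p. snd p \<in> {fst p - h..fst p + h})"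
        unfolding atLeastAtMost_iff by measurable
      show ?thesis using sets_eq_imp_space_eq[OF \<nu>(2)] by (intro N.measurable_measure) auto
    qed
    show ?thesis by (simp add: nn_integral_add nn_integral_cmult)
  qed
  also have "(\<integral>\<^sup>+x. ennreal \<bar>\<Delta> (x + (- h))\<bar> \<partial>lborel) = (\<integral>\<^sup>+x. ennreal \<bar>\<Delta> x\<bar> \<partial>lborel)"
    by (rule shift) measurable
  also have "(\<integral>\<^sup>+x. ennreal (measure \<nu> {x - h..x + h}) \<partial>lborel) = ennreal (2 * h)"
    by (rule nn_integral_window[OF \<nu> h(1)])
  also have "ennreal (2 * h) + ennreal (1 / h) * (\<integral>\<^sup>+x. ennreal \<bar>\<Delta> x\<bar> \<partial>lborel) + ennreal (1 / h) * (\<integral>\<^sup>+x. ennreal \<bar>\<Delta> x\<bar> \<partial>lborel)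
    = ennreal (2 * h) + ennreal (2 / h) * (\<integral>\<^sup>+x. ennreal \<bar>\<Delta> x\<bar> \<partial>lborel)"
  proof -
    have "ennreal (1 / h) * c + ennreal (1 / h) * c = ennreal (2 / h) * c" for c
      using h by (simp flip: distrib_right ennreal_plus)
    then show ?thesis by (simp only: add.assoc)
  qed
  also have "\<dots> \<le> ennreal (2 * h) + ennreal (2 / h) * (ennreal h * (2 * (\<integral>\<^sup>+y. ennreal (\<bar>y\<bar> * \<bar>g y\<bar>) \<partial>lborel) + ennreal h * ?I) + 2 * ?I)"
    using ID unfolding IY by (intro add_left_mono mult_left_mono) auto
  also have "\<dots> = ennreal (2 * h) + (4 * (\<integral>\<^sup>+y. ennreal (\<bar>y\<bar> * \<bar>g y\<bar>) \<partial>lborel) + ennreal (2 * h + 4 / h) * ?I)"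
  proof -
    have e: "ennreal (2 / h) * ennreal h = 2" "ennreal (2 / h) * 2 = ennreal (4 / h)" "2 * ennreal h = ennreal (2 * h)"
    proof -
      have two: "(2 :: ennreal) = ennreal 2" by simp
      show "ennreal (2 / h) * ennreal h = 2" using h by (simp flip: ennreal_mult)
      show "ennreal (2 / h) * 2 = ennreal (4 / h)" "2 * ennreal h = ennreal (2 * h)"
        unfolding two using h by (subst ennreal_mult[symmetric]; simp)+
    qed
    have "ennreal (2 / h) * (ennreal h * (2 * a + ennreal h * b) + 2 * b) = 4 * a + ennreal (2 * h + 4 / h) * b" for a b :: ennreal
    proof -
      have "ennreal (2 / h) * (ennreal h * (2 * a + ennreal h * b) + 2 * b)
        = (ennreal (2 / h) * ennreal h) * (2 * a + ennreal h * b) + ennreal (2 / h) * 2 * b"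
        by (simp add: distrib_left mult.assoc)
      also have "\<dots> = 2 * (2 * a) + (2 * ennreal h) * b + ennreal (4 / h) * b"
        unfolding e(1,2) by (simp add: distrib_left mult.assoc)
      also have "\<dots> = 4 * a + (ennreal (2 * h) + ennreal (4 / h)) * b"
      proof -
        have "2 * (2 * a) = 4 * a" by (simp flip: mult.assoc)
        then show ?thesis unfolding e by (simp only: distrib_right add.assoc)
      qed
      finally show ?thesis using h by (simp add: ennreal_plus)
    qed
    then show ?thesis by simp
  qed
  also have "\<dots> \<le> ennreal (2 * h) + (4 * (\<integral>\<^sup>+y. ennreal (\<bar>y\<bar> * \<bar>g y\<bar>) \<partial>lborel) + ennreal (6 / h) * ?I)"
  proof -
    have "h * h \<le> 1 * 1" using h by (intro mult_mono) auto
    then have "2 * h + 4 / h \<le> 6 / h" using h by (simp add: field_simps)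
    then show ?thesis by (intro add_left_mono mult_right_mono ennreal_leI) auto
  qed
  finally show ?thesis by (simp add: g_def add.assoc)
qed

section \<open>Entropy\<close>

lemma obs_density_le_half:
  assumes "prob_space \<mu>" "sets \<mu> = sets borel" shows "obs_density \<mu> y \<le> 1 / 2"
proof -
  interpret prob_space \<mu> by fact
  have "obs_density \<mu> y \<le> (\<integral>x. 1 / 2 \<partial>\<mu>)"
    unfolding obs_density_def using assms(2) finite_measure_axioms
    by (intro integral_mono laplace_integrable laplace_density_le) auto
  then show ?thesis using prob_space by simp
qed

text \<open>The kernel is symmetric, so for a fixed source \<open>x\<close> it can be interpolated
  in the observation \<open>y\<close>. This is exact unless the source lies strictly inside the
  cell, whence the factor \<open>measure \<mu> {a<..<b}\<close>.\<close>

lemma obs_density_interpolation: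
  assumes fin: "finite_measure \<mu>" and s: "sets \<mu> = sets borel"
    and ab: "a < b" "b - a \<le> 1" and y: "y \<in> {a..b}"
  shows "\<bar>obs_density \<mu> y - (weight_left a b y * obs_density \<mu> a + weight_right a b y * obs_density \<mu> b)\<bar>
    \<le> (b - a) * measure \<mu> {a<..<b}"
proof -
  interpret finite_measure \<mu> by fact
  note li = laplace_integrable[OF fin s]
  note flip = laplace_density_symmetric[of y] laplace_density_symmetric[of a] laplace_density_symmetric[of b]
  have [measurable]: "{a<..<b} \<in> sets \<mu>" using s by simp
  let ?d = "\<lambda>x. laplace_density (y - x) - (weight_left a b y * laplace_density (a - x) + weight_right a b y * laplace_density (b - x))"
  have eq: "obs_density \<mu> y - (weight_left a b y * obs_density \<mu> a + weight_right a b y * obs_density \<mu> b) = (\<integral>x. ?d x \<partial>\<mu>)"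
    unfolding obs_density_def by (simp add: li)
  have "\<bar>\<integral>x. ?d x \<partial>\<mu>\<bar> \<le> (\<integral>x. \<bar>?d x\<bar> \<partial>\<mu>)" by (rule integral_abs_bound)
  also have "\<dots> \<le> (\<integral>x. (b - a) * indicator {a<..<b} x \<partial>\<mu>)"
  proof (rule integral_mono)
    show "integrable \<mu> (\<lambda>x. (b - a) * indicator {a<..<b} x)"
      by (intro integrable_mult_right integrable_real_indicator) (simp_all add: emeasure_eq_measure)
    show "\<bar>?d x\<bar> \<le> (b - a) * indicator {a<..<b} x" for x
    proof (cases "x \<in> {a<..<b}")
      case True
      then show ?thesis using laplace_interpolation_inside[OF ab(1) y, of x] ab(2) by (simp add: flip[of x])
    next
      case False
      then show ?thesis using laplace_interpolation_outside[OF ab(1) y False] by (simp add: flip[of x])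
    qed
  qed (auto simp: li)
  also have "\<dots> = (b - a) * measure \<mu> {a<..<b}" using sets_eq_imp_space_eq[OF s] by simp
  finally show ?thesis unfolding eq .
qed

definition cell :: "real \<Rightarrow> real \<Rightarrow> nat \<Rightarrow> real set" where
  "cell c \<delta> i = {c + real i * \<delta>..<c + real (Suc i) * \<delta>}"

lemma cell_index_unique:
  assumes "0 < \<delta>" "x \<in> cell c \<delta> i" shows "i = nat \<lfloor>(x - c) / \<delta>\<rfloor>"
proof -
  have "real i \<le> (x - c) / \<delta>" "(x - c) / \<delta> < real i + 1"
    using assms by (auto simp: cell_def field_simps)
  then have "\<lfloor>(x - c) / \<delta>\<rfloor> = int i" by (intro floor_unique) auto
  then show ?thesis by simp
qed

lemma disjoint_cells: "0 < \<delta> \<Longrightarrow> disjoint_family_on (cell c \<delta>) I"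
  unfolding disjoint_family_on_def using cell_index_unique by blast

lemma UN_cells:
  assumes "0 < \<delta>" shows "(\<Union>i<N. cell c \<delta> i) = {c..<c + real N * \<delta>}"
proof (intro equalityI subsetI)
  fix x assume "x \<in> (\<Union>i<N. cell c \<delta> i)"
  then obtain i where i: "i < N" "x \<in> cell c \<delta> i" by auto
  have "real (Suc i) * \<delta> \<le> real N * \<delta>" using i assms by (intro mult_right_mono) auto
  moreover have "0 \<le> real i * \<delta>" using assms by simp
  ultimately show "x \<in> {c..<c + real N * \<delta>}" using i by (auto simp: cell_def)
next
  fix x assume x: "x \<in> {c..<c + real N * \<delta>}"
  define i where "i = nat \<lfloor>(x - c) / \<delta>\<rfloor>"
  have 0: "0 \<le> (x - c) / \<delta>" using x assms by auto
  then have "real i \<le> (x - c) / \<delta>" "(x - c) / \<delta> < real i + 1"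
    unfolding i_def using floor_correct[of "(x - c) / \<delta>"] by auto
  then have "x \<in> cell c \<delta> i" using assms by (auto simp: cell_def field_simps)
  moreover have "i < N"
  proof -
    have "(x - c) / \<delta> < real N" using x assms by (auto simp: field_simps)
    then have "real i < real N" using \<open>real i \<le> _\<close> by linarith
    then show ?thesis by simp
  qed
  ultimately show "x \<in> (\<Union>i<N. cell c \<delta> i)" by auto
qed

lemma cell_sets [measurable]: "cell c \<delta> i \<in> sets borel" by (simp add: cell_def)

text \<open>On a cell the density is determined by its values at the two nodes, up to an error which
  is small because the cell carries little mass on average. Hence values at the nodes agreeing
  to precision \<open>\<delta>\<^sup>2\<close> make the densities agree to the same order in \<open>L\<^sup>1\<close>.\<close>

lemma obs_density_L1_of_nodes:
  assumes \<mu>: "prob_space \<mu>" "sets \<mu> = sets borel" and \<nu>: "prob_space \<nu>" "sets \<nu> = sets borel"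
    and \<delta>: "0 < \<delta>" "\<delta> \<le> 1"
    and node: "\<And>i. i \<le> N \<Longrightarrow> \<bar>obs_density \<mu> (c + real i * \<delta>) - obs_density \<nu> (c + real i * \<delta>)\<bar> \<le> \<delta>\<^sup>2"
  shows "(\<integral>y. \<bar>obs_density \<mu> y - obs_density \<nu> y\<bar> * indicator {c..<c + real N * \<delta>} y \<partial>lborel) \<le> (real N * \<delta> + 2) * \<delta>\<^sup>2"
proof -
  interpret M: prob_space \<mu> by fact
  interpret N: prob_space \<nu> by fact
  note FM = M.finite_measure_axioms \<mu>(2) and FN = N.finite_measure_axioms \<nu>(2)
  let ?g = "\<lambda>y. \<bar>obs_density \<mu> y - obs_density \<nu> y\<bar>"
  have int: "integrable lborel ?g"
    by (intro integrable_abs Bochner_Integration.integrable_diff obs_density_integrable FM FN)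
  have intA: "integrable lborel (\<lambda>y. ?g y * indicator A y)" if "A \<in> sets borel" for A
    using integrable_mult_indicator[OF _ int, of A] that by (simp add: mult.commute)
  define m where "m i = measure \<mu> (cell c \<delta> i) + measure \<nu> (cell c \<delta> i)" for i
  have point: "?g y \<le> \<delta>\<^sup>2 + \<delta> * m i" if i: "i < N" and y: "y \<in> cell c \<delta> i" for i y
  proof -
    define a b where "a = c + real i * \<delta>" and "b = c + real (Suc i) * \<delta>"
    have ab: "a < b" "b - a = \<delta>" "y \<in> {a..b}" using \<delta> y by (auto simp: a_def b_def cell_def algebra_simps)
    define u v where "u = weight_left a b y" and "v = weight_right a b y"
    have uv: "0 \<le> u" "0 \<le> v" "u + v \<le> 1"
      using weight_nonneg[OF ab(1,3)] weight_sum_le_1[OF ab(1,3)] by (auto simp: u_def v_def)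
    have sub: "{a<..<b} \<subseteq> cell c \<delta> i" by (auto simp: a_def b_def cell_def)
    have 1: "\<bar>obs_density \<mu> y - (u * obs_density \<mu> a + v * obs_density \<mu> b)\<bar> \<le> \<delta> * measure \<mu> (cell c \<delta> i)"
      using obs_density_interpolation[OF FM ab(1) _ ab(3)] ab(2) \<delta> M.finite_measure_mono[OF sub] \<mu>
      by (auto simp: u_def v_def intro: order_trans mult_left_mono)
    have 2: "\<bar>obs_density \<nu> y - (u * obs_density \<nu> a + v * obs_density \<nu> b)\<bar> \<le> \<delta> * measure \<nu> (cell c \<delta> i)"
      using obs_density_interpolation[OF FN ab(1) _ ab(3)] ab(2) \<delta> N.finite_measure_mono[OF sub] \<nu>
      by (auto simp: u_def v_def intro: order_trans mult_left_mono)
    have na: "\<bar>obs_density \<mu> a - obs_density \<nu> a\<bar> \<le> \<delta>\<^sup>2" using node[of i] i by (simp add: a_def)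
    have nb: "\<bar>obs_density \<mu> b - obs_density \<nu> b\<bar> \<le> \<delta>\<^sup>2" using node[of "Suc i"] i by (simp add: b_def)
    have "\<bar>(u * obs_density \<mu> a + v * obs_density \<mu> b) - (u * obs_density \<nu> a + v * obs_density \<nu> b)\<bar>
      = \<bar>u * (obs_density \<mu> a - obs_density \<nu> a) + v * (obs_density \<mu> b - obs_density \<nu> b)\<bar>"
      by (simp add: algebra_simps)
    also have "\<dots> \<le> u * \<bar>obs_density \<mu> a - obs_density \<nu> a\<bar> + v * \<bar>obs_density \<mu> b - obs_density \<nu> b\<bar>"
      using uv by (intro order_trans[OF abs_triangle_ineq]) (simp add: abs_mult)
    also have "\<dots> \<le> u * \<delta>\<^sup>2 + v * \<delta>\<^sup>2" using na nb uv by (intro add_mono mult_left_mono) auto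
    also have "\<dots> \<le> \<delta>\<^sup>2" using uv mult_left_le_one_le[of "\<delta>\<^sup>2" "u + v"] by (simp add: algebra_simps)
    finally show ?thesis using 1 2 unfolding m_def distrib_left by linarith
  qed
  have 1: "(\<integral>y. ?g y * indicator {c..<c + real N * \<delta>} y \<partial>lborel) = (\<integral>y. (\<Sum>i<N. ?g y * indicator (cell c \<delta> i) y) \<partial>lborel)"
  proof (rule Bochner_Integration.integral_cong)
    fix y
    have "indicator {c..<c + real N * \<delta>} y = (\<Sum>i<N. indicator (cell c \<delta> i) y :: real)"
      unfolding UN_cells[OF \<delta>(1), symmetric]
      by (rule indicator_UN_disjoint) (auto intro: disjoint_cells \<delta>)
    then show "?g y * indicator {c..<c + real N * \<delta>} y = (\<Sum>i<N. ?g y * indicator (cell c \<delta> i) y)"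
      by (simp add: sum_distrib_left)
  qed simp
  have 2: "(\<integral>y. (\<Sum>i<N. ?g y * indicator (cell c \<delta> i) y) \<partial>lborel) = (\<Sum>i<N. \<integral>y. ?g y * indicator (cell c \<delta> i) y \<partial>lborel)"
    by (rule Bochner_Integration.integral_sum) (intro intA cell_sets)
  have 3: "(\<Sum>i<N. \<integral>y. ?g y * indicator (cell c \<delta> i) y \<partial>lborel) \<le> (\<Sum>i<N. \<delta> * (\<delta>\<^sup>2 + \<delta> * m i))"
  proof (rule sum_mono)
    fix i assume i: "i \<in> {..<N}"
    have "(\<integral>y. ?g y * indicator (cell c \<delta> i) y \<partial>lborel) \<le> (\<integral>y. (\<delta>\<^sup>2 + \<delta> * m i) * indicator (cell c \<delta> i) y \<partial>lborel)"
    proof (rule integral_mono)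
      show "integrable lborel (\<lambda>y. (\<delta>\<^sup>2 + \<delta> * m i) * indicator (cell c \<delta> i) y)"
        using \<delta> by (intro integrable_mult_right integrable_real_indicator) (simp_all add: cell_def)
      show "?g y * indicator (cell c \<delta> i) y \<le> (\<delta>\<^sup>2 + \<delta> * m i) * indicator (cell c \<delta> i) y" for y
        using point i by (auto split: split_indicator)
    qed (intro intA cell_sets)
    also have "\<dots> = \<delta> * (\<delta>\<^sup>2 + \<delta> * m i)" using \<delta> by (simp add: cell_def algebra_simps)
    finally show "(\<integral>y. ?g y * indicator (cell c \<delta> i) y \<partial>lborel) \<le> \<delta> * (\<delta>\<^sup>2 + \<delta> * m i)" .
  qed
  have 4: "(\<Sum>i<N. \<delta> * (\<delta>\<^sup>2 + \<delta> * m i)) = real N * \<delta> * \<delta>\<^sup>2 + \<delta>\<^sup>2 * (\<Sum>i<N. m i)"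
      proof -
    have "\<delta> * (\<delta>\<^sup>2 + \<delta> * m i) = \<delta> * \<delta>\<^sup>2 + \<delta>\<^sup>2 * m i" for i by (simp add: distrib_left power2_eq_square)
    then have "(\<Sum>i<N. \<delta> * (\<delta>\<^sup>2 + \<delta> * m i)) = (\<Sum>i<N. \<delta> * \<delta>\<^sup>2) + (\<Sum>i<N. \<delta>\<^sup>2 * m i)" by (simp add: sum.distrib)
    then show ?thesis by (simp add: sum_distrib_left)
  qed
  have 5: "real N * \<delta> * \<delta>\<^sup>2 + \<delta>\<^sup>2 * (\<Sum>i<N. m i) \<le> real N * \<delta> * \<delta>\<^sup>2 + \<delta>\<^sup>2 * 2"
  proof -
    have "(\<Sum>i<N. measure \<mu> (cell c \<delta> i)) = measure \<mu> (\<Union>i<N. cell c \<delta> i)"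
      by (rule M.finite_measure_finite_Union[symmetric])
        (simp_all add: \<mu>(2) image_subset_iff cell_sets disjoint_cells \<delta>)
    moreover have "(\<Sum>i<N. measure \<nu> (cell c \<delta> i)) = measure \<nu> (\<Union>i<N. cell c \<delta> i)"
      by (rule N.finite_measure_finite_Union[symmetric])
        (simp_all add: \<nu>(2) image_subset_iff cell_sets disjoint_cells \<delta>)
    ultimately have "(\<Sum>i<N. m i) \<le> 1 + 1" unfolding m_def sum.distrib
      using M.prob_le_1[of "\<Union>i<N. cell c \<delta> i"] N.prob_le_1[of "\<Union>i<N. cell c \<delta> i"] by linarith
    then show ?thesis by (intro add_left_mono mult_left_mono) auto
  qed
  show ?thesis using 3 5 unfolding 1 2 4 by (simp add: distrib_right)
qed

text \<open>The L1 distance is twice the integral of the positive part of \<open>f0 - f\<close>, so the far tail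
  only enters through \<open>f0\<close>.\<close>

lemma test_sets_exist:
  fixes f0 :: "real \<Rightarrow> real" and c \<delta> \<epsilon> :: real and N :: nat
  assumes f0: "integrable lborel f0" "\<And>y. 0 \<le> f0 y" "(\<integral>y. f0 y \<partial>lborel) = 1"
    and \<delta>: "0 < \<delta>" "\<delta> \<le> 1"
  defines "I \<equiv> {c..<c + real N * \<delta>}"
  shows "\<exists>\<A>. finite \<A> \<and> card \<A> \<le> (nat \<lfloor>1 / \<delta>\<^sup>2\<rfloor> + 1) ^ (N + 1) \<and> \<A> \<subseteq> sets borel \<and>
    (\<forall>\<mu>. prob_space \<mu> \<longrightarrow> sets \<mu> = sets borel \<longrightarrow>
      (\<forall>A\<in>\<A>. (\<integral>y. f0 y * indicator A y \<partial>lborel) - (\<integral>y. obs_density \<mu> y * indicator A y \<partial>lborel) \<le> \<epsilon>) \<longrightarrow>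
      (\<integral>y. \<bar>obs_density \<mu> y - f0 y\<bar> \<partial>lborel)
        \<le> 2 * \<epsilon> + 4 * (real N * \<delta> + 2) * \<delta>\<^sup>2 + 2 * (\<integral>y. f0 y * indicator (- I) y \<partial>lborel))"
proof -
  define \<P> where "\<P> = {\<mu> :: real measure. prob_space \<mu> \<and> sets \<mu> = sets borel}"
  define x where "x i = c + real i * \<delta>" for i :: nat
  \<comment> \<open>Node values are rounded down in units of \<open>\<delta>\<^sup>2\<close>: equal
    codes give the agreement that \<open>obs_density_L1_of_nodes\<close> asks for, and boundedness
    of the densities leaves finitely many codes.\<close>
  define code where "code \<mu> = (\<lambda>i\<in>{..N}. nat \<lfloor>obs_density \<mu> (x i) / \<delta>\<^sup>2\<rfloor>)" for \<mu>
  define K where "K = nat \<lfloor>1 / \<delta>\<^sup>2\<rfloor>"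
  have code: "code \<mu> \<in> (\<Pi>\<^sub>E i\<in>{..N}. {..K})" if "\<mu> \<in> \<P>" for \<mu>
  proof -
    have "obs_density \<mu> (x i) / \<delta>\<^sup>2 \<le> 1 / \<delta>\<^sup>2" for i
      using obs_density_le_half[of \<mu> "x i"] that \<delta> by (intro divide_right_mono) (auto simp: \<P>_def)
    then show ?thesis unfolding code_def K_def by (auto intro!: nat_mono floor_mono)
  qed
  have card_codes: "finite (code ` \<P>)" "card (code ` \<P>) \<le> (K + 1) ^ (N + 1)"
  proof -
    have sub: "code ` \<P> \<subseteq> (\<Pi>\<^sub>E i\<in>{..N}. {..K})" using code by auto
    have fin: "finite (\<Pi>\<^sub>E i\<in>{..N}. {..K})" by (intro finite_PiE) auto
    show "finite (code ` \<P>)" using sub fin by (rule finite_subset)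
    have "card (code ` \<P>) \<le> card (\<Pi>\<^sub>E i\<in>{..N}. {..K})" by (rule card_mono[OF fin sub])
    also have "\<dots> = (K + 1) ^ (N + 1)" by (simp add: card_PiE)
    finally show "card (code ` \<P>) \<le> (K + 1) ^ (N + 1)" .
  qed
  define rep where "rep v = (SOME \<nu>. \<nu> \<in> \<P> \<and> code \<nu> = v)" for v
  have rep: "rep (code \<mu>) \<in> \<P>" "code (rep (code \<mu>)) = code \<mu>" if "\<mu> \<in> \<P>" for \<mu>
    using someI[of "\<lambda>\<nu>. \<nu> \<in> \<P> \<and> code \<nu> = code \<mu>" \<mu>] that by (auto simp: rep_def)
  \<comment> \<open>The Scheffe set of \<open>f0\<close> against one representative of the code, cut
    to the grid. It serves all measures with that code.\<close>
  define A where "A v = {y \<in> I. obs_density (rep v) y < f0 y}" for v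
  define \<A> where "\<A> = A ` code ` \<P>"
  have [measurable]: "f0 \<in> borel_measurable borel" using f0(1) by auto
  have [measurable]: "I \<in> sets borel" by (simp add: I_def)
  have dens: "integrable lborel (obs_density \<mu>)" "obs_density \<mu> \<in> borel_measurable borel" "(\<integral>y. obs_density \<mu> y \<partial>lborel) = 1"
    if "\<mu> \<in> \<P>" for \<mu>
  proof -
    interpret prob_space \<mu> using that by (simp add: \<P>_def)
    have s: "sets \<mu> = sets borel" using that by (simp add: \<P>_def)
    note F = finite_measure_axioms s
    show i: "integrable lborel (obs_density \<mu>)" by (rule obs_density_integrable[OF F])
    show "obs_density \<mu> \<in> borel_measurable borel" by (rule obs_density_measurable[OF F])
    have "ennreal (\<integral>y. obs_density \<mu> y \<partial>lborel) = (\<integral>\<^sup>+y. ennreal (obs_density \<mu> y) \<partial>lborel)"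
      by (intro nn_integral_eq_integral[symmetric] i AE_I2 obs_density_nonneg[OF F])
    also have "\<dots> = 1" using obs_density_total[OF F] emeasure_space_1 sets_eq_imp_space_eq[OF s] by simp
    finally show "(\<integral>y. obs_density \<mu> y \<partial>lborel) = 1" using ennreal_eq_1 by metis
  qed
  have A_sets: "A (code \<mu>) \<in> sets borel" if "\<mu> \<in> \<P>" for \<mu>
    using dens(2)[OF rep(1)[OF that]] unfolding A_def by measurable
  have intI: "integrable lborel (\<lambda>y. g y * indicator B y)" if "integrable lborel g" "B \<in> sets borel" for g :: "real \<Rightarrow> real" and B
    using integrable_mult_indicator[OF _ that(1), of B] that(2) by (simp add: mult.commute)
  have main: "(\<integral>y. \<bar>obs_density \<mu> y - f0 y\<bar> \<partial>lborel)
        \<le> 2 * \<epsilon> + 4 * (real N * \<delta> + 2) * \<delta>\<^sup>2 + 2 * (\<integral>y. f0 y * indicator (- I) y \<partial>lborel)"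
    if \<mu>: "\<mu> \<in> \<P>" and close: "\<And>B. B \<in> \<A> \<Longrightarrow> (\<integral>y. f0 y * indicator B y \<partial>lborel) - (\<integral>y. obs_density \<mu> y * indicator B y \<partial>lborel) \<le> \<epsilon>" for \<mu>
  proof -
    define \<nu> where "\<nu> = rep (code \<mu>)"
    have \<nu>: "\<nu> \<in> \<P>" "code \<nu> = code \<mu>" using rep[OF \<mu>] by (auto simp: \<nu>_def)
    note [measurable] = dens(2)[OF \<mu>] dens(2)[OF \<nu>(1)]
    define f where "f = obs_density \<mu>"
    define g where "g = obs_density \<nu>"
    have [measurable]: "f \<in> borel_measurable borel" "g \<in> borel_measurable borel" by (simp_all add: f_def g_def)
    have fi: "integrable lborel f" "integrable lborel g" "(\<integral>y. f y \<partial>lborel) = 1" using dens[OF \<mu>] dens[OF \<nu>(1)] by (auto simp: f_def g_def)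
    define E where "E = (real N * \<delta> + 2) * \<delta>\<^sup>2"
    have node: "\<bar>f (x i) - g (x i)\<bar> \<le> \<delta>\<^sup>2" if "i \<le> N" for i
    proof -
      have F: "finite_measure \<mu>" "finite_measure \<nu>" "sets \<mu> = sets borel" "sets \<nu> = sets borel"
        using \<mu> \<nu> by (auto simp: \<P>_def prob_space.finite_measure)
      have "nat \<lfloor>g (x i) / \<delta>\<^sup>2\<rfloor> = nat \<lfloor>f (x i) / \<delta>\<^sup>2\<rfloor>"
        using fun_cong[OF \<nu>(2), of i] that by (simp add: code_def f_def g_def)
      moreover have "0 \<le> f (x i) / \<delta>\<^sup>2" "0 \<le> g (x i) / \<delta>\<^sup>2"
        using obs_density_nonneg[OF F(1,3)] obs_density_nonneg[OF F(2,4)] by (auto simp: f_def g_def)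
      ultimately have "\<bar>f (x i) / \<delta>\<^sup>2 - g (x i) / \<delta>\<^sup>2\<bar> \<le> 1"
        by linarith
      then have "\<bar>(f (x i) - g (x i)) / \<delta>\<^sup>2\<bar> \<le> 1" by (simp add: diff_divide_distrib)
      then show ?thesis using \<delta> by (simp add: abs_divide)
    qed
    have L1: "(\<integral>y. \<bar>f y - g y\<bar> * indicator I y \<partial>lborel) \<le> E"
      using obs_density_L1_of_nodes[of \<mu> \<nu> \<delta> N c] \<mu> \<nu>(1) \<delta> node
      by (auto simp: \<P>_def E_def I_def f_def g_def x_def)
    define B where "B = A (code \<mu>)"
    have B: "B = {y \<in> I. g y < f0 y}" by (simp add: B_def A_def g_def \<nu>_def)
    have Bs [measurable]: "B \<in> sets borel" unfolding B by measurable
    have "B \<in> \<A>" using \<mu> by (auto simp: \<A>_def B_def)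
    note closeB = close[OF this]
    have P: "(\<integral>y. \<bar>f y - f0 y\<bar> \<partial>lborel) = 2 * (\<integral>y. max 0 (f0 y - f y) \<partial>lborel)"
    proof -
      have mi: "integrable lborel (\<lambda>y. max 0 (f0 y - f y))"
        using f0(1) fi(1) by (intro integrable_max) auto
      have "(\<integral>y. \<bar>f y - f0 y\<bar> \<partial>lborel) = (\<integral>y. 2 * max 0 (f0 y - f y) + (f y - f0 y) \<partial>lborel)"
        by (intro Bochner_Integration.integral_cong) (auto simp: max_def)
      also have "\<dots> = 2 * (\<integral>y. max 0 (f0 y - f y) \<partial>lborel) + ((\<integral>y. f y \<partial>lborel) - (\<integral>y. f0 y \<partial>lborel))"
        using mi f0(1) fi(1) by simp
      finally show ?thesis using f0(3) fi(3) by simp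
    qed
    have "(\<integral>y. max 0 (f0 y - f y) \<partial>lborel) \<le> (\<integral>y. (f0 y * indicator B y - f y * indicator B y)
        + 2 * (\<bar>f y - g y\<bar> * indicator I y) + f0 y * indicator (- I) y \<partial>lborel)"
    proof (rule integral_mono)
      show "integrable lborel (\<lambda>y. max 0 (f0 y - f y))"
        using f0(1) fi(1) by (intro integrable_max) auto
      show "integrable lborel (\<lambda>y. (f0 y * indicator B y - f y * indicator B y)
        + 2 * (\<bar>f y - g y\<bar> * indicator I y) + f0 y * indicator (- I) y)"
        using f0(1) fi by (intro Bochner_Integration.integrable_add Bochner_Integration.integrable_diff integrable_mult_right intI integrable_abs) auto
      \<comment> \<open>Three regions: on \<open>B\<close> a negative \<open>f0 - f\<close> is
        outweighed by \<open>f - g\<close>, since \<open>g < f0\<close>; on \<open>I\<close> outside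
        \<open>B\<close> one has \<open>f0 \<le> g\<close>, so \<open>f0 - f \<le> g - f\<close>;
        outside \<open>I\<close> the term \<open>f0\<close> suffices because \<open>f\<close> is
        nonnegative.\<close>
      show "max 0 (f0 y - f y) \<le> (f0 y * indicator B y - f y * indicator B y)
        + 2 * (\<bar>f y - g y\<bar> * indicator I y) + f0 y * indicator (- I) y" for y
      proof -
        have F: "finite_measure \<mu>" "sets \<mu> = sets borel" using \<mu> by (auto simp: \<P>_def prob_space.finite_measure)
        have "0 \<le> f y" unfolding f_def by (rule obs_density_nonneg[OF F])
        moreover have "g y - f y \<le> \<bar>f y - g y\<bar>" "f y - g y \<le> \<bar>f y - g y\<bar>" by auto
        ultimately show ?thesis using f0(2)[of y] unfolding B max_def
          by (cases "y \<in> I"; cases "g y < f0 y") auto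
      qed
    qed
    also have "\<dots> = ((\<integral>y. f0 y * indicator B y \<partial>lborel) - (\<integral>y. f y * indicator B y \<partial>lborel))
        + 2 * (\<integral>y. \<bar>f y - g y\<bar> * indicator I y \<partial>lborel) + (\<integral>y. f0 y * indicator (- I) y \<partial>lborel)"
    proof -
      have "integrable lborel (\<lambda>y. f0 y * indicator B y)" by (rule intI[OF f0(1) Bs])
      moreover have "integrable lborel (\<lambda>y. f y * indicator B y)" by (rule intI[OF fi(1) Bs])
      moreover have "integrable lborel (\<lambda>y. \<bar>f y - g y\<bar> * indicator I y)"
        using fi by (intro intI integrable_abs Bochner_Integration.integrable_diff) auto
      moreover have "integrable lborel (\<lambda>y. f0 y * indicator (- I) y)" by (rule intI[OF f0(1)]) simp
      ultimately show ?thesis by simp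
    qed
    also have "\<dots> \<le> \<epsilon> + 2 * E + (\<integral>y. f0 y * indicator (- I) y \<partial>lborel)"
      using closeB L1 by (simp add: f_def)
    finally show ?thesis using P unfolding f_def E_def by (simp add: algebra_simps)
  qed
  show ?thesis
  proof (intro exI[of _ \<A>] conjI allI impI)
    show "finite \<A>" using card_codes by (simp add: \<A>_def)
    show "card \<A> \<le> (nat \<lfloor>1 / \<delta>\<^sup>2\<rfloor> + 1) ^ (N + 1)"
      using card_codes card_image_le[OF card_codes(1), of A] unfolding \<A>_def K_def by linarith
    show "\<A> \<subseteq> sets borel" using A_sets by (auto simp: \<A>_def)
    fix \<mu> :: "real measure"
    assume "prob_space \<mu>" "sets \<mu> = sets borel"
      and "\<forall>A\<in>\<A>. (\<integral>y. f0 y * indicator A y \<partial>lborel) - (\<integral>y. obs_density \<mu> y * indicator A y \<partial>lborel) \<le> \<epsilon>"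
    then show "(\<integral>y. \<bar>obs_density \<mu> y - f0 y\<bar> \<partial>lborel)
        \<le> 2 * \<epsilon> + 4 * (real N * \<delta> + 2) * \<delta>\<^sup>2 + 2 * (\<integral>y. f0 y * indicator (- I) y \<partial>lborel)"
      by (intro main) (simp_all add: \<P>_def)
  qed
qed

section \<open>Light-tailed signals\<close>

lemma nn_integral_abs:
  fixes g :: "real \<Rightarrow> ennreal"
  assumes [measurable]: "g \<in> borel_measurable borel"
  shows "(\<integral>\<^sup>+x. g \<bar>x\<bar> \<partial>lborel) = 2 * (\<integral>\<^sup>+x. g x * indicator {0..} x \<partial>lborel)"
proof -
  have "(\<integral>\<^sup>+x. g \<bar>x\<bar> \<partial>lborel) = (\<integral>\<^sup>+x. g x * indicator {0..} x + g (- x) * indicator {..<0} x \<partial>lborel)"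
    by (intro nn_integral_cong) (auto split: split_indicator)
  also have "\<dots> = (\<integral>\<^sup>+x. g x * indicator {0..} x \<partial>lborel) + (\<integral>\<^sup>+x. g (- x) * indicator {..<0} x \<partial>lborel)"
    by (rule nn_integral_add) measurable
  also have "(\<integral>\<^sup>+x. g (- x) * indicator {..<0} x \<partial>lborel) = (\<integral>\<^sup>+x. g x * indicator {0..} x \<partial>lborel)"
  proof -
    have "(\<integral>\<^sup>+x. g (- x) * indicator {..<0} x \<partial>lborel) = (\<integral>\<^sup>+x. g (- (0 + (-1) * x)) * indicator {..<0} (0 + (-1) * x) \<partial>lborel)"
      by (subst nn_integral_real_affine[where c="-1" and t=0]) auto
    also have "\<dots> = (\<integral>\<^sup>+x. g x * indicator {0..} x \<partial>lborel)"
    proof (rule nn_integral_cong_AE)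
      show "AE x in lborel. g (- (0 + (-1) * x)) * indicator {..<0} (0 + (-1) * x) = g x * indicator {0..} x"
        using AE_lborel_singleton[of "0::real"] by eventually_elim (auto split: split_indicator)
    qed
    finally show ?thesis .
  qed
  finally show ?thesis by (simp add: mult_2)
qed

lemma nn_integral_exp_abs_tail:
  assumes a: "0 < a" and T: "0 \<le> T"
  shows "(\<integral>\<^sup>+x. ennreal (exp (- a * \<bar>x\<bar>)) * indicator {T..} \<bar>x\<bar> \<partial>lborel) = ennreal (2 * exp (- a * T) / a)"
proof -
  have lim: "((\<lambda>x. - exp (- a * x) / a) \<longlongrightarrow> 0) at_top" using a by real_asymp
  have "(\<integral>\<^sup>+x. ennreal (exp (- a * x)) * indicator {T..} x \<partial>lborel) = ennreal (0 - (- exp (- a * T) / a))"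
    using a by (intro nn_integral_FTC_atLeast[OF _ _ _ lim]) (auto intro!: derivative_eq_intros)
  moreover have "(\<integral>\<^sup>+x. ennreal (exp (- a * x)) * indicator {T..} x * indicator {0..} x \<partial>lborel) = (\<integral>\<^sup>+x. ennreal (exp (- a * x)) * indicator {T..} x \<partial>lborel)"
    using T by (intro nn_integral_cong) (auto split: split_indicator)
  ultimately have "(\<integral>\<^sup>+x. ennreal (exp (- a * \<bar>x\<bar>)) * indicator {T..} \<bar>x\<bar> \<partial>lborel) = 2 * ennreal (exp (- a * T) / a)"
    by (subst nn_integral_abs) simp_all
  also have "\<dots> = ennreal (2 * exp (- a * T) / a)" using a by (simp add: ennreal_mult flip: ennreal_numeral times_divide_eq_right)
  finally show ?thesis .
qed

lemma nn_integral_exp_abs: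
  assumes "0 < a" shows "(\<integral>\<^sup>+x. ennreal (exp (- a * \<bar>x\<bar>)) \<partial>lborel) = ennreal (2 / a)"
proof -
  have "(\<integral>\<^sup>+x. ennreal (exp (- a * \<bar>x\<bar>)) \<partial>lborel) = (\<integral>\<^sup>+x. ennreal (exp (- a * \<bar>x\<bar>)) * indicator {0..} \<bar>x\<bar> \<partial>lborel)"
    by (intro nn_integral_cong) simp
  then show ?thesis using nn_integral_exp_abs_tail[OF assms, of 0] by simp
qed

section \<open>Moments of centred normal laws\<close>

abbreviation gauss :: "real \<Rightarrow> real measure" where
  "gauss \<sigma> \<equiv> density lborel (\<lambda>x. ennreal (normal_density 0 \<sigma> x))"

lemma prob_space_gauss: "0 < \<sigma> \<Longrightarrow> prob_space (gauss \<sigma>)"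
  using prob_space_normal_density[of \<sigma> 0] by simp

text \<open>Completing the square: the tilt by \<open>exp (t * x)\<close> moves the mean of the
  normal law to \<open>t * \<sigma>\<^sup>2\<close> and leaves its variance unchanged.\<close>

lemma gauss_exp_moment:
  assumes \<sigma>: "0 < \<sigma>"
  shows "(\<integral>\<^sup>+x. ennreal (exp (t * x)) \<partial>gauss \<sigma>) = ennreal (exp (t\<^sup>2 * \<sigma>\<^sup>2 / 2))"
proof -
  have point: "normal_density 0 \<sigma> x * exp (t * x) = exp (t\<^sup>2 * \<sigma>\<^sup>2 / 2) * normal_density (t * \<sigma>\<^sup>2) \<sigma> x" for x
  proof -
    have "- (x - 0)\<^sup>2 / (2 * \<sigma>\<^sup>2) + t * x = t\<^sup>2 * \<sigma>\<^sup>2 / 2 + - (x - t * \<sigma>\<^sup>2)\<^sup>2 / (2 * \<sigma>\<^sup>2)"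
      using \<sigma> by (simp add: field_simps power2_eq_square)
    then have "exp (- (x - 0)\<^sup>2 / (2 * \<sigma>\<^sup>2)) * exp (t * x) = exp (t\<^sup>2 * \<sigma>\<^sup>2 / 2) * exp (- (x - t * \<sigma>\<^sup>2)\<^sup>2 / (2 * \<sigma>\<^sup>2))"
      by (simp only: exp_add[symmetric])
    then show ?thesis unfolding normal_density_def by (simp add: field_simps)
  qed
  have "(\<integral>\<^sup>+x. ennreal (exp (t * x)) \<partial>gauss \<sigma>) = (\<integral>\<^sup>+x. ennreal (normal_density 0 \<sigma> x * exp (t * x)) \<partial>lborel)"
    using \<sigma> by (subst nn_integral_density) (auto simp: ennreal_mult)
  also have "\<dots> = (\<integral>\<^sup>+x. ennreal (exp (t\<^sup>2 * \<sigma>\<^sup>2 / 2)) * ennreal (normal_density (t * \<sigma>\<^sup>2) \<sigma> x) \<partial>lborel)"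
    unfolding point by (simp add: ennreal_mult)
  also have "\<dots> = ennreal (exp (t\<^sup>2 * \<sigma>\<^sup>2 / 2)) * (\<integral>\<^sup>+x. ennreal (normal_density (t * \<sigma>\<^sup>2) \<sigma> x) \<partial>lborel)"
    by (rule nn_integral_cmult) measurable
  also have "(\<integral>\<^sup>+x. ennreal (normal_density (t * \<sigma>\<^sup>2) \<sigma> x) \<partial>lborel) = 1"
    using prob_space.emeasure_space_1[OF prob_space_normal_density[OF \<sigma>, of "t * \<sigma>\<^sup>2"]] by (simp add: emeasure_density)
  finally show ?thesis by simp
qed

lemma gauss_exp_abs_moment:
  assumes \<sigma>: "0 < \<sigma>"
  shows "(\<integral>\<^sup>+x. ennreal (exp (t * \<bar>x\<bar>)) \<partial>gauss \<sigma>) \<le> ennreal (2 * exp (t\<^sup>2 * \<sigma>\<^sup>2 / 2))"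
proof -
  have "(\<integral>\<^sup>+x. ennreal (exp (t * \<bar>x\<bar>)) \<partial>gauss \<sigma>) \<le> (\<integral>\<^sup>+x. ennreal (exp (t * x)) + ennreal (exp ((- t) * x)) \<partial>gauss \<sigma>)"
    by (intro nn_integral_mono) (auto simp: abs_if)
  also have "\<dots> = (\<integral>\<^sup>+x. ennreal (exp (t * x)) \<partial>gauss \<sigma>) + (\<integral>\<^sup>+x. ennreal (exp ((- t) * x)) \<partial>gauss \<sigma>)"
    by (rule nn_integral_add) measurable
  also have "\<dots> = ennreal (2 * exp (t\<^sup>2 * \<sigma>\<^sup>2 / 2))"
    unfolding gauss_exp_moment[OF \<sigma>] by (simp flip: ennreal_plus)
  finally show ?thesis .
qed

lemma gauss_exp_abs_integral:
  assumes \<sigma>: "0 < \<sigma>"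
  shows "integrable (gauss \<sigma>) (\<lambda>x. exp (t * \<bar>x\<bar>))" "(\<integral>x. exp (t * \<bar>x\<bar>) \<partial>gauss \<sigma>) \<le> 2 * exp (t\<^sup>2 * \<sigma>\<^sup>2 / 2)"
proof -
  show i: "integrable (gauss \<sigma>) (\<lambda>x. exp (t * \<bar>x\<bar>))"
    using le_less_trans[OF gauss_exp_abs_moment[OF \<sigma>, of t]] by (intro integrableI_nonneg) auto
  have "ennreal (\<integral>x. exp (t * \<bar>x\<bar>) \<partial>gauss \<sigma>) = (\<integral>\<^sup>+x. ennreal (exp (t * \<bar>x\<bar>)) \<partial>gauss \<sigma>)"
    by (intro nn_integral_eq_integral[symmetric] i) auto
  also have "\<dots> \<le> ennreal (2 * exp (t\<^sup>2 * \<sigma>\<^sup>2 / 2))" by (rule gauss_exp_abs_moment[OF \<sigma>])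
  finally show "(\<integral>x. exp (t * \<bar>x\<bar>) \<partial>gauss \<sigma>) \<le> 2 * exp (t\<^sup>2 * \<sigma>\<^sup>2 / 2)"
    by (subst (asm) ennreal_le_iff) auto
qed

text \<open>In the scale-free variable \<open>u = \<bar>x\<bar> / \<sigma>\<close> both factors are
  dominated by exponentials: \<open>u\<^sup>2 \<le> 2 * exp u\<close>, and
  \<open>exp \<bar>x\<bar> \<le> exp u\<close> since \<open>\<sigma> \<le> 1\<close>. The moment of
  \<open>exp (2 * u)\<close> is bounded independently of \<open>\<sigma>\<close>, so the gain
  \<open>\<sigma>\<^sup>2\<close> survives the exponential weight.\<close>

lemma gauss_square_exp_integral:
  assumes \<sigma>: "0 < \<sigma>" "\<sigma> \<le> 1"
  shows "integrable (gauss \<sigma>) (\<lambda>x. x\<^sup>2 * exp \<bar>x\<bar>)" "(\<integral>x. x\<^sup>2 * exp \<bar>x\<bar> \<partial>gauss \<sigma>) \<le> 4 * exp 2 * \<sigma>\<^sup>2"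
proof -
  have point: "x\<^sup>2 * exp \<bar>x\<bar> \<le> 2 * \<sigma>\<^sup>2 * exp (2 / \<sigma> * \<bar>x\<bar>)" for x :: real
  proof -
    define u where "u = \<bar>x\<bar> / \<sigma>"
    have u: "0 \<le> u" using \<sigma> by (simp add: u_def)
    have "u\<^sup>2 \<le> 2 * exp u" using exp_lower_Taylor_quadratic[OF u] u by simp
    moreover have "exp \<bar>x\<bar> \<le> exp u" using \<sigma> by (simp add: u_def le_divide_eq mult_left_le)
    ultimately have "u\<^sup>2 * exp \<bar>x\<bar> \<le> 2 * exp u * exp u" by (intro mult_mono) auto
    then have le: "\<sigma>\<^sup>2 * (u\<^sup>2 * exp \<bar>x\<bar>) \<le> \<sigma>\<^sup>2 * (2 * exp u * exp u)" by (intro mult_left_mono) auto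
    have eq1: "x\<^sup>2 * exp \<bar>x\<bar> = \<sigma>\<^sup>2 * (u\<^sup>2 * exp \<bar>x\<bar>)" using \<sigma> by (simp add: u_def power_divide)
    have eq2: "\<sigma>\<^sup>2 * (2 * exp u * exp u) = 2 * \<sigma>\<^sup>2 * exp (2 / \<sigma> * \<bar>x\<bar>)"
      by (simp add: u_def mult_exp_exp mult.assoc)
    show ?thesis using le unfolding eq1 eq2 .
  qed
  note g = gauss_exp_abs_integral[OF \<sigma>(1), of "2 / \<sigma>"]
  show i: "integrable (gauss \<sigma>) (\<lambda>x. x\<^sup>2 * exp \<bar>x\<bar>)"
    using point by (intro Bochner_Integration.integrable_bound[OF integrable_mult_right[OF g(1), of "2 * \<sigma>\<^sup>2"]]) auto
  have "(\<integral>x. x\<^sup>2 * exp \<bar>x\<bar> \<partial>gauss \<sigma>) \<le> (\<integral>x. 2 * \<sigma>\<^sup>2 * exp (2 / \<sigma> * \<bar>x\<bar>) \<partial>gauss \<sigma>)"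
    using point by (intro integral_mono i integrable_mult_right g(1))
  also have "\<dots> = 2 * \<sigma>\<^sup>2 * (\<integral>x. exp (2 / \<sigma> * \<bar>x\<bar>) \<partial>gauss \<sigma>)" by simp
  also have "\<dots> \<le> 2 * \<sigma>\<^sup>2 * (2 * exp ((2 / \<sigma>)\<^sup>2 * \<sigma>\<^sup>2 / 2))" by (intro mult_left_mono g(2)) auto
  also have "(2 / \<sigma>)\<^sup>2 * \<sigma>\<^sup>2 / 2 = 2" using \<sigma> by (simp add: power_divide)
  finally show "(\<integral>x. x\<^sup>2 * exp \<bar>x\<bar> \<partial>gauss \<sigma>) \<le> 4 * exp 2 * \<sigma>\<^sup>2" by (simp add: mult_ac)
qed

lemma gauss_reflect:
  fixes g :: "real \<Rightarrow> real"
  assumes [measurable]: "g \<in> borel_measurable borel"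
  shows "(\<integral>x. g (- x) \<partial>gauss \<sigma>) = (\<integral>x. g x \<partial>gauss \<sigma>)"
proof -
  have nd: "normal_density 0 \<sigma> (- x) = normal_density 0 \<sigma> x" for x by (simp add: normal_density_def)
  have "(\<integral>x. g x \<partial>gauss \<sigma>) = (\<integral>x. normal_density 0 \<sigma> x * g x \<partial>lborel)"
    by (subst integral_density) auto
  also have "\<dots> = \<bar>- 1\<bar> *\<^sub>R (\<integral>x. normal_density 0 \<sigma> (0 + (-1) * x) * g (0 + (-1) * x) \<partial>lborel)"
    by (rule lborel_integral_real_affine) simp
  also have "\<dots> = (\<integral>x. normal_density 0 \<sigma> x * g (- x) \<partial>lborel)" by (simp add: nd)
  also have "\<dots> = (\<integral>x. g (- x) \<partial>gauss \<sigma>)" by (subst integral_density) auto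
  finally show ?thesis by simp
qed

lemma laplace_density_split: "laplace_density (y - x) \<le> exp \<bar>x\<bar> * exp (- \<bar>y\<bar>) / 2"
  "exp (- \<bar>y\<bar>) * laplace_density x \<le> laplace_density (y - x)"
proof -
  have "exp (- \<bar>y - x\<bar>) \<le> exp \<bar>x\<bar> * exp (- \<bar>y\<bar>)"
    unfolding mult_exp_exp by (subst exp_le_cancel_iff) linarith
  then show "laplace_density (y - x) \<le> exp \<bar>x\<bar> * exp (- \<bar>y\<bar>) / 2"
    by (simp add: laplace_density_def)
  have "exp (- \<bar>y\<bar>) * exp (- \<bar>x\<bar>) \<le> exp (- \<bar>y - x\<bar>)"
    unfolding mult_exp_exp by (subst exp_le_cancel_iff) linarith
  then show "exp (- \<bar>y\<bar>) * laplace_density x \<le> laplace_density (y - x)"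
    by (simp add: laplace_density_def)
qed

text \<open>The decay rate \<open>1 + C0\<close> exceeds the rate 1 of the noise. Hence
  \<open>exp \<bar>x\<bar>\<close> is integrable against the signal with an exponentially small
  remainder, and the noise alone decides how \<open>f0\<close> decays.\<close>

locale light_tailed_density =
  fixes f0X :: "real \<Rightarrow> real" and C C0 :: real
  assumes f0X_measurable [measurable]: "f0X \<in> borel_measurable borel"
    and f0X_nonneg: "\<And>x. 0 \<le> f0X x"
    and C_pos: "0 < C" and C0_pos: "0 < C0"
    and f0X_le: "\<And>x. f0X x \<le> C * exp (- (1 + C0) * \<bar>x\<bar>)"
    and prob_\<mu>0: "prob_space (density lborel (\<lambda>x. ennreal (f0X x)))"
begin

abbreviation \<mu>0 :: "real measure" where "\<mu>0 \<equiv> density lborel (\<lambda>x. ennreal (f0X x))"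

abbreviation f0 :: "real \<Rightarrow> real" where "f0 \<equiv> obs_density \<mu>0"

interpretation M0: prob_space \<mu>0 by (rule prob_\<mu>0)

lemma finite_\<mu>0: "finite_measure \<mu>0" by (rule M0.finite_measure_axioms)

lemma sets_\<mu>0: "sets \<mu>0 = sets borel" by simp

lemma f0_measurable [measurable]: "f0 \<in> borel_measurable borel"
  by (rule obs_density_measurable[OF finite_\<mu>0 sets_\<mu>0])

lemma f0_ge: "f0 0 * exp (- \<bar>y\<bar>) \<le> f0 y"
proof -
  have "f0 0 * exp (- \<bar>y\<bar>) = (\<integral>x. exp (- \<bar>y\<bar>) * laplace_density (0 - x) \<partial>\<mu>0)"
    by (simp add: obs_density_def mult.commute)
  also have "\<dots> \<le> f0 y"
    unfolding obs_density_def
  proof (intro integral_mono integrable_mult_right laplace_integrable finite_\<mu>0 sets_\<mu>0)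
    show "exp (- \<bar>y\<bar>) * laplace_density (0 - x) \<le> laplace_density (y - x)" for x
      using laplace_density_split(2)[of y x] by (simp add: laplace_density_def)
  qed
  finally show ?thesis .
qed

lemma f0_pos: "0 < f0 y"
  using M0.emeasure_space_1 by (intro obs_density_pos finite_\<mu>0) auto

lemma exp_tail_le:
  assumes T: "0 \<le> T"
  shows "(\<integral>\<^sup>+x. ennreal (exp \<bar>x\<bar>) * indicator {T..} \<bar>x\<bar> \<partial>\<mu>0) \<le> ennreal (2 * C / C0 * exp (- C0 * T))"
proof -
  have "(\<integral>\<^sup>+x. ennreal (exp \<bar>x\<bar>) * indicator {T..} \<bar>x\<bar> \<partial>\<mu>0)
    = (\<integral>\<^sup>+x. ennreal (f0X x) * (ennreal (exp \<bar>x\<bar>) * indicator {T..} \<bar>x\<bar>) \<partial>lborel)"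
    by (rule nn_integral_density) measurable
  also have "\<dots> \<le> (\<integral>\<^sup>+x. ennreal C * (ennreal (exp (- C0 * \<bar>x\<bar>)) * indicator {T..} \<bar>x\<bar>) \<partial>lborel)"
  proof (rule nn_integral_mono)
    fix x
    have "f0X x * exp \<bar>x\<bar> \<le> C * exp (- (1 + C0) * \<bar>x\<bar>) * exp \<bar>x\<bar>" by (intro mult_right_mono f0X_le) simp
    also have "\<dots> = C * exp (- C0 * \<bar>x\<bar>)" by (simp add: algebra_simps flip: exp_add)
    finally show "ennreal (f0X x) * (ennreal (exp \<bar>x\<bar>) * indicator {T..} \<bar>x\<bar>) \<le> ennreal C * (ennreal (exp (- C0 * \<bar>x\<bar>)) * indicator {T..} \<bar>x\<bar>)"
      using f0X_nonneg C_pos by (auto intro!: ennreal_leI simp flip: ennreal_mult split: split_indicator)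
  qed
  also have "\<dots> = ennreal C * (\<integral>\<^sup>+x. ennreal (exp (- C0 * \<bar>x\<bar>)) * indicator {T..} \<bar>x\<bar> \<partial>lborel)"
    by (rule nn_integral_cmult) measurable
  also have "\<dots> = ennreal C * ennreal (2 * exp (- C0 * T) / C0)"
    by (simp only: nn_integral_exp_abs_tail[OF C0_pos T])
  also have "\<dots> = ennreal (2 * C / C0 * exp (- C0 * T))"
    using C_pos C0_pos by (simp add: mult_ac flip: ennreal_mult)
  finally show ?thesis .
qed

text \<open>Half the bound of \<open>exp_tail_le\<close> at \<open>T = 0\<close>; the other factor
  is the \<open>1 / 2\<close> of the Laplace density.\<close>

definition C1 :: real where "C1 = C / C0"

lemma C1_pos: "0 < C1" using C_pos C0_pos by (simp add: C1_def)

lemma laplace_tail_le: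
  assumes T: "0 \<le> T" and A: "A \<in> sets borel" "\<And>x. x \<in> A \<Longrightarrow> T \<le> \<bar>x\<bar>"
  shows "(\<integral>x. indicator A x * laplace_density (y - x) \<partial>\<mu>0) \<le> C1 * exp (- C0 * T) * exp (- \<bar>y\<bar>)"
proof -
  note A(1)[measurable]
  have i: "integrable \<mu>0 (\<lambda>x. indicator A x * laplace_density (y - x))"
    using integrable_real_mult_indicator[OF _ laplace_integrable[OF finite_\<mu>0 sets_\<mu>0], of A y] A(1)
    by (simp add: mult.commute)
  have "ennreal (\<integral>x. indicator A x * laplace_density (y - x) \<partial>\<mu>0) = (\<integral>\<^sup>+x. ennreal (indicator A x * laplace_density (y - x)) \<partial>\<mu>0)"
    by (intro nn_integral_eq_integral[symmetric] i) (auto simp: laplace_density_pos less_imp_le)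
  also have "\<dots> \<le> (\<integral>\<^sup>+x. ennreal (exp (- \<bar>y\<bar>) / 2) * (ennreal (exp \<bar>x\<bar>) * indicator {T..} \<bar>x\<bar>) \<partial>\<mu>0)"
    using laplace_density_split(1)[of y] A(2)
    by (intro nn_integral_mono) (auto intro!: ennreal_leI simp: mult_ac simp flip: ennreal_mult split: split_indicator)
  also have "\<dots> = ennreal (exp (- \<bar>y\<bar>) / 2) * (\<integral>\<^sup>+x. ennreal (exp \<bar>x\<bar>) * indicator {T..} \<bar>x\<bar> \<partial>\<mu>0)"
    by (rule nn_integral_cmult) measurable
  also have "\<dots> \<le> ennreal (exp (- \<bar>y\<bar>) / 2) * ennreal (2 * C / C0 * exp (- C0 * T))"
    by (intro mult_left_mono exp_tail_le T) simp
  also have "\<dots> = ennreal (C1 * exp (- C0 * T) * exp (- \<bar>y\<bar>))"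
    using C_pos C0_pos by (simp add: C1_def mult_ac flip: ennreal_mult)
  finally show ?thesis using C1_pos by (subst (asm) ennreal_le_iff) auto
qed

text \<open>Together with \<open>f0_ge\<close> this makes \<open>f0\<close> comparable to
  \<open>exp (- \<bar>y\<bar>)\<close>, the scale on which all later errors are measured.\<close>

lemma f0_le: "f0 y \<le> C1 * exp (- \<bar>y\<bar>)"
proof -
  have "(\<integral>x. indicator UNIV x * laplace_density (y - x) \<partial>\<mu>0) \<le> C1 * exp (- C0 * 0) * exp (- \<bar>y\<bar>)"
    by (rule laplace_tail_le) auto
  then show ?thesis unfolding obs_density_def by simp
qed

text \<open>Any point \<open>y\<close> of the interval can set the scale, since
  \<open>exp (- \<bar>x\<bar>)\<close> changes by at most the factor \<open>exp (b - a)\<close>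
  within it.\<close>

lemma measure_interval_le:
  assumes "a \<le> y" "y \<le> b" "a \<le> b"
  shows "measure \<mu>0 {a..b} \<le> (b - a) * (C * exp (b - a)) * exp (- \<bar>y\<bar>)"
proof -
  have "emeasure \<mu>0 {a..b} = (\<integral>\<^sup>+x. ennreal (f0X x) * indicator {a..b} x \<partial>lborel)"
    by (rule emeasure_density) auto
  also have "\<dots> \<le> (\<integral>\<^sup>+x. ennreal (C * exp (b - a) * exp (- \<bar>y\<bar>)) * indicator {a..b} x \<partial>lborel)"
  proof (rule nn_integral_mono)
    fix x
    have "f0X x \<le> C * exp (b - a) * exp (- \<bar>y\<bar>)" if "x \<in> {a..b}"
    proof -
      have "f0X x \<le> C * exp (- (1 + C0) * \<bar>x\<bar>)" by (rule f0X_le)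
      also have "\<dots> \<le> C * exp ((b - a) + - \<bar>y\<bar>)"
      proof -
        have "- (1 + C0) * \<bar>x\<bar> \<le> - \<bar>x\<bar>" using C0_pos by (simp add: algebra_simps)
        also have "\<dots> \<le> (b - a) + - \<bar>y\<bar>" using that assms by auto
        finally show ?thesis using C_pos by simp
      qed
      finally show ?thesis by (simp add: mult.assoc mult_exp_exp)
    qed
    then show "ennreal (f0X x) * indicator {a..b} x \<le> ennreal (C * exp (b - a) * exp (- \<bar>y\<bar>)) * indicator {a..b} x"
      by (auto intro!: ennreal_leI split: split_indicator)
  qed
  also have "\<dots> = ennreal ((b - a) * (C * exp (b - a)) * exp (- \<bar>y\<bar>))"
  proof -
    define K where "K = C * exp (b - a) * exp (- \<bar>y\<bar>)"
    have "(\<integral>\<^sup>+x. ennreal K * indicator {a..b} x \<partial>lborel) = ennreal (K * (b - a))"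
      using assms C_pos by (subst nn_integral_cmult) (auto simp: K_def simp flip: ennreal_mult)
    then show ?thesis by (simp add: K_def mult_ac)
  qed
  finally show ?thesis using assms C_pos unfolding M0.emeasure_eq_measure by (subst (asm) ennreal_le_iff) auto
qed

definition C2 :: real where "C2 = 16 * (C1 + C)"

lemma C2_pos: "0 < C2" using C1_pos C_pos by (simp add: C2_def)

text \<open>No derivative of \<open>f0\<close> is used. Interpolation at \<open>y\<close> from the
  nodes \<open>y - h\<close> and \<open>y + h\<close> has two equal weights \<open>u\<close>, and
  with \<open>S\<close> the sum of the node values,
  \<open>S - 2 * f0 y = (1 - 2 * u) * S - 2 * (f0 y - u * S)\<close>. The first term is quadratic by
  the deficit of the weights, the second because the interpolation error is the interval length
  times the mass of the interval, again of the order of the length.\<close>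

lemma second_difference_le:
  "\<bar>f0 (y + x) + f0 (y - x) - 2 * f0 y\<bar> \<le> C2 * exp (- \<bar>y\<bar>) * (x\<^sup>2 * exp \<bar>x\<bar>)"
proof -
  define h where "h = \<bar>x\<bar>"
  define S where "S = f0 (y - h) + f0 (y + h)"
  define E where "E = exp h * exp (- \<bar>y\<bar>)"
  have E: "0 < E" by (simp add: E_def)
  have h: "0 \<le> h" by (simp add: h_def)
  have S: "f0 (y + x) + f0 (y - x) = S" by (cases "0 \<le> x") (auto simp: S_def h_def abs_if)
  have near: "f0 z \<le> C1 * E" if "\<bar>z - y\<bar> \<le> h" for z
  proof -
    have "exp (- \<bar>z\<bar>) \<le> exp (h + - \<bar>y\<bar>)" using that by (subst exp_le_cancel_iff) linarith
    then show ?thesis using f0_le[of z] C1_pos order_trans mult_left_mono[of _ _ C1]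
      unfolding E_def exp_add by (meson less_imp_le order_trans)
  qed
  have S_le: "S \<le> 2 * C1 * E" using near[of "y - h"] near[of "y + h"] h by (simp add: S_def)
  have S0: "0 \<le> S" using f0_pos by (simp add: S_def add_nonneg_nonneg less_imp_le)
  have "\<bar>S - 2 * f0 y\<bar> \<le> C2 * E * h\<^sup>2"
  \<comment> \<open>Interpolation needs distinct nodes at distance at most 1, that is
    \<open>0 < 2 * h \<le> 1\<close>; beyond that the factor \<open>h\<^sup>2\<close> is at least
    \<open>1 / 4\<close> and the size of \<open>f0\<close> suffices.\<close>
  proof (cases "h = 0 \<or> 1 / 2 < h")
    case True
    then show ?thesis
    proof
      assume "h = 0" then show ?thesis by (simp add: S_def)
    next
      assume "1 / 2 < h"
      then have "1 \<le> 4 * h\<^sup>2" using power_mono[of "1/2" h 2] by (simp add: power2_eq_square)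
      have "\<bar>S - 2 * f0 y\<bar> \<le> 2 * C1 * E"
        using S_le S0 near[of y] h f0_pos[of y] by (auto simp: abs_le_iff)
      also have "\<dots> \<le> 2 * C1 * E * (4 * h\<^sup>2)"
        using \<open>1 \<le> 4 * h\<^sup>2\<close> C1_pos E by (simp add: mult_le_cancel_left1)
      also have "\<dots> = (8 * C1) * (E * h\<^sup>2)" by simp
      also have "\<dots> \<le> C2 * (E * h\<^sup>2)" using C1_pos C_pos E by (intro mult_right_mono) (auto simp: C2_def)
      finally show ?thesis by (simp add: mult.assoc)
    qed
  next
    case False
    then have h: "0 < h" "h \<le> 1 / 2" using h by auto
    define a b where "a = y - h" and "b = y + h"
    have ab: "a < b" "b - a = 2 * h" "y \<in> {a..b}" using h by (auto simp: a_def b_def)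
    define u where "u = sinh h / sinh (2 * h)"
    have uu: "weight_left a b y = u" "weight_right a b y = u"
      by (simp_all add: weight_left_def weight_right_def u_def a_def b_def)
    have u: "0 \<le> u" "2 * u \<le> 1" "1 - (2 * h)\<^sup>2 \<le> 2 * u"
      using weight_nonneg[OF ab(1,3)] weight_sum_le_1[OF ab(1,3)] weight_sum_ge[OF ab(1,3)] ab(2) h by (auto simp: uu)
    have "\<bar>f0 y - (u * f0 a + u * f0 b)\<bar> \<le> 2 * h * measure \<mu>0 {a<..<b}"
      using obs_density_interpolation[OF finite_\<mu>0 sets_\<mu>0 ab(1) _ ab(3)] h ab(2) by (simp add: uu)
    also have "\<dots> \<le> 2 * h * ((b - a) * (C * exp (b - a)) * exp (- \<bar>y\<bar>))"
    proof (rule mult_left_mono)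
      have "measure \<mu>0 {a<..<b} \<le> measure \<mu>0 {a..b}" by (intro M0.finite_measure_mono) auto
      also have "\<dots> \<le> (b - a) * (C * exp (b - a)) * exp (- \<bar>y\<bar>)" using ab by (intro measure_interval_le) auto
      finally show "measure \<mu>0 {a<..<b} \<le> (b - a) * (C * exp (b - a)) * exp (- \<bar>y\<bar>)" .
    qed (use h in simp)
    also have "\<dots> = 4 * C * h\<^sup>2 * (exp h * E)"
    proof -
      have "exp (2 * h) = exp h * exp h" by (simp add: mult_exp_exp)
      then show ?thesis unfolding ab(2) E_def by (simp add: power2_eq_square)
    qed
    also have "\<dots> \<le> 4 * C * h\<^sup>2 * (2 * E)"
    proof -
      have "exp h \<le> 1 + h + h\<^sup>2" using h by (intro exp_le_quadratic) auto
      also have "\<dots> \<le> 2" using h mult_mono[of h "1/2" h "1/2"] by (simp add: power2_eq_square)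
      finally show ?thesis using E C_pos by (intro mult_left_mono mult_right_mono) auto
    qed
    finally have r: "\<bar>f0 y - u * S\<bar> \<le> 8 * C * h\<^sup>2 * E" by (simp add: S_def a_def b_def distrib_left)
    define P Q where "P = (1 - 2 * u) * S" and "Q = f0 y - u * S"
    have "P \<le> (2 * h)\<^sup>2 * (2 * C1 * E)" unfolding P_def using u S_le S0 by (intro mult_mono) auto
    moreover have "0 \<le> P" using u S0 by (simp add: P_def)
    moreover have "S - 2 * f0 y = P - 2 * Q" by (simp add: P_def Q_def algebra_simps)
    moreover have "\<bar>Q\<bar> \<le> 8 * C * h\<^sup>2 * E" using r by (simp add: Q_def)
    ultimately have "\<bar>S - 2 * f0 y\<bar> \<le> (2 * h)\<^sup>2 * (2 * C1 * E) + 2 * (8 * C * h\<^sup>2 * E)"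
      by linarith
    also have "\<dots> = (8 * C1 + 16 * C) * (E * h\<^sup>2)" by (simp add: algebra_simps power2_eq_square)
    also have "\<dots> \<le> C2 * (E * h\<^sup>2)" using C1_pos E by (intro mult_right_mono) (auto simp: C2_def)
    finally show ?thesis by (simp add: mult.assoc)
  qed
  then show ?thesis unfolding S by (simp add: E_def h_def mult_ac)
qed

lemma gauss_f0_integrable: "0 < \<sigma> \<Longrightarrow> integrable (gauss \<sigma>) (\<lambda>x. f0 (y + c * x))"
  by (rule finite_measure.integrable_const_bound[where B=1])
     (auto simp: prob_space.finite_measure prob_space_gauss abs_of_pos f0_pos
       intro!: AE_I2 order_trans[OF obs_density_le_half[OF prob_\<mu>0 sets_\<mu>0]])

text \<open>Symmetry of the normal law cancels the first-order term, so the bias is half an average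
  of second differences and hence of order \<open>\<sigma>\<^sup>2\<close>.\<close>

lemma smoothing_bias:
  assumes \<sigma>: "0 < \<sigma>" "\<sigma> \<le> 1"
  shows "\<bar>(\<integral>x. f0 (y - x) \<partial>gauss \<sigma>) - f0 y\<bar> \<le> 2 * exp 2 * C2 * \<sigma>\<^sup>2 * exp (- \<bar>y\<bar>)"
proof -
  interpret G: prob_space "gauss \<sigma>" by (rule prob_space_gauss[OF \<sigma>(1)])
  note ip = gauss_f0_integrable[OF \<sigma>(1), of y 1, simplified] and im = gauss_f0_integrable[OF \<sigma>(1), of y "-1", simplified]
  have "(\<integral>x. f0 (y + x) \<partial>gauss \<sigma>) = (\<integral>x. f0 (y - x) \<partial>gauss \<sigma>)"
    using gauss_reflect[of "\<lambda>x. f0 (y - x)" \<sigma>] by simp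
  then have eq: "2 * ((\<integral>x. f0 (y - x) \<partial>gauss \<sigma>) - f0 y) = (\<integral>x. f0 (y + x) + f0 (y - x) - 2 * f0 y \<partial>gauss \<sigma>)"
    using ip im G.prob_space by simp
  have "\<bar>\<integral>x. f0 (y + x) + f0 (y - x) - 2 * f0 y \<partial>gauss \<sigma>\<bar> \<le> (\<integral>x. \<bar>f0 (y + x) + f0 (y - x) - 2 * f0 y\<bar> \<partial>gauss \<sigma>)" by (rule integral_abs_bound)
  also have "\<dots> \<le> (\<integral>x. C2 * exp (- \<bar>y\<bar>) * (x\<^sup>2 * exp \<bar>x\<bar>) \<partial>gauss \<sigma>)"
    by (intro integral_mono integrable_abs Bochner_Integration.integrable_diff Bochner_Integration.integrable_add
        ip im integrable_mult_right gauss_square_exp_integral(1) \<sigma> second_difference_le) simp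
  also have "\<dots> = C2 * exp (- \<bar>y\<bar>) * (\<integral>x. x\<^sup>2 * exp \<bar>x\<bar> \<partial>gauss \<sigma>)" by simp
  also have "\<dots> \<le> C2 * exp (- \<bar>y\<bar>) * (4 * exp 2 * \<sigma>\<^sup>2)"
    using C2_pos by (intro mult_left_mono gauss_square_exp_integral(2) \<sigma>) auto
  finally have "2 * \<bar>(\<integral>x. f0 (y - x) \<partial>gauss \<sigma>) - f0 y\<bar> \<le> C2 * exp (- \<bar>y\<bar>) * (4 * exp 2 * \<sigma>\<^sup>2)"
    unfolding eq[symmetric] abs_mult by (simp only: abs_numeral)
  then show ?thesis by (simp add: mult_ac)
qed

end

section \<open>Discretisation of the signal\<close>

lemma sum_lessThan_double: "(\<Sum>k<2 * N. g k) = (\<Sum>i<N. g (2 * i) + g (2 * i + 1))"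
  for g :: "nat \<Rightarrow> 'a :: comm_monoid_add"
  by (induction N) (simp_all add: add.assoc)

text \<open>The indices \<open>2 i\<close> and \<open>2 i + 1\<close> stand for the left and the right end of the \<open>i\<close>-th cell; a node
  shared by two cells carries two disjoint spots.\<close>

definition anchor :: "real \<Rightarrow> real \<Rightarrow> nat \<Rightarrow> real" where
  "anchor c \<delta> k = (if even k then c + real (k div 2) * \<delta> else c + real (Suc (k div 2)) * \<delta>)"

definition spot :: "real \<Rightarrow> real \<Rightarrow> real \<Rightarrow> nat \<Rightarrow> real set" where
  "spot c \<delta> \<rho> k = (if even k then {anchor c \<delta> k..<anchor c \<delta> k + \<rho>} else {anchor c \<delta> k - \<rho>..<anchor c \<delta> k})"

lemma spot_sets [measurable]: "spot c \<delta> \<rho> k \<in> sets borel"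
  by (simp add: spot_def)

lemma spot_near: "z \<in> spot c \<delta> \<rho> k \<Longrightarrow> \<bar>z - anchor c \<delta> k\<bar> \<le> \<rho>"
  by (auto simp: spot_def split: if_splits)

lemma spot_subset_cell:
  assumes "0 < \<rho>" "2 * \<rho> \<le> \<delta>" shows "spot c \<delta> \<rho> k \<subseteq> cell c \<delta> (k div 2)"
  using assms by (auto simp: spot_def anchor_def cell_def algebra_simps)

lemma disjoint_spots:
  assumes "0 < \<rho>" "2 * \<rho> \<le> \<delta>" shows "disjoint_family_on (spot c \<delta> \<rho>) I"
  unfolding disjoint_family_on_def
proof (intro ballI impI)
  fix j k :: nat assume "j \<noteq> k"
  show "spot c \<delta> \<rho> j \<inter> spot c \<delta> \<rho> k = {}"
  proof (cases "j div 2 = k div 2")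
    case True
    then have "even j \<noteq> even k" using \<open>j \<noteq> k\<close> by presburger
    then show ?thesis using assms True by (auto simp: spot_def anchor_def algebra_simps)
  next
    case False
    have \<delta>: "0 < \<delta>" using assms by simp
    show ?thesis
    proof (rule equals0I)
      fix x assume "x \<in> spot c \<delta> \<rho> j \<inter> spot c \<delta> \<rho> k"
      then have "x \<in> cell c \<delta> (j div 2)" "x \<in> cell c \<delta> (k div 2)"
        using spot_subset_cell[OF assms, of c j] spot_subset_cell[OF assms, of c k] by auto
      from this[THEN cell_index_unique[OF \<delta>]] show False using False by simp
    qed
  qed
qed

lemma anchor_bounds:
  assumes "0 < \<delta>" "k < 2 * N" shows "c \<le> anchor c \<delta> k" "anchor c \<delta> k \<le> c + real N * \<delta>"
proof -
  have k: "Suc (k div 2) \<le> N" "k div 2 \<le> N" using assms(2) by linarith+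
  have "real (k div 2) * \<delta> \<le> real N * \<delta>" "real (Suc (k div 2)) * \<delta> \<le> real N * \<delta>"
    using assms(1) k[THEN of_nat_mono[where 'a=real]] by (intro mult_right_mono; simp)+
  then show "c \<le> anchor c \<delta> k" "anchor c \<delta> k \<le> c + real N * \<delta>" using assms by (auto simp: anchor_def)
qed

text \<open>The error is relative to the kernel, as required for errors proportional to
  \<open>exp (- \<bar>y\<bar>)\<close>; an absolute Lipschitz bound would be useless in the
  tails.\<close>

lemma laplace_near:
  assumes "\<bar>z - x\<bar> \<le> \<rho>" "\<rho> \<le> 1"
  shows "\<bar>laplace_density (y - z) - laplace_density (y - x)\<bar> \<le> 2 * \<rho> * laplace_density (y - x)"
proof -
  have \<rho>: "0 \<le> \<rho>" using assms by linarith
  note p = laplace_density_pos[of "y - x", THEN less_imp_le]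
  have "exp \<bar>z - x\<bar> \<le> exp \<rho>" using assms by simp
  also have "exp \<rho> \<le> 1 + \<rho> + \<rho>\<^sup>2" using assms \<rho> by (intro exp_le_quadratic) auto
  also have "\<dots> \<le> 1 + 2 * \<rho>" using \<rho> assms by (simp add: power2_eq_square mult_left_le)
  finally have e: "exp \<bar>z - x\<bar> \<le> 1 + 2 * \<rho>" .
  have up: "laplace_density (y - z) \<le> (1 + 2 * \<rho>) * laplace_density (y - x)"
    using laplace_density_shift[of y z x] mult_right_mono[OF e p] by linarith
  have "laplace_density (y - x) * exp (- \<rho>) \<le> laplace_density (y - x) * exp (- \<bar>x - z\<bar>)"
    using assms p by (intro mult_left_mono) auto
  also have "\<dots> \<le> laplace_density (y - z)"
    using laplace_density_shift[of y x z] by (simp add: exp_minus field_simps)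
  finally have "laplace_density (y - x) * exp (- \<rho>) \<le> laplace_density (y - z)" .
  moreover have "laplace_density (y - x) * (1 - \<rho>) \<le> laplace_density (y - x) * exp (- \<rho>)"
    using exp_ge_add_one_self[of "- \<rho>"] p by (intro mult_left_mono) auto
  ultimately have "laplace_density (y - x) * (1 - \<rho>) \<le> laplace_density (y - z)" by linarith
  moreover have "0 \<le> \<rho> * laplace_density (y - x)" using \<rho> p by simp
  ultimately show ?thesis using up by (simp add: abs_le_iff algebra_simps)
qed

context light_tailed_density
begin

interpretation M0: prob_space \<mu>0 by (rule prob_\<mu>0)

text \<open>The mass that the cell \<open>k div 2\<close> sends to its left end (even
  \<open>k\<close>) or right end (odd \<open>k\<close>) when each point is split according to the
  interpolation weights. These are the target weights for the prior.\<close>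

definition node_weight :: "real \<Rightarrow> real \<Rightarrow> nat \<Rightarrow> real" where
  "node_weight c \<delta> k = (\<integral>x. indicator (cell c \<delta> (k div 2)) x *
     (if even k then weight_left (c + real (k div 2) * \<delta>) (c + real (Suc (k div 2)) * \<delta>) x
      else weight_right (c + real (k div 2) * \<delta>) (c + real (Suc (k div 2)) * \<delta>) x) \<partial>\<mu>0)"

text \<open>The summands are the error of the node approximation, the relative error of the spots
  times the bound on the node mixture, and the contribution of the slack
  \<open>\<eta>\<close>.\<close>

definition C3 :: real where "C3 = (C1 + 3 * C) + (3 + 2 * (2 * C1 + 1)) * (2 * C1 + 3 * C) + 4"

context
  fixes c \<delta> T :: real and N :: nat
  assumes \<delta>: "0 < \<delta>" "\<delta> \<le> 1" and c: "c = - T" and T: "0 \<le> T" "real N * \<delta> = 2 * T"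
    and tail: "exp (- C0 * T) \<le> \<delta>\<^sup>2"
begin

definition lo :: "nat \<Rightarrow> real" where "lo i = c + real i * \<delta>"
definition hi :: "nat \<Rightarrow> real" where "hi i = c + real (Suc i) * \<delta>"

lemma lo_hi: "lo i < hi i" "hi i - lo i = \<delta>" "cell c \<delta> i = {lo i..<hi i}"
  using \<delta> by (auto simp: lo_def hi_def cell_def algebra_simps)

abbreviation "wl i \<equiv> weight_left (lo i) (hi i)"
abbreviation "wr i \<equiv> weight_right (lo i) (hi i)"

lemma w_bounds:
  assumes "x \<in> cell c \<delta> i"
  shows "0 \<le> wl i x" "0 \<le> wr i x" "wl i x + wr i x \<le> 1" "1 - \<delta>\<^sup>2 \<le> wl i x + wr i x"
  using assms weight_nonneg[OF lo_hi(1), of x i] weight_sum_le_1[OF lo_hi(1), of x i] weight_sum_ge[OF lo_hi(1), of x i] \<delta>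
  by (auto simp: lo_hi)

lemma node_weight_eq:
  "node_weight c \<delta> (2 * i) = (\<integral>x. indicator (cell c \<delta> i) x * wl i x \<partial>\<mu>0)"
  "node_weight c \<delta> (2 * i + 1) = (\<integral>x. indicator (cell c \<delta> i) x * wr i x \<partial>\<mu>0)"
  by (simp_all add: node_weight_def lo_def hi_def)

lemma weight_integrable:
  "integrable \<mu>0 (\<lambda>x. indicator (cell c \<delta> i) x * wl i x)" "integrable \<mu>0 (\<lambda>x. indicator (cell c \<delta> i) x * wr i x)"
proof -
  have [measurable]: "wl i \<in> borel_measurable borel" "wr i \<in> borel_measurable borel" by (rule weight_measurable)+
  have "\<bar>indicator (cell c \<delta> i) x * wl i x\<bar> \<le> 1" "\<bar>indicator (cell c \<delta> i) x * wr i x\<bar> \<le> 1" for x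
    using w_bounds[of x i] by (auto split: split_indicator)
  then show "integrable \<mu>0 (\<lambda>x. indicator (cell c \<delta> i) x * wl i x)" "integrable \<mu>0 (\<lambda>x. indicator (cell c \<delta> i) x * wr i x)"
    by (intro M0.integrable_const_bound[where B=1] AE_I2; simp)+
qed

lemma cell_indicator_integrable: "integrable \<mu>0 (\<lambda>x. indicator (cell c \<delta> i) x :: real)"
  by (intro M0.integrable_const_bound[where B=1] AE_I2) (auto split: split_indicator)

lemma node_weight_nonneg: "0 \<le> node_weight c \<delta> k"
proof -
  have "0 \<le> node_weight c \<delta> (2 * i)" "0 \<le> node_weight c \<delta> (2 * i + 1)" for i
    unfolding node_weight_eq using w_bounds[of _ i]
    by (intro integral_nonneg_AE AE_I2; auto split: split_indicator)+
  then show ?thesis by (cases "even k") (auto elim!: evenE oddE)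
qed

lemma inside: "(\<Union>i<N. cell c \<delta> i) = {- T..<T}"
  using UN_cells[OF \<delta>(1), of c N] T c by simp

lemma measure_inside: "1 - 2 * C1 * \<delta>\<^sup>2 \<le> (\<Sum>i<N. measure \<mu>0 (cell c \<delta> i))" "(\<Sum>i<N. measure \<mu>0 (cell c \<delta> i)) \<le> 1"
proof -
  have eq: "(\<Sum>i<N. measure \<mu>0 (cell c \<delta> i)) = measure \<mu>0 {- T..<T}"
    unfolding inside[symmetric]
    by (rule M0.finite_measure_finite_Union[symmetric]) (simp_all add: image_subset_iff cell_sets disjoint_cells \<delta>)
  then show "(\<Sum>i<N. measure \<mu>0 (cell c \<delta> i)) \<le> 1" using M0.prob_le_1 by simp
  have "ennreal (measure \<mu>0 (- {- T..<T})) = (\<integral>\<^sup>+x. indicator (- {- T..<T}) x \<partial>\<mu>0)"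
    by (simp add: M0.emeasure_eq_measure)
  also have "\<dots> \<le> (\<integral>\<^sup>+x. ennreal (exp \<bar>x\<bar>) * indicator {T..} \<bar>x\<bar> \<partial>\<mu>0)"
    by (intro nn_integral_mono) (auto split: split_indicator)
  also have "\<dots> \<le> ennreal (2 * C / C0 * exp (- C0 * T))" by (rule exp_tail_le[OF T(1)])
  also have "\<dots> \<le> ennreal (2 * C1 * \<delta>\<^sup>2)"
    unfolding C1_def using tail C_pos C0_pos by (intro ennreal_leI) (simp add: divide_right_mono mult_left_mono)
  finally have "measure \<mu>0 (- {- T..<T}) \<le> 2 * C1 * \<delta>\<^sup>2" using C1_pos by (subst (asm) ennreal_le_iff) auto
  moreover have "measure \<mu>0 (- {- T..<T}) = 1 - measure \<mu>0 {- T..<T}"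
    using M0.prob_compl[of "{- T..<T}"] by (simp add: Compl_eq_Diff_UNIV)
  ultimately show "1 - 2 * C1 * \<delta>\<^sup>2 \<le> (\<Sum>i<N. measure \<mu>0 (cell c \<delta> i))" unfolding eq by simp
qed

text \<open>Mass is lost twice: at most \<open>2 * C1 * \<delta>\<^sup>2\<close> lies outside the
  grid, and inside it the interpolation weights drop at most the fraction
  \<open>\<delta>\<^sup>2\<close>.\<close>

lemma node_weight_sum: "1 - (2 * C1 + 1) * \<delta>\<^sup>2 \<le> (\<Sum>k<2 * N. node_weight c \<delta> k)" "(\<Sum>k<2 * N. node_weight c \<delta> k) \<le> 1"
proof -
  have *: "(\<Sum>k<2 * N. node_weight c \<delta> k) = (\<Sum>i<N. \<integral>x. indicator (cell c \<delta> i) x * wl i x + indicator (cell c \<delta> i) x * wr i x \<partial>\<mu>0)"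
    unfolding sum_lessThan_double node_weight_eq by (simp add: weight_integrable)
  have "(\<Sum>i<N. (1 - \<delta>\<^sup>2) * measure \<mu>0 (cell c \<delta> i)) \<le> (\<Sum>k<2 * N. node_weight c \<delta> k)"
    unfolding *
  proof (rule sum_mono)
    fix i
    have "(1 - \<delta>\<^sup>2) * measure \<mu>0 (cell c \<delta> i) = (\<integral>x. (1 - \<delta>\<^sup>2) * indicator (cell c \<delta> i) x \<partial>\<mu>0)" by simp
    also have "\<dots> \<le> (\<integral>x. indicator (cell c \<delta> i) x * wl i x + indicator (cell c \<delta> i) x * wr i x \<partial>\<mu>0)"
      using w_bounds[of _ i]
      by (intro integral_mono integrable_mult_right cell_indicator_integrable Bochner_Integration.integrable_add weight_integrable)
         (auto split: split_indicator)
    finally show "(1 - \<delta>\<^sup>2) * measure \<mu>0 (cell c \<delta> i) \<le> \<dots>" .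
  qed
  moreover have "(\<Sum>i<N. (1 - \<delta>\<^sup>2) * measure \<mu>0 (cell c \<delta> i)) \<ge> 1 - (2 * C1 + 1) * \<delta>\<^sup>2"
  proof -
    define m where "m = (\<Sum>i<N. measure \<mu>0 (cell c \<delta> i))"
    have "\<delta>\<^sup>2 * m \<le> \<delta>\<^sup>2" using measure_inside(2) by (simp add: m_def mult_left_le)
    then have "(1 - \<delta>\<^sup>2) * m \<ge> 1 - (2 * C1 + 1) * \<delta>\<^sup>2" using measure_inside(1) by (simp add: m_def algebra_simps)
    then show ?thesis by (simp add: m_def sum_distrib_left)
  qed
  ultimately show "1 - (2 * C1 + 1) * \<delta>\<^sup>2 \<le> (\<Sum>k<2 * N. node_weight c \<delta> k)" by linarith
  have "(\<Sum>k<2 * N. node_weight c \<delta> k) \<le> (\<Sum>i<N. measure \<mu>0 (cell c \<delta> i))"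
    unfolding *
  proof (rule sum_mono)
    fix i
    have "(\<integral>x. indicator (cell c \<delta> i) x * wl i x + indicator (cell c \<delta> i) x * wr i x \<partial>\<mu>0) \<le> (\<integral>x. indicator (cell c \<delta> i) x \<partial>\<mu>0)"
      using w_bounds[of _ i]
      by (intro integral_mono cell_indicator_integrable Bochner_Integration.integrable_add weight_integrable)
         (auto split: split_indicator)
    then show "(\<integral>x. indicator (cell c \<delta> i) x * wl i x + indicator (cell c \<delta> i) x * wr i x \<partial>\<mu>0) \<le> measure \<mu>0 (cell c \<delta> i)" by simp
  qed
  then show "(\<Sum>k<2 * N. node_weight c \<delta> k) \<le> 1" using measure_inside(2) by linarith
qed

text \<open>Interpolation is exact for every cell not containing \<open>y\<close>, so at most one
  cell contributes. Its error is \<open>\<delta>\<close> times its mass, and that mass is itself of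
  order \<open>\<delta> * exp (- \<bar>y\<bar>)\<close>; the mass outside the grid is covered by the
  tail assumption.\<close>

lemma node_approximation:
  "\<bar>f0 y - (\<Sum>k<2 * N. node_weight c \<delta> k * laplace_density (y - anchor c \<delta> k))\<bar> \<le> (C1 + 3 * C) * \<delta>\<^sup>2 * exp (- \<bar>y\<bar>)"
proof -
  let ?l = "\<lambda>x. laplace_density (y - x)"
  have li: "integrable \<mu>0 (\<lambda>x. indicator A x * ?l x)" if "A \<in> sets borel" for A
    using integrable_real_mult_indicator[OF _ laplace_integrable[OF finite_\<mu>0 sets_\<mu>0], of A y] that by (simp add: mult.commute)
  define d where "d i x = indicator (cell c \<delta> i) x * (?l x - (wl i x * ?l (lo i) + wr i x * ?l (hi i)))" for i x
  have d_eq: "(\<integral>x. d i x \<partial>\<mu>0) = (\<integral>x. indicator (cell c \<delta> i) x * ?l x \<partial>\<mu>0)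
      - (node_weight c \<delta> (2 * i) * ?l (lo i) + node_weight c \<delta> (2 * i + 1) * ?l (hi i))" for i
  proof -
    have "(\<integral>x. d i x \<partial>\<mu>0) = (\<integral>x. indicator (cell c \<delta> i) x * ?l x -
      (indicator (cell c \<delta> i) x * wl i x * ?l (lo i) + indicator (cell c \<delta> i) x * wr i x * ?l (hi i)) \<partial>\<mu>0)"
      unfolding d_def by (intro Bochner_Integration.integral_cong) (auto simp: algebra_simps)
    also have "\<dots> = (\<integral>x. indicator (cell c \<delta> i) x * ?l x \<partial>\<mu>0)
      - ((\<integral>x. indicator (cell c \<delta> i) x * wl i x \<partial>\<mu>0) * ?l (lo i) + (\<integral>x. indicator (cell c \<delta> i) x * wr i x \<partial>\<mu>0) * ?l (hi i))"
      using li[of "cell c \<delta> i"] weight_integrable[of i] by simp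
    finally show ?thesis unfolding node_weight_eq .
  qed
  have "f0 y = (\<integral>x. indicator (- {- T..<T}) x * ?l x + (\<Sum>i<N. indicator (cell c \<delta> i) x * ?l x) \<partial>\<mu>0)"
    unfolding obs_density_def
  proof (rule Bochner_Integration.integral_cong)
    fix x
    have "(\<Sum>i<N. indicator (cell c \<delta> i) x :: real) = indicator {- T..<T} x"
      unfolding inside[symmetric] by (rule indicator_UN_disjoint[symmetric]) (auto intro: disjoint_cells \<delta>)
    then have "(\<Sum>i<N. indicator (cell c \<delta> i) x * ?l x) = indicator {- T..<T} x * ?l x" by (simp flip: sum_distrib_right)
    then show "?l x = indicator (- {- T..<T}) x * ?l x + (\<Sum>i<N. indicator (cell c \<delta> i) x * ?l x)"
      by (auto split: split_indicator)
  qed simp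
  also have "\<dots> = (\<integral>x. indicator (- {- T..<T}) x * ?l x \<partial>\<mu>0) + (\<Sum>i<N. \<integral>x. indicator (cell c \<delta> i) x * ?l x \<partial>\<mu>0)"
    by (subst Bochner_Integration.integral_add, intro li, simp, intro Bochner_Integration.integrable_sum li cell_sets,
        subst Bochner_Integration.integral_sum, intro li cell_sets, rule refl)
  finally have f0_eq: "f0 y = \<dots>" .
  have w_eq: "(\<Sum>k<2 * N. node_weight c \<delta> k * ?l (anchor c \<delta> k))
    = (\<Sum>i<N. node_weight c \<delta> (2 * i) * ?l (lo i) + node_weight c \<delta> (2 * i + 1) * ?l (hi i))"
    unfolding sum_lessThan_double by (simp add: anchor_def lo_def hi_def)
  have diff: "f0 y - (\<Sum>k<2 * N. node_weight c \<delta> k * ?l (anchor c \<delta> k))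
    = (\<integral>x. indicator (- {- T..<T}) x * ?l x \<partial>\<mu>0) + (\<Sum>i<N. \<integral>x. d i x \<partial>\<mu>0)"
    unfolding f0_eq w_eq d_eq by (simp add: sum_subtractf)
  have out: "\<bar>\<integral>x. indicator (- {- T..<T}) x * ?l x \<partial>\<mu>0\<bar> \<le> C1 * \<delta>\<^sup>2 * exp (- \<bar>y\<bar>)"
  proof -
    have "(\<integral>x. indicator (- {- T..<T}) x * ?l x \<partial>\<mu>0) \<le> C1 * exp (- C0 * T) * exp (- \<bar>y\<bar>)"
      by (rule laplace_tail_le[OF T(1)]) auto
    also have "\<dots> \<le> C1 * \<delta>\<^sup>2 * exp (- \<bar>y\<bar>)"
      using tail C1_pos by (intro mult_right_mono mult_left_mono) auto
    finally show ?thesis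
      by (subst abs_of_nonneg) (auto intro!: integral_nonneg_AE AE_I2 simp: laplace_density_pos less_imp_le)
  qed
  \<comment> \<open>One factor \<open>\<delta>\<close> is the interpolation error, the other the
    length of the cell; the 3 bounds \<open>exp \<delta>\<close>.\<close>
  define K where "K = \<delta>\<^sup>2 * (3 * C) * exp (- \<bar>y\<bar>)"
  have di: "\<bar>\<integral>x. d i x \<partial>\<mu>0\<bar> \<le> indicator (cell c \<delta> i) y * K" for i
  proof -
    have pt: "\<bar>d i x\<bar> \<le> (\<delta> * indicator (cell c \<delta> i) y) * indicator (cell c \<delta> i) x" if "x \<noteq> lo i \<or> True" "y \<noteq> lo i \<or> y \<in> cell c \<delta> i" for x
    proof (cases "x \<in> cell c \<delta> i")
      case True
      show ?thesis
      proof (cases "y \<in> cell c \<delta> i")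
        case False
        then show ?thesis using laplace_interpolation_outside[OF lo_hi(1), of x i y] True
          by (auto simp: d_def lo_hi)
      next
        case y: True
        then show ?thesis using laplace_interpolation_inside[OF lo_hi(1), of x i y] True \<delta>
          by (auto simp: d_def lo_hi)
      qed
    qed (simp add: d_def)
    have dint: "integrable \<mu>0 (d i)"
    proof -
      have "d i = (\<lambda>x. indicator (cell c \<delta> i) x * ?l x -
        (indicator (cell c \<delta> i) x * wl i x * ?l (lo i) + indicator (cell c \<delta> i) x * wr i x * ?l (hi i)))"
        unfolding d_def by (auto simp: algebra_simps)
      then show ?thesis using li[of "cell c \<delta> i"] weight_integrable[of i] by simp
    qed
    have "\<bar>\<integral>x. d i x \<partial>\<mu>0\<bar> \<le> (\<integral>x. \<bar>d i x\<bar> \<partial>\<mu>0)" by (rule integral_abs_bound)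
    also have "\<dots> \<le> (\<integral>x. (\<delta> * indicator (cell c \<delta> i) y) * indicator (cell c \<delta> i) x \<partial>\<mu>0)"
    proof (intro integral_mono integrable_abs dint integrable_mult_right cell_indicator_integrable)
      show "\<bar>d i x\<bar> \<le> (\<delta> * indicator (cell c \<delta> i) y) * indicator (cell c \<delta> i) x" for x
        using lo_hi by (intro pt) auto
    qed
    also have "\<dots> = indicator (cell c \<delta> i) y * (\<delta> * measure \<mu>0 (cell c \<delta> i))" by simp
    also have "\<dots> \<le> indicator (cell c \<delta> i) y * K"
    proof (cases "y \<in> cell c \<delta> i")
      case True
      have "measure \<mu>0 (cell c \<delta> i) \<le> measure \<mu>0 {lo i..hi i}"
        unfolding lo_hi by (intro M0.finite_measure_mono) auto
      also have "\<dots> \<le> \<delta> * (C * exp \<delta>) * exp (- \<bar>y\<bar>)"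
        using measure_interval_le[of "lo i" y "hi i"] True lo_hi(1)[of i] by (auto simp: lo_hi)
      also have "\<dots> \<le> \<delta> * (C * 3) * exp (- \<bar>y\<bar>)"
        using \<delta> C_pos exp_le order_trans[of "exp \<delta>" "exp 1" 3] by (intro mult_right_mono mult_left_mono) auto
      finally have "\<delta> * measure \<mu>0 (cell c \<delta> i) \<le> \<delta> * (\<delta> * (C * 3) * exp (- \<bar>y\<bar>))" using \<delta> by (intro mult_left_mono) auto
      then show ?thesis using True by (simp add: K_def power2_eq_square mult_ac)
    qed simp
    finally show ?thesis .
  qed
  have "\<bar>\<Sum>i<N. \<integral>x. d i x \<partial>\<mu>0\<bar> \<le> (\<Sum>i<N. indicator (cell c \<delta> i) y * K)"
    by (intro order_trans[OF sum_abs] sum_mono di)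
  also have "\<dots> = indicator (\<Union>i<N. cell c \<delta> i) y * K"
    by (subst indicator_UN_disjoint) (auto intro: disjoint_cells \<delta> simp: sum_distrib_right)
  also have "\<dots> \<le> K" using C_pos by (auto simp: K_def split: split_indicator)
  finally show ?thesis unfolding diff using out by (simp add: K_def algebra_simps)
qed

text \<open>Besides the discretisation error, mass inside a spot sits up to
  \<open>\<delta>\<^sup>2 / 2\<close> away from its anchor, and the spot masses deviate from the
  node weights. The latter deviation has an absolute part of order \<open>\<eta>\<close>, while the
  kernel at an anchor can exceed \<open>exp (- \<bar>y\<bar>)\<close> by a factor of order
  \<open>exp T\<close>; this is why \<open>\<eta> * exp T\<close> has to be small.\<close>

lemma spots_approximation:
  fixes H :: "real measure" and \<eta> :: real
  assumes H: "prob_space H" "sets H = sets borel"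
    and \<eta>: "0 < \<eta>" "real (Suc (2 * N)) * \<eta> * exp T \<le> \<delta>\<^sup>2"
    and s: "s = (\<Sum>k<2 * N. node_weight c \<delta> k)" "1 / 2 \<le> s"
    and box: "\<And>k. k < 2 * N \<Longrightarrow> node_weight c \<delta> k / (s + real (Suc (2 * N)) * \<eta>) \<le> measure H (spot c \<delta> (\<delta>\<^sup>2 / 2) k)
       \<and> measure H (spot c \<delta> (\<delta>\<^sup>2 / 2) k) \<le> (node_weight c \<delta> k + \<eta>) / s"
  defines "U \<equiv> \<Union>k<2 * N. spot c \<delta> (\<delta>\<^sup>2 / 2) k"
  shows "\<bar>(\<integral>z. indicator U z * laplace_density (y - z) \<partial>H) - f0 y\<bar> \<le> C3 * \<delta>\<^sup>2 * exp (- \<bar>y\<bar>)"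
proof -
  interpret H: prob_space H by (rule H(1))
  define \<rho> where "\<rho> = \<delta>\<^sup>2 / 2"
  define w where "w k = node_weight c \<delta> k" for k
  define p where "p k = measure H (spot c \<delta> \<rho> k)" for k
  define l where "l k = laplace_density (y - anchor c \<delta> k)" for k
  define E where "E = exp (- \<bar>y\<bar>)"
  have E: "0 < E" by (simp add: E_def)
  have \<delta>2: "0 < \<delta>\<^sup>2" "\<delta>\<^sup>2 \<le> \<delta>" "\<delta>\<^sup>2 \<le> 1" using \<delta> by (auto simp: power2_eq_square mult_le_one mult_left_le)
  have \<rho>: "0 < \<rho>" "2 * \<rho> \<le> \<delta>" "\<rho> \<le> 1" using \<delta>2 by (auto simp: \<rho>_def)
  have w0: "0 \<le> w k" for k by (simp add: w_def node_weight_nonneg)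
  have l0: "0 \<le> l k" for k by (simp add: l_def laplace_density_pos less_imp_le)
  have s1: "s \<le> 1" "1 - (2 * C1 + 1) * \<delta>\<^sup>2 \<le> s" using node_weight_sum s(1) by auto
  define M where "M = real (Suc (2 * N)) * \<eta>"
  have M: "0 < M" "M \<le> \<delta>\<^sup>2"
  proof -
    show "0 < M" using \<eta> by (simp add: M_def)
    have "M * 1 \<le> M * exp T" using T \<open>0 < M\<close> by (intro mult_left_mono) auto
    then show "M \<le> \<delta>\<^sup>2" using \<eta>(2) unfolding M_def by linarith
  qed
  have \<eta>1: "\<eta> \<le> 1" 
  proof -
    have "1 * \<eta> \<le> M" unfolding M_def using \<eta> by (intro mult_right_mono) auto
    then show ?thesis using M \<delta>2 by simp
  qed
  have sp [measurable]: "spot c \<delta> \<rho> k \<in> sets H" for k using H(2) by simp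
  have li: "integrable H (\<lambda>z. laplace_density (y - z))" by (rule laplace_integrable[OF H.finite_measure_axioms H(2)])
  have lik: "integrable H (\<lambda>z. indicator (spot c \<delta> \<rho> k) z * laplace_density (y - z))" for k
    using integrable_real_mult_indicator[OF sp li] by (simp add: mult.commute)
  have "(\<integral>z. indicator U z * laplace_density (y - z) \<partial>H) = (\<integral>z. (\<Sum>k<2 * N. indicator (spot c \<delta> \<rho> k) z * laplace_density (y - z)) \<partial>H)"
  proof (rule Bochner_Integration.integral_cong)
    fix z
    have "indicator U z = (\<Sum>k<2 * N. indicator (spot c \<delta> \<rho> k) z :: real)"
      unfolding U_def \<rho>_def[symmetric] by (rule indicator_UN_disjoint) (auto intro: disjoint_spots \<rho>)
    then show "indicator U z * laplace_density (y - z) = (\<Sum>k<2 * N. indicator (spot c \<delta> \<rho> k) z * laplace_density (y - z))"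
      by (simp add: sum_distrib_right)
  qed simp
  also have "\<dots> = (\<Sum>k<2 * N. \<integral>z. indicator (spot c \<delta> \<rho> k) z * laplace_density (y - z) \<partial>H)"
    by (rule Bochner_Integration.integral_sum) (rule lik)
  finally have f1: "(\<integral>z. indicator U z * laplace_density (y - z) \<partial>H) = \<dots>" .
  have each: "\<bar>(\<integral>z. indicator (spot c \<delta> \<rho> k) z * laplace_density (y - z) \<partial>H) - w k * l k\<bar>
    \<le> (3 + 2 * (2 * C1 + 1)) * \<delta>\<^sup>2 * (w k * l k) + 4 * \<eta> * l k" if k: "k < 2 * N" for k
  proof -
    have ind: "integrable H (\<lambda>z. indicator (spot c \<delta> \<rho> k) z :: real)"
      by (intro H.integrable_const_bound[where B=1] AE_I2) (auto split: split_indicator)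
    have eq: "(\<integral>z. indicator (spot c \<delta> \<rho> k) z * laplace_density (y - z) \<partial>H) - p k * l k
       = (\<integral>z. indicator (spot c \<delta> \<rho> k) z * laplace_density (y - z) - l k * indicator (spot c \<delta> \<rho> k) z \<partial>H)"
      using lik[of k] ind sets.sets_into_space[OF sp, of k] by (simp add: p_def Int_absorb2 mult.commute)
    have "\<bar>\<integral>z. indicator (spot c \<delta> \<rho> k) z * laplace_density (y - z) - l k * indicator (spot c \<delta> \<rho> k) z \<partial>H\<bar>
      \<le> (\<integral>z. \<bar>indicator (spot c \<delta> \<rho> k) z * laplace_density (y - z) - l k * indicator (spot c \<delta> \<rho> k) z\<bar> \<partial>H)"
      by (rule integral_abs_bound)
    also have "\<dots> \<le> (\<integral>z. (2 * \<rho> * l k) * indicator (spot c \<delta> \<rho> k) z \<partial>H)"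
    proof (intro integral_mono integrable_abs Bochner_Integration.integrable_diff lik integrable_mult_right ind)
      show "\<bar>indicator (spot c \<delta> \<rho> k) z * laplace_density (y - z) - l k * indicator (spot c \<delta> \<rho> k) z\<bar>
        \<le> 2 * \<rho> * l k * indicator (spot c \<delta> \<rho> k) z" for z
        using laplace_near[OF spot_near \<rho>(3), of z c \<delta> k y] by (auto simp: l_def split: split_indicator)
    qed
    also have "\<dots> = 2 * \<rho> * l k * p k" using sets.sets_into_space[OF sp, of k] by (simp add: p_def Int_absorb2)
    finally have 1: "\<bar>(\<integral>z. indicator (spot c \<delta> \<rho> k) z * laplace_density (y - z) \<partial>H) - p k * l k\<bar> \<le> 2 * \<rho> * l k * p k"
      unfolding eq .
    have b: "w k / (s + M) \<le> p k" "p k \<le> (w k + \<eta>) / s"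
      using box[OF k] by (auto simp: w_def p_def M_def \<rho>_def)
    have "w k - p k \<le> M * w k"
    proof -
      have "w k * (1 - M) * (s + M) \<le> w k * 1"
        unfolding mult.assoc
      proof (intro mult_left_mono w0)
        have "(1 - M) * (s + M) \<le> (1 - M) * (1 + M)" using s1 M \<delta>2 by (intro mult_left_mono) auto
        also have "\<dots> \<le> 1" by (simp add: algebra_simps)
        finally show "(1 - M) * (s + M) \<le> 1" .
      qed
      then have "w k * (1 - M) \<le> w k / (s + M)" using s M by (simp add: pos_le_divide_eq)
      then show ?thesis using b(1) by (simp add: algebra_simps)
    qed
    moreover have up: "p k - w k \<le> 2 * (1 - s) * w k + 2 * \<eta>"
    proof -
      \<comment> \<open>This linear bound on the reciprocal holds on \<open>[1 / 2, 1]\<close>: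
        after multiplication by \<open>s\<close> the difference of the sides is
        \<open>(2 * s - 1) * (1 - s)\<close>.\<close>
      have "1 / s \<le> 1 + 2 * (1 - s)"
      proof -
        have "0 \<le> (2 * s - 1) * (1 - s)" using s s1 by (intro mult_nonneg_nonneg) auto
        then show ?thesis using s by (simp add: field_simps)
      qed
      then have "w k * (1 / s) \<le> w k * (1 + 2 * (1 - s))" using w0 by (intro mult_left_mono) auto
      moreover have "\<eta> / s \<le> 2 * \<eta>" using s \<eta> by (simp add: field_simps)
      ultimately show ?thesis using b(2) by (simp add: add_divide_distrib algebra_simps)
    qed
    moreover have "(1 - s) * w k \<le> (2 * C1 + 1) * \<delta>\<^sup>2 * w k" using s1 w0 by (intro mult_right_mono) auto
    moreover have "M * w k \<le> \<delta>\<^sup>2 * w k" using M w0 by (intro mult_right_mono) auto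
    moreover have "0 \<le> (1 - s) * w k" "0 \<le> M * w k" "0 \<le> \<delta>\<^sup>2 * w k" using s1 w0 M by auto
    ultimately have 2: "\<bar>p k - w k\<bar> \<le> (1 + 2 * (2 * C1 + 1)) * \<delta>\<^sup>2 * w k + 2 * \<eta>"
      using \<eta> by (simp add: abs_le_iff algebra_simps)
    have 3: "2 * \<rho> * p k \<le> 2 * \<delta>\<^sup>2 * w k + 2 * \<eta>"
    proof -
      have "(w k + \<eta>) / s \<le> (w k + \<eta>) / (1 / 2)"
        using s w0[of k] \<eta> by (intro divide_left_mono) auto
      then have "p k \<le> 2 * (w k + \<eta>)" using b(2) by simp
      then have "\<delta>\<^sup>2 * p k \<le> \<delta>\<^sup>2 * (2 * (w k + \<eta>))" using \<delta>2 by (intro mult_left_mono) auto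
      moreover have "\<delta>\<^sup>2 * \<eta> \<le> \<eta>" using \<delta>2 \<eta> by (simp add: mult_left_le_one_le)
      ultimately show ?thesis by (simp add: \<rho>_def algebra_simps)
    qed
    have "\<bar>p k * l k - w k * l k\<bar> \<le> ((1 + 2 * (2 * C1 + 1)) * \<delta>\<^sup>2 * w k + 2 * \<eta>) * l k"
      using mult_right_mono[OF 2 l0, of k] l0[of k] by (simp add: abs_mult flip: left_diff_distrib)
    moreover have "2 * \<rho> * l k * p k \<le> (2 * \<delta>\<^sup>2 * w k + 2 * \<eta>) * l k"
      using mult_right_mono[OF 3 l0, of k] by (simp add: mult_ac)
    ultimately have "\<bar>(\<integral>z. indicator (spot c \<delta> \<rho> k) z * laplace_density (y - z) \<partial>H) - w k * l k\<bar>
      \<le> ((1 + 2 * (2 * C1 + 1)) * \<delta>\<^sup>2 * w k + 2 * \<eta>) * l k + (2 * \<delta>\<^sup>2 * w k + 2 * \<eta>) * l k"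
      using 1 by linarith
    also have "\<dots> = (3 + 2 * (2 * C1 + 1)) * \<delta>\<^sup>2 * (w k * l k) + 4 * \<eta> * l k" by (simp add: algebra_simps)
    finally show ?thesis .
  qed
  define S where "S = (\<Sum>k<2 * N. w k * l k)"
  have S: "\<bar>f0 y - S\<bar> \<le> (C1 + 3 * C) * \<delta>\<^sup>2 * E" unfolding S_def w_def l_def E_def by (rule node_approximation)
  have S_le: "S \<le> (2 * C1 + 3 * C) * E"
  proof -
    have "(C1 + 3 * C) * \<delta>\<^sup>2 * E \<le> (C1 + 3 * C) * 1 * E"
      using \<delta>2 C1_pos C_pos E by (intro mult_right_mono mult_left_mono) auto
    moreover have "f0 y \<le> C1 * E" unfolding E_def by (rule f0_le)
    ultimately show ?thesis using S by (simp add: abs_le_iff algebra_simps)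
  qed
  \<comment> \<open>All anchors lie in \<open>[- T, T]\<close>, so each kernel is at most
    \<open>exp T * E\<close>, and the smallness condition on \<open>\<eta>\<close> absorbs the
    number of spots and the factor \<open>exp T\<close> together.\<close>
  have l_sum: "4 * \<eta> * (\<Sum>k<2 * N. l k) \<le> 4 * \<delta>\<^sup>2 * E"
  proof -
    have "l k \<le> exp T * E" if "k < 2 * N" for k
    proof -
      have "\<bar>anchor c \<delta> k\<bar> \<le> T" using anchor_bounds[OF \<delta>(1) that, of c] T c by auto
      then have "exp \<bar>anchor c \<delta> k\<bar> * E \<le> exp T * E" using E by (intro mult_right_mono) auto
      moreover have "l k \<le> exp \<bar>anchor c \<delta> k\<bar> * E / 2" unfolding l_def E_def by (rule laplace_density_split)
      moreover have "0 \<le> exp \<bar>anchor c \<delta> k\<bar> * E" using E by simp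
      ultimately show ?thesis by linarith
    qed
    then have "(\<Sum>k<2 * N. l k) \<le> (\<Sum>k<2 * N. exp T * E)" by (intro sum_mono) auto
    also have "\<dots> = real (2 * N) * (exp T * E)" by simp
    also have "\<dots> \<le> real (Suc (2 * N)) * (exp T * E)" using E by (intro mult_right_mono) auto
    finally have "\<eta> * (\<Sum>k<2 * N. l k) \<le> \<eta> * (real (Suc (2 * N)) * (exp T * E))" using \<eta> by (intro mult_left_mono) auto
    also have "\<dots> = real (Suc (2 * N)) * \<eta> * exp T * E" by (simp add: mult_ac)
    also have "\<dots> \<le> \<delta>\<^sup>2 * E" using \<eta> E by (intro mult_right_mono) auto
    finally show ?thesis by simp
  qed
  have "\<bar>(\<Sum>k<2 * N. \<integral>z. indicator (spot c \<delta> \<rho> k) z * laplace_density (y - z) \<partial>H) - S\<bar>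
    \<le> (\<Sum>k<2 * N. (3 + 2 * (2 * C1 + 1)) * \<delta>\<^sup>2 * (w k * l k) + 4 * \<eta> * l k)"
    unfolding S_def sum_subtractf[symmetric] using each by (intro order_trans[OF sum_abs] sum_mono) auto
  also have "\<dots> = (3 + 2 * (2 * C1 + 1)) * \<delta>\<^sup>2 * S + 4 * \<eta> * (\<Sum>k<2 * N. l k)"
    by (simp add: sum.distrib S_def sum_distrib_left)
  also have "\<dots> \<le> (3 + 2 * (2 * C1 + 1)) * \<delta>\<^sup>2 * ((2 * C1 + 3 * C) * E) + 4 * \<delta>\<^sup>2 * E"
    using S_le C1_pos l_sum by (intro add_mono mult_left_mono) auto
  finally have "\<bar>(\<integral>z. indicator U z * laplace_density (y - z) \<partial>H) - f0 y\<bar>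
    \<le> (C1 + 3 * C) * \<delta>\<^sup>2 * E + ((3 + 2 * (2 * C1 + 1)) * \<delta>\<^sup>2 * ((2 * C1 + 3 * C) * E) + 4 * \<delta>\<^sup>2 * E)"
    unfolding f1 using S by linarith
  also have "\<dots> = C3 * \<delta>\<^sup>2 * E" by (simp add: C3_def algebra_simps)
  finally show ?thesis by (simp add: E_def)
qed

text \<open>The lower ends of the box add up to \<open>s / (s + M)\<close>, where \<open>M\<close>
  is the total slack.\<close>

lemma spots_mass:
  fixes H :: "real measure" and \<eta> :: real
  assumes H: "prob_space H" "sets H = sets borel" and \<eta>: "0 < \<eta>"
    and s: "s = (\<Sum>k<2 * N. node_weight c \<delta> k)" "1 / 2 \<le> s"
    and box: "\<And>k. k < 2 * N \<Longrightarrow> node_weight c \<delta> k / (s + real (Suc (2 * N)) * \<eta>) \<le> measure H (spot c \<delta> (\<delta>\<^sup>2 / 2) k)"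
  shows "1 - 2 * (real (Suc (2 * N)) * \<eta>) \<le> measure H (\<Union>k<2 * N. spot c \<delta> (\<delta>\<^sup>2 / 2) k)"
proof -
  interpret H: prob_space H by (rule H(1))
  define M where "M = real (Suc (2 * N)) * \<eta>"
  have M: "0 < M" using \<eta> by (simp add: M_def)
  have \<delta>2: "0 < \<delta>\<^sup>2 / 2" "2 * (\<delta>\<^sup>2 / 2) \<le> \<delta>" using \<delta> by (auto simp: power2_eq_square mult_left_le)
  have "1 - 2 * M \<le> s / (s + M)"
  proof -
    have "M * 1 \<le> M * (2 * s)" using s M by (intro mult_left_mono) auto
    moreover have "(1 - 2 * M) * (s + M) = s + M * 1 - M * (2 * s) - 2 * (M * M)" by (simp add: algebra_simps)
    moreover have "0 \<le> M * M" by simp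
    ultimately have "(1 - 2 * M) * (s + M) \<le> s" by linarith
    then show ?thesis using s M by (simp add: pos_le_divide_eq)
  qed
  also have "\<dots> = (\<Sum>k<2 * N. node_weight c \<delta> k / (s + M))" by (simp add: s(1) sum_divide_distrib)
  also have "\<dots> \<le> (\<Sum>k<2 * N. measure H (spot c \<delta> (\<delta>\<^sup>2 / 2) k))"
    using box by (intro sum_mono) (auto simp: M_def)
  also have "\<dots> = measure H (\<Union>k<2 * N. spot c \<delta> (\<delta>\<^sup>2 / 2) k)"
    by (rule H.finite_measure_finite_Union[symmetric])
       (simp_all add: H(2) image_subset_iff spot_sets disjoint_spots[OF \<delta>2])
  finally show ?thesis by (simp add: M_def)
qed

end

end

section \<open>Normal mixtures\<close>

text \<open>Normal smoothing commutes with the noise. \<open>H\<close> may have any finite mass,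
  since the formula is also applied to the restriction of a mixing measure to the spots.\<close>

lemma obs_density_convolution:
  assumes H: "finite_measure H" "sets H = sets borel" and \<sigma>: "0 < \<sigma>"
  shows "integrable (gauss \<sigma>) (\<lambda>x. obs_density H (y - x))"
    and "obs_density (gauss \<sigma> \<star> H) y = (\<integral>x. obs_density H (y - x) \<partial>gauss \<sigma>)"
proof -
  interpret H: finite_measure H by (rule H(1))
  interpret G: prob_space "gauss \<sigma>" by (rule prob_space_gauss[OF \<sigma>])
  note [measurable] = obs_density_measurable[OF H]
  have sp: "space H = UNIV" using sets_eq_imp_space_eq[OF H(2)] by simp
  have bd: "\<bar>obs_density H z\<bar> \<le> measure H UNIV" for z
  proof -
    have "\<bar>obs_density H z\<bar> = obs_density H z" using obs_density_nonneg[OF H, of z] by simp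
    also have "\<dots> \<le> (\<integral>x. 1 \<partial>H)"
      unfolding obs_density_def using laplace_density_le[THEN order_trans, of 1]
      by (intro integral_mono laplace_integrable H) auto
    finally show ?thesis using sp by simp
  qed
  show int: "integrable (gauss \<sigma>) (\<lambda>x. obs_density H (y - x))"
    using bd by (intro G.integrable_const_bound[where B="measure H UNIV"] AE_I2) auto
  have fin: "finite_measure (gauss \<sigma> \<star> H)" by (rule convolution_finite[OF G.finite_measure_axioms H(1) H(2)]) simp
  have "ennreal (obs_density (gauss \<sigma> \<star> H) y) = (\<integral>\<^sup>+x. ennreal (laplace_density (y - x)) \<partial>(gauss \<sigma> \<star> H))"
    by (rule ennreal_obs_density[OF fin]) simp
  also have "\<dots> = (\<integral>\<^sup>+x. (\<integral>\<^sup>+z. ennreal (laplace_density (y - (x + z))) \<partial>H) \<partial>gauss \<sigma>)"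
    by (rule nn_integral_convolution[OF G.finite_measure_axioms H(1) H(2)]) auto
  also have "\<dots> = (\<integral>\<^sup>+x. ennreal (obs_density H (y - x)) \<partial>gauss \<sigma>)"
    by (intro nn_integral_cong) (simp add: ennreal_obs_density[OF H] diff_diff_add)
  also have "\<dots> = ennreal (\<integral>x. obs_density H (y - x) \<partial>gauss \<sigma>)"
    by (intro nn_integral_eq_integral int AE_I2 obs_density_nonneg[OF H])
  finally show "obs_density (gauss \<sigma> \<star> H) y = (\<integral>x. obs_density H (y - x) \<partial>gauss \<sigma>)"
    using obs_density_nonneg[OF fin, of y] obs_density_nonneg[OF H]
    by (subst (asm) ennreal_inj) (auto intro!: integral_nonneg_AE)
qed

lemma emeasure_convolution_UNIV:
  assumes H: "finite_measure H" "sets H = sets borel" and \<sigma>: "0 < \<sigma>"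
  shows "emeasure (gauss \<sigma> \<star> H) UNIV = emeasure H UNIV"
proof -
  interpret H: finite_measure H by (rule H(1))
  interpret G: prob_space "gauss \<sigma>" by (rule prob_space_gauss[OF \<sigma>])
  have sp: "space H = UNIV" using sets_eq_imp_space_eq[OF H(2)] by simp
  have "emeasure (gauss \<sigma> \<star> H) UNIV = (\<integral>\<^sup>+x. 1 \<partial>(gauss \<sigma> \<star> H))" by simp
  also have "\<dots> = (\<integral>\<^sup>+x. (\<integral>\<^sup>+z. 1 \<partial>H) \<partial>gauss \<sigma>)"
    by (rule nn_integral_convolution[OF G.finite_measure_axioms H(1) H(2)]) auto
  also have "\<dots> = emeasure H UNIV" using G.emeasure_space_1 sp by simp
  finally show ?thesis .
qed

lemma prob_space_convolution:
  assumes H: "prob_space H" "sets H = sets borel" and \<sigma>: "0 < \<sigma>"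
  shows "prob_space (gauss \<sigma> \<star> H)"
  using emeasure_convolution_UNIV[OF prob_space.finite_measure[OF H(1)] H(2) \<sigma>]
    prob_space.emeasure_space_1[OF H(1)] sets_eq_imp_space_eq[OF H(2)]
  by (intro prob_spaceI) simp

context light_tailed_density
begin

text \<open>Only the part \<open>g\<close> of the density that comes from \<open>U\<close> is compared with \<open>f0\<close>; the remaining
  mass of \<open>H\<close> may lie anywhere and can only decrease \<open>f0\<^sup>2 / f\<close>. The bound is the integral of
  \<open>f0\<^sup>2 / g = (f0 - g)\<^sup>2 / g + 2 f0 - g\<close>.\<close>

lemma chi_square_bound:
  assumes H: "prob_space H" "sets H = sets borel" and U: "U \<in> sets borel"
    and \<delta>: "0 < \<delta>" "2 * \<delta> \<le> 1" and \<sigma>: "\<delta> \<le> \<sigma>" "\<sigma> \<le> 2 * \<delta>"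
    and K: "0 < K" "\<And>y. \<bar>(\<integral>z. indicator U z * laplace_density (y - z) \<partial>H) - f0 y\<bar> \<le> K * \<delta>\<^sup>2 * exp (- \<bar>y\<bar>)"
    and mass: "1 - m \<le> measure H U"
    and K': "K' = 4 * K + 8 * exp 2 * C2" "K' * \<delta>\<^sup>2 \<le> f0 0 / 2"
  shows "(\<integral>\<^sup>+y. ennreal ((f0 y)\<^sup>2 / obs_density (gauss \<sigma> \<star> H) y) \<partial>lborel) \<le> ennreal (1 + (4 * K'\<^sup>2 / f0 0 * \<delta> ^ 4 + m))"
proof -
  interpret H: prob_space H by (rule H(1))
  have \<sigma>0: "0 < \<sigma>" "\<sigma> \<le> 1" using \<delta> \<sigma> by auto
  interpret G: prob_space "gauss \<sigma>" by (rule prob_space_gauss[OF \<sigma>0(1)])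
  define k where "k = f0 0"
  have k: "0 < k" by (simp add: k_def f0_pos)
  have [measurable]: "U \<in> sets H" using U H(2) by simp
  define H1 where "H1 = density H (indicator U)"
  have H1: "finite_measure H1" "sets H1 = sets borel" "emeasure H1 UNIV = emeasure H U"
  proof -
    have sp: "space H = UNIV" using sets_eq_imp_space_eq[OF H(2)] by simp
    show e: "emeasure H1 UNIV = emeasure H U"
      unfolding H1_def using sp sets.top[of H] by (subst emeasure_density) (auto simp flip: times_divide_eq_right)
    show "finite_measure H1" using e sp by (intro finite_measureI) (simp add: H1_def)
    show "sets H1 = sets borel" using H(2) by (simp add: H1_def)
  qed
  note F1 = H1(1,2) and FH = H.finite_measure_axioms H(2)
  note [measurable] = obs_density_measurable[OF F1] obs_density_measurable[OF FH]
  have h1: "obs_density H1 y = (\<integral>z. indicator U z * laplace_density (y - z) \<partial>H)" for y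
  proof -
    have [measurable]: "(\<lambda>z. laplace_density (y - z)) \<in> borel_measurable H"
      using H(2) by (simp cong: measurable_cong_sets)
    have H1_eq: "H1 = density H (\<lambda>z. ennreal (indicator U z))" unfolding H1_def by (simp add: ennreal_indicator)
    show ?thesis unfolding obs_density_def H1_eq by (subst integral_density) auto
  qed
  have h1_le: "obs_density H1 y \<le> obs_density H y" for y
    unfolding h1 unfolding obs_density_def
  proof (rule integral_mono)
    show "integrable H (\<lambda>z. indicator U z * laplace_density (y - z))"
      using integrable_real_mult_indicator[OF _ laplace_integrable[OF FH], of U y] by (simp add: mult.commute)
    show "integrable H (\<lambda>z. laplace_density (y - z))" by (rule laplace_integrable[OF FH])
  qed (auto split: split_indicator simp: laplace_density_pos less_imp_le)
  define g where "g y = obs_density (gauss \<sigma> \<star> H1) y" for y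
  define f where "f y = obs_density (gauss \<sigma> \<star> H) y" for y
  have Fc: "finite_measure (gauss \<sigma> \<star> H1)" "sets (gauss \<sigma> \<star> H1) = sets borel"
    using convolution_finite[OF G.finite_measure_axioms H1(1) H1(2)] by auto
  have [measurable]: "g \<in> borel_measurable borel" unfolding g_def by (rule obs_density_measurable[OF Fc])
  have Fcf: "finite_measure (gauss \<sigma> \<star> H)" "sets (gauss \<sigma> \<star> H) = sets borel"
    using convolution_finite[OF G.finite_measure_axioms FH] by auto
  have [measurable]: "f \<in> borel_measurable borel" unfolding f_def by (rule obs_density_measurable[OF Fcf])
  note cg = obs_density_convolution[OF F1 \<sigma>0(1)] and cf = obs_density_convolution[OF FH \<sigma>0(1)]
  have gf: "g y \<le> f y" for y
    unfolding g_def f_def cg(2) cf(2) by (intro integral_mono cg cf h1_le)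
  define E where "E y = exp (- \<bar>y\<bar>)" for y :: real
  have E: "0 < E y" for y by (simp add: E_def)
  have [measurable]: "E \<in> borel_measurable borel" unfolding E_def by measurable
  have close: "\<bar>g y - f0 y\<bar> \<le> K' * \<delta>\<^sup>2 * E y" for y
  proof -
    have i0: "integrable (gauss \<sigma>) (\<lambda>x. f0 (y - x))" using gauss_f0_integrable[OF \<sigma>0(1), of y "-1"] by simp
    have eq: "g y - (\<integral>x. f0 (y - x) \<partial>gauss \<sigma>) = (\<integral>x. obs_density H1 (y - x) - f0 (y - x) \<partial>gauss \<sigma>)"
      unfolding g_def cg(2) using cg(1) i0 by simp
    have "\<bar>\<integral>x. obs_density H1 (y - x) - f0 (y - x) \<partial>gauss \<sigma>\<bar> \<le> (\<integral>x. \<bar>obs_density H1 (y - x) - f0 (y - x)\<bar> \<partial>gauss \<sigma>)"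
      by (rule integral_abs_bound)
    also have "\<dots> \<le> (\<integral>x. K * \<delta>\<^sup>2 * E y * exp (1 * \<bar>x\<bar>) \<partial>gauss \<sigma>)"
    proof (intro integral_mono integrable_abs Bochner_Integration.integrable_diff cg(1) i0 integrable_mult_right gauss_exp_abs_integral(1) \<sigma>0)
      fix x
      have "exp (- \<bar>y - x\<bar>) \<le> exp (- \<bar>y\<bar>) * exp (1 * \<bar>x\<bar>)"
        unfolding mult_exp_exp by (subst exp_le_cancel_iff) linarith
      then have "K * \<delta>\<^sup>2 * exp (- \<bar>y - x\<bar>) \<le> K * \<delta>\<^sup>2 * (exp (- \<bar>y\<bar>) * exp (1 * \<bar>x\<bar>))"
        using K(1) by (intro mult_left_mono) auto
      then show "\<bar>obs_density H1 (y - x) - f0 (y - x)\<bar> \<le> K * \<delta>\<^sup>2 * E y * exp (1 * \<bar>x\<bar>)"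
        using K(2)[of "y - x"] unfolding h1 E_def by (simp add: mult.assoc)
    qed
    also have "\<dots> = K * \<delta>\<^sup>2 * E y * (\<integral>x. exp (1 * \<bar>x\<bar>) \<partial>gauss \<sigma>)" by simp
    also have "\<dots> \<le> K * \<delta>\<^sup>2 * E y * 4"
    proof (intro mult_left_mono)
      have "exp (1\<^sup>2 * \<sigma>\<^sup>2 / 2) \<le> exp (1 / 2 :: real)" using \<sigma>0 power_le_one[of \<sigma> 2] by simp
      also have "\<dots> \<le> 1 + 1 / 2 + (1 / 2)\<^sup>2" by (rule exp_le_quadratic) simp
      also have "\<dots> \<le> 2" by (simp add: power2_eq_square)
      finally show "(\<integral>x. exp (1 * \<bar>x\<bar>) \<partial>gauss \<sigma>) \<le> 4" using gauss_exp_abs_integral(2)[OF \<sigma>0(1), of 1] by simp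
    qed (use K(1) E[of y] in simp)
    finally have 1: "\<bar>g y - (\<integral>x. f0 (y - x) \<partial>gauss \<sigma>)\<bar> \<le> K * \<delta>\<^sup>2 * E y * 4" unfolding eq .
    have "\<bar>(\<integral>x. f0 (y - x) \<partial>gauss \<sigma>) - f0 y\<bar> \<le> 2 * exp 2 * C2 * \<sigma>\<^sup>2 * E y"
      unfolding E_def by (rule smoothing_bias[OF \<sigma>0])
    also have "\<dots> \<le> 2 * exp 2 * C2 * (4 * \<delta>\<^sup>2) * E y"
    proof -
      have "\<sigma>\<^sup>2 \<le> (2 * \<delta>)\<^sup>2" using \<sigma> \<sigma>0 by (intro power_mono) auto
      then show ?thesis using C2_pos E[of y] by (intro mult_right_mono mult_left_mono) auto
    qed
    finally have 2: "\<bar>(\<integral>x. f0 (y - x) \<partial>gauss \<sigma>) - f0 y\<bar> \<le> 2 * exp 2 * C2 * (4 * \<delta>\<^sup>2) * E y" .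
    have "\<bar>g y - f0 y\<bar> \<le> K * \<delta>\<^sup>2 * E y * 4 + 2 * exp 2 * C2 * (4 * \<delta>\<^sup>2) * E y" using 1 2 by linarith
    also have "\<dots> = K' * \<delta>\<^sup>2 * E y" by (simp add: K'(1) algebra_simps)
    finally show ?thesis .
  qed
  \<comment> \<open>The smallness of \<open>K' * \<delta>\<^sup>2\<close> preserves half of the
    lower bound of \<open>f0\<close>, which makes the division by \<open>g\<close> harmless.\<close>
  have g_ge: "k / 2 * E y \<le> g y" for y
  proof -
    have "K' * \<delta>\<^sup>2 * E y \<le> k / 2 * E y" using K'(2) E[of y] by (intro mult_right_mono) (auto simp: k_def)
    moreover have "k * E y \<le> f0 y" unfolding k_def E_def by (rule f0_ge)
    ultimately show ?thesis using close[of y] by (simp add: abs_le_iff)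
  qed
  have g0: "0 < g y" for y using g_ge[of y] k E[of y] by (smt (verit) mult_pos_pos half_gt_zero)
  define a where "a = 2 * K'\<^sup>2 * \<delta> ^ 4 / k"
  have a: "0 \<le> a" using k by (simp add: a_def)
  have point: "(f0 y)\<^sup>2 / f y + g y \<le> a * E y + 2 * f0 y" for y
  proof -
    have "(f0 y)\<^sup>2 / f y \<le> (f0 y)\<^sup>2 / g y" using gf[of y] g0[of y] by (intro divide_left_mono mult_pos_pos) auto
    also have "(f0 y)\<^sup>2 / g y = (g y - f0 y)\<^sup>2 / g y + 2 * f0 y - g y"
      using g0[of y] by (simp add: field_simps power2_eq_square)
    finally have 1: "(f0 y)\<^sup>2 / f y + g y \<le> (g y - f0 y)\<^sup>2 / g y + 2 * f0 y" by simp
    have "(g y - f0 y)\<^sup>2 / g y \<le> (K' * \<delta>\<^sup>2 * E y)\<^sup>2 / (k / 2 * E y)"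
    proof (rule frac_le)
      show "(g y - f0 y)\<^sup>2 \<le> (K' * \<delta>\<^sup>2 * E y)\<^sup>2"
        using power_mono[OF close[of y], of 2] by simp
      show "0 < k / 2 * E y" using k E[of y] by simp
    qed (use g_ge in auto)
    also have "\<dots> = a * E y" using k E[of y] by (simp add: a_def field_simps power2_eq_square power4_eq_xxxx)
    finally show ?thesis using 1 by simp
  qed
  have fpos: "0 < f y" for y using g0[of y] gf[of y] by simp
  let ?X = "\<integral>\<^sup>+y. ennreal ((f0 y)\<^sup>2 / f y) \<partial>lborel"
  \<comment> \<open>The total of \<open>g\<close>, which is the mass of \<open>U\<close>, is kept on
    the left so that nothing has to be subtracted in \<open>ennreal\<close>; it is removed once
    finiteness allows real arithmetic.\<close>
  have "?X + ennreal (measure H U) = ?X + (\<integral>\<^sup>+y. ennreal (g y) \<partial>lborel)"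
    unfolding g_def obs_density_total[OF Fc] emeasure_convolution_UNIV[OF F1 \<sigma>0(1)] H1(3) H.emeasure_eq_measure ..
  also have "\<dots> = (\<integral>\<^sup>+y. ennreal ((f0 y)\<^sup>2 / f y) + ennreal (g y) \<partial>lborel)"
    by (rule nn_integral_add[symmetric]) measurable
  also have "\<dots> \<le> (\<integral>\<^sup>+y. ennreal a * ennreal (E y) + 2 * ennreal (f0 y) \<partial>lborel)"
  proof (rule nn_integral_mono)
    fix y
    have "ennreal ((f0 y)\<^sup>2 / f y) + ennreal (g y) = ennreal ((f0 y)\<^sup>2 / f y + g y)"
      using g0[of y] fpos[of y] by (intro ennreal_plus[symmetric]) auto
    also have "\<dots> \<le> ennreal (a * E y + 2 * f0 y)" by (intro ennreal_leI point)
    also have "\<dots> = ennreal a * ennreal (E y) + 2 * ennreal (f0 y)"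
      using a E[of y] f0_pos[of y] by (subst ennreal_plus) (auto simp: ennreal_mult)
    finally show "ennreal ((f0 y)\<^sup>2 / f y) + ennreal (g y) \<le> \<dots>" .
  qed
  also have "\<dots> = ennreal a * (\<integral>\<^sup>+y. ennreal (E y) \<partial>lborel) + 2 * (\<integral>\<^sup>+y. ennreal (f0 y) \<partial>lborel)"
    by (simp add: nn_integral_add nn_integral_cmult)
  also have "(\<integral>\<^sup>+y. ennreal (E y) \<partial>lborel) = 2" unfolding E_def using nn_integral_exp_abs[of 1] by simp
  also have "(\<integral>\<^sup>+y. ennreal (f0 y) \<partial>lborel) = 1"
    using obs_density_total[OF finite_\<mu>0 sets_\<mu>0] prob_space.emeasure_space_1[OF prob_\<mu>0] by simp
  also have "ennreal a * 2 + 2 * 1 = ennreal (2 * a + 2)" using a by (simp add: ennreal_plus ennreal_mult mult.commute)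
  finally have le: "?X + ennreal (measure H U) \<le> ennreal (2 * a + 2)" .
  have "?X \<le> ?X + ennreal (measure H U)" by simp
  also note le
  also have "ennreal (2 * a + 2) < \<top>" by simp
  finally have "?X < \<top>" .
  then obtain r where r: "0 \<le> r" "?X = ennreal r" by (cases ?X) auto
  have "ennreal (r + measure H U) \<le> ennreal (2 * a + 2)" using le r by (simp add: ennreal_plus)
  then have "r + measure H U \<le> 2 * a + 2" using a by (subst (asm) ennreal_le_iff) auto
  then have "r \<le> 1 + (2 * a + m)" using mass by simp
  also have "2 * a = 4 * K'\<^sup>2 / f0 0 * \<delta> ^ 4" by (simp add: a_def k_def)
  finally show ?thesis using r unfolding f_def by (simp add: ennreal_leI)
qed

end

section \<open>Measurability of the map from parameters to mixtures\<close>

lemma gauss_measurable: "gauss \<in> restrict_space borel {0<..} \<rightarrow>\<^sub>M prob_algebra borel"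
proof (rule measurable_prob_algebraI)
  show "prob_space (gauss \<sigma>)" if "\<sigma> \<in> space (restrict_space borel {0<..})" for \<sigma>
    using that by (intro prob_space_gauss) (auto simp: space_restrict_space)
  show "gauss \<in> restrict_space borel {0<..} \<rightarrow>\<^sub>M subprob_algebra borel"
  proof (rule measurable_subprob_algebra)
    show "subprob_space (gauss \<sigma>)" if "\<sigma> \<in> space (restrict_space borel {0<..})" for \<sigma>
      using that by (intro prob_space_imp_subprob_space prob_space_gauss) (auto simp: space_restrict_space)
    fix A :: "real set" assume [measurable]: "A \<in> sets borel"
    have "(\<lambda>\<sigma>. \<integral>\<^sup>+x. ennreal (normal_density 0 \<sigma> x) * indicator A x \<partial>lborel) \<in> borel_measurable borel"
      unfolding normal_density_def by measurable
    then show "(\<lambda>\<sigma>. emeasure (gauss \<sigma>) A) \<in> borel_measurable (restrict_space borel {0<..})"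
      by (intro measurable_restrict_space1) (simp add: emeasure_density)
  qed simp
qed

lemma convolution_measurable:
  assumes D: "sets D = sets (prob_algebra borel)" and S: "sets S = sets (restrict_space borel {0<..})"
  shows "(\<lambda>(H, \<sigma>). gauss \<sigma> \<star> H) \<in> D \<Otimes>\<^sub>M S \<rightarrow>\<^sub>M prob_algebra borel"
proof -
  have fst: "fst \<in> D \<Otimes>\<^sub>M S \<rightarrow>\<^sub>M prob_algebra borel"
    using measurable_fst[of D S] measurable_cong_sets[OF refl D] by blast
  have snd: "(\<lambda>p. gauss (snd p)) \<in> D \<Otimes>\<^sub>M S \<rightarrow>\<^sub>M prob_algebra borel"
    using measurable_compose[OF measurable_snd[of D S]] gauss_measurable measurable_cong_sets[OF S refl] by blast
  have "(\<lambda>p. distr (gauss (snd p) \<Otimes>\<^sub>M fst p) borel (\<lambda>(x, y). x + y)) \<in> D \<Otimes>\<^sub>M S \<rightarrow>\<^sub>M prob_algebra borel"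
    by (rule measurable_distr_prob_space2[OF measurable_pair_prob[OF snd fst]]) measurable
  then show ?thesis unfolding convolution_def case_prod_beta .
qed

text \<open>The Bochner integral is routed through the nonnegative integral, which depends
  measurably on the integrating measure.\<close>

lemma obs_density_jointly_measurable:
  assumes k: "k \<in> M \<rightarrow>\<^sub>M prob_algebra borel"
  shows "(\<lambda>(\<theta>, y). obs_density (k \<theta>) y) \<in> borel_measurable (M \<Otimes>\<^sub>M borel)"
proof -
  have k': "(\<lambda>p. k (fst p)) \<in> M \<Otimes>\<^sub>M borel \<rightarrow>\<^sub>M subprob_algebra borel"
    by (intro measurable_prob_algebraD measurable_compose[OF measurable_fst k])
  have "(\<lambda>p. \<integral>\<^sup>+x. ennreal (laplace_density (snd p - x)) \<partial>k (fst p)) \<in> borel_measurable (M \<Otimes>\<^sub>M (borel :: real measure))"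
    by (rule nn_integral_measurable_subprob_algebra2[OF _ k']) measurable
  then have "(\<lambda>p. enn2real (\<integral>\<^sup>+x. ennreal (laplace_density (snd p - x)) \<partial>k (fst p))) \<in> borel_measurable (M \<Otimes>\<^sub>M (borel :: real measure))"
    by measurable
  also have "?this \<longleftrightarrow> ?thesis"
  proof (rule measurable_cong)
    fix p :: "'a \<times> real" assume "p \<in> space (M \<Otimes>\<^sub>M borel)"
    then have "k (fst p) \<in> space (prob_algebra borel)" using measurable_space[OF k] by (auto simp: space_pair_measure)
    then have "finite_measure (k (fst p))" "sets (k (fst p)) = sets borel"
      by (auto simp: space_prob_algebra prob_space.finite_measure)
    from ennreal_obs_density[OF this] obs_density_nonneg[OF this]
    show "enn2real (\<integral>\<^sup>+x. ennreal (laplace_density (snd p - x)) \<partial>k (fst p)) = (case p of (\<theta>, y) \<Rightarrow> obs_density (k \<theta>) y)"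
      by (metis case_prod_beta enn2real_ennreal)
  qed
  finally show ?thesis .
qed

section \<open>Tail moments of signal, noise and observation\<close>

lemma pos_part_le_exp: "0 < b \<Longrightarrow> max 0 t \<le> 1 / b * exp (b * t)" for b t :: real
proof -
  assume b: "0 < b"
  have "b * t \<le> exp (b * t)" using exp_ge_add_one_self[of "b * t"] by linarith
  then show ?thesis using b by (simp add: max_def field_simps)
qed

text \<open>The positive part is dominated by an exponential of rate 1/2, which uses half of the
  decay of the kernel; the other half integrates to 4.\<close>

lemma laplace_tail_moment:
  "(\<integral>\<^sup>+y. ennreal (max 0 (\<bar>y - x\<bar> - B)) * ennreal (laplace_density (y - x)) \<partial>lborel) \<le> ennreal (4 * exp (- B / 2))"
proof -
  have "(\<integral>\<^sup>+y. ennreal (max 0 (\<bar>y - x\<bar> - B)) * ennreal (laplace_density (y - x)) \<partial>lborel)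
    = (\<integral>\<^sup>+u. ennreal (max 0 (\<bar>u\<bar> - B)) * ennreal (laplace_density u) \<partial>lborel)"
    using nn_integral_real_affine[of "\<lambda>y. ennreal (max 0 (\<bar>y - x\<bar> - B)) * ennreal (laplace_density (y - x))" 1 x] by simp
  also have "\<dots> \<le> (\<integral>\<^sup>+u. ennreal (exp (- B / 2)) * ennreal (exp (- (1 / 2) * \<bar>u\<bar>)) \<partial>lborel)"
  proof (rule nn_integral_mono)
    fix u
    have "max 0 (\<bar>u\<bar> - B) * laplace_density u \<le> (1 / (1 / 2) * exp (1 / 2 * (\<bar>u\<bar> - B))) * (exp (- \<bar>u\<bar>) / 2)"
      unfolding laplace_density_def by (intro mult_right_mono pos_part_le_exp) auto
    also have "\<dots> = exp (1 / 2 * (\<bar>u\<bar> - B) + - \<bar>u\<bar>)" by (simp only: exp_add) simp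
    also have "1 / 2 * (\<bar>u\<bar> - B) + - \<bar>u\<bar> = - B / 2 + - (1 / 2) * \<bar>u\<bar>" by (simp add: field_simps)
    also have "exp (- B / 2 + - (1 / 2) * \<bar>u\<bar>) = exp (- B / 2) * exp (- (1 / 2) * \<bar>u\<bar>)" by (rule exp_add)
    finally have "ennreal (max 0 (\<bar>u\<bar> - B) * laplace_density u) \<le> ennreal (exp (- B / 2) * exp (- (1 / 2) * \<bar>u\<bar>))"
      by (rule ennreal_leI)
    then show "ennreal (max 0 (\<bar>u\<bar> - B)) * ennreal (laplace_density u) \<le> ennreal (exp (- B / 2)) * ennreal (exp (- (1 / 2) * \<bar>u\<bar>))"
      by (simp only: ennreal_mult''[OF less_imp_le[OF laplace_density_pos]] ennreal_mult''[OF exp_ge_zero])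
  qed
  also have "\<dots> = ennreal (exp (- B / 2)) * (\<integral>\<^sup>+u. ennreal (exp (- (1 / 2) * \<bar>u\<bar>)) \<partial>lborel)"
    by (rule nn_integral_cmult) measurable
  also have "(\<integral>\<^sup>+u. ennreal (exp (- (1 / 2) * \<bar>u\<bar>)) \<partial>lborel) = ennreal (2 / (1 / 2))" by (rule nn_integral_exp_abs) simp
  also have "ennreal (exp (- B / 2)) * ennreal (2 / (1 / 2)) = ennreal (4 * exp (- B / 2))"
    by (subst ennreal_mult[symmetric]) (auto simp: mult.commute)
  finally show ?thesis .
qed

text \<open>If \<open>\<bar>y\<bar> > 6 * B\<close>, then \<open>(\<bar>x\<bar> - 2 * B) + (\<bar>y
  - x\<bar> - B) \<ge> \<bar>y\<bar> - 3 * B \<ge> \<bar>y\<bar> / 2\<close>. A large observation is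
  thus charged to a large signal or to a large noise, with thresholds \<open>2 * B\<close> and
  \<open>B\<close>.\<close>

lemma obs_density_tail_moment:
  assumes \<mu>: "prob_space \<mu>" "sets \<mu> = sets borel"
  shows "(\<integral>\<^sup>+y. ennreal (\<bar>y\<bar> * indicator {6 * B<..} \<bar>y\<bar>) * ennreal (obs_density \<mu> y) \<partial>lborel)
    \<le> 2 * ((\<integral>\<^sup>+x. ennreal (max 0 (\<bar>x\<bar> - 2 * B)) \<partial>\<mu>) + ennreal (4 * exp (- B / 2)))"
proof -
  interpret prob_space \<mu> by fact
  have "(\<integral>\<^sup>+y. ennreal (\<bar>y\<bar> * indicator {6 * B<..} \<bar>y\<bar>) * ennreal (obs_density \<mu> y) \<partial>lborel)
    = (\<integral>\<^sup>+x. (\<integral>\<^sup>+y. ennreal (\<bar>y\<bar> * indicator {6 * B<..} \<bar>y\<bar>) * ennreal (laplace_density (y - x)) \<partial>lborel) \<partial>\<mu>)"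
    by (rule nn_integral_obs_density[OF finite_measure_axioms \<mu>(2)]) measurable
  also have "\<dots> \<le> (\<integral>\<^sup>+x. 2 * (ennreal (max 0 (\<bar>x\<bar> - 2 * B)) + ennreal (4 * exp (- B / 2))) \<partial>\<mu>)"
  proof (rule nn_integral_mono)
    fix x
    have "(\<integral>\<^sup>+y. ennreal (\<bar>y\<bar> * indicator {6 * B<..} \<bar>y\<bar>) * ennreal (laplace_density (y - x)) \<partial>lborel)
      \<le> (\<integral>\<^sup>+y. 2 * (ennreal (max 0 (\<bar>x\<bar> - 2 * B)) * ennreal (laplace_density (y - x))
           + ennreal (max 0 (\<bar>y - x\<bar> - B)) * ennreal (laplace_density (y - x))) \<partial>lborel)"
    proof (rule nn_integral_mono)
      fix y
      have "\<bar>y\<bar> * indicator {6 * B<..} \<bar>y\<bar> \<le> 2 * (max 0 (\<bar>x\<bar> - 2 * B) + max 0 (\<bar>y - x\<bar> - B))"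
      proof -
        have "\<bar>y\<bar> \<le> \<bar>x\<bar> + \<bar>y - x\<bar>" by linarith
        then show ?thesis by (auto simp: max_def split: split_indicator)
      qed
      then have "ennreal (\<bar>y\<bar> * indicator {6 * B<..} \<bar>y\<bar>) \<le> ennreal (2 * (max 0 (\<bar>x\<bar> - 2 * B) + max 0 (\<bar>y - x\<bar> - B)))"
        by (rule ennreal_leI)
      also have "\<dots> = 2 * (ennreal (max 0 (\<bar>x\<bar> - 2 * B)) + ennreal (max 0 (\<bar>y - x\<bar> - B)))"
        by (simp add: ennreal_mult ennreal_plus)
      finally have "ennreal (\<bar>y\<bar> * indicator {6 * B<..} \<bar>y\<bar>) * ennreal (laplace_density (y - x))
        \<le> 2 * (ennreal (max 0 (\<bar>x\<bar> - 2 * B)) + ennreal (max 0 (\<bar>y - x\<bar> - B))) * ennreal (laplace_density (y - x))"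
        by (rule mult_right_mono) simp
      then show "ennreal (\<bar>y\<bar> * indicator {6 * B<..} \<bar>y\<bar>) * ennreal (laplace_density (y - x))
        \<le> 2 * (ennreal (max 0 (\<bar>x\<bar> - 2 * B)) * ennreal (laplace_density (y - x))
           + ennreal (max 0 (\<bar>y - x\<bar> - B)) * ennreal (laplace_density (y - x)))"
        by (simp only: distrib_right mult.assoc)
    qed
    also have "\<dots> = 2 * ((\<integral>\<^sup>+y. ennreal (max 0 (\<bar>x\<bar> - 2 * B)) * ennreal (laplace_density (y - x)) \<partial>lborel)
           + (\<integral>\<^sup>+y. ennreal (max 0 (\<bar>y - x\<bar> - B)) * ennreal (laplace_density (y - x)) \<partial>lborel))"
      by (subst nn_integral_cmult, measurable) (subst nn_integral_add, measurable)
    also have "(\<integral>\<^sup>+y. ennreal (max 0 (\<bar>x\<bar> - 2 * B)) * ennreal (laplace_density (y - x)) \<partial>lborel) = ennreal (max 0 (\<bar>x\<bar> - 2 * B))"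
      by (subst nn_integral_cmult) (simp_all add: laplace_nn_integral)
    also have "2 * (ennreal (max 0 (\<bar>x\<bar> - 2 * B)) + (\<integral>\<^sup>+y. ennreal (max 0 (\<bar>y - x\<bar> - B)) * ennreal (laplace_density (y - x)) \<partial>lborel))
      \<le> 2 * (ennreal (max 0 (\<bar>x\<bar> - 2 * B)) + ennreal (4 * exp (- B / 2)))"
      by (intro mult_left_mono add_left_mono laplace_tail_moment) simp
    finally show "(\<integral>\<^sup>+y. ennreal (\<bar>y\<bar> * indicator {6 * B<..} \<bar>y\<bar>) * ennreal (laplace_density (y - x)) \<partial>lborel)
      \<le> 2 * (ennreal (max 0 (\<bar>x\<bar> - 2 * B)) + ennreal (4 * exp (- B / 2)))" .
  qed
  also have "\<dots> = 2 * ((\<integral>\<^sup>+x. ennreal (max 0 (\<bar>x\<bar> - 2 * B)) \<partial>\<mu>) + ennreal (4 * exp (- B / 2)))"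
  proof -
    note [measurable_cong] = \<mu>(2)
    have "(\<integral>\<^sup>+x. 2 * (ennreal (max 0 (\<bar>x\<bar> - 2 * B)) + ennreal (4 * exp (- B / 2))) \<partial>\<mu>)
      = 2 * (\<integral>\<^sup>+x. ennreal (max 0 (\<bar>x\<bar> - 2 * B)) + ennreal (4 * exp (- B / 2)) \<partial>\<mu>)"
      by (rule nn_integral_cmult) measurable
    also have "(\<integral>\<^sup>+x. ennreal (max 0 (\<bar>x\<bar> - 2 * B)) + ennreal (4 * exp (- B / 2)) \<partial>\<mu>)
      = (\<integral>\<^sup>+x. ennreal (max 0 (\<bar>x\<bar> - 2 * B)) \<partial>\<mu>) + (\<integral>\<^sup>+x. ennreal (4 * exp (- B / 2)) \<partial>\<mu>)"
      by (rule nn_integral_add) measurable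
    also have "(\<integral>\<^sup>+x. ennreal (4 * exp (- B / 2)) \<partial>\<mu>) = ennreal (4 * exp (- B / 2))"
      using emeasure_space_1 by simp
    finally show ?thesis .
  qed
  finally show ?thesis .
qed

text \<open>The exponential majorant has rate \<open>1 / \<sigma>\<close>, at which the bound on the
  normal moment is the constant \<open>2 * exp (1 / 2)\<close>, free of
  \<open>\<sigma>\<close>.\<close>

lemma gauss_tail_moment:
  assumes \<sigma>: "0 < \<sigma>"
  shows "(\<integral>\<^sup>+x. ennreal (max 0 (\<bar>x\<bar> - B)) \<partial>gauss \<sigma>) \<le> ennreal (4 * \<sigma> * exp (- B / \<sigma>))"
proof -
  have "(\<integral>\<^sup>+x. ennreal (max 0 (\<bar>x\<bar> - B)) \<partial>gauss \<sigma>) \<le> (\<integral>\<^sup>+x. ennreal (\<sigma> * exp (- B / \<sigma>)) * ennreal (exp (1 / \<sigma> * \<bar>x\<bar>)) \<partial>gauss \<sigma>)"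
  proof (rule nn_integral_mono)
    fix x
    have "max 0 (\<bar>x\<bar> - B) \<le> 1 / (1 / \<sigma>) * exp (1 / \<sigma> * (\<bar>x\<bar> - B))" using \<sigma> by (intro pos_part_le_exp) simp
    also have "1 / \<sigma> * (\<bar>x\<bar> - B) = - B / \<sigma> + 1 / \<sigma> * \<bar>x\<bar>" using \<sigma> by (simp add: field_simps)
    also have "1 / (1 / \<sigma>) * exp (- B / \<sigma> + 1 / \<sigma> * \<bar>x\<bar>) = \<sigma> * exp (- B / \<sigma>) * exp (1 / \<sigma> * \<bar>x\<bar>)" unfolding exp_add by simp
    finally show "ennreal (max 0 (\<bar>x\<bar> - B)) \<le> ennreal (\<sigma> * exp (- B / \<sigma>)) * ennreal (exp (1 / \<sigma> * \<bar>x\<bar>))"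
      using \<sigma> by (auto intro!: ennreal_leI simp flip: ennreal_mult)
  qed
  also have "\<dots> = ennreal (\<sigma> * exp (- B / \<sigma>)) * (\<integral>\<^sup>+x. ennreal (exp (1 / \<sigma> * \<bar>x\<bar>)) \<partial>gauss \<sigma>)"
    by (rule nn_integral_cmult) measurable
  also have "\<dots> \<le> ennreal (\<sigma> * exp (- B / \<sigma>)) * ennreal (2 * exp ((1 / \<sigma>)\<^sup>2 * \<sigma>\<^sup>2 / 2))"
    by (intro mult_left_mono gauss_exp_abs_moment \<sigma>) simp
  also have "(1 / \<sigma>)\<^sup>2 * \<sigma>\<^sup>2 / 2 = 1 / 2" using \<sigma> by (simp add: power_divide)
  also have "ennreal (\<sigma> * exp (- B / \<sigma>)) * ennreal (2 * exp (1 / 2)) \<le> ennreal (\<sigma> * exp (- B / \<sigma>)) * ennreal 4"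
  proof (intro mult_left_mono ennreal_leI)
    have "exp (1 / 2 :: real) \<le> 1 + 1 / 2 + (1 / 2)\<^sup>2" by (rule exp_le_quadratic) simp
    then show "2 * exp (1 / 2 :: real) \<le> 4" by (simp add: power2_eq_square)
  qed simp
  also have "\<dots> = ennreal (4 * \<sigma> * exp (- B / \<sigma>))" using \<sigma> by (subst ennreal_mult[symmetric]) (auto simp: mult_ac)
  finally show ?thesis .
qed

lemma convolution_tail_moment:
  assumes H: "prob_space H" "sets H = sets borel" and \<sigma>: "0 < \<sigma>"
  shows "(\<integral>\<^sup>+x. ennreal (max 0 (\<bar>x\<bar> - 2 * B)) \<partial>(gauss \<sigma> \<star> H))
    \<le> (\<integral>\<^sup>+z. ennreal (max 0 (\<bar>z\<bar> - B)) \<partial>H) + ennreal (4 * \<sigma> * exp (- B / \<sigma>))"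
proof -
  interpret H: prob_space H by (rule H(1))
  interpret G: prob_space "gauss \<sigma>" by (rule prob_space_gauss[OF \<sigma>])
  note [measurable_cong] = H(2)
  have "(\<integral>\<^sup>+x. ennreal (max 0 (\<bar>x\<bar> - 2 * B)) \<partial>(gauss \<sigma> \<star> H))
    = (\<integral>\<^sup>+x. (\<integral>\<^sup>+z. ennreal (max 0 (\<bar>x + z\<bar> - 2 * B)) \<partial>H) \<partial>gauss \<sigma>)"
    by (rule nn_integral_convolution[OF G.finite_measure_axioms H.finite_measure_axioms H(2)]) auto
  also have "\<dots> \<le> (\<integral>\<^sup>+x. (\<integral>\<^sup>+z. ennreal (max 0 (\<bar>z\<bar> - B)) + ennreal (max 0 (\<bar>x\<bar> - B)) \<partial>H) \<partial>gauss \<sigma>)"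
    by (intro nn_integral_mono) (auto simp: max_def simp flip: ennreal_plus intro!: ennreal_leI)
  also have "\<dots> = (\<integral>\<^sup>+x. (\<integral>\<^sup>+z. ennreal (max 0 (\<bar>z\<bar> - B)) \<partial>H) + ennreal (max 0 (\<bar>x\<bar> - B)) \<partial>gauss \<sigma>)"
    by (subst nn_integral_add) (auto simp: H.emeasure_space_1)
  also have "\<dots> = (\<integral>\<^sup>+z. ennreal (max 0 (\<bar>z\<bar> - B)) \<partial>H) + (\<integral>\<^sup>+x. ennreal (max 0 (\<bar>x\<bar> - B)) \<partial>gauss \<sigma>)"
    using G.emeasure_space_1 by (subst nn_integral_add) auto
  also have "\<dots> \<le> (\<integral>\<^sup>+z. ennreal (max 0 (\<bar>z\<bar> - B)) \<partial>H) + ennreal (4 * \<sigma> * exp (- B / \<sigma>))"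
    by (intro add_left_mono gauss_tail_moment \<sigma>)
  finally show ?thesis .
qed

context light_tailed_density
begin

lemma \<mu>0_tail_moment:
  assumes "0 \<le> B"
  shows "(\<integral>\<^sup>+x. ennreal (max 0 (\<bar>x\<bar> - 2 * B)) \<partial>\<mu>0) \<le> ennreal (2 * C1 * exp (- B))"
proof -
  have "(\<integral>\<^sup>+x. ennreal (max 0 (\<bar>x\<bar> - 2 * B)) \<partial>\<mu>0) \<le> (\<integral>\<^sup>+x. ennreal (exp (- B)) * (ennreal (exp \<bar>x\<bar>) * indicator {0..} \<bar>x\<bar>) \<partial>\<mu>0)"
  proof (rule nn_integral_mono)
    fix x
    have "max 0 (\<bar>x\<bar> - 2 * B) \<le> exp (\<bar>x\<bar> - 2 * B)" using pos_part_le_exp[of 1 "\<bar>x\<bar> - 2 * B"] by simp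
    also have "\<dots> \<le> exp (- B + \<bar>x\<bar>)" using assms by simp
    also have "\<dots> = exp (- B) * exp \<bar>x\<bar>" by (rule exp_add)
    finally show "ennreal (max 0 (\<bar>x\<bar> - 2 * B)) \<le> ennreal (exp (- B)) * (ennreal (exp \<bar>x\<bar>) * indicator {0..} \<bar>x\<bar>)"
      by (auto intro!: ennreal_leI simp flip: ennreal_mult)
  qed
  also have "\<dots> = ennreal (exp (- B)) * (\<integral>\<^sup>+x. ennreal (exp \<bar>x\<bar>) * indicator {0..} \<bar>x\<bar> \<partial>\<mu>0)"
    by (rule nn_integral_cmult) measurable
  also have "\<dots> \<le> ennreal (exp (- B)) * ennreal (2 * C / C0 * exp (- C0 * 0))"
    by (intro mult_left_mono exp_tail_le) auto
  also have "\<dots> = ennreal (2 * C1 * exp (- B))" using C_pos C0_pos by (simp add: C1_def mult_ac flip: ennreal_mult)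
  finally show ?thesis .
qed

text \<open>The weight \<open>\<bar>y\<bar>\<close> is cut at \<open>6 * B\<close>: below, it costs
  the factor \<open>6 * B\<close> in front of the \<open>L\<^sup>1\<close> distance; above, the two
  densities are treated separately through their tail moments. The moment \<open>v\<close> is the
  only information about the tail of \<open>H\<close>.\<close>

theorem wasserstein1_bound:
  assumes H: "prob_space H" "sets H = sets borel" and \<sigma>: "0 < \<sigma>" and B: "0 \<le> B" and h: "0 < h" "h \<le> 1"
    and L1: "(\<integral>y. \<bar>obs_density (gauss \<sigma> \<star> H) y - f0 y\<bar> \<partial>lborel) \<le> e1"
    and tail: "(\<integral>\<^sup>+z. ennreal (max 0 (\<bar>z\<bar> - B)) \<partial>H) \<le> ennreal v" "0 \<le> v"
  shows "wasserstein1 (gauss \<sigma> \<star> H) \<mu>0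
    \<le> ennreal (2 * h + 24 * B * e1 + 8 * (v + 4 * \<sigma> * exp (- B / \<sigma>) + (8 + 2 * C1) * exp (- B / 2)) + 6 / h * e1)"
proof -
  let ?\<nu> = "gauss \<sigma> \<star> H"
  have \<nu>: "prob_space ?\<nu>" "sets ?\<nu> = sets borel" by (simp_all add: prob_space_convolution[OF H \<sigma>])
  interpret N: prob_space ?\<nu> by (rule \<nu>(1))
  define f where "f = obs_density ?\<nu>"
  have [measurable]: "f \<in> borel_measurable borel" unfolding f_def by (rule obs_density_measurable[OF N.finite_measure_axioms \<nu>(2)])
  have f0': "0 \<le> f y" for y unfolding f_def by (rule obs_density_nonneg[OF N.finite_measure_axioms \<nu>(2)])
  have e1: "0 \<le> e1" by (rule order_trans[OF _ L1]) (rule integral_nonneg_AE, simp)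
  have X0: "(\<integral>\<^sup>+y. ennreal \<bar>f y - f0 y\<bar> \<partial>lborel) \<le> ennreal e1"
  proof -
    have "integrable lborel (\<lambda>y. \<bar>f y - f0 y\<bar>)"
      unfolding f_def by (intro integrable_abs Bochner_Integration.integrable_diff obs_density_integrable finite_\<mu>0 N.finite_measure_axioms) auto
    then have "(\<integral>\<^sup>+y. ennreal \<bar>f y - f0 y\<bar> \<partial>lborel) = ennreal (\<integral>y. \<bar>f y - f0 y\<bar> \<partial>lborel)"
      by (intro nn_integral_eq_integral) auto
    then show ?thesis using L1 by (simp add: f_def ennreal_leI)
  qed
  define q where "q = 4 * exp (- B / 2)"
  have X1: "(\<integral>\<^sup>+y. ennreal (\<bar>y\<bar> * \<bar>f y - f0 y\<bar>) \<partial>lborel)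
    \<le> ennreal (6 * B * e1 + 2 * (v + 4 * \<sigma> * exp (- B / \<sigma>) + q) + 2 * (2 * C1 * exp (- B) + q))"
  proof -
    have "(\<integral>\<^sup>+y. ennreal (\<bar>y\<bar> * \<bar>f y - f0 y\<bar>) \<partial>lborel)
      \<le> (\<integral>\<^sup>+y. ennreal (6 * B) * ennreal \<bar>f y - f0 y\<bar> + ennreal (\<bar>y\<bar> * indicator {6 * B<..} \<bar>y\<bar>) * ennreal (f y)
          + ennreal (\<bar>y\<bar> * indicator {6 * B<..} \<bar>y\<bar>) * ennreal (f0 y) \<partial>lborel)"
    proof (rule nn_integral_mono)
      fix y
      let ?i = "\<bar>y\<bar> * indicator {6 * B<..} \<bar>y\<bar>"
      have p: "0 \<le> f0 y" "0 \<le> f y" using f0_pos[of y] f0'[of y] by auto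
      have "\<bar>y\<bar> * \<bar>f y - f0 y\<bar> \<le> 6 * B * \<bar>f y - f0 y\<bar> + ?i * f y + ?i * f0 y"
      proof (cases "6 * B < \<bar>y\<bar>")
        case True
        have "\<bar>y\<bar> * \<bar>f y - f0 y\<bar> \<le> \<bar>y\<bar> * (f y + f0 y)" using p by (intro mult_left_mono) auto
        moreover have "0 \<le> 6 * B * \<bar>f y - f0 y\<bar>" using B by simp
        ultimately show ?thesis using True by (simp add: distrib_left)
      next
        case False
        then show ?thesis by (simp add: mult_right_mono)
      qed
      then have "ennreal (\<bar>y\<bar> * \<bar>f y - f0 y\<bar>) \<le> ennreal (6 * B * \<bar>f y - f0 y\<bar> + ?i * f y + ?i * f0 y)" by (rule ennreal_leI)
      also have "\<dots> = ennreal (6 * B) * ennreal \<bar>f y - f0 y\<bar> + ennreal ?i * ennreal (f y) + ennreal ?i * ennreal (f0 y)"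
        using p B by (simp add: ennreal_plus ennreal_mult)
      finally show "ennreal (\<bar>y\<bar> * \<bar>f y - f0 y\<bar>) \<le> \<dots>" .
    qed
    also have "\<dots> = ennreal (6 * B) * (\<integral>\<^sup>+y. ennreal \<bar>f y - f0 y\<bar> \<partial>lborel)
        + (\<integral>\<^sup>+y. ennreal (\<bar>y\<bar> * indicator {6 * B<..} \<bar>y\<bar>) * ennreal (f y) \<partial>lborel)
        + (\<integral>\<^sup>+y. ennreal (\<bar>y\<bar> * indicator {6 * B<..} \<bar>y\<bar>) * ennreal (f0 y) \<partial>lborel)"
      by (simp add: nn_integral_add nn_integral_cmult)
    also have "\<dots> \<le> ennreal (6 * B) * ennreal e1 + 2 * (ennreal v + ennreal (4 * \<sigma> * exp (- B / \<sigma>)) + ennreal q)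
       + 2 * (ennreal (2 * C1 * exp (- B)) + ennreal q)"
    proof (intro add_mono mult_left_mono X0)
      have "(\<integral>\<^sup>+y. ennreal (\<bar>y\<bar> * indicator {6 * B<..} \<bar>y\<bar>) * ennreal (f y) \<partial>lborel)
        \<le> 2 * ((\<integral>\<^sup>+x. ennreal (max 0 (\<bar>x\<bar> - 2 * B)) \<partial>?\<nu>) + ennreal q)"
        unfolding f_def q_def by (rule obs_density_tail_moment[OF \<nu>])
      also have "\<dots> \<le> 2 * (ennreal v + ennreal (4 * \<sigma> * exp (- B / \<sigma>)) + ennreal q)"
        using order_trans[OF convolution_tail_moment[OF H \<sigma>, of B] add_right_mono[OF tail(1)]]
        by (intro mult_left_mono add_right_mono) auto
      finally show "(\<integral>\<^sup>+y. ennreal (\<bar>y\<bar> * indicator {6 * B<..} \<bar>y\<bar>) * ennreal (f y) \<partial>lborel) \<le> \<dots>" .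
      have "(\<integral>\<^sup>+y. ennreal (\<bar>y\<bar> * indicator {6 * B<..} \<bar>y\<bar>) * ennreal (f0 y) \<partial>lborel)
        \<le> 2 * ((\<integral>\<^sup>+x. ennreal (max 0 (\<bar>x\<bar> - 2 * B)) \<partial>\<mu>0) + ennreal q)"
        unfolding q_def by (rule obs_density_tail_moment[OF prob_\<mu>0 sets_\<mu>0])
      also have "\<dots> \<le> 2 * (ennreal (2 * C1 * exp (- B)) + ennreal q)"
        by (intro mult_left_mono add_right_mono \<mu>0_tail_moment B) auto
      finally show "(\<integral>\<^sup>+y. ennreal (\<bar>y\<bar> * indicator {6 * B<..} \<bar>y\<bar>) * ennreal (f0 y) \<partial>lborel) \<le> \<dots>" .
    qed simp
    also have "\<dots> = ennreal (6 * B * e1 + 2 * (v + 4 * \<sigma> * exp (- B / \<sigma>) + q) + 2 * (2 * C1 * exp (- B) + q))"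
    proof -
      define s where "s = 4 * \<sigma> * exp (- B / \<sigma>)"
      define p where "p = 2 * C1 * exp (- B)"
      have nn: "0 \<le> s" "0 \<le> p" "0 \<le> q" "0 \<le> 6 * B * e1" using B e1 \<sigma> C1_pos by (auto simp: s_def p_def q_def)
      have two: "2 * ennreal t = ennreal (2 * t)" if "0 \<le> t" for t using that by (simp add: ennreal_mult)
      have "ennreal (6 * B) * ennreal e1 = ennreal (6 * B * e1)" using B e1 by (simp only: ennreal_mult''[symmetric])
      moreover have "2 * (ennreal v + ennreal s + ennreal q) = ennreal (2 * (v + s + q))"
        using nn tail(2) by (simp only: two[symmetric] add_nonneg_nonneg ennreal_plus)
      moreover have "2 * (ennreal p + ennreal q) = ennreal (2 * (p + q))"
        using nn by (simp only: two[symmetric] add_nonneg_nonneg ennreal_plus)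
      ultimately show ?thesis unfolding s_def[symmetric] p_def[symmetric]
        using nn tail(2) by (simp only:) (subst ennreal_plus[symmetric]; simp)+
    qed
    finally show ?thesis .
  qed
  have "wasserstein1 ?\<nu> \<mu>0 \<le> ennreal (2 * h) + 4 * (\<integral>\<^sup>+y. ennreal (\<bar>y\<bar> * \<bar>f y - f0 y\<bar>) \<partial>lborel)
    + ennreal (6 / h) * (\<integral>\<^sup>+y. ennreal \<bar>f y - f0 y\<bar> \<partial>lborel)"
    unfolding f_def by (rule wasserstein1_le_obs_density[OF \<nu> prob_\<mu>0 sets_\<mu>0 h])
  also have "\<dots> \<le> ennreal (2 * h) + 4 * ennreal (6 * B * e1 + 2 * (v + 4 * \<sigma> * exp (- B / \<sigma>) + q) + 2 * (2 * C1 * exp (- B) + q))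
    + ennreal (6 / h) * ennreal e1"
    by (intro add_mono mult_left_mono X0 X1) auto
  also have "\<dots> = ennreal (2 * h + 4 * (6 * B * e1 + 2 * (v + 4 * \<sigma> * exp (- B / \<sigma>) + q) + 2 * (2 * C1 * exp (- B) + q)) + 6 / h * e1)"
  proof -
    define A where "A = 6 * B * e1 + 2 * (v + 4 * \<sigma> * exp (- B / \<sigma>) + q) + 2 * (2 * C1 * exp (- B) + q)"
    have "0 \<le> A" using B e1 tail(2) \<sigma> C1_pos by (simp add: A_def q_def)
    have "4 * ennreal A = ennreal (4 * A)" using \<open>0 \<le> A\<close> by (simp add: ennreal_mult)
    moreover have "ennreal (6 / h) * ennreal e1 = ennreal (6 / h * e1)" by (simp only: ennreal_mult''[OF e1])
    ultimately show ?thesis unfolding A_def[symmetric] using h e1 \<open>0 \<le> A\<close>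
      by (simp only:) (subst ennreal_plus[symmetric]; simp)+
  qed
  also have "\<dots> \<le> ennreal (2 * h + 24 * B * e1 + 8 * (v + 4 * \<sigma> * exp (- B / \<sigma>) + (8 + 2 * C1) * exp (- B / 2)) + 6 / h * e1)"
  proof (rule ennreal_leI)
    have "C1 * exp (- B) \<le> C1 * exp (- B / 2)" using B C1_pos by (intro mult_left_mono) auto
    then show "2 * h + 4 * (6 * B * e1 + 2 * (v + 4 * \<sigma> * exp (- B / \<sigma>) + q) + 2 * (2 * C1 * exp (- B) + q)) + 6 / h * e1
      \<le> 2 * h + 24 * B * e1 + 8 * (v + 4 * \<sigma> * exp (- B / \<sigma>) + (8 + 2 * C1) * exp (- B / 2)) + 6 / h * e1"
      by (simp add: q_def algebra_simps)
  qed
  finally show ?thesis .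
qed

end

section \<open>Prior mass\<close>

text \<open>The sets \<open>V k\<close> and their common complement form the partition to which
  Ferguson's property is applied. The complement takes the role of the last coordinate;
  \<open>G\<close> bounds its Gamma factor, and its exponent is replaced by the total mass of
  \<open>H\<close>, which is permissible because \<open>\<eta> / 2 \<le> 1\<close>.\<close>

lemma dirichlet_process_box:
  fixes V :: "nat \<Rightarrow> real set" and w :: "nat \<Rightarrow> real"
  assumes D: "is_dirichlet_process H D" and H: "finite_measure H" "sets H = sets borel"
    and V: "\<And>k. k < m \<Longrightarrow> V k \<in> sets borel" "disjoint_family_on V {..<m}"
    and \<alpha>: "0 < \<alpha>" "\<And>k. k < m \<Longrightarrow> \<alpha> \<le> measure H (V k) \<and> measure H (V k) \<le> 1"
    and rest: "0 < measure H (- (\<Union>k<m. V k))" "Gamma (measure H (- (\<Union>k<m. V k))) \<le> G"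
    and w: "\<And>i. i < m \<Longrightarrow> 0 \<le> w i" and s: "s = (\<Sum>i<m. w i)" "0 < s" "s \<le> 1"
    and \<eta>: "0 < \<eta>" "\<eta> \<le> 1"
  defines "S \<equiv> {P \<in> space D. \<forall>k<m. w k / (s + real (Suc m) * \<eta>) \<le> measure P (V k) \<and> measure P (V k) \<le> (w k + \<eta>) / s}"
  shows "S \<in> sets D"
    and "ennreal ((\<alpha> * exp (-2) / 2 * \<eta>) ^ m * ((\<eta> / 2) powr (measure H UNIV + 1) * exp (-1) / G)) \<le> emeasure D S"
proof -
  interpret H: finite_measure H by fact
  have sD [measurable_cong]: "sets D = sets (prob_algebra borel)" using D by (simp add: is_dirichlet_process_def)
  have spH: "space H = UNIV" using sets_eq_imp_space_eq[OF H(2)] by simp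
  have [measurable]: "(\<lambda>P. measure P A) \<in> borel_measurable D" if "A \<in> sets borel" for A
    using measurable_measure_prob_algebra[OF that] measurable_cong_sets[OF sD refl] by blast
  show S: "S \<in> sets D"
  proof -
    have "{P \<in> space D. \<forall>k\<in>{..<m}. w k / (s + real (Suc m) * \<eta>) \<le> measure P (V k) \<and> measure P (V k) \<le> (w k + \<eta>) / s} \<in> sets D"
    proof (rule sets.sets_Collect_finite_All)
      fix k assume "k \<in> {..<m}"
      then have [measurable]: "V k \<in> sets borel" using V by simp
      show "{P \<in> space D. w k / (s + real (Suc m) * \<eta>) \<le> measure P (V k) \<and> measure P (V k) \<le> (w k + \<eta>) / s} \<in> sets D"
        by measurable
    qed simp
    then show ?thesis by (simp only: S_def Ball_def lessThan_iff)
  qed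
  define R where "R = - (\<Union>k<m. V k)"
  define A where "A i = (if i < m then V i else R)" for i
  define a where "a i = measure H (A i)" for i
  have R [measurable]: "R \<in> sets borel" unfolding R_def using V by (intro borel_comp sets.finite_UN) auto
  have A_sets: "\<forall>i<Suc m. A i \<in> sets borel" using V R by (auto simp: A_def)
  have A_disj: "disjoint_family_on A {..<Suc m}"
    using V(2) unfolding disjoint_family_on_def A_def R_def by (auto simp: less_Suc_eq) 
  have A_un: "(\<Union>i<Suc m. A i) = UNIV"
  proof -
    have "(\<Union>i<Suc m. A i) = (\<Union>i<m. A i) \<union> A m" by (simp add: lessThan_Suc Un_commute)
    also have "\<dots> = (\<Union>i<m. V i) \<union> R" by (simp add: A_def)
    finally show ?thesis by (auto simp: R_def)
  qed
  let ?f = "\<lambda>P. \<lambda>i\<in>{..<Suc m}. measure P (A i)"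
  let ?P = "\<Pi>\<^sub>M i\<in>{..<Suc m}. (borel :: real measure)"
  have dist: "distr D ?P ?f = dirichlet_law (Suc m) a"
    using D A_sets A_disj A_un unfolding is_dirichlet_process_def a_def by blast
  have f: "?f \<in> D \<rightarrow>\<^sub>M ?P" using A_sets by (intro measurable_restrict) auto
  let ?B = "{p \<in> space ?P. \<forall>i<m. w i / (s + real (Suc m) * \<eta>) \<le> p i \<and> p i \<le> (w i + \<eta>) / s}"
  have am: "a m = measure H R" by (simp add: a_def A_def)
  have ai: "a i = measure H (V i)" if "i < m" for i using that by (simp add: a_def A_def)
  have G: "0 < Gamma (a m)" "Gamma (a m) \<le> G" using rest by (auto simp: am R_def Gamma_real_pos)
  have "ennreal ((\<alpha> * exp (-2) / 2 * \<eta>) ^ m * ((\<eta> / 2) powr (measure H UNIV + 1) * exp (-1) / G))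
    \<le> ennreal ((\<Prod>i<m. a i * exp (-2) / 2 * \<eta>) * ((\<eta> / 2) powr (a m + 1) * exp (-1) / Gamma (a m)))"
  proof (intro ennreal_leI mult_mono frac_le)
    have "(\<Prod>i<m. \<alpha> * exp (-2) / 2 * \<eta>) \<le> (\<Prod>i<m. a i * exp (-2) / 2 * \<eta>)"
      using \<alpha> \<eta> by (intro prod_mono) (auto simp: ai intro!: mult_right_mono)
    then show "(\<alpha> * exp (-2) / 2 * \<eta>) ^ m \<le> (\<Prod>i<m. a i * exp (-2) / 2 * \<eta>)" by simp
    have "a m \<le> measure H UNIV" unfolding am using H by (intro H.finite_measure_mono) auto
    then show "(\<eta> / 2) powr (measure H UNIV + 1) \<le> (\<eta> / 2) powr (a m + 1)"
      using \<eta> by (intro powr_mono') auto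
    show "0 \<le> (\<Prod>i<m. a i * exp (-2) / 2 * \<eta>)" using \<eta> by (intro prod_nonneg) (auto simp: a_def)
  qed (use G \<eta> in auto)
  also have "\<dots> \<le> emeasure (dirichlet_law (Suc m) a) ?B"
    using \<alpha> rest w s \<eta> by (intro dirichlet_law_box) (auto simp: ai am R_def intro: less_le_trans)
  also have "\<dots> = emeasure D (?f -` ?B \<inter> space D)"
  proof -
    have "?B \<in> sets ?P"
    proof -
      have "{p \<in> space ?P. \<forall>i\<in>{..<m}. w i / (s + real (Suc m) * \<eta>) \<le> p i \<and> p i \<le> (w i + \<eta>) / s} \<in> sets ?P"
      proof (rule sets.sets_Collect_finite_All)
        fix i assume "i \<in> {..<m}"
        then have [measurable]: "(\<lambda>p. p i) \<in> borel_measurable ?P"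
          using measurable_component_singleton[of i "{..<Suc m}" "\<lambda>_. borel :: real measure"] by simp
        show "{p \<in> space ?P. w i / (s + real (Suc m) * \<eta>) \<le> p i \<and> p i \<le> (w i + \<eta>) / s} \<in> sets ?P"
          by measurable
      qed simp
      then show ?thesis by (simp add: Ball_def)
    qed
    then show ?thesis unfolding dist[symmetric] by (rule emeasure_distr[OF f])
  qed
  also have "?f -` ?B \<inter> space D = S"
  proof -
    have "?f P \<in> space ?P" for P by (auto simp: space_PiM)
    then show ?thesis by (auto simp: A_def S_def)
  qed
  finally show "ennreal ((\<alpha> * exp (-2) / 2 * \<eta>) ^ m * ((\<eta> / 2) powr (measure H UNIV + 1) * exp (-1) / G)) \<le> emeasure D S" .
qed

section \<open>Base measures with light tails\<close>

locale base_density =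
  fixes h0 :: "real \<Rightarrow> real" and b0 b0' c0 c0' \<iota> :: real
  assumes h0_measurable [measurable]: "h0 \<in> borel_measurable borel"
    and params: "0 < b0" "0 < b0'" "0 < c0" "0 < c0'" "1 < \<iota>"
    and h0_ge: "\<And>u. c0 * exp (- b0 * \<bar>u\<bar> powr \<iota>) \<le> h0 u"
    and h0_le: "\<And>u. h0 u \<le> c0' * exp (- b0' * \<bar>u\<bar> powr \<iota>)"
begin

abbreviation H0 :: "real measure" where "H0 \<equiv> density lborel (\<lambda>u. ennreal (h0 u))"

lemma finite_H0: "finite_measure H0"
proof (rule finite_measureI)
  have "emeasure H0 UNIV = (\<integral>\<^sup>+u. ennreal (h0 u) \<partial>lborel)" by (simp add: emeasure_density)
  also have "\<dots> \<le> (\<integral>\<^sup>+u. ennreal (c0' * exp b0') * ennreal (exp (- b0' * \<bar>u\<bar>)) \<partial>lborel)"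
  proof (rule nn_integral_mono)
    fix u
    have "\<bar>u\<bar> - 1 \<le> \<bar>u\<bar> powr \<iota>"
    proof (cases "1 \<le> \<bar>u\<bar>")
      case True
      then have "\<bar>u\<bar> powr 1 \<le> \<bar>u\<bar> powr \<iota>" using params by (intro powr_mono) auto
      then show ?thesis using True by simp
    next
      case False
      have "0 \<le> \<bar>u\<bar> powr \<iota>" by simp
      then show ?thesis using False by linarith
    qed
    then have "b0' * (\<bar>u\<bar> - 1) \<le> b0' * \<bar>u\<bar> powr \<iota>" using params by (intro mult_left_mono) auto
    then have "exp (- b0' * \<bar>u\<bar> powr \<iota>) \<le> exp (b0' + - b0' * \<bar>u\<bar>)" by (simp add: algebra_simps)
    then have "c0' * exp (- b0' * \<bar>u\<bar> powr \<iota>) \<le> c0' * (exp b0' * exp (- b0' * \<bar>u\<bar>))"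
      unfolding exp_add using params by (intro mult_left_mono) auto
    then have "h0 u \<le> c0' * exp b0' * exp (- b0' * \<bar>u\<bar>)" using h0_le[of u] by (simp only: mult.assoc)
    then have "ennreal (h0 u) \<le> ennreal (c0' * exp b0' * exp (- b0' * \<bar>u\<bar>))" by (rule ennreal_leI)
    then show "ennreal (h0 u) \<le> ennreal (c0' * exp b0') * ennreal (exp (- b0' * \<bar>u\<bar>))"
      by (simp only: ennreal_mult''[OF exp_ge_zero])
  qed
  also have "\<dots> = ennreal (c0' * exp b0') * (\<integral>\<^sup>+u. ennreal (exp (- b0' * \<bar>u\<bar>)) \<partial>lborel)"
    by (rule nn_integral_cmult) measurable
  also have "\<dots> = ennreal (c0' * exp b0') * ennreal (2 / b0')" by (simp only: nn_integral_exp_abs[OF params(2)])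
  also have "\<dots> < \<infinity>" by (simp add: ennreal_mult_less_top)
  finally show "emeasure H0 (space H0) \<noteq> \<infinity>" by simp
qed

interpretation H0: finite_measure H0 by (rule finite_H0)

lemma measure_H0_interval_ge:
  assumes "x \<le> y" "{x..<y} \<subseteq> {- T..T}"
  shows "(y - x) * (c0 * exp (- b0 * T powr \<iota>)) \<le> measure H0 {x..<y}"
proof -
  define q where "q = c0 * exp (- b0 * T powr \<iota>)"
  have q: "0 \<le> q" using params by (simp add: q_def)
  have "ennreal ((y - x) * q) = (\<integral>\<^sup>+u. ennreal q * indicator {x..<y} u \<partial>lborel)"
    using assms q by (subst nn_integral_cmult) (auto simp: ennreal_mult mult.commute)
  also have "\<dots> \<le> (\<integral>\<^sup>+u. ennreal (h0 u) * indicator {x..<y} u \<partial>lborel)"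
  proof (intro nn_integral_mono)
    fix u
    have "q \<le> h0 u" if "u \<in> {x..<y}"
    proof -
      have "u \<in> {- T..T}" using that assms by blast
      then have "\<bar>u\<bar> \<le> T" by auto
      then have "\<bar>u\<bar> powr \<iota> \<le> T powr \<iota>" using params by (intro powr_mono2) auto
      then have "q \<le> c0 * exp (- b0 * \<bar>u\<bar> powr \<iota>)" unfolding q_def using params by (intro mult_left_mono) auto
      then show ?thesis using h0_ge[of u] by linarith
    qed
    then show "ennreal q * indicator {x..<y} u \<le> ennreal (h0 u) * indicator {x..<y} u"
      by (auto intro: ennreal_leI split: split_indicator)
  qed
  also have "\<dots> = emeasure H0 {x..<y}" by (rule emeasure_density[symmetric]) auto
  finally show ?thesis unfolding H0.emeasure_eq_measure q_def by (subst (asm) ennreal_le_iff) auto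
qed

lemma measure_H0_interval_le:
  assumes "x \<le> y"
  shows "measure H0 {x..<y} \<le> (y - x) * c0'"
proof -
  have "emeasure H0 {x..<y} = (\<integral>\<^sup>+u. ennreal (h0 u) * indicator {x..<y} u \<partial>lborel)" by (rule emeasure_density) auto
  also have "\<dots> \<le> (\<integral>\<^sup>+u. ennreal c0' * indicator {x..<y} u \<partial>lborel)"
  proof (intro nn_integral_mono mult_right_mono ennreal_leI)
    fix u
    have "exp (- b0' * \<bar>u\<bar> powr \<iota>) \<le> 1" using params by simp
    then have "c0' * exp (- b0' * \<bar>u\<bar> powr \<iota>) \<le> c0' * 1" using params by (intro mult_left_mono) auto
    then show "h0 u \<le> c0'" using h0_le[of u] by linarith
  qed simp
  also have "\<dots> = ennreal ((y - x) * c0')"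
    using assms params by (subst nn_integral_cmult) (auto simp: ennreal_mult mult.commute)
  finally show ?thesis unfolding H0.emeasure_eq_measure using assms params by (subst (asm) ennreal_le_iff) auto
qed

lemma measure_H0_pos: "0 < measure H0 UNIV"
proof -
  have "0 < (1 - 0) * (c0 * exp (- b0 * 1 powr \<iota>))" using params by simp
  also have "\<dots> \<le> measure H0 {0..<1}" by (rule measure_H0_interval_ge) auto
  also have "\<dots> \<le> measure H0 UNIV" by (intro H0.finite_measure_mono) auto
  finally show ?thesis .
qed

text \<open>Beyond \<open>B\<close> the power satisfies \<open>\<bar>u\<bar> powr \<iota> \<ge> B
  powr (\<iota> - 1) * \<bar>u\<bar>\<close>, so the density decays exponentially at the rate
  \<open>b\<close> growing with \<open>B\<close>. Half of this rate dominates the factor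
  \<open>\<bar>u\<bar> - B\<close>.\<close>

lemma H0_tail_moment:
  assumes B: "1 \<le> B"
  shows "(\<integral>\<^sup>+u. ennreal (max 0 (\<bar>u\<bar> - B)) \<partial>H0) \<le> ennreal (8 * c0' / b0'\<^sup>2 * exp (- b0' * B powr \<iota> / 2))"
proof -
  define b where "b = b0' * B powr (\<iota> - 1)"
  have b: "b0' \<le> b" "0 < b"
  proof -
    have "1 \<le> B powr (\<iota> - 1)" using B params by (intro ge_one_powr_ge_zero) auto
    then show "b0' \<le> b" using params by (simp add: b_def)
    then show "0 < b" using params by simp
  qed
  have bB: "b * B = b0' * B powr \<iota>"
    using B powr_add[of B "\<iota> - 1" 1] by (simp add: b_def)
  have "(\<integral>\<^sup>+u. ennreal (max 0 (\<bar>u\<bar> - B)) \<partial>H0) = (\<integral>\<^sup>+u. ennreal (h0 u) * ennreal (max 0 (\<bar>u\<bar> - B)) \<partial>lborel)"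
    by (rule nn_integral_density) measurable
  also have "\<dots> \<le> (\<integral>\<^sup>+u. ennreal (2 * c0' / b * exp (- b * B / 2)) * ennreal (exp (- (b / 2) * \<bar>u\<bar>)) \<partial>lborel)"
  proof (rule nn_integral_mono)
    fix u
    have h0u: "0 \<le> h0 u" using h0_ge[of u] params by (meson exp_ge_zero less_imp_le mult_nonneg_nonneg order_trans)
    have "h0 u * max 0 (\<bar>u\<bar> - B) \<le> 2 * c0' / b * exp (- b * B / 2) * exp (- (b / 2) * \<bar>u\<bar>)"
    proof (cases "\<bar>u\<bar> \<le> B")
      case True
      then show ?thesis using params b by simp
    next
      case False
      then have "b * \<bar>u\<bar> \<le> b0' * \<bar>u\<bar> powr \<iota>"
      proof -
        have "B powr (\<iota> - 1) \<le> \<bar>u\<bar> powr (\<iota> - 1)" using False B params by (intro powr_mono2) auto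
        then have "b0' * B powr (\<iota> - 1) * \<bar>u\<bar> \<le> b0' * (\<bar>u\<bar> powr (\<iota> - 1)) * \<bar>u\<bar>" using params by (intro mult_right_mono mult_left_mono) auto
        also have "\<dots> = b0' * \<bar>u\<bar> powr \<iota>" using False B powr_add[of "\<bar>u\<bar>" "\<iota> - 1" 1] by simp
        finally show ?thesis by (simp add: b_def)
      qed
      then have "c0' * exp (- b0' * \<bar>u\<bar> powr \<iota>) \<le> c0' * exp (- b * \<bar>u\<bar>)" using params by (intro mult_left_mono) auto
      then have 1: "h0 u \<le> c0' * exp (- b * \<bar>u\<bar>)" using h0_le[of u] by linarith
      have "1 + b / 2 * (\<bar>u\<bar> - B) \<le> exp (b / 2 * (\<bar>u\<bar> - B))" by (rule exp_ge_add_one_self)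
      then have "b / 2 * (\<bar>u\<bar> - B) \<le> exp (b / 2 * (\<bar>u\<bar> - B))" by linarith
      then have 2: "max 0 (\<bar>u\<bar> - B) \<le> 2 / b * exp (b / 2 * (\<bar>u\<bar> - B))"
        using b False by (simp add: field_simps)
      have "h0 u * max 0 (\<bar>u\<bar> - B) \<le> c0' * exp (- b * \<bar>u\<bar>) * (2 / b * exp (b / 2 * (\<bar>u\<bar> - B)))"
        using 1 2 params by (intro mult_mono) auto
      also have "\<dots> = 2 * c0' / b * (exp (- b * \<bar>u\<bar>) * exp (b / 2 * (\<bar>u\<bar> - B)))" by simp
      also have "exp (- b * \<bar>u\<bar>) * exp (b / 2 * (\<bar>u\<bar> - B)) = exp (- b * B / 2) * exp (- (b / 2) * \<bar>u\<bar>)"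
        unfolding mult_exp_exp by (simp add: field_simps)
      finally show ?thesis by (simp only: mult.assoc)
    qed
    then have "ennreal (h0 u * max 0 (\<bar>u\<bar> - B)) \<le> ennreal (2 * c0' / b * exp (- b * B / 2) * exp (- (b / 2) * \<bar>u\<bar>))" by (rule ennreal_leI)
    then show "ennreal (h0 u) * ennreal (max 0 (\<bar>u\<bar> - B)) \<le> ennreal (2 * c0' / b * exp (- b * B / 2)) * ennreal (exp (- (b / 2) * \<bar>u\<bar>))"
      by (simp only: ennreal_mult'[OF h0u] ennreal_mult''[OF exp_ge_zero])
  qed
  also have "\<dots> = ennreal (2 * c0' / b * exp (- b * B / 2)) * (\<integral>\<^sup>+u. ennreal (exp (- (b / 2) * \<bar>u\<bar>)) \<partial>lborel)"
    by (rule nn_integral_cmult) measurable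
  also have "(\<integral>\<^sup>+u. ennreal (exp (- (b / 2) * \<bar>u\<bar>)) \<partial>lborel) = ennreal (2 / (b / 2))" using b by (intro nn_integral_exp_abs) simp
  also have "ennreal (2 * c0' / b * exp (- b * B / 2)) * ennreal (2 / (b / 2)) = ennreal (2 * c0' / b * exp (- b * B / 2) * (2 / (b / 2)))"
    using b params by (intro ennreal_mult[symmetric]) auto
  also have "\<dots> \<le> ennreal (8 * c0' / b0'\<^sup>2 * exp (- b0' * B powr \<iota> / 2))"
  proof (rule ennreal_leI)
    have eq: "2 * c0' / b * exp (- b * B / 2) * (2 / (b / 2)) = 8 * c0' / b\<^sup>2 * exp (- (b * B) / 2)"
      using b by (simp add: power2_eq_square)
    have "8 * c0' / b\<^sup>2 \<le> 8 * c0' / b0'\<^sup>2"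
      using b params by (intro divide_left_mono power_mono) auto
    then have "8 * c0' / b\<^sup>2 * exp (- (b * B) / 2) \<le> 8 * c0' / b0'\<^sup>2 * exp (- (b * B) / 2)" by (intro mult_right_mono) auto
    then show "2 * c0' / b * exp (- b * B / 2) * (2 / (b / 2)) \<le> 8 * c0' / b0'\<^sup>2 * exp (- b0' * B powr \<iota> / 2)"
      unfolding eq bB by simp
  qed
  finally show ?thesis .
qed

end

text \<open>On \<open>[\<delta>, 2 * \<delta>]\<close> the lower bound of the density is smallest at
  the left end up to the power of \<open>\<sigma>\<close>, which is at least 1: both
  \<open>1 / \<sigma>\<close> and \<open>\<bar>ln \<sigma>\<bar>\<close> decrease on
  \<open>(0, 1]\<close>. The factor \<open>\<delta>\<close> is the length of the interval.\<close>

lemma bandwidth_prior_lower: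
  fixes pi_s :: "real \<Rightarrow> real"
  assumes S: "Pi_s = density (restrict_space lborel {0<..}) (\<lambda>\<sigma>. ennreal (pi_s \<sigma>))"
    and cont: "continuous_on {0<..} pi_s" and D1: "0 < D1" and s1: "0 \<le> s1" and t1: "0 \<le> t1"
    and low: "\<exists>C>0. \<forall>\<^sub>F \<sigma> in at_right 0. \<sigma> powr (- s1) * exp (- D1 * (1 / \<sigma>) * \<bar>ln \<sigma>\<bar> powr t1) \<le> C * pi_s \<sigma>"
  shows "\<exists>c>0. \<exists>\<delta>0>0. \<forall>\<delta>. 0 < \<delta> \<longrightarrow> \<delta> < \<delta>0 \<longrightarrow>
    ennreal (c * \<delta> * exp (- D1 / \<delta> * \<bar>ln \<delta>\<bar> powr t1)) \<le> emeasure Pi_s {\<delta>..2 * \<delta>}"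
proof -
  obtain C where C: "0 < C" and ev: "\<forall>\<^sub>F \<sigma> in at_right 0. \<sigma> powr (- s1) * exp (- D1 * (1 / \<sigma>) * \<bar>ln \<sigma>\<bar> powr t1) \<le> C * pi_s \<sigma>"
    using low by blast
  obtain r where r: "0 < r" "\<And>\<sigma>. 0 < \<sigma> \<Longrightarrow> \<sigma> < r \<Longrightarrow> \<sigma> powr (- s1) * exp (- D1 * (1 / \<sigma>) * \<bar>ln \<sigma>\<bar> powr t1) \<le> C * pi_s \<sigma>"
    using ev unfolding eventually_at_right_field by auto
  have pim [measurable]: "pi_s \<in> borel_measurable (restrict_space borel {0<..})"
    by (rule borel_measurable_continuous_on_restrict[OF cont])
  \<comment> \<open>Keeps all of \<open>[\<delta>, 2 * \<delta>]\<close> below \<open>r\<close>,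
    where the prior bound is valid, and below 1, where \<open>\<bar>ln \<sigma>\<bar>\<close> is
    monotone.\<close>
  define \<delta>0 where "\<delta>0 = min (r / 2) (1 / 2)"
  have "ennreal (1 / C * \<delta> * exp (- D1 / \<delta> * \<bar>ln \<delta>\<bar> powr t1)) \<le> emeasure Pi_s {\<delta>..2 * \<delta>}" if \<delta>: "0 < \<delta>" "\<delta> < \<delta>0" for \<delta>
  proof -
    define q where "q = 1 / C * exp (- D1 / \<delta> * \<bar>ln \<delta>\<bar> powr t1)"
    have q: "0 \<le> q" using C by (simp add: q_def)
    have point: "q \<le> pi_s \<sigma>" if \<sigma>: "\<delta> \<le> \<sigma>" "\<sigma> \<le> 2 * \<delta>" for \<sigma>
    proof -
      have \<sigma>1: "0 < \<sigma>" "\<sigma> < r" "\<sigma> \<le> 1" using \<sigma> \<delta> by (auto simp: \<delta>0_def)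
      have "1 \<le> \<sigma> powr (- s1)"
        using \<sigma>1 s1 powr_mono2'[of "- s1" \<sigma> 1] by simp
      moreover have "exp (- D1 / \<delta> * \<bar>ln \<delta>\<bar> powr t1) \<le> exp (- D1 * (1 / \<sigma>) * \<bar>ln \<sigma>\<bar> powr t1)"
      proof -
        have "ln \<delta> \<le> ln \<sigma>" "ln \<sigma> \<le> 0" using \<sigma> \<sigma>1 \<delta> by (auto simp: ln_le_zero_iff)
        then have "\<bar>ln \<sigma>\<bar> powr t1 \<le> \<bar>ln \<delta>\<bar> powr t1" using t1 by (intro powr_mono2) auto
        moreover have "D1 / \<sigma> \<le> D1 / \<delta>" using \<sigma> \<sigma>1 \<delta> D1 by (intro divide_left_mono mult_pos_pos) auto
        ultimately have "D1 / \<sigma> * \<bar>ln \<sigma>\<bar> powr t1 \<le> D1 / \<delta> * \<bar>ln \<delta>\<bar> powr t1"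
          using D1 \<delta> by (intro mult_mono) auto
        then show ?thesis by simp
      qed
      ultimately have "1 * exp (- D1 / \<delta> * \<bar>ln \<delta>\<bar> powr t1) \<le> \<sigma> powr (- s1) * exp (- D1 * (1 / \<sigma>) * \<bar>ln \<sigma>\<bar> powr t1)"
        by (intro mult_mono) auto
      also have "\<dots> \<le> C * pi_s \<sigma>" by (rule r(2)) (use \<sigma>1 in auto)
      finally show ?thesis using C by (simp add: q_def field_simps)
    qed
    have "ennreal (1 / C * \<delta> * exp (- D1 / \<delta> * \<bar>ln \<delta>\<bar> powr t1)) = ennreal (q * \<delta>)" by (simp add: q_def mult_ac)
    also have "\<dots> = (\<integral>\<^sup>+\<sigma>. ennreal q * indicator {\<delta>..2 * \<delta>} \<sigma> \<partial>lborel)"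
      using q \<delta> by (subst nn_integral_cmult) (auto simp: ennreal_mult)
    also have "\<dots> = (\<integral>\<^sup>+\<sigma>. ennreal q * indicator {\<delta>..2 * \<delta>} \<sigma> \<partial>restrict_space lborel {0<..})"
      using \<delta> by (subst nn_integral_restrict_space) (auto intro!: nn_integral_cong split: split_indicator)
    also have "\<dots> \<le> (\<integral>\<^sup>+\<sigma>. ennreal (pi_s \<sigma>) * indicator {\<delta>..2 * \<delta>} \<sigma> \<partial>restrict_space lborel {0<..})"
      using point by (intro nn_integral_mono) (auto intro: ennreal_leI split: split_indicator)
    also have "\<dots> = emeasure Pi_s {\<delta>..2 * \<delta>}"
      unfolding S
    proof (rule emeasure_density[symmetric])
      show "(\<lambda>\<sigma>. ennreal (pi_s \<sigma>)) \<in> borel_measurable (restrict_space lborel {0<..})"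
      proof -
        have "sets (restrict_space lborel {0::real<..}) = sets (restrict_space borel {0<..})"
          by (rule sets_restrict_space_cong) simp
        moreover have "(\<lambda>\<sigma>. ennreal (pi_s \<sigma>)) \<in> borel_measurable (restrict_space borel {0<..})"
          by measurable
        ultimately show ?thesis using measurable_cong_sets[OF _ refl] by blast
      qed
      show "{\<delta>..2 * \<delta>} \<in> sets (restrict_space lborel {0<..})"
        using \<delta> by (subst sets_restrict_space_iff) auto
    qed
    finally show ?thesis .
  qed
  moreover have "0 < \<delta>0" "0 < 1 / C" using r C by (auto simp: \<delta>0_def)
  ultimately show ?thesis by blast
qed

section \<open>The posterior of the deconvolution model\<close>

locale deconvolution =
  light_tailed_density f0X C C0 + base_density h0 b0 b0' c0 c0' \<iota>
  for f0X h0 :: "real \<Rightarrow> real" and C C0 b0 b0' c0 c0' \<iota> :: real +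
  fixes D :: "real measure measure" and Pi_s :: "real measure"
  assumes D: "is_dirichlet_process H0 D"
    and prob_Pi_s: "prob_space Pi_s" and sets_Pi_s: "sets Pi_s = sets (restrict_space borel {0<..})"
begin

interpretation S: prob_space Pi_s by (rule prob_Pi_s)

lemma prob_D: "prob_space D" and sets_D: "sets D = sets (prob_algebra borel)"
  using D by (auto simp: is_dirichlet_process_def)

interpretation D: prob_space D by (rule prob_D)

lemma space_D: "H \<in> space D \<longleftrightarrow> prob_space H \<and> sets H = sets borel"
  using sets_eq_imp_space_eq[OF sets_D] by (auto simp: space_prob_algebra)

lemma space_Pi_s: "space Pi_s = {0<..}"
  using sets_eq_imp_space_eq[OF sets_Pi_s] by (simp add: space_restrict_space)

definition \<Omega> :: "(real measure \<times> real) measure" where "\<Omega> = D \<Otimes>\<^sub>M Pi_s"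

definition kern :: "real measure \<times> real \<Rightarrow> real measure" where "kern = (\<lambda>(H, \<sigma>). gauss \<sigma> \<star> H)"

definition fm :: "real measure \<times> real \<Rightarrow> real \<Rightarrow> real" where "fm \<theta> = obs_density (kern \<theta>)"

lemma space_\<Omega>: "(H, \<sigma>) \<in> space \<Omega> \<longleftrightarrow> prob_space H \<and> sets H = sets borel \<and> 0 < \<sigma>"
  by (auto simp: \<Omega>_def space_pair_measure space_D space_Pi_s)

lemma prob_\<Omega>: "prob_space \<Omega>"
  unfolding \<Omega>_def by (rule prob_space_pair[OF prob_D prob_Pi_s])

lemma kern_measurable [measurable]: "kern \<in> \<Omega> \<rightarrow>\<^sub>M prob_algebra borel"
  unfolding kern_def \<Omega>_def by (rule convolution_measurable[OF sets_D sets_Pi_s])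

lemma kern_prob: "\<theta> \<in> space \<Omega> \<Longrightarrow> prob_space (kern \<theta>)" "\<theta> \<in> space \<Omega> \<Longrightarrow> sets (kern \<theta>) = sets borel"
  using measurable_space[OF kern_measurable] by (auto simp: space_prob_algebra)

lemma f0_total: "(\<integral>\<^sup>+y. ennreal (f0 y) \<partial>lborel) = 1"
  using obs_density_total[OF finite_\<mu>0 sets_\<mu>0] prob_space.emeasure_space_1[OF prob_\<mu>0] by simp

sublocale model: dominated_model \<Omega> fm f0
proof (rule dominated_model.intro[OF prob_\<Omega>], unfold_locales)
  show "case_prod fm \<in> borel_measurable (\<Omega> \<Otimes>\<^sub>M borel)"
  proof -
    have "case_prod fm = (\<lambda>(\<theta>, y). obs_density (kern \<theta>) y)" by (simp add: fun_eq_iff fm_def)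
    then show ?thesis using obs_density_jointly_measurable[OF kern_measurable] by (simp only:)
  qed
  fix \<theta> assume \<theta>: "\<theta> \<in> space \<Omega>"
  interpret K: prob_space "kern \<theta>" by (rule kern_prob(1)[OF \<theta>])
  have one: "emeasure (kern \<theta>) UNIV = 1"
    using K.emeasure_space_1 sets_eq_imp_space_eq[OF kern_prob(2)[OF \<theta>]] by simp
  show "0 < fm \<theta> y" for y
    unfolding fm_def using one by (intro obs_density_pos K.finite_measure_axioms kern_prob(2)[OF \<theta>]) simp
  show "(\<integral>\<^sup>+y. ennreal (fm \<theta> y) \<partial>lborel) = 1"
    unfolding fm_def obs_density_total[OF K.finite_measure_axioms kern_prob(2)[OF \<theta>]] by (rule one)
qed (simp_all add: f0_pos f0_total)

lemma mixture_prior_eq: "mixture_prior D Pi_s = distr \<Omega> (prob_algebra borel) kern"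
  by (simp add: mixture_prior_def \<Omega>_def kern_def)

text \<open>Dividing numerator and denominator of the posterior by the likelihood of \<open>f0\<close>.\<close>

lemma posterior_exceeds:
  assumes W: "W \<in> sets (prob_algebra borel)" and y: "y \<in> space (model.P0n n)" and d: "0 < d"
    and gt: "d < measure (posterior (mixture_prior D Pi_s) n y) W"
  shows "ennreal d * (\<integral>\<^sup>+\<theta>. model.lr n \<theta> y \<partial>\<Omega>) < (\<integral>\<^sup>+\<theta>. model.lr n \<theta> y * indicator (kern -` W \<inter> space \<Omega>) \<theta> \<partial>\<Omega>)"
proof -
  let ?Q = "mixture_prior D Pi_s"
  define lik where "lik \<mu> = (\<Prod>i<n. obs_density \<mu> (y i))" for \<mu>
  define F where "F = (\<Prod>i<n. f0 (y i))"
  have F: "0 < F" unfolding F_def by (intro prod_pos) (simp add: f0_pos)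
  have [measurable]: "lik \<in> borel_measurable (prob_algebra borel)"
    unfolding lik_def
  proof (rule borel_measurable_prod)
    fix i
    have "(\<lambda>\<mu>. (\<mu>, y i)) \<in> prob_algebra borel \<rightarrow>\<^sub>M prob_algebra borel \<Otimes>\<^sub>M borel" by measurable
    from measurable_compose[OF this obs_density_jointly_measurable[of "\<lambda>\<mu>. \<mu>" "prob_algebra borel"]]
    show "(\<lambda>\<mu>. obs_density \<mu> (y i)) \<in> borel_measurable (prob_algebra borel)" by simp
  qed
  have lik_pos: "0 < lik (kern \<theta>)" if "\<theta> \<in> space \<Omega>" for \<theta>
    unfolding lik_def using model.f_pos[OF that] by (intro prod_pos) (simp add: fm_def)
  have lik_le: "lik (kern \<theta>) \<le> 1" if "\<theta> \<in> space \<Omega>" for \<theta>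
    unfolding lik_def
  proof (intro prod_le_1)
    fix i
    show "0 \<le> obs_density (kern \<theta>) (y i) \<and> obs_density (kern \<theta>) (y i) \<le> 1"
      using model.f_pos[OF that, of "y i"] obs_density_le_half[OF kern_prob[OF that], of "y i"] by (simp add: fm_def)
  qed
  define Z where "Z = (\<integral>\<nu>. lik \<nu> \<partial>?Q)"
  have Z_eq: "Z = (\<integral>\<theta>. lik (kern \<theta>) \<partial>\<Omega>)"
    unfolding Z_def mixture_prior_eq by (rule integral_distr) measurable
  have int: "integrable \<Omega> (\<lambda>\<theta>. lik (kern \<theta>))"
    using lik_pos lik_le by (intro model.integrable_const_bound[where B=1]) (auto intro!: AE_I2 simp: abs_of_pos)
  have Z0: "0 \<le> Z" unfolding Z_eq using lik_pos by (intro integral_nonneg_AE AE_I2) (auto simp: less_imp_le)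
  have lr_lik: "ennreal (lik (kern \<theta>)) = ennreal F * model.lr n \<theta> y" if \<theta>: "\<theta> \<in> space \<Omega>" for \<theta>
  proof -
    have "model.lr n \<theta> y = ennreal (\<Prod>i<n. fm \<theta> (y i) / f0 (y i))"
      unfolding model.lr_def using model.f_pos[OF \<theta>] f0_pos by (intro prod_ennreal) (auto simp: less_imp_le)
    also have "(\<Prod>i<n. fm \<theta> (y i) / f0 (y i)) = lik (kern \<theta>) / F"
      by (simp add: prod_dividef lik_def F_def fm_def)
    finally show ?thesis using F lik_pos[OF \<theta>] by (simp flip: ennreal_mult)
  qed
  note [measurable] = model.lr_measurable_fst[OF y]
  have ZF: "ennreal Z = ennreal F * (\<integral>\<^sup>+\<theta>. model.lr n \<theta> y \<partial>\<Omega>)"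
  proof -
    have "ennreal Z = (\<integral>\<^sup>+\<theta>. ennreal (lik (kern \<theta>)) \<partial>\<Omega>)"
      unfolding Z_eq using lik_pos by (intro nn_integral_eq_integral[symmetric] int AE_I2) (auto simp: less_imp_le)
    also have "\<dots> = (\<integral>\<^sup>+\<theta>. ennreal F * model.lr n \<theta> y \<partial>\<Omega>)" by (intro nn_integral_cong lr_lik)
    also have "\<dots> = ennreal F * (\<integral>\<^sup>+\<theta>. model.lr n \<theta> y \<partial>\<Omega>)" by (rule nn_integral_cmult) measurable
    finally show ?thesis .
  qed
  let ?P = "posterior ?Q n y"
  let ?I = "\<integral>\<^sup>+\<theta>. model.lr n \<theta> y * indicator (kern -` W \<inter> space \<Omega>) \<theta> \<partial>\<Omega>"
  have "emeasure ?P W = (\<integral>\<^sup>+\<mu>. ennreal (lik \<mu> / Z) * indicator W \<mu> \<partial>?Q)"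
    unfolding posterior_def lik_def[symmetric] Z_def[symmetric]
    using W by (intro emeasure_density) (auto simp: mixture_prior_eq)
  also have "\<dots> = (\<integral>\<^sup>+\<theta>. ennreal (lik (kern \<theta>) / Z) * indicator W (kern \<theta>) \<partial>\<Omega>)"
    unfolding mixture_prior_eq using W by (intro nn_integral_distr) auto
  also have "\<dots> = (\<integral>\<^sup>+\<theta>. ennreal (F / Z) * (model.lr n \<theta> y * indicator (kern -` W \<inter> space \<Omega>) \<theta>) \<partial>\<Omega>)"
  proof (rule nn_integral_cong)
    fix \<theta> assume \<theta>: "\<theta> \<in> space \<Omega>"
    have "ennreal (lik (kern \<theta>) / Z) = ennreal (1 / Z) * ennreal (lik (kern \<theta>))"
      using Z0 lik_pos[OF \<theta>] by (simp flip: ennreal_mult)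
    also have "\<dots> = ennreal (F / Z) * model.lr n \<theta> y"
      unfolding lr_lik[OF \<theta>] mult.assoc[symmetric] using F Z0 by (simp flip: ennreal_mult)
    finally show "ennreal (lik (kern \<theta>) / Z) * indicator W (kern \<theta>) = ennreal (F / Z) * (model.lr n \<theta> y * indicator (kern -` W \<inter> space \<Omega>) \<theta>)"
      using \<theta> by (auto split: split_indicator)
  qed
  also have "\<dots> = ennreal (F / Z) * ?I"
    using W by (intro nn_integral_cmult borel_measurable_times_ennreal borel_measurable_indicator measurable_sets[OF kern_measurable]) measurable
  finally have P: "emeasure ?P W = ennreal (F / Z) * ?I" .
  \<comment> \<open>A vanishing normalising constant would make the factor \<open>F / Z\<close> zero
    by the convention for division, hence the posterior mass zero, against
    \<open>gt\<close>.\<close>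
  have Zp: "0 < Z"
  proof (rule ccontr)
    assume "\<not> 0 < Z"
    then have "Z = 0" using Z0 by simp
    then show False using P gt d by (simp add: measure_def)
  qed
  have fin: "emeasure ?P W \<noteq> \<top>" using gt d unfolding measure_def by (intro notI) simp
  have "ennreal d < emeasure ?P W"
    using gt d fin by (subst emeasure_eq_ennreal_measure) (auto intro: ennreal_lessI)
  then have lt: "ennreal d < ennreal (F / Z) * ?I" unfolding P .
  have "ennreal (Z / F) * ennreal d < ennreal (Z / F) * (ennreal (F / Z) * ?I)"
    using lt F Zp by (intro ennreal_mult_strict_left_mono) auto
  also have "\<dots> = ?I" using F Zp by (simp flip: mult.assoc ennreal_mult)
  finally have 1: "ennreal (Z / F) * ennreal d < ?I" .
  have "ennreal (Z / F) = ennreal (1 / F) * ennreal Z" using F Z0 by (simp flip: ennreal_mult)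
  also have "\<dots> = (\<integral>\<^sup>+\<theta>. model.lr n \<theta> y \<partial>\<Omega>)" unfolding ZF mult.assoc[symmetric] using F by (simp flip: ennreal_mult)
  finally show ?thesis using 1 by (simp add: mult.commute)
qed

text \<open>The abstract bound is translated to the posterior on laws: the set \<open>W\<close> is
  pulled back along \<open>kern\<close>, and the probabilities of the test sets become integrals of
  densities.\<close>

lemma posterior_probability_bound:
  fixes \<A> :: "real set set" and W :: "real measure set"
  assumes B: "B \<in> sets \<Omega>" and b: "0 < measure \<Omega> B" and e: "0 < e" and d: "0 < d"
    and chi: "\<And>\<theta>. \<theta> \<in> B \<Longrightarrow> (\<integral>\<^sup>+y. ennreal ((f0 y)\<^sup>2 / fm \<theta> y) \<partial>lborel) \<le> ennreal (exp \<chi>')"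
    and A: "finite \<A>" "\<A> \<subseteq> sets borel" and \<epsilon>: "0 < \<epsilon>" "\<epsilon> \<le> 1" and V: "V \<in> sets \<Omega>"
    and cover: "\<And>\<theta>. \<theta> \<in> space \<Omega> \<Longrightarrow> kern \<theta> \<in> W \<Longrightarrow> \<theta> \<notin> V \<Longrightarrow>
      \<exists>A\<in>\<A>. (\<integral>y. fm \<theta> y * indicator A y \<partial>lborel) \<le> (\<integral>y. f0 y * indicator A y \<partial>lborel) - \<epsilon>"
  shows "measure (model.P0n n) {y \<in> space (model.P0n n). d < measure (posterior (mixture_prior D Pi_s) n y) W}
    \<le> e / measure \<Omega> B * exp (real n * \<chi>') + real (card \<A>) * exp (- (real n * \<epsilon>\<^sup>2 / 16))
      + (measure \<Omega> V + real (card \<A>) * exp (- (real n * \<epsilon>\<^sup>2 / 16))) / (d * e)"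
    (is "measure _ ?Y \<le> ?R")
proof (cases "W \<in> sets (prob_algebra borel)")
  \<comment> \<open>A set outside the sigma-algebra has \<open>measure\<close> 0 by convention, so
    the event is empty for \<open>d > 0\<close>.\<close>
  case False
  have "W \<notin> sets (posterior (mixture_prior D Pi_s) n y)" for y
    using False by (simp add: posterior_def mixture_prior_eq)
  then have Y: "?Y = {}" using d by (auto simp: measure_notin_sets)
  have "0 \<le> ?R" using e d b by (intro add_nonneg_nonneg divide_nonneg_nonneg mult_nonneg_nonneg) auto
  then show ?thesis unfolding Y by (simp only: measure_empty)
next
  case True
  define W' where "W' = kern -` W \<inter> space \<Omega>"
  have W': "W' \<in> sets \<Omega>" unfolding W'_def by (rule measurable_sets[OF kern_measurable True])
  have meas: "measure (density lborel (\<lambda>y. ennreal (g y))) A = (\<integral>y. g y * indicator A y \<partial>lborel)"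
    if "integrable lborel g" "\<And>y. 0 \<le> g y" "A \<in> sets borel" for g A
  proof -
    have [measurable]: "g \<in> borel_measurable borel" "A \<in> sets borel" using that by auto
    have "emeasure (density lborel (\<lambda>y. ennreal (g y))) A = (\<integral>\<^sup>+y. ennreal (g y) * indicator A y \<partial>lborel)"
      by (rule emeasure_density) auto
    also have "\<dots> = (\<integral>\<^sup>+y. ennreal (g y * indicator A y) \<partial>lborel)"
      by (intro nn_integral_cong) (auto split: split_indicator)
    also have "\<dots> = ennreal (\<integral>y. g y * indicator A y \<partial>lborel)"
      using that integrable_real_mult_indicator[OF _ that(1), of A] by (intro nn_integral_eq_integral) auto
    finally show ?thesis using that by (simp add: measure_def integral_nonneg_AE)
  qed
  have cov: "W' \<subseteq> V \<union> (\<Union>A\<in>\<A>. {\<theta> \<in> space \<Omega>. measure (model.P\<theta> \<theta>) A \<le> measure model.P0 A - \<epsilon>})"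
  proof
    fix \<theta> assume "\<theta> \<in> W'"
    then have \<theta>: "\<theta> \<in> space \<Omega>" "kern \<theta> \<in> W" by (auto simp: W'_def)
    note K = prob_space.finite_measure[OF kern_prob(1)[OF \<theta>(1)]] kern_prob(2)[OF \<theta>(1)]
    show "\<theta> \<in> V \<union> (\<Union>A\<in>\<A>. {\<theta> \<in> space \<Omega>. measure (model.P\<theta> \<theta>) A \<le> measure model.P0 A - \<epsilon>})"
    proof (cases "\<theta> \<in> V")
      case False
      then obtain A where A': "A \<in> \<A>" "(\<integral>y. fm \<theta> y * indicator A y \<partial>lborel) \<le> (\<integral>y. f0 y * indicator A y \<partial>lborel) - \<epsilon>"
        using cover[OF \<theta>] by blast
      have As: "A \<in> sets borel" using A A' by auto
      have "measure (model.P\<theta> \<theta>) A = (\<integral>y. fm \<theta> y * indicator A y \<partial>lborel)"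
        unfolding model.P\<theta>_def fm_def by (rule meas[OF obs_density_integrable[OF K] obs_density_nonneg[OF K] As])
      moreover have "measure model.P0 A = (\<integral>y. f0 y * indicator A y \<partial>lborel)"
        unfolding model.P0_def
        by (rule meas[OF obs_density_integrable[OF finite_\<mu>0 sets_\<mu>0] obs_density_nonneg[OF finite_\<mu>0 sets_\<mu>0] As])
      ultimately have "measure (model.P\<theta> \<theta>) A \<le> measure model.P0 A - \<epsilon>" using A'(2) by linarith
      then show ?thesis using A'(1) \<theta>(1) by blast
    qed simp
  qed
  interpret P0n: prob_space "model.P0n n" by (rule model.prob_space_P0n)
  have "measure (model.P0n n) ?Y \<le> measure (model.P0n n) {y \<in> space (model.P0n n).
      ennreal d * (\<integral>\<^sup>+\<theta>. model.lr n \<theta> y \<partial>\<Omega>) < (\<integral>\<^sup>+\<theta>. model.lr n \<theta> y * indicator W' \<theta> \<partial>\<Omega>)}"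
  proof (rule P0n.finite_measure_mono)
    show "?Y \<subseteq> {y \<in> space (model.P0n n). ennreal d * (\<integral>\<^sup>+\<theta>. model.lr n \<theta> y \<partial>\<Omega>) < (\<integral>\<^sup>+\<theta>. model.lr n \<theta> y * indicator W' \<theta> \<partial>\<Omega>)}"
      using posterior_exceeds[OF True _ d] by (auto simp: W'_def)
    note [measurable] = W'
    interpret pair_sigma_finite \<Omega> "model.P0n n" by (rule model.pair_sigma_finite_P0n)
    show "{y \<in> space (model.P0n n). ennreal d * (\<integral>\<^sup>+\<theta>. model.lr n \<theta> y \<partial>\<Omega>) < (\<integral>\<^sup>+\<theta>. model.lr n \<theta> y * indicator W' \<theta> \<partial>\<Omega>)} \<in> sets (model.P0n n)"
      by measurable
  qed
  also have "\<dots> \<le> ?R"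
    using A by (intro model.posterior_mass_bound[OF B b e d chi A(1) _ \<epsilon> V W' cov]) auto
  finally show ?thesis .
qed


interpretation H0: finite_measure H0 by (rule finite_H0)

definition A0 :: real where "A0 = measure H0 UNIV"

definition K0 :: real where "K0 = 4 * C3 + 8 * exp 2 * C2"

text \<open>Coefficient of \<open>\<delta> ^ 4\<close> in the chi-square bound: one part from the
  squared approximation error, and 2 from the mass that may lie outside the spots.\<close>

definition \<kappa>0 :: real where "\<kappa>0 = 4 * K0\<^sup>2 / f0 0 + 2"

lemma A0_pos: "0 < A0" unfolding A0_def by (rule measure_H0_pos)

lemma C3_pos: "0 < C3"
  unfolding C3_def using C1_pos C_pos by (intro add_pos_pos mult_pos_pos) auto

lemma \<kappa>0_pos: "0 < \<kappa>0"
  unfolding \<kappa>0_def using f0_pos[of 0] by (intro add_nonneg_pos) auto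

lemma spot_in_interval:
  assumes "0 < \<delta>" "\<delta> \<le> 1" "real N * \<delta> = 2 * T" "k < 2 * N"
  shows "spot (- T) \<delta> (\<delta>\<^sup>2 / 2) k \<subseteq> {- T..T}"
proof -
  have \<rho>: "0 < \<delta>\<^sup>2 / 2" "2 * (\<delta>\<^sup>2 / 2) \<le> \<delta>" using assms by (auto simp: power2_eq_square mult_left_le)
  have "spot (- T) \<delta> (\<delta>\<^sup>2 / 2) k \<subseteq> cell (- T) \<delta> (k div 2)" by (rule spot_subset_cell[OF \<rho>])
  also have "\<dots> \<subseteq> (\<Union>i<N. cell (- T) \<delta> i)" using assms(4) by (intro UN_upper) auto
  also have "\<dots> = {- T..<- T + real N * \<delta>}" by (rule UN_cells[OF assms(1)])
  also have "\<dots> \<subseteq> {- T..T}" using assms(3) by auto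
  finally show ?thesis .
qed

lemma spot_measure_H0:
  assumes "0 < \<delta>" "\<delta> \<le> 1" "real N * \<delta> = 2 * T" "k < 2 * N"
  shows "\<delta>\<^sup>2 / 2 * (c0 * exp (- b0 * T powr \<iota>)) \<le> measure H0 (spot (- T) \<delta> (\<delta>\<^sup>2 / 2) k)"
    "measure H0 (spot (- T) \<delta> (\<delta>\<^sup>2 / 2) k) \<le> \<delta>\<^sup>2 / 2 * c0'"
proof -
  define x where "x = (if even k then anchor (- T) \<delta> k else anchor (- T) \<delta> k - \<delta>\<^sup>2 / 2)"
  have eq: "spot (- T) \<delta> (\<delta>\<^sup>2 / 2) k = {x..<x + \<delta>\<^sup>2 / 2}" by (simp add: spot_def x_def)
  have sub: "{x..<x + \<delta>\<^sup>2 / 2} \<subseteq> {- T..T}" using spot_in_interval[OF assms] unfolding eq .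
  show "\<delta>\<^sup>2 / 2 * (c0 * exp (- b0 * T powr \<iota>)) \<le> measure H0 (spot (- T) \<delta> (\<delta>\<^sup>2 / 2) k)"
    using measure_H0_interval_ge[OF _ sub] by (simp add: eq)
  show "measure H0 (spot (- T) \<delta> (\<delta>\<^sup>2 / 2) k) \<le> \<delta>\<^sup>2 / 2 * c0'"
    using measure_H0_interval_le[of x "x + \<delta>\<^sup>2 / 2"] by (simp add: eq)
qed

text \<open>The neighbourhood is a product of a box for the spot masses and the band
  \<open>[\<delta>, 2 * \<delta>]\<close> for the bandwidth. The slack is chosen so that
  \<open>(2 * N + 1) * \<eta> = \<delta> ^ 4 * exp (- T)\<close>: the factor
  \<open>exp (- T)\<close> compensates the growth of the kernels at remote anchors, and the fourth
  power is needed because missing mass enters the chi-square distance linearly, unlike the pointwise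
  error, which is squared.\<close>

theorem prior_mass:
  fixes N :: nat and \<delta> T G sm :: real
  assumes \<delta>: "0 < \<delta>" "2 * \<delta> \<le> 1" and T: "0 \<le> T" "real N * \<delta> = 2 * T" and tail: "exp (- C0 * T) \<le> \<delta>\<^sup>2"
    and small: "(2 * C1 + 1) * \<delta>\<^sup>2 \<le> 1 / 2" "K0 * \<delta>\<^sup>2 \<le> f0 0 / 2" "c0' * \<delta>\<^sup>2 \<le> 2" "2 * c0' * T * \<delta> \<le> A0 / 2"
    and G: "\<And>a. A0 / 2 \<le> a \<Longrightarrow> a \<le> A0 \<Longrightarrow> Gamma a \<le> G"
    and sm: "ennreal sm \<le> emeasure Pi_s {\<delta>..2 * \<delta>}" "0 \<le> sm"
  defines "\<eta> \<equiv> \<delta> ^ 4 * exp (- T) / real (Suc (2 * N))"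
    and "\<alpha> \<equiv> \<delta>\<^sup>2 / 2 * (c0 * exp (- b0 * T powr \<iota>))"
  shows "\<exists>B\<in>sets \<Omega>. (\<forall>\<theta>\<in>B. (\<integral>\<^sup>+y. ennreal ((f0 y)\<^sup>2 / fm \<theta> y) \<partial>lborel) \<le> ennreal (exp (\<kappa>0 * \<delta> ^ 4))) \<and>
    (\<alpha> * exp (-2) / 2 * \<eta>) ^ (2 * N) * ((\<eta> / 2) powr (A0 + 1) * exp (-1) / G) * sm \<le> measure \<Omega> B"
proof -
  have \<delta>1: "\<delta> \<le> 1" using \<delta> by simp
  have \<delta>2: "0 < \<delta>\<^sup>2" "\<delta>\<^sup>2 \<le> 1" "\<delta> ^ 4 \<le> \<delta>\<^sup>2" "\<delta> ^ 4 \<le> 1"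
    using \<delta>(1) \<delta>1 power_le_one[of \<delta> 2] power_le_one[of \<delta> 4] power_decreasing[of 2 4 \<delta>] by auto
  define \<rho> where "\<rho> = \<delta>\<^sup>2 / 2"
  have \<rho>: "0 < \<rho>" "2 * \<rho> \<le> \<delta>" using \<delta> \<delta>1 by (auto simp: \<rho>_def power2_eq_square mult_left_le)
  define V where "V k = spot (- T) \<delta> \<rho> k" for k
  define w where "w k = node_weight (- T) \<delta> k" for k
  define s where "s = (\<Sum>k<2 * N. w k)"
  note ctx = \<delta>(1) \<delta>1 refl[of "- T"] T tail
  have s: "1 / 2 \<le> s" "s \<le> 1"
    using node_weight_sum[OF ctx] small(1) by (auto simp: s_def w_def)
  have w0: "0 \<le> w k" for k unfolding w_def by (rule node_weight_nonneg[OF ctx])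
  define M where "M = real (Suc (2 * N)) * \<eta>"
  have M: "M = \<delta> ^ 4 * exp (- T)" by (simp add: M_def \<eta>_def)
  have eT: "exp (- T) \<le> 1" using T by simp
  have M_le: "M \<le> \<delta> ^ 4" unfolding M using eT \<delta> by (simp add: mult_left_le)
  have \<eta>0: "0 < \<eta>" using \<delta> by (simp add: \<eta>_def)
  have \<eta>1: "\<eta> \<le> 1"
  proof -
    have "1 * \<eta> \<le> M" unfolding M_def using \<eta>0 by (intro mult_right_mono) auto
    then show ?thesis using M_le \<delta>2 by simp
  qed
  have MT: "M * exp T \<le> \<delta>\<^sup>2"
  proof -
    have "M * exp T = \<delta> ^ 4 * (exp (- T) * exp T)" by (simp add: M)
    then show ?thesis using \<delta>2 by (simp add: mult_exp_exp)
  qed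
  have \<alpha>0: "0 < \<alpha>" using \<delta> params by (simp add: \<alpha>_def)
  have V_H0: "\<alpha> \<le> measure H0 (V k) \<and> measure H0 (V k) \<le> 1" if "k < 2 * N" for k
    using spot_measure_H0[OF \<delta>(1) \<delta>1 T(2) that] small(3) unfolding V_def \<rho>_def \<alpha>_def by (simp add: mult.commute)
  have V_sets: "V k \<in> sets borel" for k by (simp add: V_def spot_sets)
  have V_disj: "disjoint_family_on V {..<2 * N}" using disjoint_spots[OF \<rho>] by (simp add: V_def[abs_def])
  define R where "R = - (\<Union>k<2 * N. V k)"
  have UV: "(\<Union>k<2 * N. V k) \<in> sets borel" using V_sets by (intro sets.finite_UN) auto
  \<comment> \<open>The spots together occupy at most half of the base mass, so the shape of the
    remaining cell stays in a compact interval of positive numbers, where \<open>Gamma\<close> is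
    bounded by \<open>G\<close>.\<close>
  have R_H0: "A0 / 2 \<le> measure H0 R" "measure H0 R \<le> A0"
  proof -
    have "measure H0 (\<Union>k<2 * N. V k) = (\<Sum>k<2 * N. measure H0 (V k))"
      by (rule H0.finite_measure_finite_Union) (auto simp: V_sets V_disj)
    also have "\<dots> \<le> (\<Sum>k<2 * N. \<delta>\<^sup>2 / 2 * c0')"
      using spot_measure_H0(2)[OF \<delta>(1) \<delta>1 T(2)] by (intro sum_mono) (auto simp: V_def \<rho>_def)
    also have "\<dots> = (real N * \<delta>) * \<delta> * c0'" by (simp add: power2_eq_square)
    also have "\<dots> \<le> A0 / 2" unfolding T(2) using small(4) by (simp add: mult_ac)
    finally have "measure H0 (\<Union>k<2 * N. V k) \<le> A0 / 2" .
    moreover have "measure H0 R = A0 - measure H0 (\<Union>k<2 * N. V k)"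
      using H0.finite_measure_compl[of "\<Union>k<2 * N. V k"] UV by (simp add: R_def A0_def Compl_eq_Diff_UNIV)
    ultimately show "A0 / 2 \<le> measure H0 R" by simp
    show "measure H0 R \<le> A0" unfolding A0_def using UV by (intro H0.finite_measure_mono) (auto simp: R_def)
  qed
  define Bx where "Bx = {P \<in> space D. \<forall>k<2 * N. w k / (s + real (Suc (2 * N)) * \<eta>) \<le> measure P (V k) \<and> measure P (V k) \<le> (w k + \<eta>) / s}"
  have R0: "0 < measure H0 R" "Gamma (measure H0 R) \<le> G" using R_H0 A0_pos G by auto
  have Bx: "Bx \<in> sets D"
    "ennreal ((\<alpha> * exp (-2) / 2 * \<eta>) ^ (2 * N) * ((\<eta> / 2) powr (A0 + 1) * exp (-1) / G)) \<le> emeasure D Bx"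
    unfolding Bx_def A0_def
    by (rule dirichlet_process_box[OF D finite_H0 _ V_sets V_disj \<alpha>0 V_H0 R0[unfolded R_def] w0 s_def _ s(2) \<eta>0 \<eta>1]; use s in simp)+
  define B where "B = Bx \<times> {\<delta>..2 * \<delta>}"
  have I: "{\<delta>..2 * \<delta>} \<in> sets Pi_s"
    unfolding sets_Pi_s using \<delta> by (subst sets_restrict_space_iff) auto
  have B: "B \<in> sets \<Omega>" unfolding B_def \<Omega>_def using Bx(1) I by simp
  define q where "q = (\<alpha> * exp (-2) / 2 * \<eta>) ^ (2 * N) * ((\<eta> / 2) powr (A0 + 1) * exp (-1) / G)"
  have G0: "0 < G" using R0 Gamma_real_pos[of "measure H0 R"] by linarith
  have q0: "0 \<le> q" unfolding q_def using \<alpha>0 \<eta>0 G0 by simp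
  have "ennreal (q * sm) \<le> emeasure D Bx * emeasure Pi_s {\<delta>..2 * \<delta>}"
    unfolding ennreal_mult[OF q0 sm(2)] using Bx(2) sm(1) by (intro mult_mono) (auto simp: q_def)
  also have "\<dots> = emeasure \<Omega> B"
    unfolding B_def \<Omega>_def by (rule S.emeasure_pair_measure_Times[symmetric, OF Bx(1) I])
  finally have "q * sm \<le> measure \<Omega> B"
    unfolding model.emeasure_eq_measure by (subst (asm) ennreal_le_iff) auto
  moreover have "(\<integral>\<^sup>+y. ennreal ((f0 y)\<^sup>2 / fm \<theta> y) \<partial>lborel) \<le> ennreal (exp (\<kappa>0 * \<delta> ^ 4))" if "\<theta> \<in> B" for \<theta>
  proof -
    obtain H \<sigma> where \<theta>: "\<theta> = (H, \<sigma>)" "H \<in> Bx" "\<delta> \<le> \<sigma>" "\<sigma> \<le> 2 * \<delta>" using \<open>\<theta> \<in> B\<close> by (auto simp: B_def)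
    have H: "prob_space H" "sets H = sets borel" using \<theta>(2) by (auto simp: Bx_def space_D)
    have box: "node_weight (- T) \<delta> k / (s + real (Suc (2 * N)) * \<eta>) \<le> measure H (spot (- T) \<delta> (\<delta>\<^sup>2 / 2) k)
       \<and> measure H (spot (- T) \<delta> (\<delta>\<^sup>2 / 2) k) \<le> (node_weight (- T) \<delta> k + \<eta>) / s" if "k < 2 * N" for k
      using \<theta>(2) that by (auto simp: Bx_def w_def V_def \<rho>_def)
    have s': "s = (\<Sum>k<2 * N. node_weight (- T) \<delta> k)" by (simp add: s_def w_def)
    let ?U = "\<Union>k<2 * N. spot (- T) \<delta> (\<delta>\<^sup>2 / 2) k"
    have approx: "\<bar>(\<integral>z. indicator ?U z * laplace_density (y - z) \<partial>H) - f0 y\<bar> \<le> C3 * \<delta>\<^sup>2 * exp (- \<bar>y\<bar>)" for y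
      by (rule spots_approximation[OF ctx H \<eta>0 MT[unfolded M_def] s' s(1) box])
    have mass: "1 - 2 * M \<le> measure H ?U"
      unfolding M_def by (rule spots_mass[OF ctx H \<eta>0 s' s(1)]) (use box in blast)
    have U: "?U \<in> sets borel" by (intro sets.finite_UN spot_sets) auto
    have "(\<integral>\<^sup>+y. ennreal ((f0 y)\<^sup>2 / fm \<theta> y) \<partial>lborel) \<le> ennreal (1 + (4 * K0\<^sup>2 / f0 0 * \<delta> ^ 4 + 2 * M))"
      unfolding fm_def kern_def \<theta>(1) case_prod_conv
      by (rule chi_square_bound[OF H U \<delta> \<theta>(3,4) C3_pos approx mass K0_def small(2)])
    also have "\<dots> \<le> ennreal (exp (\<kappa>0 * \<delta> ^ 4))"
    proof (rule ennreal_leI)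
      have "1 + (4 * K0\<^sup>2 / f0 0 * \<delta> ^ 4 + 2 * M) \<le> 1 + \<kappa>0 * \<delta> ^ 4"
        using M_le by (simp add: \<kappa>0_def distrib_right)
      also have "\<dots> \<le> exp (\<kappa>0 * \<delta> ^ 4)" by (rule exp_ge_add_one_self)
      finally show "1 + (4 * K0\<^sup>2 / f0 0 * \<delta> ^ 4 + 2 * M) \<le> exp (\<kappa>0 * \<delta> ^ 4)" .
    qed
    finally show ?thesis .
  qed
  ultimately show ?thesis using B unfolding q_def by blast
qed

text \<open>The part of the parameter space that is discarded by prior mass alone. Locations are
  restricted through a first moment beyond \<open>B\<close>, not by a compact support, which a draw
  from a Dirichlet process with full support would not have.\<close>

definition remote :: "real \<Rightarrow> real \<Rightarrow> real \<Rightarrow> (real measure \<times> real) set" where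
  "remote r B v = {\<theta> \<in> space \<Omega>. r < snd \<theta>} \<union> {\<theta> \<in> space \<Omega>. ennreal v < (\<integral>\<^sup>+z. ennreal (max 0 (\<bar>z\<bar> - B)) \<partial>fst \<theta>)}"

text \<open>For the locations, Markov's inequality is applied to the random tail moment, whose mean
  is at most the tail moment of the normalised base measure.\<close>

lemma remote_mass:
  assumes B: "1 \<le> B" and v: "0 < v" and r: "0 \<le> r"
  shows "remote r B v \<in> sets \<Omega>"
    "measure \<Omega> (remote r B v) \<le> measure Pi_s {r<..} + 1 / v * (1 / A0 * (8 * c0' / b0'\<^sup>2 * exp (- b0' * B powr \<iota> / 2)))"
proof -
  let ?g = "\<lambda>H. \<integral>\<^sup>+z. ennreal (max 0 (\<bar>z\<bar> - B)) \<partial>H"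
  have g: "?g \<in> borel_measurable D"
  proof -
    have "?g \<in> borel_measurable (subprob_algebra borel)" by (intro nn_integral_measurable_subprob_algebra) measurable
    moreover have "(\<lambda>H. H) \<in> D \<rightarrow>\<^sub>M subprob_algebra borel"
      unfolding measurable_cong_sets[OF sets_D refl] by (rule measurable_prob_algebraD) simp
    ultimately show ?thesis by (rule measurable_compose[rotated])
  qed
  define V1 where "V1 = {\<theta> \<in> space \<Omega>. r < snd \<theta>}"
  define V2 where "V2 = {\<theta> \<in> space \<Omega>. ennreal v < ?g (fst \<theta>)}"
  have R: "{r<..} \<in> sets Pi_s"
    unfolding sets_Pi_s using r by (subst sets_restrict_space_iff) auto
  have V1: "V1 = space D \<times> {r<..}"
    unfolding V1_def \<Omega>_def using r by (auto simp: space_pair_measure space_Pi_s)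
  have V1s: "V1 \<in> sets \<Omega>" unfolding V1 \<Omega>_def using R by simp
  have gf: "(\<lambda>\<theta>. ?g (fst \<theta>)) \<in> borel_measurable \<Omega>"
    unfolding \<Omega>_def by (rule measurable_compose[OF measurable_fst g])
  have V2s: "V2 \<in> sets \<Omega>" unfolding V2_def using gf by measurable
  show "remote r B v \<in> sets \<Omega>" using V1s V2s by (simp add: remote_def V1_def V2_def)
  have m1: "measure \<Omega> V1 = measure Pi_s {r<..}"
  proof -
    have "emeasure \<Omega> V1 = emeasure D (space D) * emeasure Pi_s {r<..}"
      unfolding V1 \<Omega>_def by (rule S.emeasure_pair_measure_Times[OF sets.top R])
    then show ?thesis by (simp add: D.emeasure_space_1 measure_def)
  qed
  have m2: "measure \<Omega> V2 \<le> 1 / v * (1 / A0 * (8 * c0' / b0'\<^sup>2 * exp (- b0' * B powr \<iota> / 2)))"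
  proof -
    define x where "x = 8 * c0' / b0'\<^sup>2 * exp (- b0' * B powr \<iota> / 2)"
    have x: "0 \<le> x" using params by (simp add: x_def)
    have "emeasure \<Omega> V2 = (\<integral>\<^sup>+\<theta>. indicator V2 \<theta> \<partial>\<Omega>)" using V2s by simp
    also have "\<dots> \<le> (\<integral>\<^sup>+\<theta>. ennreal (1 / v) * ?g (fst \<theta>) \<partial>\<Omega>)"
    proof (rule nn_integral_mono)
      fix \<theta>
      show "indicator V2 \<theta> \<le> ennreal (1 / v) * ?g (fst \<theta>)"
      proof (cases "\<theta> \<in> V2")
        case True
        have "1 = ennreal (1 / v) * ennreal v" using v by (simp flip: ennreal_mult)
        also have "\<dots> \<le> ennreal (1 / v) * ?g (fst \<theta>)" using True by (intro mult_left_mono) (auto simp: V2_def less_imp_le)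
        finally show ?thesis using True by simp
      qed simp
    qed
    also have "\<dots> = ennreal (1 / v) * (\<integral>\<^sup>+\<theta>. ?g (fst \<theta>) \<partial>\<Omega>)" by (rule nn_integral_cmult[OF gf])
    also have "(\<integral>\<^sup>+\<theta>. ?g (fst \<theta>) \<partial>\<Omega>) = (\<integral>\<^sup>+H. (\<integral>\<^sup>+\<sigma>. ?g (fst (H, \<sigma>)) \<partial>Pi_s) \<partial>D)"
      unfolding \<Omega>_def using gf[unfolded \<Omega>_def] by (rule S.nn_integral_fst[symmetric])
    also have "\<dots> = (\<integral>\<^sup>+H. ?g H \<partial>D)" by (simp add: S.emeasure_space_1)
    also have "\<dots> \<le> ennreal (1 / A0) * ?g H0"
      unfolding A0_def by (intro dirichlet_process_nn_integral_le[OF D finite_H0 _ measure_H0_pos]) auto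
    also have "\<dots> \<le> ennreal (1 / A0) * ennreal x"
      unfolding x_def by (intro mult_left_mono H0_tail_moment B) auto
    finally have "emeasure \<Omega> V2 \<le> ennreal (1 / v) * (ennreal (1 / A0) * ennreal x)" by (simp add: mult_left_mono)
    also have "\<dots> = ennreal (1 / v * (1 / A0 * x))" using v A0_pos x by (simp flip: ennreal_mult)
    finally have le: "emeasure \<Omega> V2 \<le> ennreal (1 / v * (1 / A0 * x))" .
    have nonneg: "0 \<le> 1 / v * (1 / A0 * x)" using v A0_pos x by simp
    show ?thesis using le unfolding model.emeasure_eq_measure ennreal_le_iff[OF nonneg] by (simp only: x_def)
  qed
  have "measure \<Omega> (remote r B v) \<le> measure \<Omega> V1 + measure \<Omega> V2"
    unfolding remote_def V1_def[symmetric] V2_def[symmetric] by (rule measure_Un_le[OF V1s V2s])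
  then show "measure \<Omega> (remote r B v) \<le> measure Pi_s {r<..} + 1 / v * (1 / A0 * (8 * c0' / b0'\<^sup>2 * exp (- b0' * B powr \<iota> / 2)))"
    using m1 m2 by linarith
qed

lemma f0_outside_le:
  assumes T: "0 \<le> T" shows "(\<integral>y. f0 y * indicator (- {- T..<T}) y \<partial>lborel) \<le> 2 * C1 * exp (- T)"
proof -
  have int: "integrable lborel (\<lambda>y. f0 y * indicator (- {- T..<T}) y)"
    using integrable_real_mult_indicator[OF _ obs_density_integrable[OF finite_\<mu>0 sets_\<mu>0], of "- {- T..<T}"] by simp
  have "ennreal (\<integral>y. f0 y * indicator (- {- T..<T}) y \<partial>lborel) = (\<integral>\<^sup>+y. ennreal (f0 y * indicator (- {- T..<T}) y) \<partial>lborel)"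
    using f0_pos by (intro nn_integral_eq_integral[symmetric] int AE_I2) (auto simp: less_imp_le)
  also have "\<dots> \<le> (\<integral>\<^sup>+y. ennreal C1 * (ennreal (exp (- 1 * \<bar>y\<bar>)) * indicator {T..} \<bar>y\<bar>) \<partial>lborel)"
  proof (rule nn_integral_mono)
    fix y
    have "ennreal (f0 y) \<le> ennreal C1 * ennreal (exp (- 1 * \<bar>y\<bar>))"
      unfolding ennreal_mult''[OF exp_ge_zero, symmetric] using f0_le[of y] by (intro ennreal_leI) simp
    then show "ennreal (f0 y * indicator (- {- T..<T}) y) \<le> ennreal C1 * (ennreal (exp (- 1 * \<bar>y\<bar>)) * indicator {T..} \<bar>y\<bar>)"
      by (auto split: split_indicator)
  qed
  also have "\<dots> = ennreal C1 * (\<integral>\<^sup>+y. ennreal (exp (- 1 * \<bar>y\<bar>)) * indicator {T..} \<bar>y\<bar> \<partial>lborel)"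
    by (rule nn_integral_cmult) measurable
  also have "\<dots> = ennreal C1 * ennreal (2 * exp (- 1 * T) / 1)" by (simp only: nn_integral_exp_abs_tail[OF zero_less_one T])
  also have "\<dots> = ennreal (2 * C1 * exp (- T))" using C1_pos by (subst ennreal_mult[symmetric]) (auto simp: mult_ac)
  finally show ?thesis using C1_pos by (subst (asm) ennreal_le_iff) auto
qed

text \<open>The cover of the bad set is found by contraposition: a parameter outside the remote part
  that none of the test sets separates from \<open>f0\<close> by more than \<open>\<epsilon>\<close>
  has \<open>L\<^sup>1\<close> error at most \<open>e1\<close>, hence Wasserstein distance at most
  \<open>\<omega>\<close>.\<close>

theorem posterior_wasserstein_bound:
  fixes N n :: nat and \<delta> T \<epsilon> r Bt v h \<omega> d e :: real
  assumes \<delta>: "0 < \<delta>" "\<delta> \<le> 1" and T: "0 \<le> T" "real N * \<delta> = 2 * T" and \<epsilon>: "0 < \<epsilon>" "\<epsilon> \<le> 1"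
    and Bt: "1 \<le> Bt" and v: "0 < v" and r: "0 < r" and h: "0 < h" "h \<le> 1" and d: "0 < d" and e: "0 < e"
    and B: "B \<in> sets \<Omega>" "0 < measure \<Omega> B"
    and chi: "\<And>\<theta>. \<theta> \<in> B \<Longrightarrow> (\<integral>\<^sup>+y. ennreal ((f0 y)\<^sup>2 / fm \<theta> y) \<partial>lborel) \<le> ennreal (exp \<chi>')"
  defines "e1 \<equiv> 2 * \<epsilon> + 4 * (2 * T + 2) * \<delta>\<^sup>2 + 4 * C1 * exp (- T)"
  assumes \<omega>: "2 * h + 24 * Bt * e1 + 8 * (v + 4 * r * exp (- Bt / r) + (8 + 2 * C1) * exp (- Bt / 2)) + 6 / h * e1 \<le> \<omega>"
  defines "E \<equiv> real ((nat \<lfloor>1 / \<delta>\<^sup>2\<rfloor> + 1) ^ (N + 1)) * exp (- (real n * \<epsilon>\<^sup>2 / 16))"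
  shows "measure (model.P0n n) {y \<in> space (model.P0n n).
      d < measure (posterior (mixture_prior D Pi_s) n y) {\<mu> \<in> space (prob_algebra borel). ennreal \<omega> < wasserstein1 \<mu> \<mu>0}}
    \<le> e / measure \<Omega> B * exp (real n * \<chi>') + E + (measure \<Omega> (remote r Bt v) + E) / (d * e)"
proof -
  have f0int: "integrable lborel f0" by (rule obs_density_integrable[OF finite_\<mu>0 sets_\<mu>0])
  have "ennreal (\<integral>y. f0 y \<partial>lborel) = 1"
    using nn_integral_eq_integral[OF f0int] f0_pos f0_total by (simp add: less_imp_le)
  then have f0one: "(\<integral>y. f0 y \<partial>lborel) = 1" using ennreal_eq_1 by metis
  obtain \<A> where \<A>: "finite \<A>" "card \<A> \<le> (nat \<lfloor>1 / \<delta>\<^sup>2\<rfloor> + 1) ^ (N + 1)" "\<A> \<subseteq> sets borel"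
    and test: "\<And>\<mu>. prob_space \<mu> \<Longrightarrow> sets \<mu> = sets borel \<Longrightarrow>
      (\<forall>A\<in>\<A>. (\<integral>y. f0 y * indicator A y \<partial>lborel) - (\<integral>y. obs_density \<mu> y * indicator A y \<partial>lborel) \<le> \<epsilon>) \<Longrightarrow>
      (\<integral>y. \<bar>obs_density \<mu> y - f0 y\<bar> \<partial>lborel)
        \<le> 2 * \<epsilon> + 4 * (real N * \<delta> + 2) * \<delta>\<^sup>2 + 2 * (\<integral>y. f0 y * indicator (- {- T..<- T + real N * \<delta>}) y \<partial>lborel)"
    using test_sets_exist[OF f0int less_imp_le[OF f0_pos] f0one \<delta>, of N \<epsilon> "- T"]
    by (elim exE conjE) (rule that; (assumption | (drule spec, drule (1) mp, drule (1) mp, erule (1) mp)))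
  have I: "- T + real N * \<delta> = T" using T by simp
  have "measure (model.P0n n) {y \<in> space (model.P0n n).
      d < measure (posterior (mixture_prior D Pi_s) n y) {\<mu> \<in> space (prob_algebra borel). ennreal \<omega> < wasserstein1 \<mu> \<mu>0}}
    \<le> e / measure \<Omega> B * exp (real n * \<chi>') + real (card \<A>) * exp (- (real n * \<epsilon>\<^sup>2 / 16))
      + (measure \<Omega> (remote r Bt v) + real (card \<A>) * exp (- (real n * \<epsilon>\<^sup>2 / 16))) / (d * e)"
  proof (rule posterior_probability_bound[OF B e d chi \<A>(1,3) \<epsilon> remote_mass(1)[OF Bt v less_imp_le[OF r]]])
    fix \<theta> assume \<theta>: "\<theta> \<in> space \<Omega>" "\<theta> \<notin> remote r Bt v"
      and far: "kern \<theta> \<in> {\<mu> \<in> space (prob_algebra borel). ennreal \<omega> < wasserstein1 \<mu> \<mu>0}"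
    obtain H \<sigma> where \<theta>_eq: "\<theta> = (H, \<sigma>)" by (cases \<theta>)
    have H: "prob_space H" "sets H = sets borel" "0 < \<sigma>" using \<theta>(1) by (auto simp: \<theta>_eq space_\<Omega>)
    have \<sigma>: "\<sigma> \<le> r" and tail: "(\<integral>\<^sup>+z. ennreal (max 0 (\<bar>z\<bar> - Bt)) \<partial>H) \<le> ennreal v"
      using \<theta> by (auto simp: remote_def \<theta>_eq not_less)
    have kern: "kern \<theta> = (gauss \<sigma> \<star> H)" by (simp add: kern_def \<theta>_eq)
    show "\<exists>A\<in>\<A>. (\<integral>y. fm \<theta> y * indicator A y \<partial>lborel) \<le> (\<integral>y. f0 y * indicator A y \<partial>lborel) - \<epsilon>"
    proof (rule ccontr)
      assume "\<not> ?thesis"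
      then have "\<forall>A\<in>\<A>. (\<integral>y. f0 y * indicator A y \<partial>lborel) - (\<integral>y. obs_density (kern \<theta>) y * indicator A y \<partial>lborel) \<le> \<epsilon>"
        unfolding fm_def by (simp add: not_le algebra_simps less_imp_le)
      from test[OF kern_prob[OF \<theta>(1)] this]
      have "(\<integral>y. \<bar>obs_density (kern \<theta>) y - f0 y\<bar> \<partial>lborel)
        \<le> 2 * \<epsilon> + 4 * (real N * \<delta> + 2) * \<delta>\<^sup>2 + 2 * (\<integral>y. f0 y * indicator (- {- T..<T}) y \<partial>lborel)"
        unfolding I .
      then have L1: "(\<integral>y. \<bar>obs_density (gauss \<sigma> \<star> H) y - f0 y\<bar> \<partial>lborel) \<le> e1"
        using f0_outside_le[OF T(1)] unfolding e1_def T(2) kern by linarith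
      have e1: "0 \<le> e1" using \<epsilon> T C1_pos by (simp add: e1_def)
      have "wasserstein1 (gauss \<sigma> \<star> H) \<mu>0
        \<le> ennreal (2 * h + 24 * Bt * e1 + 8 * (v + 4 * \<sigma> * exp (- Bt / \<sigma>) + (8 + 2 * C1) * exp (- Bt / 2)) + 6 / h * e1)"
        using Bt v by (intro wasserstein1_bound H h L1 tail) auto
      also have "\<dots> \<le> ennreal \<omega>"
      proof (rule ennreal_leI)
        \<comment> \<open>The normal tail term increases with the bandwidth, so its value at the
          cutoff \<open>r\<close> serves all \<open>\<sigma> \<le> r\<close>.\<close>
        have "\<sigma> * exp (- Bt / \<sigma>) \<le> r * exp (- Bt / r)"
        proof (rule mult_mono)
          have "Bt / r \<le> Bt / \<sigma>" using \<sigma> H(3) Bt r by (intro divide_left_mono) auto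
          then show "exp (- Bt / \<sigma>) \<le> exp (- Bt / r)" by simp
        qed (use \<sigma> r in auto)
        then show "2 * h + 24 * Bt * e1 + 8 * (v + 4 * \<sigma> * exp (- Bt / \<sigma>) + (8 + 2 * C1) * exp (- Bt / 2)) + 6 / h * e1 \<le> \<omega>"
          by (intro order_trans[OF _ \<omega>] add_mono mult_left_mono order_refl) (simp_all add: mult.assoc)
      qed
      finally show False using far unfolding kern by (blast dest: leD)
    qed
  qed
  also have "\<dots> \<le> e / measure \<Omega> B * exp (real n * \<chi>') + E + (measure \<Omega> (remote r Bt v) + E) / (d * e)"
  proof -
    have "real (card \<A>) * exp (- (real n * \<epsilon>\<^sup>2 / 16)) \<le> E"
      unfolding E_def using \<A>(2) by (intro mult_right_mono of_nat_mono) auto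
    then show ?thesis using d e by (intro add_mono divide_right_mono) auto
  qed
  finally show ?thesis .
qed

end

section \<open>The contraction rate\<close>

lemma log_powr_negligible:
  fixes q s :: real assumes "0 < q" "0 < s" shows "((\<lambda>r. (5 * ln r) powr q / r powr s) \<longlongrightarrow> 0) at_top"
  using assms by real_asymp

lemma eventually_scaled_le:
  fixes g :: "'a \<Rightarrow> real"
  assumes "(g \<longlongrightarrow> 0) F" "0 < b" shows "\<forall>\<^sub>F x in F. c * g x \<le> b"
proof -
  have "((\<lambda>x. c * g x) \<longlongrightarrow> 0) F" using assms(1) by (rule tendsto_mult_right_zero)
  then show ?thesis using assms(2) by (auto dest!: order_tendstoD(2) elim: eventually_mono)
qed

lemma exp_five_ln: "0 < r \<Longrightarrow> exp (5 * ln r) = r ^ 5" for r :: real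
  using exp_of_nat_mult[of 5 "ln r"] by simp

text \<open>Here \<open>L\<close> stands for \<open>ln n\<close>, and every factor polynomial in
  \<open>n\<close> costs a multiple of \<open>L\<close> in the exponent. There are about
  \<open>r * L\<close> spots, each costing up to \<open>L powr \<iota>\<close> through the base
  density at distance \<open>T\<close>, and the bandwidth costs \<open>r * L powr t1\<close>; the
  exponent \<open>p = \<iota> + 1 + t1\<close> dominates all of this.\<close>

lemma prior_mass_exponent:
  fixes \<delta> T L r \<tau> b0 c0 \<iota> t1 A D1 G sm p :: real and N :: nat
  assumes L: "3 \<le> L" and r: "1 \<le> r" and \<tau>: "1 \<le> \<tau>" and T: "T = \<tau> * L" and b0: "0 < b0" and \<iota>: "1 < \<iota>" and t1: "0 \<le> t1"
    and A: "0 \<le> A" and D1: "0 < D1" and \<delta>: "exp (- L) \<le> \<delta>" and c0: "exp (- L) \<le> c0"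
    and N: "real (2 * N) \<le> 8 * \<tau> * L * r" "real (Suc (2 * N)) \<le> exp L"
    and G: "0 < G" "G \<le> exp (L - 1)" and sm: "exp (- (2 * L + 2 * D1 * r * L powr t1)) \<le> sm"
    and p: "p = \<iota> + 1 + t1"
  defines "\<eta> \<equiv> \<delta> ^ 4 * exp (- T) / real (Suc (2 * N))"
    and "\<alpha> \<equiv> \<delta>\<^sup>2 / 2 * (c0 * exp (- b0 * T powr \<iota>))"
    and "Cb \<equiv> 8 * \<tau> * (10 + \<tau> + b0 * \<tau> powr \<iota>) + (6 + \<tau>) * (A + 1) + 3 + 2 * D1"
  shows "exp (- (Cb * (r * L powr p))) \<le> (\<alpha> * exp (-2) / 2 * \<eta>) ^ (2 * N) * ((\<eta> / 2) powr (A + 1) * exp (-1) / G) * sm"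
proof -
  define b where "b = b0 * \<tau> powr \<iota>"
  \<comment> \<open>The cost of one spot: \<open>4 * L\<close> plus the \<open>\<iota>\<close> term
    from \<open>\<alpha>\<close>, \<open>L\<close> from the numerical factor, and
    \<open>(5 + \<tau>) * L\<close> from \<open>\<eta>\<close>.\<close>
  define X where "X = (10 + \<tau>) * L + b * L powr \<iota>"
  define P where "P = L powr p"
  have b: "0 \<le> b" using b0 by (simp add: b_def)
  have Tp: "T powr \<iota> = \<tau> powr \<iota> * L powr \<iota>" using \<tau> L by (simp add: T powr_mult)
  have half: "exp (- L) \<le> 1 / 2"
  proof -
    have "2 \<le> exp L" using exp_ge_add_one_self[of L] L by linarith
    then show ?thesis by (simp add: exp_minus field_simps)
  qed
  have half2: "exp (- L) \<le> exp (-2) / 2"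
  proof -
    have "2 \<le> exp (L - 2)" using exp_ge_add_one_self[of "L - 2"] L by linarith
    then have "2 * exp (- L) \<le> exp (L - 2) * exp (- L)" by (intro mult_right_mono) auto
    then show ?thesis by (simp add: mult_exp_exp)
  qed
  have \<delta>0: "0 < \<delta>" using \<delta> exp_gt_zero[of "- L"] by linarith
  have d2: "exp (- (2 * L)) \<le> \<delta>\<^sup>2"
    using power_mono[OF \<delta>, of 2] exp_of_nat_mult[of 2 "- L"] by simp
  have d4: "exp (- (4 * L)) \<le> \<delta> ^ 4"
    using power_mono[OF \<delta>, of 4] exp_of_nat_mult[of 4 "- L"] by simp
  have "exp (- (2 * L)) * exp (- L) * (exp (- L) * exp (- (b * L powr \<iota>))) \<le> \<delta>\<^sup>2 * (1 / 2) * (c0 * exp (- (b * L powr \<iota>)))"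
    using c0 order_trans[OF exp_ge_zero c0] by (intro mult_mono d2 half order_refl) auto
  then have \<alpha>: "exp (- (4 * L + b * L powr \<iota>)) \<le> \<alpha>"
    unfolding \<alpha>_def Tp by (simp add: mult_exp_exp b_def mult_ac)
  have "exp (- (4 * L)) * exp (- T) * exp (- L) \<le> \<delta> ^ 4 * exp (- T) * (1 / real (Suc (2 * N)))"
  proof (intro mult_mono d4 order_refl)
    have "1 / exp L \<le> 1 / real (Suc (2 * N))" using N(2) by (intro divide_left_mono) auto
    then show "exp (- L) \<le> 1 / real (Suc (2 * N))" by (simp add: exp_minus inverse_eq_divide)
  qed auto
  then have \<eta>: "exp (- ((5 + \<tau>) * L)) \<le> \<eta>"
    unfolding \<eta>_def T by (simp add: mult_exp_exp algebra_simps)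
  have "exp (- ((5 + \<tau>) * L)) * exp (- L) \<le> \<eta> * (1 / 2)"
    using order_trans[OF exp_ge_zero \<eta>] by (intro mult_mono \<eta> half) auto
  then have \<eta>2: "exp (- ((6 + \<tau>) * L)) \<le> \<eta> / 2" by (simp add: mult_exp_exp algebra_simps)
  have "exp (- (4 * L + b * L powr \<iota>)) * exp (- L) * exp (- ((5 + \<tau>) * L)) \<le> \<alpha> * (exp (-2) / 2) * \<eta>"
    using order_trans[OF exp_ge_zero \<alpha>] by (intro mult_mono \<alpha> \<eta> half2) auto
  then have base: "exp (- X) \<le> \<alpha> * exp (-2) / 2 * \<eta>" by (simp add: mult_exp_exp X_def algebra_simps)
  have X0: "0 \<le> X" using \<tau> L b by (simp add: X_def)
  have f1: "exp (- (8 * \<tau> * L * r * X)) \<le> (\<alpha> * exp (-2) / 2 * \<eta>) ^ (2 * N)"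
  proof -
    have "exp (- (8 * \<tau> * L * r * X)) \<le> exp (- (real (2 * N) * X))" using mult_right_mono[OF N(1) X0] by simp
    also have "\<dots> = exp (- X) ^ (2 * N)" using exp_of_nat_mult[of "2 * N" "- X"] by simp
    also have "\<dots> \<le> (\<alpha> * exp (-2) / 2 * \<eta>) ^ (2 * N)" by (intro power_mono base) auto
    finally show ?thesis .
  qed
  have f2: "exp (- ((6 + \<tau>) * L * (A + 1))) \<le> (\<eta> / 2) powr (A + 1)"
  proof -
    have "exp (- ((6 + \<tau>) * L * (A + 1))) = exp (- ((6 + \<tau>) * L)) powr (A + 1)" by (simp add: exp_powr_real)
    also have "\<dots> \<le> (\<eta> / 2) powr (A + 1)" using A by (intro powr_mono2 \<eta>2) auto
    finally show ?thesis .
  qed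
  have f3: "exp (- L) \<le> exp (-1) / G"
  proof -
    have "exp (- L) = exp (-1) / exp (L - 1)" by (simp flip: exp_diff)
    also have "\<dots> \<le> exp (-1) / G" using G by (intro divide_left_mono) auto
    finally show ?thesis .
  qed
  have p2: "2 \<le> p" using p \<iota> t1 by simp
  have L1: "1 \<le> L" using L by simp
  have P1: "L * L \<le> P" using powr_mono[OF p2 L1] L by (simp add: P_def power2_eq_square)
  have P2: "L * L powr \<iota> \<le> P"
  proof -
    have "L * L powr \<iota> = L powr (1 + \<iota>)" using L by (simp add: powr_add)
    also have "\<dots> \<le> P" unfolding P_def using p t1 L1 by (intro powr_mono) auto
    finally show ?thesis .
  qed
  have P3: "L powr t1 \<le> P" unfolding P_def using p \<iota> L1 by (intro powr_mono) auto
  have P4: "L \<le> r * P"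
  proof -
    have "L * 1 \<le> L * L" using L by (intro mult_left_mono) auto
    then have "L \<le> P" using P1 by simp
    also have "\<dots> \<le> r * P" using r by (simp add: P_def mult_le_cancel_right1)
    finally show ?thesis .
  qed
  have e1: "8 * \<tau> * L * r * X \<le> 8 * \<tau> * (10 + \<tau> + b) * (r * P)"
  proof -
    have "8 * \<tau> * L * r * X = 8 * \<tau> * r * ((10 + \<tau>) * (L * L) + b * (L * L powr \<iota>))" by (simp add: X_def algebra_simps)
    also have "\<dots> \<le> 8 * \<tau> * r * ((10 + \<tau>) * P + b * P)"
      using \<tau> r b by (intro mult_left_mono add_mono P1 P2) auto
    finally show ?thesis by (simp add: algebra_simps)
  qed
  have e2: "(6 + \<tau>) * L * (A + 1) \<le> (6 + \<tau>) * (A + 1) * (r * P)"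
    using mult_left_mono[OF P4, of "(6 + \<tau>) * (A + 1)"] \<tau> A by (simp add: mult_ac)
  have e3: "2 * D1 * r * L powr t1 \<le> 2 * D1 * (r * P)"
    using mult_left_mono[OF P3, of "2 * D1 * r"] D1 r by (simp add: mult_ac)
  have "exp (- (Cb * (r * P))) \<le> exp (- (8 * \<tau> * L * r * X + (6 + \<tau>) * L * (A + 1) + L + (2 * L + 2 * D1 * r * L powr t1)))"
  proof -
    define Q where "Q = r * P"
    have "Cb * Q = 8 * \<tau> * (10 + \<tau> + b) * Q + (6 + \<tau>) * (A + 1) * Q + 3 * Q + 2 * D1 * Q"
      by (simp add: Cb_def b_def distrib_right)
    then show ?thesis using e1 e2 e3 P4 unfolding Q_def[symmetric] by simp
  qed
  also have "\<dots> = exp (- (8 * \<tau> * L * r * X)) * (exp (- ((6 + \<tau>) * L * (A + 1))) * exp (- L)) * exp (- (2 * L + 2 * D1 * r * L powr t1))"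
    by (simp add: mult_exp_exp)
  also have "\<dots> \<le> (\<alpha> * exp (-2) / 2 * \<eta>) ^ (2 * N) * ((\<eta> / 2) powr (A + 1) * (exp (-1) / G)) * sm"
    using order_trans[OF exp_ge_zero f1] G by (intro mult_mono f1 f2 f3 sm) (auto intro!: mult_nonneg_nonneg)
  finally show ?thesis by (simp add: P_def)
qed

context deconvolution
begin

text \<open>At level \<open>n\<close> the line is truncated to \<open>[-T, T]\<close> with \<open>T = \<tau>0 ln n\<close>, which makes both \<open>exp (- C0 T)\<close>
  and \<open>exp (- T)\<close> at most \<open>1 / n\<close>. With \<open>r = n powr (1 / 5)\<close> and \<open>p = \<iota> + 1 + t1\<close>, the prior mass is at least
  \<open>exp (- Cb r (ln n) powr p)\<close>, \<open>K1\<close> is chosen so that the tests beat the covering number and this mass,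
  and \<open>Ke\<close>, \<open>Kf\<close> are the resulting constants in \<open>L\<^sup>1\<close> and in \<open>W\<^sub>1\<close>.\<close>

definition \<tau>0 :: real where "\<tau>0 = 1 / C0 + 1"

definition Cb :: "real \<Rightarrow> real" where
  "Cb D1 = 8 * \<tau>0 * (10 + \<tau>0 + b0 * \<tau>0 powr \<iota>) + (6 + \<tau>0) * (A0 + 1) + 3 + 2 * D1"

definition K1 :: "real \<Rightarrow> real" where "K1 D1 = 4 * sqrt (4 * \<tau>0 + Cb D1 + \<kappa>0 + 2)"

definition Ke :: "real \<Rightarrow> real" where "Ke D1 = 2 * K1 D1 + 8 * \<tau>0 + 8 + 4 * C1"

definition Kf :: "real \<Rightarrow> real" where "Kf D1 = 2 + 24 * Ke D1 + 8 * (1 + 4 + (8 + 2 * C1)) + 6 * Ke D1"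

lemma \<tau>0_ge: "1 \<le> \<tau>0" using C0_pos by (simp add: \<tau>0_def)

lemma Cb_pos: assumes "0 < D1" shows "0 < Cb D1"
  unfolding Cb_def using assms \<tau>0_ge A0_pos params by (intro add_nonneg_pos add_nonneg_nonneg mult_nonneg_nonneg) auto

lemma K1_pos: assumes "0 < D1" shows "0 < K1 D1"
  using Cb_pos[OF assms] \<kappa>0_pos \<tau>0_ge by (simp add: K1_def)

lemma Ke_pos: assumes "0 < D1" shows "0 < Ke D1"
  using K1_pos[OF assms] C1_pos \<tau>0_ge by (simp add: Ke_def)

lemma Kf_pos: assumes "0 < D1" shows "0 < Kf D1"
  using Ke_pos[OF assms] C1_pos by (simp add: Kf_def)

text \<open>Rounding the number of cells up makes the grid fit \<open>[- T, T]\<close> exactly, and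
  the resulting width stays within a factor 2 of \<open>1 / r\<close>. The bound
  \<open>3 \<le> r\<close> ensures \<open>ln r \<ge> 1\<close>.\<close>

lemma sieve_grid:
  fixes r :: real
  assumes r: "3 \<le> r"
  defines "L \<equiv> 5 * ln r"
  defines "N \<equiv> nat \<lceil>2 * (\<tau>0 * L) * r\<rceil>"
  defines "\<delta> \<equiv> 2 * (\<tau>0 * L) / real N"
  shows "5 \<le> L" "real N * \<delta> = 2 * (\<tau>0 * L)" "1 / (2 * r) \<le> \<delta>" "\<delta> \<le> 1 / r" "real N + 1 \<le> 4 * \<tau>0 * L * r"
    "exp (- C0 * (\<tau>0 * L)) \<le> \<delta>\<^sup>2" "exp (- L) \<le> \<delta>"
proof -
  have "ln (exp 1) \<le> ln r" using r exp_le by (subst ln_le_cancel_iff) auto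
  then show L: "5 \<le> L" by (simp add: L_def)
  define x where "x = 2 * (\<tau>0 * L) * r"
  have TL: "1 * 5 \<le> \<tau>0 * L" using \<tau>0_ge L by (intro mult_mono) auto
  have x2: "2 \<le> x"
  proof -
    have "2 * 1 \<le> 2 * (\<tau>0 * L) * r" using TL r by (intro mult_mono) auto
    then show ?thesis by (simp add: x_def)
  qed
  have N: "x \<le> real N" "real N \<le> x + 1" unfolding N_def x_def[symmetric] using x2 by linarith+
  have N0: "0 < real N" using N(1) x2 by linarith
  show "real N * \<delta> = 2 * (\<tau>0 * L)" using N0 by (simp add: \<delta>_def)
  show "real N + 1 \<le> 4 * \<tau>0 * L * r" using N x2 by (simp add: x_def)
  have "2 * (\<tau>0 * L) / (2 * x) \<le> \<delta>" unfolding \<delta>_def using N x2 TL by (intro divide_left_mono) auto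
  then show lo: "1 / (2 * r) \<le> \<delta>" using TL r \<tau>0_ge L by (simp add: x_def)
  have "\<delta> \<le> 2 * (\<tau>0 * L) / x" unfolding \<delta>_def using N x2 TL by (intro divide_left_mono) auto
  then show "\<delta> \<le> 1 / r" using TL r \<tau>0_ge L by (simp add: x_def)
  have eL: "exp (- L) = 1 / r ^ 5" using r by (simp add: L_def exp_minus exp_five_ln inverse_eq_divide)
  have r3: "4 \<le> r ^ 3" using power_mono[OF r, of 3] by simp
  have "4 * r\<^sup>2 \<le> r ^ 3 * r\<^sup>2" using r3 by (intro mult_right_mono) auto
  then have "4 * r\<^sup>2 \<le> r ^ 5" by (simp flip: power_add)
  then have "1 / r ^ 5 \<le> 1 / (4 * r\<^sup>2)" using r by (intro divide_left_mono) auto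
  also have "\<dots> = (1 / (2 * r))\<^sup>2" by (simp add: power_divide power_mult_distrib)
  also have "\<dots> \<le> \<delta>\<^sup>2" using lo r by (intro power_mono) auto
  finally have eL2: "exp (- L) \<le> \<delta>\<^sup>2" unfolding eL .
  have "C0 * (\<tau>0 * L) = L + C0 * L" using C0_pos by (simp add: \<tau>0_def field_simps)
  then have "exp (- C0 * (\<tau>0 * L)) \<le> exp (- L)" using C0_pos L by simp
  then show "exp (- C0 * (\<tau>0 * L)) \<le> \<delta>\<^sup>2" using eL2 by linarith
  have "2 * r * 1 \<le> 4 * r * r" using r by (intro mult_mono) auto
  then have "2 * r \<le> r ^ 5" using \<open>4 * r\<^sup>2 \<le> r ^ 5\<close> by (simp add: power2_eq_square)
  then have "1 / r ^ 5 \<le> 1 / (2 * r)" using r by (intro divide_left_mono) auto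
  then show "exp (- L) \<le> \<delta>" using lo eL by linarith
qed

text \<open>The \<open>L\<^sup>1\<close> error \<open>e1\<close> is of order
  \<open>L powr (p / 2) / r\<^sup>2\<close>. The window \<open>1 / r\<close> turns it into order
  \<open>L powr (p / 2) / r\<close>, while the truncation at \<open>r * L\<close> brings one more
  logarithm; this gives the exponent \<open>p / 2 + 1\<close>. All remaining terms are powers of
  \<open>1 / n\<close> times at most \<open>r\<close>.\<close>

lemma rate_dominates:
  fixes r :: real
  assumes r: "3 \<le> r" and D1: "0 < D1" and p: "2 \<le> p"
  defines "L \<equiv> 5 * ln r"
  defines "\<delta> \<equiv> 2 * (\<tau>0 * L) / real (nat \<lceil>2 * (\<tau>0 * L) * r\<rceil>)"
  defines "e1 \<equiv> 2 * (K1 D1 * L powr (p / 2) / r\<^sup>2) + 4 * (2 * (\<tau>0 * L) + 2) * \<delta>\<^sup>2 + 4 * C1 * exp (- (\<tau>0 * L))"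
  shows "2 * (1 / r) + 24 * (r * L) * e1 + 8 * (1 / r ^ 5 + 4 * r * exp (- (r * L) / r) + (8 + 2 * C1) * exp (- (r * L) / 2)) + 6 / (1 / r) * e1
    \<le> Kf D1 * (1 / r) * L powr (p / 2 + 1)"
proof -
  note g = sieve_grid[OF r, folded L_def, folded \<delta>_def]
  define q where "q = 1 / r"
  define Q where "Q = L powr (p / 2)"
  have q: "0 < q" "q \<le> 1" using r by (auto simp: q_def)
  have eL: "exp (- L) = q ^ 5" using r by (simp add: L_def exp_minus exp_five_ln inverse_eq_divide q_def power_divide)
  have L1: "1 \<le> L" using g(1) by simp
  have QL: "L \<le> Q" using powr_mono[of 1 "p / 2" L] p L1 by (simp add: Q_def)
  have Q1: "1 \<le> Q" using QL L1 by simp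
  have QL': "L powr (p / 2 + 1) = Q * L" using L1 by (simp add: Q_def powr_add)
  have d: "0 \<le> \<delta>" using g(7) exp_ge_zero[of "- L"] by linarith
  have d2: "\<delta>\<^sup>2 \<le> q\<^sup>2" using g(4) d by (intro power_mono) (auto simp: q_def)
  have e1: "e1 \<le> Ke D1 * Q * q\<^sup>2"
  proof -
    have a: "4 * (2 * (\<tau>0 * L) + 2) * \<delta>\<^sup>2 \<le> 4 * (2 * (\<tau>0 * Q) + 2 * Q) * q\<^sup>2"
      using QL Q1 \<tau>0_ge L1 by (intro mult_mono d2 add_mono mult_left_mono) auto
    have "L \<le> \<tau>0 * L" using \<tau>0_ge L1 by (simp add: mult_le_cancel_right1)
    then have "exp (- (\<tau>0 * L)) \<le> q ^ 5" unfolding eL[symmetric] by simp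
    also have "\<dots> \<le> q\<^sup>2" using q by (intro power_decreasing) auto
    also have "\<dots> \<le> Q * q\<^sup>2" using Q1 by (simp add: mult_le_cancel_right1)
    finally have b: "4 * C1 * exp (- (\<tau>0 * L)) \<le> 4 * C1 * (Q * q\<^sup>2)" using C1_pos by (intro mult_left_mono) auto
    have c: "2 * (K1 D1 * L powr (p / 2) / r\<^sup>2) = 2 * K1 D1 * (Q * q\<^sup>2)" by (simp add: Q_def q_def power_divide)
    have "e1 \<le> 2 * K1 D1 * (Q * q\<^sup>2) + 4 * (2 * (\<tau>0 * Q) + 2 * Q) * q\<^sup>2 + 4 * C1 * (Q * q\<^sup>2)"
      unfolding e1_def using a b c by linarith
    also have "\<dots> = Ke D1 * Q * q\<^sup>2" by (simp add: Ke_def algebra_simps)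
    finally show ?thesis .
  qed
  have one: "q \<le> q * (Q * L)"
  proof -
    have "1 * 1 \<le> Q * L" using Q1 L1 by (intro mult_mono) auto
    then show ?thesis using q by (simp add: mult_le_cancel_left1)
  qed
  have rq: "r * q = 1" using r by (simp add: q_def)
  \<comment> \<open>This truncation term fixes the logarithmic exponent of the rate.\<close>
  have t2: "24 * (r * L) * e1 \<le> 24 * Ke D1 * (q * (Q * L))"
  proof -
    have "24 * (r * L) * e1 \<le> 24 * (r * L) * (Ke D1 * Q * q\<^sup>2)" using e1 r L1 by (intro mult_left_mono) auto
    also have "\<dots> = 24 * Ke D1 * (q * (Q * L)) * (r * q)" by (simp add: power2_eq_square)
    finally show ?thesis unfolding rq by simp
  qed
  have t6: "6 / (1 / r) * e1 \<le> 6 * Ke D1 * (q * (Q * L))"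
  proof -
    have "6 / (1 / r) * e1 \<le> 6 * r * (Ke D1 * Q * q\<^sup>2)" using e1 r by (simp add: mult.assoc)
    also have "\<dots> = 6 * Ke D1 * (q * Q) * (r * q)" by (simp add: power2_eq_square)
    also have "\<dots> = 6 * Ke D1 * (q * (Q * 1))" unfolding rq by simp
    also have "\<dots> \<le> 6 * Ke D1 * (q * (Q * L))" using L1 q Q1 Ke_pos[OF D1] by (intro mult_left_mono) auto
    finally show ?thesis .
  qed
  have t3: "1 / r ^ 5 \<le> q * (Q * L)"
  proof -
    have "q ^ 5 \<le> q ^ 1" using q by (intro power_decreasing) auto
    then show ?thesis using one by (simp add: q_def power_divide)
  qed
  have t4: "4 * r * exp (- (r * L) / r) \<le> 4 * (q * (Q * L))"
  proof -
    have "r * exp (- (r * L) / r) = (r * q) * q ^ 4" using r by (simp add: eL power_numeral_reduce)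
    also have "\<dots> \<le> q ^ 1" unfolding rq using q power_decreasing[of 1 4 q] by simp
    finally show ?thesis using one by simp
  qed
  have t5: "(8 + 2 * C1) * exp (- (r * L) / 2) \<le> (8 + 2 * C1) * (q * (Q * L))"
  proof (intro mult_left_mono)
    have "ln r \<le> r * L / 2"
    proof -
      have "2 * L \<le> r * L" using r L1 by (intro mult_right_mono) auto
      then show ?thesis using L1 by (simp add: L_def)
    qed
    then have "exp (- (r * L) / 2) \<le> exp (- ln r)" by simp
    also have "\<dots> = q" using r by (simp add: exp_minus q_def inverse_eq_divide)
    finally show "exp (- (r * L) / 2) \<le> q * (Q * L)" using one by linarith
  qed (use C1_pos in simp)
  define z where "z = q * (Q * L)"
  have t1: "2 * (1 / r) \<le> 2 * z" using one by (simp add: q_def z_def)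
  note t = t1 t2[folded z_def] t3[folded z_def] t4[folded z_def] t5[folded z_def] t6[folded z_def]
  have "2 * (1 / r) + 24 * (r * L) * e1 + 8 * (1 / r ^ 5 + 4 * r * exp (- (r * L) / r) + (8 + 2 * C1) * exp (- (r * L) / 2)) + 6 / (1 / r) * e1
    \<le> 2 * z + 24 * Ke D1 * z + 8 * (z + 4 * z + (8 + 2 * C1) * z) + 6 * Ke D1 * z"
    by (intro add_mono mult_left_mono[of _ _ 8] t) simp
  also have "\<dots> = Kf D1 * z" by (simp add: Kf_def algebra_simps)
  also have "\<dots> = Kf D1 * (1 / r) * L powr (p / 2 + 1)" unfolding QL' z_def q_def by simp
  finally show ?thesis .
qed


text \<open>Here \<open>r\<close> plays the role of \<open>n powr (1 / 5)\<close> and \<open>L\<close> that of \<open>ln n\<close>.\<close>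

theorem contraction_at:
  fixes n :: nat and r d c\<sigma> Cs D1 D3 t1 w p G :: real
  assumes r: "3 \<le> r" and n: "real n = r ^ 5" and d: "0 < d" and D1: "0 < D1" and t1: "0 \<le> t1" and p: "p = \<iota> + 1 + t1"
  defines "L \<equiv> 5 * ln r"
  assumes N: "8 * \<tau>0 * L * r + 1 \<le> r ^ 5" and c0: "1 / r ^ 5 \<le> c0" and c\<sigma>: "1 / r ^ 5 \<le> c\<sigma>"
    and G: "\<And>a. A0 / 2 \<le> a \<Longrightarrow> a \<le> A0 \<Longrightarrow> Gamma a \<le> G" "0 < G" "G * exp 1 \<le> r ^ 5"
    and small: "(2 * C1 + 1) * (1 / r\<^sup>2) \<le> 1 / 2" "K0 * (1 / r\<^sup>2) \<le> f0 0 / 2" "c0' * (1 / r\<^sup>2) \<le> 2" "2 * c0' * (\<tau>0 * L) * (1 / r) \<le> A0 / 2"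
    and band: "\<And>\<delta>. 0 < \<delta> \<Longrightarrow> \<delta> \<le> 1 / r \<Longrightarrow>
      ennreal (c\<sigma> * \<delta> * exp (- D1 / \<delta> * \<bar>ln \<delta>\<bar> powr t1)) \<le> emeasure Pi_s {\<delta>..2 * \<delta>}"
    and \<epsilon>1: "K1 D1 * L powr (p / 2) \<le> r\<^sup>2"
    and gap: "(Cb D1 + \<kappa>0 + 2) * (r * L powr p) \<le> D3 / 2 * r powr w"
      "(Cb D1 + \<kappa>0 + 2) * (r * L powr p) \<le> b0' / 4 * r powr \<iota>"
    and tail: "measure Pi_s {r<..} \<le> Cs * exp (- D3 * r powr w)"
  shows "measure (model.P0n n) {y \<in> space (model.P0n n). d < measure (posterior (mixture_prior D Pi_s) n y)
      {\<mu> \<in> space (prob_algebra borel). ennreal (Kf D1 * (1 / r) * L powr (p / 2 + 1)) < wasserstein1 \<mu> \<mu>0}}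
    \<le> 2 * exp (- r) + (Cs * exp (- (D3 / 2 * r powr w)) + 1 / A0 * (8 * c0' / b0'\<^sup>2) * exp (- (b0' / 4 * r powr \<iota>)) + exp (- r)) / d"
proof -
  define T where "T = \<tau>0 * L"
  define N' where "N' = nat \<lceil>2 * (\<tau>0 * L) * r\<rceil>"
  define \<delta> where "\<delta> = 2 * (\<tau>0 * L) / real N'"
  note g = sieve_grid[OF r, folded L_def, folded N'_def, folded \<delta>_def, folded T_def]
  define P where "P = L powr p"
  define \<epsilon> where "\<epsilon> = K1 D1 * L powr (p / 2) / r\<^sup>2"
  define k where "k = Cb D1"
  define sm where "sm = c\<sigma> * \<delta> * exp (- D1 / \<delta> * \<bar>ln \<delta>\<bar> powr t1)"
  have L: "5 \<le> L" by (rule g(1))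
  have T0: "0 \<le> T" using \<tau>0_ge L by (simp add: T_def)
  have expL: "exp L = r ^ 5" "exp (- L) = 1 / r ^ 5"
    using r by (simp_all add: L_def exp_minus exp_five_ln inverse_eq_divide)
  have \<delta>0: "0 < \<delta>" using g(7) exp_gt_zero[of "- L"] by linarith
  have \<delta>2: "2 * \<delta> \<le> 1" "\<delta> \<le> 1"
  proof -
    have "1 / r \<le> 1 / 3" using r by (intro divide_left_mono) auto
    then show "2 * \<delta> \<le> 1" "\<delta> \<le> 1" using g(4) by linarith+
  qed
  have dd: "\<delta>\<^sup>2 \<le> 1 / r\<^sup>2" using power_mono[OF g(4), of 2] \<delta>0 by (simp add: power_divide)
  have mono: "c * \<delta>\<^sup>2 \<le> b" if "c * (1 / r\<^sup>2) \<le> b" "0 \<le> c" for b c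
    using mult_left_mono[OF dd that(2)] that(1) by linarith
  have p2: "2 \<le> p" using p t1 params by simp
  have L1: "1 \<le> L" using L by simp
  have P1: "1 \<le> P" and PL: "L * L \<le> P"
    using powr_mono[OF p2 L1] L ge_one_powr_ge_zero[of L p] p2 by (simp_all add: P_def power2_eq_square)
  have rP: "r \<le> r * P" using P1 r by (simp add: mult_le_cancel_left1)
  have k0: "0 < k" unfolding k_def by (rule Cb_pos[OF D1])
  have K0: "0 < K0" unfolding K0_def using C3_pos C2_pos by (intro add_pos_pos) auto
  have sm0: "0 \<le> sm" using order_trans[OF _ c\<sigma>] r \<delta>0 by (simp add: sm_def)
  have sm_ge: "exp (- (2 * L + 2 * D1 * r * L powr t1)) \<le> sm"
  proof -
    have "D1 / \<delta> \<le> D1 * (2 * r)"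
    proof -
      have "1 / \<delta> \<le> 1 / (1 / (2 * r))" using g(3) r \<delta>0 by (intro divide_left_mono) auto
      then show ?thesis using mult_left_mono[of "1 / \<delta>" "2 * r" D1] D1 by simp
    qed
    moreover have "\<bar>ln \<delta>\<bar> powr t1 \<le> L powr t1"
    proof (intro powr_mono2 t1)
      have "- L \<le> ln \<delta>" using g(7) \<delta>0 by (simp add: ln_ge_iff)
      moreover have "ln \<delta> \<le> 0" using \<delta>0 \<delta>2 by simp
      ultimately show "\<bar>ln \<delta>\<bar> \<le> L" by simp
    qed simp
    ultimately have "D1 / \<delta> * \<bar>ln \<delta>\<bar> powr t1 \<le> D1 * (2 * r) * L powr t1"
      using D1 r by (intro mult_mono) auto
    then have "exp (- L) * exp (- L) * exp (- (2 * D1 * r * L powr t1)) \<le> sm"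
      unfolding sm_def using c\<sigma> g(7) \<delta>0 order_trans[OF _ c\<sigma>] r by (intro mult_mono) (auto simp: expL(2) mult_ac)
    then show ?thesis by (simp add: mult_exp_exp)
  qed
  obtain B where B: "B \<in> sets \<Omega>"
    and chi: "\<And>\<theta>. \<theta> \<in> B \<Longrightarrow> (\<integral>\<^sup>+y. ennreal ((f0 y)\<^sup>2 / fm \<theta> y) \<partial>lborel) \<le> ennreal (exp (\<kappa>0 * \<delta> ^ 4))"
    and mass: "(\<delta>\<^sup>2 / 2 * (c0 * exp (- b0 * T powr \<iota>)) * exp (-2) / 2 * (\<delta> ^ 4 * exp (- T) / real (Suc (2 * N')))) ^ (2 * N')
      * (((\<delta> ^ 4 * exp (- T) / real (Suc (2 * N'))) / 2) powr (A0 + 1) * exp (-1) / G) * sm \<le> measure \<Omega> B"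
  proof -
    have "2 * c0' * T * \<delta> \<le> 2 * c0' * T * (1 / r)" using g(4) T0 params by (intro mult_left_mono) auto
    then have s4: "2 * c0' * T * \<delta> \<le> A0 / 2" using small(4) unfolding T_def by linarith
    have sm': "ennreal sm \<le> emeasure Pi_s {\<delta>..2 * \<delta>}" unfolding sm_def by (rule band[OF \<delta>0 g(4)])
    have s1: "(2 * C1 + 1) * \<delta>\<^sup>2 \<le> 1 / 2" and s2: "K0 * \<delta>\<^sup>2 \<le> f0 0 / 2" and s3: "c0' * \<delta>\<^sup>2 \<le> 2"
      using mono[OF small(1)] mono[OF small(2)] mono[OF small(3)] C1_pos K0 params by auto
    show ?thesis
      using prior_mass[OF \<delta>0 \<delta>2(1) T0 g(2) g(6) s1 s2 s3 s4 G(1) sm' sm0] that by blast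
  qed
  define m where "m = measure \<Omega> B"
  have m: "exp (- (k * (r * P))) \<le> m"
    unfolding k_def Cb_def P_def m_def
  proof (rule order_trans[OF prior_mass_exponent mass])
    show "real (2 * N') \<le> 8 * \<tau>0 * L * r" "real (Suc (2 * N')) \<le> exp L"
      using g(5) N unfolding expL of_nat_mult of_nat_Suc of_nat_numeral by linarith+
    have "G * exp 1 \<le> exp (L - 1) * exp 1" using G(3) unfolding expL(1)[symmetric] by (simp add: mult_exp_exp)
    then show "G \<le> exp (L - 1)" by simp
  qed (use L r \<tau>0_ge params t1 A0_pos D1 g(7) c0 G(2) sm_ge p in \<open>simp_all add: T_def expL\<close>)
  have m0: "0 < m" using m exp_gt_zero[of "- (k * (r * P))"] by linarith
  \<comment> \<open>the evidence of \<open>B\<close> falls below \<open>e\<close> with probability at most \<open>exp (- r)\<close>\<close>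
  define e where "e = exp (- (k * (r * P) + (\<kappa>0 + 1) * r))"
  define E where "E = real ((nat \<lfloor>1 / \<delta>\<^sup>2\<rfloor> + 1) ^ (N' + 1)) * exp (- (real n * \<epsilon>\<^sup>2 / 16))"
  \<comment> \<open>The location cutoff exceeds the bandwidth cutoff by the factor \<open>L\<close>,
    so that the normal tail term \<open>exp (- (r * L) / r)\<close> is
    \<open>exp (- L) = 1 / n\<close>.\<close>
  define R where "R = remote r (r * L) (1 / r ^ 5)"
  have \<epsilon>: "0 < \<epsilon>" "\<epsilon> \<le> 1" using K1_pos[OF D1] L1 r \<epsilon>1 by (auto simp: \<epsilon>_def)
  have rL: "r * 1 \<le> r * L" using r L1 by (intro mult_left_mono) auto
  have rL1: "1 \<le> r * L" using rL r by linarith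
  have "measure (model.P0n n) {y \<in> space (model.P0n n). d < measure (posterior (mixture_prior D Pi_s) n y)
      {\<mu> \<in> space (prob_algebra borel). ennreal (Kf D1 * (1 / r) * L powr (p / 2 + 1)) < wasserstein1 \<mu> \<mu>0}}
    \<le> e / m * exp (real n * (\<kappa>0 * \<delta> ^ 4)) + E + (measure \<Omega> R + E) / (d * e)"
    unfolding m_def E_def R_def
  proof (rule posterior_wasserstein_bound[OF \<delta>0 \<delta>2(2) T0 g(2) \<epsilon>, where h = "1 / r"])
    show "2 * (1 / r) + 24 * (r * L) * (2 * \<epsilon> + 4 * (2 * T + 2) * \<delta>\<^sup>2 + 4 * C1 * exp (- T)) +
        8 * (1 / r ^ 5 + 4 * r * exp (- (r * L) / r) + (8 + 2 * C1) * exp (- (r * L) / 2)) +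
        6 / (1 / r) * (2 * \<epsilon> + 4 * (2 * T + 2) * \<delta>\<^sup>2 + 4 * C1 * exp (- T)) \<le> Kf D1 * (1 / r) * L powr (p / 2 + 1)"
      using rate_dominates[OF r D1 p2] unfolding T_def \<epsilon>_def \<delta>_def N'_def L_def .
  qed (use r rL1 d B chi m0 in \<open>simp_all add: e_def m_def\<close>)
  also have "\<dots> \<le> exp (- r) + exp (- r) + (Cs * exp (- (D3 / 2 * r powr w)) + 1 / A0 * (8 * c0' / b0'\<^sup>2) * exp (- (b0' / 4 * r powr \<iota>)) + exp (- r)) / d"
  proof -
    have t1: "e / m * exp (real n * (\<kappa>0 * \<delta> ^ 4)) \<le> exp (- r)"
    proof -
      \<comment> \<open>With \<open>n = r ^ 5\<close> and \<open>\<delta> \<le> 1 / r\<close> the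
        accumulated chi-square error is of order \<open>r\<close>, which the term
        \<open>(\<kappa>0 + 1) * r\<close> in \<open>e\<close> compensates with \<open>r\<close> to
        spare.\<close>
      have "real n * \<delta> ^ 4 \<le> r ^ 5 * (1 / r) ^ 4"
        unfolding n using g(4) \<delta>0 r by (intro mult_left_mono power_mono) auto
      also have "\<dots> = r" using r by (simp add: power_divide power_numeral_reduce)
      finally have "\<kappa>0 * (real n * \<delta> ^ 4) \<le> \<kappa>0 * r" using \<kappa>0_pos by (intro mult_left_mono) auto
      then have x: "exp (real n * (\<kappa>0 * \<delta> ^ 4)) \<le> exp (\<kappa>0 * r)" by (simp add: mult_ac)
      have "e / m \<le> e / exp (- (k * (r * P)))" using m m0 by (intro divide_left_mono) (auto simp: e_def)
      also have "\<dots> = exp (- ((\<kappa>0 + 1) * r))" by (simp add: e_def flip: exp_diff)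
      finally have "e / m * exp (real n * (\<kappa>0 * \<delta> ^ 4)) \<le> exp (- ((\<kappa>0 + 1) * r)) * exp (\<kappa>0 * r)"
        using x m0 by (intro mult_mono) auto
      also have "\<dots> = exp (- r)" by (simp add: mult_exp_exp algebra_simps)
      finally show ?thesis .
    qed
    have E: "E \<le> exp (- ((k + \<kappa>0 + 2) * (r * P)))"
    proof -
      have "1 / \<delta>\<^sup>2 \<le> 1 / (1 / (2 * r))\<^sup>2" using g(3) r \<delta>0 by (intro divide_left_mono power_mono) auto
      also have "\<dots> = 4 * r\<^sup>2" by (simp add: power_divide power_mult_distrib)
      finally have a: "1 / \<delta>\<^sup>2 \<le> 4 * r\<^sup>2" .
      have b: "4 * r\<^sup>2 + 1 \<le> r ^ 5"
      proof -
        have "27 * r\<^sup>2 \<le> r ^ 3 * r\<^sup>2" using power_mono[OF r, of 3] by (intro mult_right_mono) auto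
        moreover have "1 \<le> r\<^sup>2" using r by simp
        ultimately show ?thesis by (simp flip: power_add)
      qed
      have "real (nat \<lfloor>1 / \<delta>\<^sup>2\<rfloor>) \<le> 1 / \<delta>\<^sup>2" using \<delta>0 by (simp add: of_nat_nat)
      then have "real (nat \<lfloor>1 / \<delta>\<^sup>2\<rfloor> + 1) \<le> exp L" using a b unfolding expL of_nat_add of_nat_1 by linarith
      then have "real ((nat \<lfloor>1 / \<delta>\<^sup>2\<rfloor> + 1) ^ (N' + 1)) \<le> exp L ^ (N' + 1)"
        unfolding of_nat_power by (intro power_mono) auto
      also have "\<dots> = exp (real (N' + 1) * L)" by (rule exp_of_nat_mult[symmetric])
      \<comment> \<open>About \<open>r * L\<close> nodes with polynomially many values each give an
        entropy of order \<open>r * L\<^sup>2\<close>, and \<open>p \<ge> 2\<close> puts it below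
        \<open>r * P\<close>.\<close>
      also have "\<dots> \<le> exp (4 * \<tau>0 * (r * P))"
      proof -
        have "real (N' + 1) * L \<le> 4 * \<tau>0 * L * r * L" using g(5) L1 by (intro mult_right_mono) auto
        also have "\<dots> = 4 * \<tau>0 * r * (L * L)" by simp
        also have "\<dots> \<le> 4 * \<tau>0 * r * P" using PL \<tau>0_ge r by (intro mult_left_mono) auto
        finally show ?thesis by (simp add: mult_ac)
      qed
      finally have c: "real ((nat \<lfloor>1 / \<delta>\<^sup>2\<rfloor> + 1) ^ (N' + 1)) \<le> exp (4 * \<tau>0 * (r * P))" .
      have "(L powr (p / 2))\<^sup>2 = P" by (simp add: P_def power2_eq_square flip: powr_add)
      moreover have "(K1 D1)\<^sup>2 = 16 * (4 * \<tau>0 + k + \<kappa>0 + 2)"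
        using \<tau>0_ge k0 \<kappa>0_pos by (simp add: K1_def k_def power_mult_distrib)
      ultimately have "\<epsilon>\<^sup>2 = 16 * (4 * \<tau>0 + k + \<kappa>0 + 2) * P / r ^ 4"
        by (simp add: \<epsilon>_def power_divide power_mult_distrib flip: power_mult)
      \<comment> \<open>Of this exponent, \<open>4 * \<tau>0\<close> pays for the number of tests;
        the remaining \<open>k + \<kappa>0 + 2\<close> exceeds the exponent of \<open>1 / e\<close>
        by one unit of \<open>r * P\<close>.\<close>
      then have "real n * \<epsilon>\<^sup>2 / 16 = (4 * \<tau>0 + k + \<kappa>0 + 2) * (r * P)"
        unfolding n using r by (simp add: power_numeral_reduce)
      then have "E \<le> exp (4 * \<tau>0 * (r * P)) * exp (- ((4 * \<tau>0 + k + \<kappa>0 + 2) * (r * P)))"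
        unfolding E_def using c by (intro mult_mono) auto
      also have "\<dots> = exp (- ((k + \<kappa>0 + 2) * (r * P)))" by (simp add: mult_exp_exp distrib_right)
      finally show ?thesis .
    qed
    have Er: "E \<le> exp (- r)"
    proof -
      have "1 * r \<le> (k + \<kappa>0 + 2) * (r * P)" using rP k0 \<kappa>0_pos r by (intro mult_mono) auto
      then have "exp (- ((k + \<kappa>0 + 2) * (r * P))) \<le> exp (- r)" by simp
      then show ?thesis using E by linarith
    qed
    have ei: "1 / e \<le> exp ((k + \<kappa>0 + 1) * (r * P))"
    proof -
      have "(\<kappa>0 + 1) * r \<le> (\<kappa>0 + 1) * (r * P)" using rP \<kappa>0_pos by (intro mult_left_mono) auto
      then have "k * (r * P) + (\<kappa>0 + 1) * r \<le> (k + \<kappa>0 + 1) * (r * P)" by (simp add: distrib_right)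
      moreover have "1 / e = exp (k * (r * P) + (\<kappa>0 + 1) * r)"
        by (simp only: e_def inverse_eq_divide[symmetric] exp_minus[symmetric] minus_minus)
      ultimately show ?thesis by simp
    qed
    have Ee: "E * (1 / e) \<le> exp (- r)"
    proof -
      have "E * (1 / e) \<le> exp (- ((k + \<kappa>0 + 2) * (r * P))) * exp ((k + \<kappa>0 + 1) * (r * P))"
        by (intro mult_mono E ei) (auto simp: e_def)
      also have "\<dots> = exp (- (r * P))" by (simp add: mult_exp_exp distrib_right)
      also have "\<dots> \<le> exp (- r)" using rP by simp
      finally show ?thesis .
    qed
    define M where "M = (k + \<kappa>0 + 2) * (r * P)"
    define x where "x = 1 / A0 * (8 * c0' / b0'\<^sup>2)"
    have x0: "0 \<le> x" using A0_pos params by (simp add: x_def)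
    \<comment> \<open>The spare \<open>L\<close> pays for the Markov factor
      \<open>r ^ 5 = exp L\<close> in the mass of the remote locations.\<close>
    have ei': "1 / e \<le> exp (M - L)"
    proof -
      have "L * 1 \<le> L * L" using L1 by (intro mult_left_mono) auto
      then have "L \<le> r * P" using PL mult_right_mono[of 1 r P] P1 r by linarith
      then have "(k + \<kappa>0 + 1) * (r * P) \<le> M - L" unfolding M_def distrib_right by linarith
      then show ?thesis using ei by (meson exp_le_cancel_iff order_trans)
    qed
    have "measure Pi_s {r<..} * (1 / e) \<le> Cs * exp (- (D3 / 2 * r powr w))"
    proof -
      have Cs: "0 \<le> Cs" using order_trans[OF measure_nonneg tail] by (simp add: zero_le_mult_iff)
      have "exp (M - L) \<le> exp M" using L1 by simp
      then have "1 / e \<le> exp M" using ei' by linarith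
      then have "measure Pi_s {r<..} * (1 / e) \<le> (Cs * exp (- D3 * r powr w)) * exp M"
        using tail Cs by (intro mult_mono) (auto simp: e_def)
      also have "\<dots> = Cs * exp (M - D3 * r powr w)" by (simp add: mult_exp_exp mult.assoc)
      also have "\<dots> \<le> Cs * exp (- (D3 / 2 * r powr w))"
        using gap(1) Cs by (intro mult_left_mono) (auto simp: M_def k_def P_def)
      finally show ?thesis .
    qed
    moreover have "(1 / (1 / r ^ 5) * (1 / A0 * (8 * c0' / b0'\<^sup>2 * exp (- b0' * (r * L) powr \<iota> / 2)))) * (1 / e) \<le> x * exp (- (b0' / 4 * r powr \<iota>))"
    proof -
      have "r powr \<iota> \<le> (r * L) powr \<iota>" using rL r params by (intro powr_mono2) auto
      then have "b0' * r powr \<iota> \<le> b0' * (r * L) powr \<iota>" using params by (intro mult_left_mono) auto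
      then have y: "exp (- b0' * (r * L) powr \<iota> / 2) \<le> exp (- (b0' / 2 * r powr \<iota>))" by simp
      have "(1 / (1 / r ^ 5) * (1 / A0 * (8 * c0' / b0'\<^sup>2 * exp (- b0' * (r * L) powr \<iota> / 2)))) * (1 / e)
          = (exp L * (x * exp (- b0' * (r * L) powr \<iota> / 2))) * (1 / e)"
        by (simp add: expL x_def)
      also have "\<dots> \<le> (exp L * (x * exp (- (b0' / 2 * r powr \<iota>)))) * exp (M - L)"
        using x0 y ei' by (intro mult_mono mult_left_mono) (auto simp: e_def)
      also have "\<dots> = x * exp (M - b0' / 2 * r powr \<iota>)" by (simp add: mult_exp_exp mult_ac)
      also have "\<dots> \<le> x * exp (- (b0' / 4 * r powr \<iota>))"
        using gap(2) x0 by (intro mult_left_mono) (auto simp: M_def k_def P_def)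
      finally show ?thesis .
    qed
    moreover have "measure \<Omega> R \<le> measure Pi_s {r<..} + 1 / (1 / r ^ 5) * (1 / A0 * (8 * c0' / b0'\<^sup>2 * exp (- b0' * (r * L) powr \<iota> / 2)))"
      unfolding R_def using r rL1 by (intro remote_mass) auto
    then have "measure \<Omega> R * (1 / e) \<le> (measure Pi_s {r<..} + 1 / (1 / r ^ 5) * (1 / A0 * (8 * c0' / b0'\<^sup>2 * exp (- b0' * (r * L) powr \<iota> / 2)))) * (1 / e)"
      by (rule mult_right_mono) (simp add: e_def)
    ultimately have "measure \<Omega> R * (1 / e) \<le> Cs * exp (- (D3 / 2 * r powr w)) + x * exp (- (b0' / 4 * r powr \<iota>))"
      unfolding distrib_right[of "measure Pi_s {r<..}"] by linarith
    then have "(measure \<Omega> R + E) * (1 / e) \<le> Cs * exp (- (D3 / 2 * r powr w)) + x * exp (- (b0' / 4 * r powr \<iota>)) + exp (- r)"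
      unfolding distrib_right[of "measure \<Omega> R"] using Ee by linarith
    then have "(measure \<Omega> R + E) * (1 / e) / d \<le> (Cs * exp (- (D3 / 2 * r powr w)) + x * exp (- (b0' / 4 * r powr \<iota>)) + exp (- r)) / d"
      using d by (intro divide_right_mono) auto
    moreover have "(measure \<Omega> R + E) / (d * e) = (measure \<Omega> R + E) * (1 / e) / d" by simp
    ultimately show ?thesis using t1 Er unfolding x_def by linarith
  qed
  finally show ?thesis by simp
qed

end

lemma eventually_power_five:
  fixes t c \<delta> :: real
  assumes "0 < t" "0 < c" "0 < \<delta>"
  shows "\<forall>\<^sub>F r in at_top. 8 * t * (5 * ln r) * r + 1 \<le> r ^ 5" "\<forall>\<^sub>F r in at_top. 1 / r ^ 5 \<le> c" "\<forall>\<^sub>F r in at_top. 1 / r < \<delta>"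
  using assms by real_asymp+

text \<open>A power above 1 beats \<open>r\<close> times any power of its logarithm. This is the
  point at which \<open>\<iota> > 1\<close> and \<open>w > 1\<close> make the remote parameters
  negligible.\<close>

lemma log_powr_dominated:
  fixes M p b w :: real
  assumes "0 < p" "1 < w" "0 < b"
  shows "\<forall>\<^sub>F r in at_top. M * (r * (5 * ln r) powr p) \<le> b * r powr w"
proof -
  have "\<forall>\<^sub>F r in at_top. M * ((5 * ln r) powr p / r powr (w - 1)) \<le> b"
    using assms by (intro eventually_scaled_le log_powr_negligible) auto
  then show ?thesis using eventually_gt_at_top[of 0]
  proof eventually_elim
    fix r :: real assume *: "M * ((5 * ln r) powr p / r powr (w - 1)) \<le> b" "0 < r"
    have "r powr w = r * r powr (w - 1)" using *(2) powr_mult_base[of r "w - 1"] by simp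
    moreover have "M * (5 * ln r) powr p \<le> b * r powr (w - 1)" using * by (simp add: field_simps)
    then have "r * (M * (5 * ln r) powr p) \<le> r * (b * r powr (w - 1))" using *(2) by (intro mult_left_mono) auto
    ultimately show "M * (r * (5 * ln r) powr p) \<le> b * r powr w" by (simp add: mult_ac)
  qed
qed

context deconvolution
begin

text \<open>All side conditions of \<open>contraction_at\<close> hold for large real
  \<open>r\<close>, and the bound it yields tends to 0 for every fixed \<open>d\<close>;
  substituting \<open>r = n powr (1 / 5)\<close> gives the limit along the integers.\<close>

theorem posterior_contraction:
  fixes c\<sigma> \<delta>0 Cs D1 D3 t1 w :: real
  assumes D1: "0 < D1" and t1: "0 \<le> t1" and D3: "0 < D3" and w: "1 < w" and c\<sigma>: "0 < c\<sigma>" and \<delta>0: "0 < \<delta>0"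
    and band: "\<And>\<delta>. 0 < \<delta> \<Longrightarrow> \<delta> < \<delta>0 \<Longrightarrow>
      ennreal (c\<sigma> * \<delta> * exp (- D1 / \<delta> * \<bar>ln \<delta>\<bar> powr t1)) \<le> emeasure Pi_s {\<delta>..2 * \<delta>}"
    and tail: "\<forall>\<^sub>F s in at_top. measure Pi_s {s<..} \<le> Cs * exp (- D3 * s powr w)"
  shows "\<exists>K>0. \<exists>\<kappa>>0. \<forall>d>0.
    (\<lambda>n. measure (model.P0n n) {y \<in> space (model.P0n n). measure (posterior (mixture_prior D Pi_s) n y)
      {\<mu> \<in> space (prob_algebra borel). wasserstein1 \<mu> \<mu>0 > ennreal (K * real n powr (- (1 / 5)) * ln (real n) powr \<kappa>)} > d})
    \<longlonglongrightarrow> 0"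
proof -
  define p where "p = \<iota> + 1 + t1"
  have p: "0 < p" using params t1 by (simp add: p_def)
  \<comment> \<open>\<open>Gamma\<close> is continuous on the compact interval
    \<open>[A0 / 2, A0]\<close>, which avoids 0, and attains its maximum there.\<close>
  obtain G where G: "\<And>a. A0 / 2 \<le> a \<Longrightarrow> a \<le> A0 \<Longrightarrow> Gamma a \<le> G" "0 < G"
  proof -
    have "continuous_on {A0 / 2..A0} (Gamma :: real \<Rightarrow> real)"
      using A0_pos by (intro continuous_on_Gamma continuous_on_id) (auto elim!: nonpos_Ints_cases)
    then obtain a where a: "a \<in> {A0 / 2..A0}" "\<forall>b\<in>{A0 / 2..A0}. Gamma b \<le> Gamma a"
      using continuous_attains_sup[of "{A0 / 2..A0}" Gamma] A0_pos by auto
    show ?thesis using a A0_pos by (intro that[of "Gamma a"]) (auto intro: Gamma_real_pos)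
  qed
  have inv2: "((\<lambda>r :: real. 1 / r\<^sup>2) \<longlongrightarrow> 0) at_top" by real_asymp
  have lninv: "((\<lambda>r :: real. 5 * ln r / r) \<longlongrightarrow> 0) at_top" by real_asymp
  define M where "M = Cb D1 + \<kappa>0 + 2"
  define x where "x = 1 / A0 * (8 * c0' / b0'\<^sup>2)"
  define \<rho> where "\<rho> d r = 2 * exp (- r) + (Cs * exp (- (D3 / 2 * r powr w)) + x * exp (- (b0' / 4 * r powr \<iota>)) + exp (- r)) / d" for d r :: real
  define err where "err d n K \<kappa> = measure (model.P0n n) {y \<in> space (model.P0n n). d < measure (posterior (mixture_prior D Pi_s) n y)
      {\<mu> \<in> space (prob_algebra borel). ennreal (K * real n powr (- (1 / 5)) * ln (real n) powr \<kappa>) < wasserstein1 \<mu> \<mu>0}}" for d n K \<kappa>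
  \<comment> \<open>The sample size is quantified inside, tied to the real variable by
    \<open>real n = r ^ 5\<close>, so that the asymptotic conditions can be checked for real
    \<open>r\<close>; none of them involves \<open>d\<close>.\<close>
  have "\<forall>\<^sub>F r in at_top. \<forall>n d. real n = r ^ 5 \<longrightarrow> 0 < d \<longrightarrow> err d n (Kf D1) (p / 2 + 1) \<le> \<rho> d r"
  proof -
    have "\<forall>\<^sub>F r in at_top. 8 * \<tau>0 * (5 * ln r) * r + 1 \<le> r ^ 5" "\<forall>\<^sub>F r in at_top. 1 / r ^ 5 \<le> c0" "\<forall>\<^sub>F r in at_top. 1 / r ^ 5 \<le> c\<sigma>"
      "\<forall>\<^sub>F r in at_top. 1 / r < \<delta>0" "\<forall>\<^sub>F r in at_top. 1 / r ^ 5 \<le> 1 / (G * exp 1)"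
      using eventually_power_five \<tau>0_ge params c\<sigma> \<delta>0 G(2) by auto
    moreover have "\<forall>\<^sub>F r in at_top. (2 * C1 + 1) * (1 / r\<^sup>2) \<le> 1 / 2" "\<forall>\<^sub>F r in at_top. K0 * (1 / r\<^sup>2) \<le> f0 0 / 2"
      "\<forall>\<^sub>F r in at_top. c0' * (1 / r\<^sup>2) \<le> 2"
      using f0_pos[of 0] by (intro eventually_scaled_le[OF inv2]; simp)+
    moreover have "\<forall>\<^sub>F r in at_top. 2 * c0' * \<tau>0 * (5 * ln r / r) \<le> A0 / 2"
      using A0_pos by (intro eventually_scaled_le[OF lninv]) simp
    moreover have "\<forall>\<^sub>F r in at_top. K1 D1 * ((5 * ln r) powr (p / 2) / r powr 2) \<le> 1"
      using p by (intro eventually_scaled_le log_powr_negligible) auto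
    moreover have "\<forall>\<^sub>F r in at_top. M * (r * (5 * ln r) powr p) \<le> D3 / 2 * r powr w"
      "\<forall>\<^sub>F r in at_top. M * (r * (5 * ln r) powr p) \<le> b0' / 4 * r powr \<iota>"
      using p w D3 params by (intro log_powr_dominated; simp)+
    moreover note tail eventually_ge_at_top[of 3]
    ultimately show ?thesis
    proof eventually_elim
      case (elim r)
      show ?case
      proof (intro allI impI)
        fix n :: nat and d :: real assume n: "real n = r ^ 5" and d: "0 < d"
        have r: "0 < r" using elim by simp
        have n5: "real n powr (- (1 / 5)) = 1 / r" "ln (real n) = 5 * ln r"
        proof -
          have n': "real n = r powr 5" unfolding n using r by (simp add: powr_numeral)
          then show "real n powr (- (1 / 5)) = 1 / r"
            unfolding n' powr_powr using r by (simp add: powr_minus inverse_eq_divide)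
          show "ln (real n) = 5 * ln r" unfolding n using r by (simp add: ln_realpow)
        qed
        have G5: "G * exp 1 \<le> r ^ 5"
        proof -
          have "G * exp 1 * (1 / r ^ 5) \<le> G * exp 1 * (1 / (G * exp 1))" using elim(5) G(2) by (intro mult_left_mono) auto
          then show ?thesis using r G(2) by (simp add: divide_le_eq)
        qed
        have K: "K1 D1 * (5 * ln r) powr (p / 2) \<le> r\<^sup>2" using elim(10) r by (simp add: divide_le_eq powr_numeral)
        have s4: "2 * c0' * (\<tau>0 * (5 * ln r)) * (1 / r) \<le> A0 / 2" using elim(9) by (simp add: mult.assoc)
        show "err d n (Kf D1) (p / 2 + 1) \<le> \<rho> d r"
          unfolding err_def n5 \<rho>_def x_def
        proof (rule contraction_at[where c\<sigma> = c\<sigma> and G = G and w = w and ?D3.0 = D3 and ?t1.0 = t1])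
          show "ennreal (c\<sigma> * \<delta> * exp (- D1 / \<delta> * \<bar>ln \<delta>\<bar> powr t1)) \<le> emeasure Pi_s {\<delta>..2 * \<delta>}" if "0 < \<delta>" "\<delta> \<le> 1 / r" for \<delta>
            using that elim(4) by (intro band) auto
        qed (fact elim n d D1 t1 p_def G G5 K s4 elim[unfolded M_def])+
      qed
    qed
  qed
  moreover have r_top: "filterlim (\<lambda>n. real n powr (1 / 5)) at_top sequentially" by real_asymp
  ultimately have ev: "\<forall>\<^sub>F n in sequentially. \<forall>m d. real m = (real n powr (1 / 5)) ^ 5 \<longrightarrow> 0 < d \<longrightarrow>
      err d m (Kf D1) (p / 2 + 1) \<le> \<rho> d (real n powr (1 / 5))"
    by (rule eventually_compose_filterlim)
  have "(\<lambda>n. err d n (Kf D1) (p / 2 + 1)) \<longlonglongrightarrow> 0" if d: "0 < d" for d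
  proof (rule tendsto_sandwich)
    show "\<forall>\<^sub>F n in sequentially. 0 \<le> err d n (Kf D1) (p / 2 + 1)" by (simp add: err_def)
    show "\<forall>\<^sub>F n in sequentially. err d n (Kf D1) (p / 2 + 1) \<le> \<rho> d (real n powr (1 / 5))"
      using ev eventually_gt_at_top[of 0]
    proof eventually_elim
      case (elim n)
      have "(real n powr (1 / 5)) ^ 5 = real n" using elim(2) by (simp add: powr_power)
      then show ?case using elim(1) d by auto
    qed
    have 1: "((\<lambda>r :: real. exp (- r)) \<longlongrightarrow> 0) at_top" by real_asymp
    have 2: "((\<lambda>r. exp (- (b * r powr a))) \<longlongrightarrow> 0) at_top" if "0 < b" "1 < a" for a b :: real
      using that by real_asymp
    have 3: "0 < D3 / 2" "0 < b0' / 4" "1 < \<iota>" using D3 params by auto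
    have "((\<lambda>r. \<rho> d r) \<longlongrightarrow> 2 * 0 + (Cs * 0 + x * 0 + 0) / d) at_top"
      unfolding \<rho>_def using d by (intro tendsto_intros 1 2 3 w) auto
    then show "(\<lambda>n. \<rho> d (real n powr (1 / 5))) \<longlonglongrightarrow> 0"
      using filterlim_compose[OF _ r_top, of "\<rho> d"] by simp
  qed simp
  then show ?thesis
    using Kf_pos[OF D1] p unfolding err_def by (intro exI[of _ "Kf D1"] conjI exI[of _ "p / 2 + 1"] allI impI) auto
qed

end

theorem theorem4p3:
  fixes f0X h0 pi_s :: "real \<Rightarrow> real"
    and \<mu>0X H0 Pi_s :: "real measure"
    and D :: "real measure measure"
    and C0 b0 b0' c0 c0' \<iota> D1 D2 D3 s1 s2 t1 t2 w :: real
  assumes f0X_meas: "f0X \<in> borel_measurable borel"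
    and f0X_nonneg: "\<forall>x. 0 \<le> f0X x"
    and \<mu>0X_density: "\<mu>0X = density lborel (\<lambda>x. ennreal (f0X x))"
    and \<mu>0X_prob: "prob_space \<mu>0X"
    and C0: "C0 > 0"
    and f0X_tail: "\<exists>C>0. \<forall>x. f0X x \<le> C * exp (- (1 + C0) * \<bar>x\<bar>)"
    and H0_density: "H0 = density lborel (\<lambda>u. ennreal (h0 u))"
    and h0_cont: "continuous_on UNIV h0"
    and h0_pos: "\<forall>u. 0 < h0 u"
    and h0_consts: "b0 > 0" "b0' > 0" "c0 > 0" "c0' > 0" "\<iota> > 1"
    and h0_bounds: "\<forall>u. c0 * exp (- b0 * \<bar>u\<bar> powr \<iota>) \<le> h0 u
                       \<and> h0 u \<le> c0' * exp (- b0' * \<bar>u\<bar> powr \<iota>)"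
    and Pi_s_density: "Pi_s = density (restrict_space lborel {0<..}) (\<lambda>\<sigma>. ennreal (pi_s \<sigma>))"
    and Pi_s_prob: "prob_space Pi_s"
    and pi_s_cont: "continuous_on {0<..} pi_s"
    and pi_s_nonneg: "\<forall>\<sigma>>0. 0 \<le> pi_s \<sigma>"
    and pi_s_consts: "D1 > 0" "D2 > 0" "s1 \<ge> 0" "s2 \<ge> 0" "t1 \<ge> 0" "t2 \<ge> 0"
    and pi_s_lower: "\<exists>C>0. \<forall>\<^sub>F \<sigma> in at_right 0.
          \<sigma> powr (- s1) * exp (- D1 * (1 / \<sigma>) * \<bar>ln \<sigma>\<bar> powr t1) \<le> C * pi_s \<sigma>"
    and pi_s_upper: "\<exists>C>0. \<forall>\<^sub>F \<sigma> in at_right 0.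
          pi_s \<sigma> \<le> C * (\<sigma> powr (- s2) * exp (- D2 * (1 / \<sigma>) * \<bar>ln \<sigma>\<bar> powr t2))"
    and Pi_s_tail_consts: "D3 > 0" "w > 1"
    and Pi_s_tail: "\<exists>C>0. \<forall>\<^sub>F s in at_top. measure Pi_s {s<..} \<le> C * exp (- D3 * s powr w)"
    and D: "is_dirichlet_process H0 D"
  shows "\<exists>K>0. \<exists>\<kappa>>0. \<forall>\<delta>>0.
    (\<lambda>n. measure (\<Pi>\<^sub>M i\<in>{..<n}. density lborel (\<lambda>y. ennreal (obs_density \<mu>0X y)))
       {y \<in> space (\<Pi>\<^sub>M i\<in>{..<n}. density lborel (\<lambda>y. ennreal (obs_density \<mu>0X y))).
          measure (posterior (mixture_prior D Pi_s) n y)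
            {\<mu> \<in> space (prob_algebra borel).
               wasserstein1 \<mu> \<mu>0X > ennreal (K * real n powr (- (1 / 5)) * ln (real n) powr \<kappa>)}
          > \<delta>}) \<longlonglongrightarrow> 0"
proof -
  from f0X_tail obtain C where C: "C > 0" "\<And>x. f0X x \<le> C * exp (- (1 + C0) * \<bar>x\<bar>)" by blast
  interpret deconvolution f0X h0 C C0 b0 b0' c0 c0' \<iota> D Pi_s
  proof (intro deconvolution.intro light_tailed_density.intro base_density.intro deconvolution_axioms.intro; (fact f0X_meas C C0 h0_consts Pi_s_prob)?)
    show "0 \<le> f0X x" for x using f0X_nonneg by blast
    show "prob_space (density lborel (\<lambda>x. ennreal (f0X x)))" using \<mu>0X_prob by (simp only: \<mu>0X_density)
    show "h0 \<in> borel_measurable borel" using h0_cont by (rule borel_measurable_continuous_onI)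
    show "c0 * exp (- b0 * \<bar>u\<bar> powr \<iota>) \<le> h0 u" "h0 u \<le> c0' * exp (- b0' * \<bar>u\<bar> powr \<iota>)" for u
      using h0_bounds by blast+
    show "is_dirichlet_process (density lborel (\<lambda>u. ennreal (h0 u))) D" using D by (simp only: H0_density)
    show "sets Pi_s = sets (restrict_space borel {0<..})"
      unfolding Pi_s_density sets_density by (rule sets_restrict_space_cong[OF sets_lborel])
  qed
  obtain c\<sigma> \<delta>0 where band: "c\<sigma> > 0" "\<delta>0 > 0" "\<And>\<delta>. 0 < \<delta> \<Longrightarrow> \<delta> < \<delta>0 \<Longrightarrow>
      ennreal (c\<sigma> * \<delta> * exp (- D1 / \<delta> * \<bar>ln \<delta>\<bar> powr t1)) \<le> emeasure Pi_s {\<delta>..2 * \<delta>}"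
    using bandwidth_prior_lower[OF Pi_s_density pi_s_cont pi_s_consts(1,3,5) pi_s_lower] by blast
  obtain Cs where tail: "\<forall>\<^sub>F s in at_top. measure Pi_s {s<..} \<le> Cs * exp (- D3 * s powr w)"
    using Pi_s_tail by blast
  show ?thesis
    using posterior_contraction[OF pi_s_consts(1,5) Pi_s_tail_consts band tail]
    unfolding model.P0n_def model.P0_def \<mu>0X_density .
qed

end
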